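(* Let $S=(S_t)_{t\ge0}$ be a free Brownian motion on a non-commutative probability space $(\mathcal{A},\varphi)$, and let $\{F_n\}_{n\geq 1}$ be a sequence in the second (symmetric) Wigner chaos of $S$ (i.e. $F_n=I_2^S(f_n)$ with $f_n\in L^2_s(\mathbb{R}_+^2)$) that converges in law to $F_\infty$. Then there exist $\lambda_0\in\mathbb{R}$ and $f\in L^2_s(\mathbb{R}_+^2)$ such that $$F_\infty \overset{\rm law}{=}A + I_2^S(f),$$ where $A\sim\mathcal{S}(0,\lambda_0^2)$ is freely independent of $S$.
   Context: $L^2_s(\mathbb{R}_+^2)$ denotes the set of real-valued square-integrable functions $f$ on $\mathbb{R}_+^2$ with $f(x,y)=f(y,x)$ a.e. $(\mathcal{A},\varphi)$ is a tracial non-commutative ($W^*$-)probability space. $\mathcal{S}(0,\sigma^2)$ is the centered semicircular law with variance $\sigma^2$ (the Dirac mass at $0$ if $\sigma=0$). A free Brownian motion $S=(S_t)_{t\ge0}$ is a process of self-adjoint elements starting from $0$, with freely independent increments and $S_t-S_s\sim\mathcal{S}(0,t-s)$ for $t\ge s$. For $f\in L^2_s(\mathbb{R}_+^2)$, $I_2^S(f)$ is the double Wigner integral (in the sense of Biane and Speicher): the unique continuous linear map $L^2_s(\mathbb{R}_+^2)\to L^2(\varphi)$ with $I_2^S(h\otimes h)=\left(\int_0^\infty h(t)\,dS_t\right)^2-\int_0^\infty h^2(t)\,dt$ for $h\in L^2(\mathbb{R}_+)$, where $(h\otimes h)(x,y)=h(x)h(y)$; it satisfies $\varphi(I_2^S(f)^2)=\|f\|^2_{L^2(\mathbb{R}_+^2)}$.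 The second (symmetric) Wigner chaos is the set of all $I_2^S(f)$, $f\in L^2_s(\mathbb{R}_+^2)$. Convergence in law $F_n\to F_\infty$ of self-adjoint non-commutative random variables means convergence of all moments, $\varphi(F_n^m)\to\varphi(F_\infty^m)$ for all $m\ge1$; equality in law means equality of all moments. $A$ may live on an enlargement of $(\mathcal{A},\varphi)$. *)

theory Defs
  imports "HOL-Probability.Probability"
begin

section \<open>Complex Hilbert spaces and their bounded operators\<close>

class complex_vector = real_vector +
  fixes scaleC :: "complex \<Rightarrow> 'a \<Rightarrow> 'a"  (infixr \<open>*\<^sub>C\<close> 75)
  assumes scaleC_add_right: "c *\<^sub>C (x + y) = c *\<^sub>C x + c *\<^sub>C y"
    and scaleC_add_left: "(c + d) *\<^sub>C x = c *\<^sub>C x + d *\<^sub>C x"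
    and scaleC_scaleC: "c *\<^sub>C d *\<^sub>C x = (c * d) *\<^sub>C x"
    and scaleC_of_real: "complex_of_real r *\<^sub>C x = r *\<^sub>R x"

text \<open>
  The class \<^class>\<open>real_inner\<close> provides the real part of the complex inner product; that
  multiplication by the imaginary unit is an isometry makes the form \<open>cinner\<close> below
  sesquilinear, conjugate-linear in its first argument.
\<close>

class complex_hilbert_space = complex_vector + real_inner + complete_space +
  assumes inner_scaleC_i: "inner (\<i> *\<^sub>C x) (\<i> *\<^sub>C y) = inner x y"

definition cinner :: "'h::complex_hilbert_space \<Rightarrow> 'h \<Rightarrow> complex" where
  "cinner x y = Complex (inner x y) (inner (\<i> *\<^sub>C x) y)"

lemma scaleC_decompose:
  "c *\<^sub>C (x::'a::complex_vector) = Re c *\<^sub>R x + Im c *\<^sub>R (\<i> *\<^sub>C x)"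
proof -
  have "c *\<^sub>C x = (complex_of_real (Re c) + complex_of_real (Im c) * \<i>) *\<^sub>C x"
    by (metis complex_eq mult.commute)
  also have "\<dots> = Re c *\<^sub>R x + Im c *\<^sub>R (\<i> *\<^sub>C x)"
    by (simp only: scaleC_add_left scaleC_scaleC [symmetric] scaleC_of_real)
  finally show ?thesis .
qed

lemma scaleC_scaleR:
  "c *\<^sub>C (r *\<^sub>R (x::'a::complex_vector)) = r *\<^sub>R (c *\<^sub>C x)"
  by (metis mult.commute scaleC_of_real scaleC_scaleC)

lemma scaleC_left_commute:
  "c *\<^sub>C d *\<^sub>C (x::'a::complex_vector) = d *\<^sub>C c *\<^sub>C x"
  by (simp add: scaleC_scaleC mult.commute)

lemma scaleC_zero_right: "c *\<^sub>C (0::'a::complex_vector) = 0"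
  using scaleC_add_right [of c 0 0] by simp

lemma scaleC_minus_right: "c *\<^sub>C (- x::'a::complex_vector) = - (c *\<^sub>C x)"
  using scaleC_add_right [of c x "- x"] by (simp add: scaleC_zero_right add_eq_0_iff)

lemma scaleC_diff_right: "c *\<^sub>C (x - y::'a::complex_vector) = c *\<^sub>C x - c *\<^sub>C y"
  using scaleC_add_right [of c x "- y"] by (simp add: scaleC_minus_right)

lemma norm_scaleC_i: "norm (\<i> *\<^sub>C (x::'h::complex_hilbert_space)) = norm x"
  by (simp add: norm_eq_sqrt_inner inner_scaleC_i)

lemma bounded_linear_scaleC:
  "bounded_linear (\<lambda>x::'h::complex_hilbert_space. c *\<^sub>C x)"
proof (rule bounded_linear_intro)
  fix x :: 'h
  have "norm (c *\<^sub>C x) \<le> \<bar>Re c\<bar> * norm x + \<bar>Im c\<bar> * norm x"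
    unfolding scaleC_decompose [of c]
    by (rule order_trans [OF norm_triangle_ineq]) (simp add: norm_scaleC_i)
  then show "norm (c *\<^sub>C x) \<le> norm x * (\<bar>Re c\<bar> + \<bar>Im c\<bar>)"
    by (simp add: algebra_simps)
qed (simp_all add: scaleC_add_right scaleC_scaleR)

lemma cinner_commute: "cinner x y = cnj (cinner y (x::'h::complex_hilbert_space))"
proof -
  have "inner (\<i> *\<^sub>C x) y = inner (\<i> *\<^sub>C \<i> *\<^sub>C x) (\<i> *\<^sub>C y)"
    by (rule inner_scaleC_i [symmetric])
  also have "\<i> *\<^sub>C \<i> *\<^sub>C x = - x"
    using scaleC_of_real [of "-1" x] by (simp add: scaleC_scaleC)
  finally show ?thesis
    by (simp add: cinner_def complex_eq_iff inner_commute)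
qed

typedef (overloaded) 'h bop =
  "{T :: 'h::complex_hilbert_space \<Rightarrow>\<^sub>L 'h.
     \<forall>c x. blinfun_apply T (c *\<^sub>C x) = c *\<^sub>C blinfun_apply T x}"
  morphisms blinfun_of_bop Abs_bop
  by (rule exI [of _ 0]) (simp add: scaleC_zero_right)

setup_lifting type_definition_bop

definition bop_apply :: "'h::complex_hilbert_space bop \<Rightarrow> 'h \<Rightarrow> 'h" where
  "bop_apply T = blinfun_apply (blinfun_of_bop T)"

instantiation bop :: (complex_hilbert_space) complex_vector
begin

lift_definition zero_bop :: "'a bop" is 0
  by (simp add: scaleC_zero_right)

lift_definition plus_bop :: "'a bop \<Rightarrow> 'a bop \<Rightarrow> 'a bop" is "(+)"
  by (simp add: blinfun.add_left scaleC_add_right)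

lift_definition minus_bop :: "'a bop \<Rightarrow> 'a bop \<Rightarrow> 'a bop" is "(-)"
  by (simp add: blinfun.diff_left scaleC_diff_right)

lift_definition uminus_bop :: "'a bop \<Rightarrow> 'a bop" is uminus
  by (simp add: blinfun.minus_left scaleC_minus_right)

lift_definition scaleR_bop :: "real \<Rightarrow> 'a bop \<Rightarrow> 'a bop" is "(*\<^sub>R)"
  by (simp add: blinfun.scaleR_left scaleC_scaleR)

lift_definition scaleC_bop :: "complex \<Rightarrow> 'a bop \<Rightarrow> 'a bop" is
  "\<lambda>c T. Blinfun (\<lambda>x. c *\<^sub>C x) o\<^sub>L T"
  by (simp add: bounded_linear_Blinfun_apply [OF bounded_linear_scaleC])
    (metis scaleC_left_commute)

instance
proof
  fix a b c :: "'a bop" and r s :: real and z w :: complex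
  show "a + b + c = a + (b + c)" "a + b = b + a" "0 + a = a" "- a + a = 0" "a - b = a + - b"
    "r *\<^sub>R (a + b) = r *\<^sub>R a + r *\<^sub>R b" "(r + s) *\<^sub>R a = r *\<^sub>R a + s *\<^sub>R a"
    "r *\<^sub>R s *\<^sub>R a = (r * s) *\<^sub>R a" "1 *\<^sub>R a = a"
    by (transfer; simp add: algebra_simps)+
  show "z *\<^sub>C (a + b) = z *\<^sub>C a + z *\<^sub>C b" "(z + w) *\<^sub>C a = z *\<^sub>C a + w *\<^sub>C a"
    "z *\<^sub>C w *\<^sub>C a = (z * w) *\<^sub>C a" "complex_of_real r *\<^sub>C a = r *\<^sub>R a"
    by (transfer; rule blinfun_eqI;
        simp add: bounded_linear_Blinfun_apply [OF bounded_linear_scaleC] blinfun.add_left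
          blinfun.scaleR_left scaleC_add_left scaleC_add_right scaleC_scaleC scaleC_of_real)+
qed

end

instantiation bop :: (complex_hilbert_space) "{ring, monoid_mult}"
begin

lift_definition one_bop :: "'a bop" is id_blinfun
  by simp

lift_definition times_bop :: "'a bop \<Rightarrow> 'a bop \<Rightarrow> 'a bop" is "(o\<^sub>L)"
  by simp

instance
proof
  fix a b c :: "'a bop"
  show "a * b * c = a * (b * c)" "1 * a = a" "a * 1 = a"
    "(a + b) * c = a * c + b * c" "a * (b + c) = a * b + a * c"
    by (transfer; rule blinfun_eqI; simp add: blinfun.add_left blinfun.add_right)+
qed

end

definition is_adjoint :: "'h::complex_hilbert_space bop \<Rightarrow> 'h bop \<Rightarrow> bool" where
  "is_adjoint T R \<longleftrightarrow> (\<forall>x y. cinner (bop_apply R x) y = cinner x (bop_apply T y))"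

definition adj :: "'h::complex_hilbert_space bop \<Rightarrow> 'h bop" where
  "adj T = (THE R. is_adjoint T R)"

definition self_adjoint :: "'h::complex_hilbert_space bop \<Rightarrow> bool" where
  "self_adjoint T \<longleftrightarrow> adj T = T"

lemma is_adjoint_unique:
  assumes "is_adjoint T R" "is_adjoint T R'"
  shows "R = R'"
proof -
  have "bop_apply R x = bop_apply R' x" for x
  proof -
    have "inner (bop_apply R x) y = inner (bop_apply R' x) y" for y
      using assms unfolding is_adjoint_def cinner_def by (metis complex.inject)
    then have "inner (bop_apply R x - bop_apply R' x) (bop_apply R x - bop_apply R' x) = 0"
      by (simp add: inner_diff_left)
    then show ?thesis by simp
  qed
  then show ?thesis
    by (auto simp: bop_apply_def blinfun_of_bop_inject [symmetric] intro: blinfun_eqI)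
qed


section \<open>The Hilbert space of square-summable families\<close>

typedef 'i ell2 = "{f :: 'i \<Rightarrow> complex. (\<lambda>i. (cmod (f i))\<^sup>2) summable_on UNIV}"
  by (rule exI [of _ "\<lambda>_. 0"]) simp

setup_lifting type_definition_ell2

lemma ell2_add_summable:
  assumes "(\<lambda>i. (cmod (f i))\<^sup>2) summable_on UNIV" "(\<lambda>i. (cmod (g i))\<^sup>2) summable_on UNIV"
  shows "(\<lambda>i. (cmod (f i + g i))\<^sup>2) summable_on UNIV"
proof (rule summable_on_comparison_test)
  show "(\<lambda>i. 2 * (cmod (f i))\<^sup>2 + 2 * (cmod (g i))\<^sup>2) summable_on UNIV"
    by (intro summable_on_add summable_on_cmult_right assms)
  fix i
  have "(cmod (f i + g i))\<^sup>2 \<le> (cmod (f i) + cmod (g i))\<^sup>2"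
    by (intro power_mono norm_triangle_ineq) simp
  also have "\<dots> \<le> 2 * (cmod (f i))\<^sup>2 + 2 * (cmod (g i))\<^sup>2"
    using sum_squares_bound [of "cmod (f i)" "cmod (g i)"] by (simp add: power2_sum)
  finally show "(cmod (f i + g i))\<^sup>2 \<le> 2 * (cmod (f i))\<^sup>2 + 2 * (cmod (g i))\<^sup>2" .
qed simp

lemma ell2_scale_summable:
  assumes "(\<lambda>i. (cmod (f i))\<^sup>2) summable_on UNIV"
  shows "(\<lambda>i. (cmod (c * f i))\<^sup>2) summable_on UNIV"
  using summable_on_cmult_right [OF assms, of "(cmod c)\<^sup>2"]
  by (simp add: norm_mult power_mult_distrib)

lemma ell2_inner_summable:
  assumes "(\<lambda>i. (cmod (f i))\<^sup>2) summable_on UNIV" "(\<lambda>i. (cmod (g i))\<^sup>2) summable_on UNIV"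
  shows "(\<lambda>i. inner (f i) (g i)) summable_on UNIV"
proof (rule abs_summable_summable, rule summable_on_comparison_test)
  show "(\<lambda>i. (cmod (f i))\<^sup>2 + (cmod (g i))\<^sup>2) summable_on UNIV"
    by (intro summable_on_add assms)
  fix i
  have "\<bar>inner (f i) (g i)\<bar> \<le> cmod (f i) * cmod (g i)"
    by (rule Cauchy_Schwarz_ineq2)
  also have "\<dots> \<le> (cmod (f i))\<^sup>2 + (cmod (g i))\<^sup>2"
    using sum_squares_bound [of "cmod (f i)" "cmod (g i)"]
      mult_nonneg_nonneg [OF norm_ge_zero norm_ge_zero, of "f i" "g i"] by linarith
  finally show "norm (inner (f i) (g i)) \<le> (cmod (f i))\<^sup>2 + (cmod (g i))\<^sup>2" by simp
qed simp

instantiation ell2 :: (type) complex_vector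
begin

lift_definition zero_ell2 :: "'a ell2" is "\<lambda>_. 0" by simp

lift_definition plus_ell2 :: "'a ell2 \<Rightarrow> 'a ell2 \<Rightarrow> 'a ell2" is "\<lambda>f g i. f i + g i"
  by (rule ell2_add_summable)

lift_definition uminus_ell2 :: "'a ell2 \<Rightarrow> 'a ell2" is "\<lambda>f i. - f i" by simp

lift_definition minus_ell2 :: "'a ell2 \<Rightarrow> 'a ell2 \<Rightarrow> 'a ell2" is "\<lambda>f g i. f i - g i"
  subgoal for f g
    using ell2_add_summable [of f "\<lambda>i. - g i"] by simp
  done

lift_definition scaleC_ell2 :: "complex \<Rightarrow> 'a ell2 \<Rightarrow> 'a ell2" is "\<lambda>c f i. c * f i"
  by (rule ell2_scale_summable)

lift_definition scaleR_ell2 :: "real \<Rightarrow> 'a ell2 \<Rightarrow> 'a ell2" is "\<lambda>r f i. complex_of_real r * f i"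
  by (rule ell2_scale_summable)

instance
proof
  fix a b c :: "'a ell2" and r s :: real and z w :: complex
  note rep = Rep_ell2_inject [symmetric] fun_eq_iff zero_ell2.rep_eq plus_ell2.rep_eq
    minus_ell2.rep_eq uminus_ell2.rep_eq scaleR_ell2.rep_eq scaleC_ell2.rep_eq
  show "a + b + c = a + (b + c)" "a + b = b + a" "0 + a = a" "- a + a = 0" "a - b = a + - b"
    "r *\<^sub>R (a + b) = r *\<^sub>R a + r *\<^sub>R b" "(r + s) *\<^sub>R a = r *\<^sub>R a + s *\<^sub>R a"
    "r *\<^sub>R s *\<^sub>R a = (r * s) *\<^sub>R a" "1 *\<^sub>R a = a"
    "z *\<^sub>C (a + b) = z *\<^sub>C a + z *\<^sub>C b" "(z + w) *\<^sub>C a = z *\<^sub>C a + w *\<^sub>C a"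
    "z *\<^sub>C w *\<^sub>C a = (z * w) *\<^sub>C a" "complex_of_real r *\<^sub>C a = r *\<^sub>R a"
    by (simp_all add: rep algebra_simps)
qed

end

instantiation ell2 :: (type) real_inner
begin

lift_definition inner_ell2 :: "'a ell2 \<Rightarrow> 'a ell2 \<Rightarrow> real" is
  "\<lambda>f g. \<Sum>\<^sub>\<infinity>i. inner (f i) (g i)" .

definition norm_ell2 :: "'a ell2 \<Rightarrow> real" where
  "norm_ell2 x = sqrt (inner x x)"

definition dist_ell2 :: "'a ell2 \<Rightarrow> 'a ell2 \<Rightarrow> real" where
  "dist_ell2 x y = norm (x - y)"

definition sgn_ell2 :: "'a ell2 \<Rightarrow> 'a ell2" where
  "sgn_ell2 x = x /\<^sub>R norm x"

definition uniformity_ell2 :: "('a ell2 \<times> 'a ell2) filter" where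
  "uniformity_ell2 = (INF e\<in>{0 <..}. principal {(x, y). dist x y < e})"

definition open_ell2 :: "'a ell2 set \<Rightarrow> bool" where
  "open_ell2 U = (\<forall>x\<in>U. \<forall>\<^sub>F (x', y) in uniformity. x' = x \<longrightarrow> y \<in> U)"

instance
proof
  fix x y z :: "'a ell2" and r :: real and U :: "'a ell2 set"
  show "inner x y = inner y x"
    by transfer (simp add: inner_commute)
  show "inner (x + y) z = inner x z + inner y z"
    by transfer (simp add: inner_add_left infsum_add ell2_inner_summable)
  show "inner (r *\<^sub>R x) y = r * inner x y"
  proof transfer
    fix r :: real and f g :: "'a \<Rightarrow> complex"
    have "inner (complex_of_real r * f i) (g i) = r * inner (f i) (g i)" for i
      by (metis inner_scaleR_left scaleR_conv_of_real)
    then show "(\<Sum>\<^sub>\<infinity>i. inner (complex_of_real r * f i) (g i)) = r * (\<Sum>\<^sub>\<infinity>i. inner (f i) (g i))"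
      by (simp add: infsum_cmult_right')
  qed
  show "0 \<le> inner x x"
    by transfer (simp add: infsum_nonneg)
  show "inner x x = 0 \<longleftrightarrow> x = 0"
  proof transfer
    fix f :: "'a \<Rightarrow> complex"
    assume f: "(\<lambda>i. (cmod (f i))\<^sup>2) summable_on UNIV"
    then have "(\<lambda>i. inner (f i) (f i)) summable_on UNIV"
      by (simp add: power2_norm_eq_inner)
    then have "f i = 0" if "(\<Sum>\<^sub>\<infinity>i. inner (f i) (f i)) = 0" for i
      using nonneg_infsum_le_0D [of "\<lambda>i. inner (f i) (f i)" UNIV i] that by simp
    then show "((\<Sum>\<^sub>\<infinity>i. inner (f i) (f i)) = 0) = (f = (\<lambda>_. 0))"
      by (intro iffI ext) (blast, simp)
  qed
qed (rule norm_ell2_def dist_ell2_def sgn_ell2_def uniformity_ell2_def open_ell2_def)+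

end

lemma ell2_norm_sq:
  "(norm x)\<^sup>2 = (\<Sum>\<^sub>\<infinity>i. (cmod (Rep_ell2 x i))\<^sup>2)"
  by (simp add: power2_norm_eq_inner inner_ell2.rep_eq)

lemma ell2_summable: "(\<lambda>i. (cmod (Rep_ell2 x i))\<^sup>2) summable_on UNIV"
  using Rep_ell2 [of x] by simp

lemma ell2_finite_sum_le:
  assumes "finite F"
  shows "(\<Sum>i\<in>F. (cmod (Rep_ell2 x i))\<^sup>2) \<le> (norm x)\<^sup>2"
  unfolding ell2_norm_sq by (rule finite_sum_le_infsum [OF ell2_summable assms]) auto

lemma ell2_norm_le:
  assumes "\<And>F. finite F \<Longrightarrow> (\<Sum>i\<in>F. (cmod (Rep_ell2 x i))\<^sup>2) \<le> e\<^sup>2" "0 \<le> e"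
  shows "norm x \<le> e"
proof -
  have "(norm x)\<^sup>2 \<le> e\<^sup>2"
    unfolding ell2_norm_sq by (rule infsum_le_finite_sums [OF ell2_summable]) (use assms in auto)
  then show ?thesis using assms(2) by (rule power2_le_imp_le)
qed

instance ell2 :: (type) complex_hilbert_space
proof
  fix x y :: "'a ell2"
  show "inner (\<i> *\<^sub>C x) (\<i> *\<^sub>C y) = inner x y"
  proof transfer
    fix f g :: "'a \<Rightarrow> complex"
    have "inner (\<i> * f i) (\<i> * g i) = inner (f i) (g i)" for i
      by (simp add: inner_complex_def)
    then show "(\<Sum>\<^sub>\<infinity>i. inner (\<i> * f i) (\<i> * g i)) = (\<Sum>\<^sub>\<infinity>i. inner (f i) (g i))"
      by (rule infsum_cong)
  qed
next
  fix X :: "nat \<Rightarrow> 'a ell2"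
  assume X: "Cauchy X"
  have coord: "cmod (Rep_ell2 x i) \<le> norm x" for x :: "'a ell2" and i
    using ell2_finite_sum_le [of "{i}" x] by (auto intro!: power2_le_imp_le [OF _ norm_ge_zero])
  have "Cauchy (\<lambda>n. Rep_ell2 (X n) i)" for i
  proof (rule metric_CauchyI)
    fix e :: real assume "0 < e"
    then obtain M where "\<forall>m\<ge>M. \<forall>n\<ge>M. dist (X m) (X n) < e"
      using X unfolding Cauchy_def by blast
    moreover have "dist (Rep_ell2 (X m) i) (Rep_ell2 (X n) i) \<le> dist (X m) (X n)" for m n
      using coord [of "X m - X n" i] by (simp add: dist_norm minus_ell2.rep_eq)
    ultimately show "\<exists>M. \<forall>m\<ge>M. \<forall>n\<ge>M. dist (Rep_ell2 (X m) i) (Rep_ell2 (X n) i) < e"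
      by (meson le_less_trans)
  qed
  then have conv: "convergent (\<lambda>n. Rep_ell2 (X n) i)" for i
    by (rule Cauchy_convergent)
  define l where "l i = lim (\<lambda>n. Rep_ell2 (X n) i)" for i
  have l: "(\<lambda>n. Rep_ell2 (X n) i) \<longlonglongrightarrow> l i" for i
    using conv [of i] by (simp add: l_def convergent_LIMSEQ_iff)
  have tail: "(\<Sum>i\<in>F. (cmod (Rep_ell2 (X n) i - l i))\<^sup>2) \<le> e\<^sup>2"
    if "finite F" and M: "\<And>m n. m \<ge> M \<Longrightarrow> n \<ge> M \<Longrightarrow> dist (X m) (X n) < e" and n: "n \<ge> M"
    for F e M n
  proof (rule LIMSEQ_le_const2)
    show "(\<lambda>m. \<Sum>i\<in>F. (cmod (Rep_ell2 (X n) i - Rep_ell2 (X m) i))\<^sup>2)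
      \<longlonglongrightarrow> (\<Sum>i\<in>F. (cmod (Rep_ell2 (X n) i - l i))\<^sup>2)"
      by (intro tendsto_intros l)
    show "\<exists>N. \<forall>m\<ge>N. (\<Sum>i\<in>F. (cmod (Rep_ell2 (X n) i - Rep_ell2 (X m) i))\<^sup>2) \<le> e\<^sup>2"
    proof (intro exI [of _ M] allI impI)
      fix m assume "M \<le> m"
      have "(\<Sum>i\<in>F. (cmod (Rep_ell2 (X n) i - Rep_ell2 (X m) i))\<^sup>2) \<le> (norm (X n - X m))\<^sup>2"
        using ell2_finite_sum_le [OF \<open>finite F\<close>, of "X n - X m"] by (simp add: minus_ell2.rep_eq)
      also have "\<dots> \<le> e\<^sup>2"
        using M [OF n \<open>M \<le> m\<close>] by (intro power_mono) (auto simp: dist_norm)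
      finally show "(\<Sum>i\<in>F. (cmod (Rep_ell2 (X n) i - Rep_ell2 (X m) i))\<^sup>2) \<le> e\<^sup>2" .
    qed
  qed
  obtain M where M: "\<And>m n. m \<ge> M \<Longrightarrow> n \<ge> M \<Longrightarrow> dist (X m) (X n) < 1"
    using X unfolding Cauchy_def by (metis zero_less_one)
  have "(\<lambda>i. (cmod (Rep_ell2 (X M) i - l i))\<^sup>2) summable_on UNIV"
    by (rule nonneg_bdd_above_summable_on)
      (use tail [OF _ M order_refl] in \<open>auto intro!: bdd_aboveI [where M = "1\<^sup>2"]\<close>)
  from ell2_add_summable [OF this, of "\<lambda>i. - Rep_ell2 (X M) i"]
  have ls: "(\<lambda>i. (cmod (l i))\<^sup>2) summable_on UNIV"
    using ell2_summable [of "X M"] by simp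
  define L where "L = Abs_ell2 l"
  have L: "Rep_ell2 L = l"
    using ls by (simp add: L_def Abs_ell2_inverse)
  have "X \<longlonglongrightarrow> L"
  proof (rule metric_LIMSEQ_I)
    fix e :: real assume "0 < e"
    then obtain M where M: "\<And>m n. m \<ge> M \<Longrightarrow> n \<ge> M \<Longrightarrow> dist (X m) (X n) < e / 2"
      using X unfolding Cauchy_def by (meson half_gt_zero)
    have "dist (X n) L < e" if "n \<ge> M" for n
    proof -
      have "norm (X n - L) \<le> e / 2"
        by (rule ell2_norm_le) (use tail [OF _ M that] \<open>0 < e\<close> in \<open>auto simp: minus_ell2.rep_eq L\<close>)
      then show ?thesis using \<open>0 < e\<close> by (simp add: dist_norm)
    qed
    then show "\<exists>no. \<forall>n\<ge>no. dist (X n) L < e" by blast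
  qed
  then show "convergent X" by (auto simp: convergent_def)
qed


section \<open>Tracial W*-probability spaces\<close>

definition unital_star_subalgebra :: "'h::complex_hilbert_space bop set \<Rightarrow> bool" where
  "unital_star_subalgebra A \<longleftrightarrow>
     1 \<in> A \<and> (\<forall>a\<in>A. \<forall>b\<in>A. a + b \<in> A \<and> a * b \<in> A) \<and> (\<forall>c. \<forall>a\<in>A. c *\<^sub>C a \<in> A) \<and> (\<forall>a\<in>A. adj a \<in> A)"

definition weak_operator_topology :: "'h::complex_hilbert_space bop topology" where
  "weak_operator_topology =
     pullback_topology UNIV (\<lambda>T (x, y). cinner x (bop_apply T y)) euclidean"

definition von_neumann_algebra :: "'h::complex_hilbert_space bop set \<Rightarrow> bool" where
  "von_neumann_algebra A \<longleftrightarrow> unital_star_subalgebra A \<and> closedin weak_operator_topology A"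

text \<open>
  \<open>normal_on A \<phi>\<close> says that \<open>\<phi>\<close> is ultraweakly continuous on \<open>A\<close>, i.e. belongs to the predual.
\<close>

definition normal_on ::
  "'h::complex_hilbert_space bop set \<Rightarrow> ('h bop \<Rightarrow> complex) \<Rightarrow> bool" where
  "normal_on A \<phi> \<longleftrightarrow> (\<exists>(\<xi> :: nat \<Rightarrow> 'h) (\<eta> :: nat \<Rightarrow> 'h).
     summable (\<lambda>k. (norm (\<xi> k))\<^sup>2) \<and> summable (\<lambda>k. (norm (\<eta> k))\<^sup>2) \<and>
     (\<forall>a\<in>A. (\<lambda>k. cinner (\<xi> k) (bop_apply a (\<eta> k))) sums \<phi> a))"

definition tracial_wstar_prob_space ::
  "'h::complex_hilbert_space bop set \<Rightarrow> ('h bop \<Rightarrow> complex) \<Rightarrow> bool" where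
  "tracial_wstar_prob_space A \<phi> \<longleftrightarrow>
     von_neumann_algebra A \<and>
     (\<forall>a\<in>A. \<forall>b\<in>A. \<forall>c d. \<phi> (c *\<^sub>C a + d *\<^sub>C b) = c * \<phi> a + d * \<phi> b) \<and>
     \<phi> 1 = 1 \<and>
     (\<forall>a\<in>A. \<phi> (adj a * a) \<in> \<real>\<^sub>\<ge>\<^sub>0) \<and>
     (\<forall>a\<in>A. \<phi> (adj a * a) = 0 \<longrightarrow> a = 0) \<and>
     (\<forall>a\<in>A. \<forall>b\<in>A. \<phi> (a * b) = \<phi> (b * a)) \<and>
     normal_on A \<phi>"

definition star_algebra_generated ::
  "'h::complex_hilbert_space bop set \<Rightarrow> 'h bop set" where
  "star_algebra_generated X = \<Inter>{B. unital_star_subalgebra B \<and> X \<subseteq> B}"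

definition free_independent ::
  "('h::complex_hilbert_space bop \<Rightarrow> complex) \<Rightarrow> 'i set \<Rightarrow> ('i \<Rightarrow> 'h bop set) \<Rightarrow> bool" where
  "free_independent \<phi> I X \<longleftrightarrow>
     (\<forall>w :: ('i \<times> 'h bop) list.
        w \<noteq> [] \<and> successively (\<noteq>) (map fst w) \<and>
        (\<forall>(i, a)\<in>set w. i \<in> I \<and> a \<in> star_algebra_generated (X i) \<and> \<phi> a = 0)
        \<longrightarrow> \<phi> (prod_list (map snd w)) = 0)"


section \<open>Laws\<close>

definition eq_law ::
  "('h::complex_hilbert_space bop \<Rightarrow> complex) \<Rightarrow> 'h bop \<Rightarrow>
   ('k::complex_hilbert_space bop \<Rightarrow> complex) \<Rightarrow> 'k bop \<Rightarrow> bool" where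
  "eq_law \<phi> a \<psi> b \<longleftrightarrow> (\<forall>m\<ge>1. \<phi> (a ^ m) = \<psi> (b ^ m))"

definition converges_in_law ::
  "('h::complex_hilbert_space bop \<Rightarrow> complex) \<Rightarrow> (nat \<Rightarrow> 'h bop) \<Rightarrow>
   ('k::complex_hilbert_space bop \<Rightarrow> complex) \<Rightarrow> 'k bop \<Rightarrow> bool" where
  "converges_in_law \<phi> F \<psi> G \<longleftrightarrow> (\<forall>m\<ge>1. (\<lambda>n. \<phi> (F n ^ m)) \<longlonglongrightarrow> \<psi> (G ^ m))"

text \<open>The parameter of \<open>semicircle_law\<close> is the variance.\<close>

definition semicircle_law :: "real \<Rightarrow> real measure" where
  "semicircle_law v =
     (if v = 0 then return borel 0
      else density lborel (\<lambda>x. ennreal (indicator {- 2 * sqrt v .. 2 * sqrt v} x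
             * sqrt (4 * v - x\<^sup>2) / (2 * pi * v))))"

definition has_semicircle_law ::
  "('h::complex_hilbert_space bop \<Rightarrow> complex) \<Rightarrow> 'h bop \<Rightarrow> real \<Rightarrow> bool" where
  "has_semicircle_law \<phi> a v \<longleftrightarrow>
     (\<forall>m\<ge>1. \<phi> (a ^ m) = complex_of_real (\<integral>x. x ^ m \<partial>semicircle_law v))"


section \<open>Free Brownian motion and Wigner integrals\<close>

definition free_brownian_motion ::
  "'h::complex_hilbert_space bop set \<Rightarrow> ('h bop \<Rightarrow> complex) \<Rightarrow> (real \<Rightarrow> 'h bop) \<Rightarrow> bool" where
  "free_brownian_motion A \<phi> S \<longleftrightarrow>
     (\<forall>t\<ge>0. S t \<in> A \<and> self_adjoint (S t)) \<and>
     S 0 = 0 \<and>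
     (\<forall>s t. 0 \<le> s \<and> s \<le> t \<longrightarrow> has_semicircle_law \<phi> (S t - S s) (t - s)) \<and>
     (\<forall>(t :: nat \<Rightarrow> real) n. 0 \<le> t 0 \<and> (\<forall>i<n. t i < t (Suc i))
        \<longrightarrow> free_independent \<phi> {..<n} (\<lambda>i. {S (t (Suc i)) - S (t i)}))"

abbreviation Rplus :: "real measure" where
  "Rplus \<equiv> restrict_space lborel {0..}"

definition L2 :: "'x measure \<Rightarrow> ('x \<Rightarrow> real) set" where
  "L2 M = {f \<in> borel_measurable M. integrable M (\<lambda>x. (f x)\<^sup>2)}"

definition L2_norm :: "'x measure \<Rightarrow> ('x \<Rightarrow> real) \<Rightarrow> real" where
  "L2_norm M f = sqrt (\<integral>x. (f x)\<^sup>2 \<partial>M)"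

definition L2_sym :: "(real \<times> real \<Rightarrow> real) set" where
  "L2_sym = {f \<in> L2 (Rplus \<Otimes>\<^sub>M Rplus). AE (x, y) in Rplus \<Otimes>\<^sub>M Rplus. f (x, y) = f (y, x)}"

definition trace_norm2 :: "('h::complex_hilbert_space bop \<Rightarrow> complex) \<Rightarrow> 'h bop \<Rightarrow> real" where
  "trace_norm2 \<phi> a = sqrt (Re (\<phi> (adj a * a)))"

text \<open>
  Continuous linear maps from a space \<open>V\<close> of square-integrable functions into \<open>L\<^sup>2(\<phi>)\<close>. Since \<open>\<phi>\<close>
  is faithful, \<open>A\<close> embeds into \<open>L\<^sup>2(\<phi>)\<close>, and the maps considered take their values in \<open>A\<close>: single
  and double Wigner integrals are bounded operators (Biane and Speicher's form of Haagerup's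
  inequality). Functions are not identified almost everywhere, but the norm bound forces
  \<open>J f = J g\<close> whenever \<open>f = g\<close> almost everywhere.
\<close>

definition continuous_linear_L2 ::
  "'x measure \<Rightarrow> ('x \<Rightarrow> real) set \<Rightarrow> 'h::complex_hilbert_space bop set \<Rightarrow>
   ('h bop \<Rightarrow> complex) \<Rightarrow> (('x \<Rightarrow> real) \<Rightarrow> 'h bop) \<Rightarrow> bool" where
  "continuous_linear_L2 M V A \<phi> J \<longleftrightarrow>
     (\<forall>f\<in>V. J f \<in> A) \<and>
     (\<forall>f\<in>V. \<forall>g\<in>V. \<forall>c d. J (\<lambda>x. c * f x + d * g x) = c *\<^sub>R J f + d *\<^sub>R J g) \<and>
     (\<exists>C. \<forall>f\<in>V. trace_norm2 \<phi> (J f) \<le> C * L2_norm M f)"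

text \<open>\<open>h \<mapsto> \<integral>h dS\<close> is the continuous linear extension of \<open>1\<^bsub>[s,t]\<^esub> \<mapsto> S\<^sub>t - S\<^sub>s\<close>.\<close>

definition is_wigner_integral1 ::
  "'h::complex_hilbert_space bop set \<Rightarrow> ('h bop \<Rightarrow> complex) \<Rightarrow> (real \<Rightarrow> 'h bop) \<Rightarrow>
   ((real \<Rightarrow> real) \<Rightarrow> 'h bop) \<Rightarrow> bool" where
  "is_wigner_integral1 A \<phi> S J \<longleftrightarrow>
     continuous_linear_L2 Rplus (L2 Rplus) A \<phi> J \<and>
     (\<forall>s t. 0 \<le> s \<and> s \<le> t \<longrightarrow> J (indicat_real {s..t}) = S t - S s)"

definition wigner_integral1 ::
  "'h::complex_hilbert_space bop set \<Rightarrow> ('h bop \<Rightarrow> complex) \<Rightarrow> (real \<Rightarrow> 'h bop) \<Rightarrow>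
   (real \<Rightarrow> real) \<Rightarrow> 'h bop" where
  "wigner_integral1 A \<phi> S h = (THE a. \<exists>J. is_wigner_integral1 A \<phi> S J \<and> a = J h)"

definition is_wigner_integral2 ::
  "'h::complex_hilbert_space bop set \<Rightarrow> ('h bop \<Rightarrow> complex) \<Rightarrow> (real \<Rightarrow> 'h bop) \<Rightarrow>
   ((real \<times> real \<Rightarrow> real) \<Rightarrow> 'h bop) \<Rightarrow> bool" where
  "is_wigner_integral2 A \<phi> S J \<longleftrightarrow>
     continuous_linear_L2 (Rplus \<Otimes>\<^sub>M Rplus) L2_sym A \<phi> J \<and>
     (\<forall>h\<in>L2 Rplus. J (\<lambda>(x, y). h x * h y) =
        (wigner_integral1 A \<phi> S h)\<^sup>2 - (\<integral>t. (h t)\<^sup>2 \<partial>Rplus) *\<^sub>R 1)"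

definition wigner_integral2 ::
  "'h::complex_hilbert_space bop set \<Rightarrow> ('h bop \<Rightarrow> complex) \<Rightarrow> (real \<Rightarrow> 'h bop) \<Rightarrow>
   (real \<times> real \<Rightarrow> real) \<Rightarrow> 'h bop" where
  "wigner_integral2 A \<phi> S f = (THE a. \<exists>J. is_wigner_integral2 A \<phi> S J \<and> a = J f)"


section \<open>Enlargements\<close>

definition unital_star_hom_on ::
  "'h::complex_hilbert_space bop set \<Rightarrow> ('h bop \<Rightarrow> 'k::complex_hilbert_space bop) \<Rightarrow> bool" where
  "unital_star_hom_on A \<iota> \<longleftrightarrow>
     \<iota> 1 = 1 \<and>
     (\<forall>a\<in>A. \<forall>b\<in>A. \<forall>c d. \<iota> (c *\<^sub>C a + d *\<^sub>C b) = c *\<^sub>C \<iota> a + d *\<^sub>C \<iota> b) \<and>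
     (\<forall>a\<in>A. \<forall>b\<in>A. \<iota> (a * b) = \<iota> a * \<iota> b) \<and>
     (\<forall>a\<in>A. \<iota> (adj a) = adj (\<iota> a))"

text \<open>An embedding \<open>\<iota>\<close> as below is automatically injective on \<open>A\<close>, because \<open>\<phi>\<close> is faithful.\<close>

definition enlargement ::
  "'h::complex_hilbert_space bop set \<Rightarrow> ('h bop \<Rightarrow> complex) \<Rightarrow>
   'k::complex_hilbert_space bop set \<Rightarrow> ('k bop \<Rightarrow> complex) \<Rightarrow> ('h bop \<Rightarrow> 'k bop) \<Rightarrow> bool" where
  "enlargement A \<phi> B \<psi> \<iota> \<longleftrightarrow>
     tracial_wstar_prob_space B \<psi> \<and> unital_star_hom_on A \<iota> \<and>
     (\<forall>a\<in>A. \<iota> a \<in> B \<and> \<psi> (\<iota> a) = \<phi> a)"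

text \<open>
  Quantification over enlargements needs a Hilbert space fixed in advance. This one is large
  enough for the free product of a von Neumann algebra \<open>A\<close> on \<open>'h\<close> with the algebra of one
  semicircular element: \<open>A\<close> is dense in \<open>L\<^sup>2(\<phi>)\<close>, so an orthonormal basis of \<open>L\<^sup>2(\<phi>)\<close> can be
  indexed by elements of \<open>A\<close>, and one of the free product space by finite words in such indices
  (up to amplification of the resulting representation).
\<close>

type_synonym 'h enlarged = "'h bop list ell2"

end

theory Submission
  imports Defs "Jordan_Normal_Form.Schur_Decomposition" "HOL-Real_Asymp.Real_Asymp"
begin

text \<open>
  The free cumulants of \<open>I\<^sub>2(f)\<close> are the power sums \<open>\<Sum>\<^sub>i \<lambda>\<^sub>i\<^sup>r\<close> (\<open>r \<ge> 2\<close>) of the eigenvalues of the kernel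
  \<open>f\<close>. Convergence in law means convergence of these power sums for each \<open>r\<close>. Order the
  eigenvalues by modulus and pass to a subsequence along which every single one converges, say
  to \<open>\<mu>\<^sub>i\<close>. For \<open>r \<ge> 3\<close> the power sums then converge to \<open>\<Sum>\<^sub>i \<mu>\<^sub>i\<^sup>r\<close>, while for \<open>r = 2\<close> some mass \<open>c\<^sup>2\<close> may be
  lost; it is the variance of a free semicircular element, as that has no other cumulants.

  Only step functions on dyadic grids are needed to make this precise: their integrals are
  quadratic polynomials in free semicircular increments, whose moments are computed by expansion
  into Wick words, and they approximate arbitrary kernels. The semicircular element is
  adjoined by means of a Fock space over the standard representation of \<open>A\<close>.
\<close>


section \<open>Bounded operators and adjoints\<close>

text \<open>The integral \<open>J\<close> is continuous only into the norm of L2(\<phi>), which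
  gives no control of operator norms, so the moments of approximants need not converge by
  themselves. They do because \<phi> is a trace and all moments stay bounded; the latter holds since
  for matrices the second cumulant dominates the higher ones. The limiting kernel can be taken
  diagonal: indicators of unit intervals are orthonormal, so the grid of mesh 1 realises every
  square-summable sequence of eigenvalues. The adjoined element must live in a tracial von Neumann
  algebra on a Hilbert space fixed in advance. A second semicircular element, acting from the right
  and agreeing with the first on the vacuum, shows that the vacuum state is a trace there; its
  faithfulness is the cyclicity of the operators acting from the right. Both integrals are definite
  descriptions. A double integral can exist only if a single one does; if there is no double
  integral, the sequence is constant, and that case is treated separately.\<close>

lemma bop_apply_simps [simp]:
  "bop_apply (S + T) x = bop_apply S x + bop_apply T x"
  "bop_apply (S - T) x = bop_apply S x - bop_apply T x"
  "bop_apply (- T) x = - bop_apply T x"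
  "bop_apply (S * T) x = bop_apply S (bop_apply T x)"
  "bop_apply 0 x = 0"
  "bop_apply 1 x = x"
  "bop_apply (r *\<^sub>R T) x = r *\<^sub>R bop_apply T x"
  "bop_apply (c *\<^sub>C T) x = c *\<^sub>C bop_apply T x"
  by (simp_all add: bop_apply_def plus_bop.rep_eq minus_bop.rep_eq uminus_bop.rep_eq
      times_bop.rep_eq zero_bop.rep_eq one_bop.rep_eq scaleR_bop.rep_eq scaleC_bop.rep_eq
      blinfun.add_left blinfun.diff_left blinfun.minus_left blinfun.scaleR_left
      bounded_linear_Blinfun_apply [OF bounded_linear_scaleC])

lemma bounded_linear_bop_apply: "bounded_linear (bop_apply T)"
  unfolding bop_apply_def by (rule blinfun.bounded_linear_right)

lemmas bop_apply_add = bounded_linear.linear [OF bounded_linear_bop_apply, THEN linear_add]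
  and bop_apply_zero [simp] = bounded_linear.linear [OF bounded_linear_bop_apply, THEN linear_0]
  and bop_apply_scaleR = bounded_linear.linear [OF bounded_linear_bop_apply, THEN linear_scale]

lemma bop_apply_scaleC: "bop_apply T (c *\<^sub>C x) = c *\<^sub>C bop_apply T x"
  using blinfun_of_bop [of T] by (simp add: bop_apply_def)

lemma bop_eqI: "(\<And>x. bop_apply S x = bop_apply T x) \<Longrightarrow> S = T"
  unfolding bop_apply_def blinfun_of_bop_inject [symmetric] by (rule blinfun_eqI) simp

definition opnorm :: "'h::complex_hilbert_space bop \<Rightarrow> real" where
  "opnorm T = norm (blinfun_of_bop T)"

lemma opnorm_nonneg [simp]: "0 \<le> opnorm T"
  by (simp add: opnorm_def)

lemma norm_bop_apply_le: "norm (bop_apply T x) \<le> opnorm T * norm x"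
  by (simp add: opnorm_def bop_apply_def norm_blinfun)

definition make_bop :: "('h::complex_hilbert_space \<Rightarrow> 'h) \<Rightarrow> 'h bop" where
  "make_bop f = Abs_bop (Blinfun f)"

lemma bop_apply_make_bop:
  assumes "\<And>x y. f (x + y) = f x + f y" "\<And>c x. f (c *\<^sub>C x) = c *\<^sub>C f x"
    and "\<And>x. norm (f x) \<le> norm x * K"
  shows "bop_apply (make_bop f) = f"
proof -
  have "f (r *\<^sub>R x) = r *\<^sub>R f x" for r x
    by (metis assms(2) scaleC_of_real)
  then have "bounded_linear f"
    by (intro bounded_linear_intro [of f K]) (use assms in auto)
  then show ?thesis
    using assms(2) by (simp add: bop_apply_def make_bop_def Abs_bop_inverse bounded_linear_Blinfun_apply)
qed

lemma scaleC_zero_left: "0 *\<^sub>C (x::'a::complex_vector) = 0"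
  using scaleC_of_real [of 0 x] by simp

lemma scaleC_one: "1 *\<^sub>C (x::'a::complex_vector) = x"
  using scaleC_of_real [of 1 x] by simp

lemma scaleC_minus_left: "(- c) *\<^sub>C (x::'a::complex_vector) = - (c *\<^sub>C x)"
  using scaleC_add_left [of c "- c" x] by (simp add: scaleC_zero_left add_eq_0_iff)

lemma inner_scaleC_i_left: "inner (\<i> *\<^sub>C x) y = - inner x (\<i> *\<^sub>C (y::'h::complex_hilbert_space))"
  using cinner_commute [of x y] by (simp add: cinner_def complex_eq_iff inner_commute)

lemma cinner_add_right: "cinner x (y + z) = cinner x y + cinner x z"
  and cinner_add_left: "cinner (y + z) x = cinner y x + cinner z x"
  by (simp_all add: cinner_def complex_eq_iff inner_add_right inner_add_left scaleC_add_right)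

lemma cinner_scaleR_right: "cinner x (r *\<^sub>R y) = complex_of_real r * cinner x y"
  by (simp add: cinner_def complex_eq_iff)

lemma cinner_scaleC_right: "cinner x (c *\<^sub>C y) = c * cinner x y"
proof -
  have "cinner x (\<i> *\<^sub>C y) = \<i> * cinner x y"
    using inner_scaleC_i_left [of x "\<i> *\<^sub>C y"] inner_scaleC_i [of x y]
    by (simp add: cinner_def complex_eq_iff inner_scaleC_i_left)
  then show ?thesis
    by (subst scaleC_decompose) (simp add: cinner_add_right cinner_scaleR_right algebra_simps,
      simp add: complex_eq_iff)
qed

lemma cinner_scaleC_left: "cinner (c *\<^sub>C x) y = cnj c * cinner x y"
  by (metis cinner_commute cinner_scaleC_right complex_cnj_cnj complex_cnj_mult)

lemma cinner_zero [simp]: "cinner 0 x = 0" "cinner x 0 = 0"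
  by (simp_all add: cinner_def complex_eq_iff scaleC_zero_right)

lemma cinner_diff_right: "cinner x (y - z) = cinner x y - cinner x z"
  and cinner_diff_left: "cinner (y - z) x = cinner y x - cinner z x"
  by (simp_all add: cinner_def complex_eq_iff inner_diff_right inner_diff_left scaleC_diff_right)

lemma cinner_self: "cinner x x = complex_of_real ((norm x)\<^sup>2)"
  using inner_scaleC_i_left [of x x]
  by (simp add: cinner_def complex_eq_iff power2_norm_eq_inner inner_commute)

lemma cinner_eq_zero_iff [simp]: "cinner x x = 0 \<longleftrightarrow> x = 0"
  by (simp add: cinner_self)

lemma cinner_eqI:
  assumes "\<And>x. cinner x y = cinner x z"
  shows "y = z"
  using assms [of "y - z"] by (metis cinner_diff_right cinner_eq_zero_iff eq_iff_diff_eq_0)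

lemma norm_scaleC: "norm (c *\<^sub>C x) = cmod c * norm (x::'h::complex_hilbert_space)"
proof -
  have "complex_of_real ((norm (c *\<^sub>C x))\<^sup>2) = complex_of_real ((cmod c * norm x)\<^sup>2)"
    unfolding cinner_self [symmetric] cinner_scaleC_left cinner_scaleC_right
    by (simp only: cinner_self power_mult_distrib of_real_mult)
      (use complex_norm_square [of c] in \<open>simp add: mult.commute\<close>)
  then have "(norm (c *\<^sub>C x))\<^sup>2 = (cmod c * norm x)\<^sup>2"
    using of_real_eq_iff by blast
  then show ?thesis
    by (simp add: power2_eq_iff_nonneg)
qed

text \<open>A unimodular multiple of \<open>y\<close> makes the product real and nonnegative; the
  real Cauchy-Schwarz inequality then applies.\<close>

lemma cinner_Cauchy_Schwarz: "cmod (cinner x y) \<le> norm x * norm y"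
proof (cases "cinner x y = 0")
  case False
  define u where "u = cnj (cinner x y) / complex_of_real (cmod (cinner x y))"
  have u: "cmod u = 1"
    using False by (simp add: u_def norm_divide)
  have "u * cinner x y = complex_of_real (cmod (cinner x y))"
    using False complex_norm_square [of "cinner x y"]
    by (simp add: u_def field_simps power2_eq_square)
  then have "cinner x (u *\<^sub>C y) = complex_of_real (cmod (cinner x y))"
    by (simp add: cinner_scaleC_right)
  then have "cmod (cinner x y) = inner x (u *\<^sub>C y)"
    by (metis Re_complex_of_real cinner_def complex.sel(1))
  also have "\<dots> \<le> norm x * norm (u *\<^sub>C y)"
    by (rule norm_cauchy_schwarz)
  finally show ?thesis by (simp add: norm_scaleC u)
qed simp

lemma bounded_linear_cinner_right: "bounded_linear (cinner x)"
  by (rule bounded_linear_intro [where K = "norm x"])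
    (simp_all add: cinner_add_right cinner_scaleR_right scaleR_conv_of_real cinner_Cauchy_Schwarz mult.commute [of _ "norm x"])

lemmas tendsto_cinner_right = bounded_linear.tendsto [OF bounded_linear_cinner_right]

section \<open>Riesz representation and existence of adjoints\<close>

lemma riesz_representation:
  fixes f :: "'h::{real_inner, complete_space} \<Rightarrow> real"
  assumes "bounded_linear f"
  shows "\<exists>y. \<forall>x. f x = inner y x"
proof -
  interpret f: bounded_linear f by fact
  obtain K where K: "\<And>x. \<bar>f x\<bar> \<le> norm x * K"
    using f.bounded by auto
  \<comment> \<open>If \<open>f\<close> is represented by y, then \<open>g x\<close> is the squared
    distance from x to y up to a constant, so y is sought as the minimiser of \<open>g\<close>.
    Minimising sequences are Cauchy by the parallelogram identity \<open>par\<close>.\<close>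
  define g where "g x = (norm x)\<^sup>2 - 2 * f x" for x
  have g_ge: "g x \<ge> - K\<^sup>2" for x
  proof -
    have "0 \<le> (norm x - K)\<^sup>2" by simp
    then show ?thesis
      using K [of x] by (simp add: g_def power2_diff abs_le_iff)
  qed
  define m where "m = Inf (range g)"
  have bdd: "bdd_below (range g)"
    using g_ge by (auto intro!: bdd_belowI)
  have m_le: "m \<le> g x" for x
    unfolding m_def by (rule cInf_lower [OF _ bdd]) simp
  have "\<exists>x. g x < m + 1 / real (Suc n)" for n
    using cInf_lessD [of "range g" "m + 1 / real (Suc n)"] by (auto simp: m_def)
  then obtain X where X: "\<And>n. g (X n) < m + 1 / real (Suc n)"
    by metis
  have par: "(norm (x - y))\<^sup>2 \<le> 2 * (g x - m) + 2 * (g y - m)" for x y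
  proof -
    have "(norm (x - y))\<^sup>2 = 2 * g x + 2 * g y - 4 * g ((1/2) *\<^sub>R (x + y))"
      by (simp add: g_def power2_norm_eq_inner inner_add_left inner_add_right inner_diff_left
          inner_diff_right f.scaleR f.add inner_commute field_simps)
    with m_le [of "(1/2) *\<^sub>R (x + y)"] show ?thesis by simp
  qed
  have "Cauchy X"
  proof (rule metric_CauchyI)
    fix e :: real assume "0 < e"
    obtain M where M: "4 / e\<^sup>2 < real M"
      using reals_Archimedean2 by blast
    have "dist (X p) (X q) < e" if "p \<ge> M" "q \<ge> M" for p q
    proof -
      have bd: "g (X k) - m < e\<^sup>2 / 4" if "k \<ge> M" for k
      proof -
        have "4 / e\<^sup>2 < real (Suc k)" using M that by linarith
        then have "1 / real (Suc k) < e\<^sup>2 / 4"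
          using \<open>0 < e\<close> by (simp add: field_simps)
        with X [of k] show ?thesis by linarith
      qed
      have "(norm (X p - X q))\<^sup>2 \<le> 2 * (g (X p) - m) + 2 * (g (X q) - m)"
        by (rule par)
      also have "\<dots> < 2 * (e\<^sup>2 / 4) + 2 * (e\<^sup>2 / 4)"
        by (intro add_strict_mono mult_strict_left_mono bd that) auto
      finally have "(norm (X p - X q))\<^sup>2 < e\<^sup>2" by simp
      then show ?thesis
        using \<open>0 < e\<close> by (simp add: dist_norm power2_less_imp_less)
    qed
    then show "\<exists>M. \<forall>p\<ge>M. \<forall>q\<ge>M. dist (X p) (X q) < e" by blast
  qed
  then obtain y where y: "X \<longlonglongrightarrow> y"
    using Cauchy_convergent_iff convergent_def by blast
  have "(\<lambda>n. g (X n)) \<longlonglongrightarrow> g y"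
    unfolding g_def by (intro tendsto_intros y f.tendsto)
  moreover have "(\<lambda>n. m + 1 / real (Suc n)) \<longlonglongrightarrow> m + 0"
    by (intro tendsto_intros LIMSEQ_inverse_real_of_nat [unfolded inverse_eq_divide])
  ultimately have gy: "g y \<le> m"
    using LIMSEQ_le [of "\<lambda>n. g (X n)" "g y" "\<lambda>n. m + 1 / real (Suc n)" m] X by (auto intro: less_imp_le)
  have "f x = inner y x" for x
  proof (rule ccontr)
    assume ne: "f x \<noteq> inner y x"
    define d where "d = inner y x - f x"
    have pos: "0 \<le> t\<^sup>2 * (norm x)\<^sup>2 + 2 * t * d" for t
    proof -
      have "g (y + t *\<^sub>R x) = g y + t\<^sup>2 * (norm x)\<^sup>2 + 2 * t * d"
        unfolding g_def d_def power2_norm_eq_inner inner_add_left inner_add_right f.scaleR f.add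
        by (simp add: inner_commute algebra_simps power2_eq_square [of t])
      with m_le [of "y + t *\<^sub>R x"] gy show ?thesis by linarith
    qed
    \<comment> \<open>The quadratic polynomial in \<open>pos\<close> is tested at its minimum, t = -
      d / |x|^2, where it is negative.\<close>
    have "x \<noteq> 0" using ne by (auto simp: f.zero)
    then have "0 < (norm x)\<^sup>2" by simp
    then have "(- d / (norm x)\<^sup>2)\<^sup>2 * (norm x)\<^sup>2 + 2 * (- d / (norm x)\<^sup>2) * d = - d\<^sup>2 / (norm x)\<^sup>2"
      by (simp add: field_simps power2_eq_square)
    moreover have "- d\<^sup>2 / (norm x)\<^sup>2 < 0"
      using ne \<open>0 < (norm x)\<^sup>2\<close> by (simp add: d_def)
    ultimately show False using pos [of "- d / (norm x)\<^sup>2"] by simp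
  qed
  then show ?thesis by blast
qed

text \<open>Riesz is applied to the real inner product only. The resulting map \<open>R\<close> is
  complex linear because representing vectors are unique and multiplication by i is skew for
  \<open>inner\<close>.\<close>

lemma is_adjoint_exists: "\<exists>R. is_adjoint T R"
proof -
  have "\<exists>z. \<forall>y. inner x (bop_apply T y) = inner z y" for x
    by (rule riesz_representation)
      (rule bounded_linear_compose [OF bounded_linear_inner_right bounded_linear_bop_apply])
  then obtain R where R: "\<And>x y. inner (R x) y = inner x (bop_apply T y)"
    by metis
  have Reqs: "R x = z" if "\<And>y. inner x (bop_apply T y) = inner z y" for x z
    using that by (metis R vector_eq_rdot)
  have add: "R (x + y) = R x + R y" for x y
    by (rule Reqs) (simp add: R inner_add_left)
  have scR: "R (r *\<^sub>R x) = r *\<^sub>R R x" for r x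
    by (rule Reqs) (simp add: R)
  have sci: "R (\<i> *\<^sub>C x) = \<i> *\<^sub>C R x" for x
    by (rule Reqs) (simp add: R inner_scaleC_i_left flip: bop_apply_scaleC)
  have scC: "R (c *\<^sub>C x) = c *\<^sub>C R x" for c x
    by (simp add: scaleC_decompose [of c] add scR sci)
  have bd: "norm (R x) \<le> norm x * opnorm T" for x
  proof (cases "R x = 0")
    case False
    have "norm (R x) * norm (R x) = inner x (bop_apply T (R x))"
      by (simp add: R [symmetric] power2_norm_eq_inner [symmetric] power2_eq_square)
    also have "\<dots> \<le> norm x * (opnorm T * norm (R x))"
      using norm_cauchy_schwarz [of x "bop_apply T (R x)"] norm_bop_apply_le [of T "R x"]
      by (meson mult_left_mono norm_ge_zero order_trans)
    finally show ?thesis using False by (simp add: mult.assoc [symmetric])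
  qed simp
  have ap: "bop_apply (make_bop R) = R"
    by (rule bop_apply_make_bop [OF add scC bd])
  have "is_adjoint T (make_bop R)"
    unfolding is_adjoint_def ap by (simp add: cinner_def R flip: sci)
  then show ?thesis ..
qed

lemma is_adjoint_adj: "is_adjoint T (adj T)"
  unfolding adj_def by (rule theI') (use is_adjoint_exists is_adjoint_unique in blast)

lemma cinner_adj_left: "cinner (bop_apply (adj T) x) y = cinner x (bop_apply T y)"
  using is_adjoint_adj [of T] by (simp add: is_adjoint_def)

lemma cinner_adj_right: "cinner x (bop_apply (adj T) y) = cinner (bop_apply T x) y"
  by (metis cinner_adj_left cinner_commute)

lemma adj_eqI:
  assumes "\<And>x y. cinner (bop_apply R x) y = cinner x (bop_apply T y)"
  shows "adj T = R"
  using assms is_adjoint_unique is_adjoint_adj unfolding is_adjoint_def by blast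

lemma adj_adj [simp]: "adj (adj T) = T"
  by (rule adj_eqI) (simp add: cinner_adj_right)

lemma adj_add: "adj (S + T) = adj S + adj T"
  by (rule adj_eqI) (simp add: cinner_add_left cinner_add_right cinner_adj_left)

lemma adj_diff: "adj (S - T) = adj S - adj T"
  by (rule adj_eqI) (simp add: cinner_diff_left cinner_diff_right cinner_adj_left)

lemma adj_mult: "adj (S * T) = adj T * adj S"
  by (rule adj_eqI) (simp add: cinner_adj_left)

lemma adj_scaleC: "adj (c *\<^sub>C T) = cnj c *\<^sub>C adj T"
  by (rule adj_eqI) (simp add: cinner_scaleC_left cinner_scaleC_right cinner_adj_left)

lemma adj_zero [simp]: "adj 0 = 0"
  by (rule adj_eqI) simp

lemma adj_one [simp]: "adj 1 = 1"
  by (rule adj_eqI) simp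

lemma bop_algebra_simps:
  fixes S T :: "'h::complex_hilbert_space bop"
  shows "(c *\<^sub>C S) * T = c *\<^sub>C (S * T)" "S * (c *\<^sub>C T) = c *\<^sub>C (S * T)"
    "(r *\<^sub>R S) * T = r *\<^sub>R (S * T)" "S * (r *\<^sub>R T) = r *\<^sub>R (S * T)"
  by (rule bop_eqI, simp add: bop_apply_scaleC bop_apply_scaleR)+

section \<open>Square-summable families\<close>

lemma ell2_rep_simps [simp]:
  "Rep_ell2 (x + y) i = Rep_ell2 x i + Rep_ell2 y i"
  "Rep_ell2 (x - y) i = Rep_ell2 x i - Rep_ell2 y i"
  "Rep_ell2 (- x) i = - Rep_ell2 x i"
  "Rep_ell2 0 i = 0"
  "Rep_ell2 (c *\<^sub>C x) i = c * Rep_ell2 x i"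
  "Rep_ell2 (r *\<^sub>R x) i = complex_of_real r * Rep_ell2 x i"
  by (simp_all add: plus_ell2.rep_eq minus_ell2.rep_eq uminus_ell2.rep_eq zero_ell2.rep_eq
      scaleC_ell2.rep_eq scaleR_ell2.rep_eq)

lemma ell2_eqI: "(\<And>i. Rep_ell2 x i = Rep_ell2 y i) \<Longrightarrow> x = y"
  by (simp add: Rep_ell2_inject [symmetric] fun_eq_iff)

lift_definition ket :: "'i \<Rightarrow> 'i ell2" is "\<lambda>i j. if j = i then 1 else 0"
proof -
  fix i :: 'i
  have "(\<lambda>j. (cmod (if j = i then 1 else 0))\<^sup>2) summable_on {i}"
    by (rule summable_on_finite) simp
  then show "(\<lambda>j. (cmod (if j = i then 1 else 0))\<^sup>2) summable_on UNIV"
    by (rule summable_on_cong_neutral [THEN iffD1, rotated -1]) auto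
qed

lemma cinner_ket_left: "cinner (ket i) x = Rep_ell2 x i"
proof -
  have "(\<Sum>\<^sub>\<infinity>j. inner (c * Rep_ell2 (ket i) j) (Rep_ell2 x j)) = inner c (Rep_ell2 x i)" for c
  proof -
    have "(\<Sum>\<^sub>\<infinity>j. inner (c * Rep_ell2 (ket i) j) (Rep_ell2 x j))
        = (\<Sum>\<^sub>\<infinity>j\<in>{i}. inner (c * Rep_ell2 (ket i) j) (Rep_ell2 x j))"
      by (rule infsum_cong_neutral) (auto simp: ket.rep_eq)
    then show ?thesis by (simp add: ket.rep_eq)
  qed
  from this [of 1] this [of \<i>] show ?thesis
    by (simp add: cinner_def inner_ell2.rep_eq complex_eq_iff)
qed

lemma cinner_ket_right: "cinner x (ket i) = cnj (Rep_ell2 x i)"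
  by (metis cinner_commute cinner_ket_left)

lemma norm_ket [simp]: "norm (ket i) = 1"
  using cinner_self [of "ket i"] by (simp add: cinner_ket_left ket.rep_eq)
    (metis norm_ge_zero of_real_1 of_real_eq_iff of_real_power one_power2 power2_eq_imp_eq zero_le_one)

lemma ell2_Abs:
  assumes "\<And>F. finite F \<Longrightarrow> (\<Sum>i\<in>F. (cmod (f i))\<^sup>2) \<le> e\<^sup>2" "0 \<le> e"
  shows "Rep_ell2 (Abs_ell2 f) = f \<and> norm (Abs_ell2 f) \<le> e"
proof -
  have "(\<lambda>i. (cmod (f i))\<^sup>2) summable_on UNIV"
    by (rule nonneg_bdd_above_summable_on) (use assms in \<open>auto intro!: bdd_aboveI [where M = "e\<^sup>2"]\<close>)
  then have "Rep_ell2 (Abs_ell2 f) = f"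
    by (simp add: Abs_ell2_inverse)
  moreover then have "norm (Abs_ell2 f) \<le> e"
    by (intro ell2_norm_le) (use assms in auto)
  ultimately show ?thesis by blast
qed

lemma ell2_norm_mono:
  assumes "\<And>i. cmod (Rep_ell2 x i) \<le> cmod (Rep_ell2 y i)"
  shows "norm x \<le> norm y"
proof (rule ell2_norm_le)
  fix F :: "'a set" assume "finite F"
  have "(\<Sum>i\<in>F. (cmod (Rep_ell2 x i))\<^sup>2) \<le> (\<Sum>i\<in>F. (cmod (Rep_ell2 y i))\<^sup>2)"
    by (intro sum_mono power_mono assms) auto
  also have "\<dots> \<le> (norm y)\<^sup>2" by (rule ell2_finite_sum_le) fact
  finally show "(\<Sum>i\<in>F. (cmod (Rep_ell2 x i))\<^sup>2) \<le> (norm y)\<^sup>2" .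
qed simp

definition ell2_on :: "'i set \<Rightarrow> 'i ell2 set" where
  "ell2_on E = {x. \<forall>i. i \<notin> E \<longrightarrow> Rep_ell2 x i = 0}"

lemma ell2_finite_approx:
  fixes x :: "'i ell2"
  assumes "0 < e"
  shows "\<exists>F. finite F \<and> norm (x - (\<Sum>i\<in>F. Rep_ell2 x i *\<^sub>C ket i)) < e"
proof -
  have rep: "Rep_ell2 (\<Sum>i\<in>F. Rep_ell2 x i *\<^sub>C ket i) j = (if j \<in> F then Rep_ell2 x j else 0)"
    if "finite F" for F j
    using that by (induction F) (auto simp: ket.rep_eq)
  have hs: "((\<lambda>i. (cmod (Rep_ell2 x i))\<^sup>2) has_sum (norm x)\<^sup>2) UNIV"
    unfolding ell2_norm_sq using ell2_summable by (rule has_sum_infsum)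
  have "(e/2)\<^sup>2 > 0" using assms by simp
  from tendstoD [OF hs [unfolded has_sum_def] this]
  obtain F where F: "finite F" "dist (\<Sum>i\<in>F. (cmod (Rep_ell2 x i))\<^sup>2) ((norm x)\<^sup>2) < (e/2)\<^sup>2"
    unfolding eventually_finite_subsets_at_top by blast
  have "norm (x - (\<Sum>i\<in>F. Rep_ell2 x i *\<^sub>C ket i)) \<le> e/2"
  proof (rule ell2_norm_le)
    fix G :: "'i set" assume G: "finite G"
    have "(\<Sum>i\<in>G. (cmod (Rep_ell2 (x - (\<Sum>i\<in>F. Rep_ell2 x i *\<^sub>C ket i)) i))\<^sup>2)
        = (\<Sum>i\<in>G. if i \<in> F then 0 else (cmod (Rep_ell2 x i))\<^sup>2)"
      by (rule sum.cong) (auto simp: rep F)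
    also have "\<dots> = (\<Sum>i\<in>G - F. (cmod (Rep_ell2 x i))\<^sup>2)"
      using G by (intro sum.mono_neutral_cong_right) auto
    also have "\<dots> = (\<Sum>i\<in>F \<union> (G - F). (cmod (Rep_ell2 x i))\<^sup>2) - (\<Sum>i\<in>F. (cmod (Rep_ell2 x i))\<^sup>2)"
      using F(1) G by (subst sum.union_disjoint) auto
    also have "\<dots> \<le> (norm x)\<^sup>2 - (\<Sum>i\<in>F. (cmod (Rep_ell2 x i))\<^sup>2)"
      using ell2_finite_sum_le [of "F \<union> (G - F)" x] F(1) G by simp
    also have "\<dots> \<le> (e/2)\<^sup>2"
      using F(2) by (simp add: dist_real_def)
    finally show "(\<Sum>i\<in>G. (cmod (Rep_ell2 (x - (\<Sum>i\<in>F. Rep_ell2 x i *\<^sub>C ket i)) i))\<^sup>2) \<le> (e/2)\<^sup>2" .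
  qed (use assms in simp)
  then show ?thesis using F(1) assms by force
qed

lemma closed_subspace_ell2_on:
  assumes "closed N" "\<And>x y. x \<in> N \<Longrightarrow> y \<in> N \<Longrightarrow> x + y \<in> N" "\<And>c x. x \<in> N \<Longrightarrow> c *\<^sub>C x \<in> N"
    and ket: "\<And>i. i \<in> E \<Longrightarrow> ket i \<in> N" and "0 \<in> N" and x: "x \<in> ell2_on E"
  shows "x \<in> N"
proof -
  have fin: "(\<Sum>i\<in>F. Rep_ell2 x i *\<^sub>C ket i) \<in> N" if "finite F" for F
    using that
  proof induction
    case (insert i F)
    then show ?case
      using ket [of i] x assms(2,3,5) by (cases "i \<in> E") (auto simp: ell2_on_def scaleC_zero_left)
  qed (use assms in simp)
  have "x \<in> closure N"
    unfolding closure_approachable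
  proof (intro allI impI)
    fix e :: real assume "0 < e"
    then obtain F where F: "finite F" "norm (x - (\<Sum>i\<in>F. Rep_ell2 x i *\<^sub>C ket i)) < e"
      using ell2_finite_approx by blast
    then show "\<exists>y\<in>N. dist y x < e"
      using fin by (metis dist_commute dist_norm)
  qed
  then show ?thesis using \<open>closed N\<close> by simp
qed

lemma bop_eq_ket:
  assumes "\<And>i. bop_apply S (ket i) = bop_apply T (ket i)"
  shows "S = T"
proof (rule bop_eqI)
  fix x
  have "x \<in> {x. bop_apply S x = bop_apply T x}"
    by (rule closed_subspace_ell2_on [where E = UNIV])
      (auto simp: assms bop_apply_add bop_apply_scaleC ell2_on_def intro!: closed_Collect_eq
        linear_continuous_on bounded_linear_bop_apply)
  then show "bop_apply S x = bop_apply T x" by simp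
qed

lemma adj_eq_ket:
  assumes "\<And>i j. Rep_ell2 (bop_apply R (ket j)) i = cnj (Rep_ell2 (bop_apply T (ket i)) j)"
  shows "adj T = R"
proof (rule bop_eq_ket, rule ell2_eqI)
  fix i j
  show "Rep_ell2 (bop_apply (adj T) (ket j)) i = Rep_ell2 (bop_apply R (ket j)) i"
    by (metis assms cinner_adj_right cinner_ket_left cinner_ket_right)
qed

text \<open>For \<open>p\<close> injective on \<open>D\<close> this is the partial isometry that
  takes \<open>ket (p z)\<close> to \<open>ket z\<close> for z in \<open>D\<close> and kills the
  remaining basis vectors. Projections, shifts of words and copies of a tensor factor are all of
  this form.\<close>

definition reidx :: "'i set \<Rightarrow> ('i \<Rightarrow> 'i) \<Rightarrow> 'i ell2 bop" where
  "reidx D p = make_bop (\<lambda>x. Abs_ell2 (\<lambda>z. if z \<in> D then Rep_ell2 x (p z) else 0))"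

lemma rep_reidx:
  assumes "inj_on p D"
  shows "Rep_ell2 (bop_apply (reidx D p) x) z = (if z \<in> D then Rep_ell2 x (p z) else 0)"
proof -
  define f where "f x = Abs_ell2 (\<lambda>z. if z \<in> D then Rep_ell2 x (p z) else 0)" for x
  have f: "Rep_ell2 (f x) = (\<lambda>z. if z \<in> D then Rep_ell2 x (p z) else 0) \<and> norm (f x) \<le> norm x" for x
  proof -
    have "(\<Sum>z\<in>F. (cmod (if z \<in> D then Rep_ell2 x (p z) else 0))\<^sup>2) \<le> (norm x)\<^sup>2" if "finite F" for F
    proof -
      have "(\<Sum>z\<in>F. (cmod (if z \<in> D then Rep_ell2 x (p z) else 0))\<^sup>2)
          = (\<Sum>z\<in>F \<inter> D. (cmod (Rep_ell2 x (p z)))\<^sup>2)"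
        using that by (intro sum.mono_neutral_cong_right) auto
      also have "\<dots> = (\<Sum>i\<in>p ` (F \<inter> D). (cmod (Rep_ell2 x i))\<^sup>2)"
        by (rule sum.reindex_cong [symmetric, of p]) (use assms in \<open>auto intro: inj_on_subset\<close>)
      also have "\<dots> \<le> (norm x)\<^sup>2" using that by (intro ell2_finite_sum_le) auto
      finally show ?thesis .
    qed
    from ell2_Abs [OF this norm_ge_zero] show ?thesis
      unfolding f_def .
  qed
  have "bop_apply (make_bop f) = f"
  proof (rule bop_apply_make_bop [where K = 1])
    show "f (x + y) = f x + f y" "f (c *\<^sub>C x) = c *\<^sub>C f x" for x y c
      by (rule ell2_eqI, simp add: f)+
    show "norm (f x) \<le> norm x * 1" for x
      using f [of x] by simp
  qed
  moreover have "reidx D p = make_bop f"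
    by (simp add: reidx_def f_def [abs_def])
  ultimately show ?thesis
    using f [of x] by simp
qed

lemma reidx_ket:
  assumes "inj_on p D" "z \<in> D" "p z = i"
  shows "bop_apply (reidx D p) (ket i) = ket z"
  by (rule ell2_eqI) (use assms in \<open>auto simp: rep_reidx ket.rep_eq inj_on_def\<close>)

lemma adj_reidx:
  assumes "inj_on p D" "inj_on q E"
    and "\<And>z. z \<in> D \<Longrightarrow> p z \<in> E \<and> q (p z) = z" "\<And>z. z \<in> E \<Longrightarrow> q z \<in> D \<and> p (q z) = z"
  shows "adj (reidx D p) = reidx E q"
proof (rule adj_eq_ket)
  fix i j
  have "i \<in> E \<and> q i = j \<longleftrightarrow> j \<in> D \<and> p j = i"
    using assms(3,4) by metis
  then show "Rep_ell2 (bop_apply (reidx E q) (ket j)) i = cnj (Rep_ell2 (bop_apply (reidx D p) (ket i)) j)"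
    by (auto simp: rep_reidx assms(1,2) ket.rep_eq)
qed

section \<open>Amplification of operators to a tensor product\<close>

locale amplify =
  fixes h :: "'z \<Rightarrow> 'x" and t :: "'z \<Rightarrow> 'y" and e :: "'x \<Rightarrow> 'y \<Rightarrow> 'z" and E :: "'x set"
  assumes h_mem: "h z \<in> E" and e_ht [simp]: "e (h z) (t z) = z"
    and h_e [simp]: "x \<in> E \<Longrightarrow> h (e x y) = x" and t_e [simp]: "x \<in> E \<Longrightarrow> t (e x y) = y"
begin

definition slice :: "'y \<Rightarrow> 'z ell2 \<Rightarrow> 'x ell2" where
  "slice y f = Abs_ell2 (\<lambda>x. if x \<in> E then Rep_ell2 f (e x y) else 0)"

text \<open>An index \<open>z\<close> stands for the pair of \<open>h z\<close> in \<open>E\<close>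
  and \<open>t z\<close>, so \<open>ell2\<close> over these indices is a tensor product. In this
  picture \<open>amp T\<close> is the compression of \<open>T\<close> to \<open>ell2_on E\<close>,
  tensored with the identity. It serves for the multiplicity of the standard representation and for
  operators on the first or last letter of a word.\<close>

definition amp :: "'x ell2 bop \<Rightarrow> 'z ell2 bop" where
  "amp T = make_bop (\<lambda>f. Abs_ell2 (\<lambda>z. Rep_ell2 (bop_apply T (slice (t z) f)) (h z)))"

lemma rep_slice: "Rep_ell2 (slice y f) x = (if x \<in> E then Rep_ell2 f (e x y) else 0)"
proof -
  have "(\<Sum>x\<in>F. (cmod (if x \<in> E then Rep_ell2 f (e x y) else 0))\<^sup>2) \<le> (norm f)\<^sup>2" if "finite F" for F
  proof -
    have "(\<Sum>x\<in>F. (cmod (if x \<in> E then Rep_ell2 f (e x y) else 0))\<^sup>2)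
        = (\<Sum>x\<in>F \<inter> E. (cmod (Rep_ell2 f (e x y)))\<^sup>2)"
      using that by (intro sum.mono_neutral_cong_right) auto
    also have "\<dots> = (\<Sum>i\<in>(\<lambda>x. e x y) ` (F \<inter> E). (cmod (Rep_ell2 f i))\<^sup>2)"
      by (rule sum.reindex_cong [symmetric, of "\<lambda>x. e x y"]) (auto intro: inj_on_inverseI [of _ h])
    also have "\<dots> \<le> (norm f)\<^sup>2" using that by (intro ell2_finite_sum_le) auto
    finally show ?thesis .
  qed
  from ell2_Abs [OF this norm_ge_zero] show ?thesis
    unfolding slice_def by simp
qed

lemma slice_add: "slice y (f + g) = slice y f + slice y g"
  and slice_scaleC: "slice y (c *\<^sub>C f) = c *\<^sub>C slice y f"
  by (rule ell2_eqI, simp add: rep_slice)+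

lemma slice_on: "slice y f \<in> ell2_on E"
  by (simp add: ell2_on_def rep_slice)

lemma slice_ket: "slice y (ket z) = (if t z = y then ket (h z) else 0)"
proof (rule ell2_eqI)
  fix x
  have "x \<in> E \<and> e x y = z \<longleftrightarrow> t z = y \<and> x = h z"
    using h_mem e_ht h_e t_e by metis
  then show "Rep_ell2 (slice y (ket z)) x = Rep_ell2 (if t z = y then ket (h z) else 0) x"
    by (auto simp: rep_slice ket.rep_eq)
qed

lemma slice_norm_sum: 
  assumes "finite Y"
  shows "(\<Sum>y\<in>Y. (norm (slice y f))\<^sup>2) \<le> (norm f)\<^sup>2"
proof -
  define g where "g z = (cmod (Rep_ell2 f z))\<^sup>2" for z
  have gs: "g summable_on A" for A
    using ell2_summable [of f] summable_on_subset_banach unfolding g_def by blast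
  have sl: "(norm (slice y f))\<^sup>2 = infsum g {z. t z = y}" for y
  proof -
    have "(norm (slice y f))\<^sup>2 = (\<Sum>\<^sub>\<infinity>x\<in>E. g (e x y))"
      unfolding ell2_norm_sq by (rule infsum_cong_neutral) (auto simp: rep_slice g_def)
    also have "\<dots> = infsum g ((\<lambda>x. e x y) ` E)"
      by (subst infsum_reindex) (auto intro: inj_on_inverseI [of _ h] simp: o_def)
    also have "(\<lambda>x. e x y) ` E = {z. t z = y}"
    proof
      show "{z. t z = y} \<subseteq> (\<lambda>x. e x y) ` E"
      proof
        fix z assume "z \<in> {z. t z = y}"
        then have "z = e (h z) y" by auto
        then show "z \<in> (\<lambda>x. e x y) ` E" using h_mem by (rule image_eqI)
      qed
    qed auto
    finally show ?thesis .
  qed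
  have "(\<Sum>y\<in>Y. (norm (slice y f))\<^sup>2) = infsum g {z. t z \<in> Y}"
    using assms
  proof induction
    case (insert y Y)
    have "{z. t z \<in> insert y Y} = {z. t z = y} \<union> {z. t z \<in> Y}" by auto
    then have "infsum g {z. t z \<in> insert y Y} = infsum g {z. t z = y} + infsum g {z. t z \<in> Y}"
      using insert.hyps by (simp add: infsum_Un_disjoint [OF gs gs] disjoint_iff)
    then show ?case using insert by (simp add: sl)
  qed simp
  also have "\<dots> \<le> infsum g UNIV"
    by (rule infsum_mono_neutral [OF gs gs]) (auto simp: g_def)
  also have "\<dots> = (norm f)\<^sup>2" by (simp add: ell2_norm_sq g_def [abs_def])
  finally show ?thesis .
qed

text \<open>Indices are grouped by their second coordinate \<open>y\<close>. On each group
  \<open>T\<close> acts on the single vector \<open>slice y f\<close>, and the squared norms of the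
  slices add up to at most that of \<open>f\<close>.\<close>

lemma amp_bound:
  assumes "finite F"
  shows "(\<Sum>z\<in>F. (cmod (Rep_ell2 (bop_apply T (slice (t z) f)) (h z)))\<^sup>2) \<le> (norm f * opnorm T)\<^sup>2"
proof -
  have "(\<Sum>z\<in>F. (cmod (Rep_ell2 (bop_apply T (slice (t z) f)) (h z)))\<^sup>2)
      = (\<Sum>y\<in>t ` F. \<Sum>z\<in>{z\<in>F. t z = y}. (cmod (Rep_ell2 (bop_apply T (slice (t z) f)) (h z)))\<^sup>2)"
    by (rule sum.image_gen [OF assms])
  also have "\<dots> \<le> (\<Sum>y\<in>t ` F. (opnorm T)\<^sup>2 * (norm (slice y f))\<^sup>2)"
  proof (rule sum_mono)
    fix y
    have "(\<Sum>z\<in>{z\<in>F. t z = y}. (cmod (Rep_ell2 (bop_apply T (slice (t z) f)) (h z)))\<^sup>2)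
        = (\<Sum>x\<in>h ` {z\<in>F. t z = y}. (cmod (Rep_ell2 (bop_apply T (slice y f)) x))\<^sup>2)"
      by (rule sum.reindex_cong [symmetric, of h]) (auto intro!: inj_on_inverseI [of _ "\<lambda>x. e x y"])
    also have "\<dots> \<le> (norm (bop_apply T (slice y f)))\<^sup>2"
      using assms by (intro ell2_finite_sum_le) auto
    also have "\<dots> \<le> (opnorm T * norm (slice y f))\<^sup>2"
      by (intro power_mono norm_bop_apply_le) simp
    finally show "(\<Sum>z\<in>{z\<in>F. t z = y}. (cmod (Rep_ell2 (bop_apply T (slice (t z) f)) (h z)))\<^sup>2)
      \<le> (opnorm T)\<^sup>2 * (norm (slice y f))\<^sup>2" by (simp add: power_mult_distrib)
  qed
  also have "\<dots> = (opnorm T)\<^sup>2 * (\<Sum>y\<in>t ` F. (norm (slice y f))\<^sup>2)"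
    by (simp add: sum_distrib_left)
  also have "\<dots> \<le> (opnorm T)\<^sup>2 * (norm f)\<^sup>2"
    using assms by (intro mult_left_mono slice_norm_sum) auto
  finally show ?thesis by (simp add: power_mult_distrib mult.commute)
qed

lemma rep_amp: "Rep_ell2 (bop_apply (amp T) f) z = Rep_ell2 (bop_apply T (slice (t z) f)) (h z)"
proof -
  define k where "k f = Abs_ell2 (\<lambda>z. Rep_ell2 (bop_apply T (slice (t z) f)) (h z))" for f
  have k: "Rep_ell2 (k f) = (\<lambda>z. Rep_ell2 (bop_apply T (slice (t z) f)) (h z))
      \<and> norm (k f) \<le> norm f * opnorm T" for f
    unfolding k_def by (rule ell2_Abs [OF amp_bound]) simp_all
  have "bop_apply (make_bop k) = k"
  proof (rule bop_apply_make_bop [where K = "opnorm T"])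
    show "k (x + y) = k x + k y" "k (c *\<^sub>C x) = c *\<^sub>C k x" for x y c
      by (rule ell2_eqI, simp add: k slice_add slice_scaleC bop_apply_add bop_apply_scaleC)+
    show "norm (k x) \<le> norm x * opnorm T" for x
      using k [of x] by simp
  qed
  moreover have "amp T = make_bop k"
    by (simp add: amp_def k_def [abs_def])
  ultimately show ?thesis
    using k [of f] by simp
qed

lemma amp_add: "amp (S + T) = amp S + amp T"
  and amp_scaleC: "amp (c *\<^sub>C T) = c *\<^sub>C amp T"
  by (intro bop_eqI ell2_eqI, simp add: rep_amp)+

lemma adj_amp: "adj (amp T) = amp (adj T)"
proof (rule adj_eq_ket)
  fix i j
  have "Rep_ell2 (bop_apply (adj T) (ket (h j))) (h i) = cnj (Rep_ell2 (bop_apply T (ket (h i))) (h j))"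
    by (metis cinner_adj_right cinner_ket_left cinner_ket_right)
  then show "Rep_ell2 (bop_apply (amp (adj T)) (ket j)) i = cnj (Rep_ell2 (bop_apply (amp T) (ket i)) j)"
    by (simp add: rep_amp slice_ket)
qed

lemma slice_amp:
  assumes "range (bop_apply T) \<subseteq> ell2_on E"
  shows "slice y (bop_apply (amp T) f) = bop_apply T (slice y f)"
  by (rule ell2_eqI) (use assms in \<open>auto simp: rep_slice rep_amp ell2_on_def\<close>)

text \<open>A compression respects the product because the right factor already maps into the
  subspace that is compressed to.\<close>

lemma amp_mult:
  assumes "range (bop_apply T) \<subseteq> ell2_on E"
  shows "amp (S * T) = amp S * amp T"
  by (intro bop_eqI ell2_eqI) (simp add: rep_amp slice_amp [OF assms])

lemma amp_one:
  assumes "\<And>x. x \<in> ell2_on E \<Longrightarrow> bop_apply T x = x"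
  shows "amp T = 1"
  by (intro bop_eqI ell2_eqI) (simp add: rep_amp assms slice_on, simp add: rep_slice h_mem)

lemma rep_amp_ket:
  "Rep_ell2 (bop_apply (amp T) (ket i)) z = (if t z = t i then Rep_ell2 (bop_apply T (ket (h i))) (h z) else 0)"
  by (simp add: rep_amp slice_ket)

end

lemma closure_csubspace:
  fixes N :: "'h::complex_hilbert_space set"
  assumes "\<And>x y. x \<in> N \<Longrightarrow> y \<in> N \<Longrightarrow> x + y \<in> N" "\<And>c x. x \<in> N \<Longrightarrow> c *\<^sub>C x \<in> N"
  shows "x \<in> closure N \<Longrightarrow> y \<in> closure N \<Longrightarrow> x + y \<in> closure N"
    and "x \<in> closure N \<Longrightarrow> c *\<^sub>C x \<in> closure N"
proof -
  show "x + y \<in> closure N" if xy: "x \<in> closure N" "y \<in> closure N"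
  proof -
    obtain f g where "\<And>n. f n \<in> N" "f \<longlonglongrightarrow> x" "\<And>n. g n \<in> N" "g \<longlonglongrightarrow> y"
      using xy unfolding closure_sequential by blast
    then show ?thesis
      unfolding closure_sequential
      by (intro exI [of _ "\<lambda>n. f n + g n"]) (auto intro: assms tendsto_add)
  qed
  show "c *\<^sub>C x \<in> closure N" if x: "x \<in> closure N"
  proof -
    obtain f where "\<And>n. f n \<in> N" "f \<longlonglongrightarrow> x"
      using x unfolding closure_sequential by blast
    then show ?thesis
      unfolding closure_sequential
      by (intro exI [of _ "\<lambda>n. c *\<^sub>C f n"])
        (auto intro: assms bounded_linear.tendsto [OF bounded_linear_scaleC])
  qed
qed

section \<open>Isometric embeddings of inner product spaces\<close>

text \<open>
  Zorn's lemma is applied to graphs of linear isometries \<open>W \<rightarrow> \<ell>\<^sup>2(V)\<close> on subspaces \<open>W\<close> whose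
  range is supported in \<open>W\<close>: when such an isometry is extended to a new vector \<open>x\<close>, the
  coordinate \<open>x\<close> is still free and carries the component of \<open>x\<close> orthogonal to \<open>W\<close>.
\<close>

locale semi_inner =
  fixes V :: "'v::complex_vector set" and B :: "'v \<Rightarrow> 'v \<Rightarrow> complex" and u :: 'v
  assumes V_add: "x \<in> V \<Longrightarrow> y \<in> V \<Longrightarrow> x + y \<in> V" and V_scale: "x \<in> V \<Longrightarrow> c *\<^sub>C x \<in> V"
    and B_add: "x \<in> V \<Longrightarrow> y \<in> V \<Longrightarrow> z \<in> V \<Longrightarrow> B x (y + z) = B x y + B x z"
    and B_scale: "x \<in> V \<Longrightarrow> y \<in> V \<Longrightarrow> B x (c *\<^sub>C y) = c * B x y"
    and B_sym: "x \<in> V \<Longrightarrow> y \<in> V \<Longrightarrow> B y x = cnj (B x y)"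
    and B_pos: "x \<in> V \<Longrightarrow> 0 \<le> Re (B x x)"
    and u: "u \<in> V" "B u u = 1"
begin

lemma B_scale_left: "x \<in> V \<Longrightarrow> y \<in> V \<Longrightarrow> B (c *\<^sub>C x) y = cnj c * B x y"
  by (metis B_scale B_sym V_scale complex_cnj_cnj complex_cnj_mult)

lemma B_add_left: "x \<in> V \<Longrightarrow> y \<in> V \<Longrightarrow> z \<in> V \<Longrightarrow> B (y + z) x = B y x + B z x"
  by (metis B_add B_sym V_add complex_cnj_add)

lemma V_diff: "x \<in> V \<Longrightarrow> y \<in> V \<Longrightarrow> x - y \<in> V"
  using V_add [of x "(-1) *\<^sub>C y"] V_scale [of y "-1"] by (simp add: scaleC_minus_left scaleC_one)

lemma Q_add: "x \<in> V \<Longrightarrow> y \<in> V \<Longrightarrow> Re (B (x + y) (x + y)) = Re (B x x) + Re (B y y) + 2 * Re (B x y)"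
  using B_sym [of x y] by (simp add: B_add B_add_left V_add)

lemma Q_scale: "x \<in> V \<Longrightarrow> Re (B (c *\<^sub>C x) (c *\<^sub>C x)) = (cmod c)\<^sup>2 * Re (B x x)"
  unfolding cmod_power2 using B_sym [of x x]
  by (simp add: B_scale B_scale_left V_scale complex_eq_iff power2_eq_square algebra_simps)

text \<open>The clause on closures says that the basis vectors of all occurring coordinates are
  limits of the range; this is what makes the range of a maximal graph dense in
  \<open>ell2_on E\<close>.\<close>

definition good :: "('v \<times> 'v ell2) set \<Rightarrow> bool" where
  "good G \<longleftrightarrow> Domain G \<subseteq> V \<and> (u, ket u) \<in> G \<and>
     (\<forall>x f y g. (x, f) \<in> G \<and> (y, g) \<in> G \<longrightarrow> (x + y, f + g) \<in> G) \<and>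
     (\<forall>x f c. (x, f) \<in> G \<longrightarrow> (c *\<^sub>C x, c *\<^sub>C f) \<in> G) \<and>
     (\<forall>x f. (x, f) \<in> G \<longrightarrow> (norm f)\<^sup>2 = Re (B x x)) \<and>
     (\<forall>x f i. (x, f) \<in> G \<and> Rep_ell2 f i \<noteq> 0 \<longrightarrow> i \<in> Domain G \<and> ket i \<in> closure (Range G))"

lemma goodD:
  assumes "good G"
  shows "(x, f) \<in> G \<Longrightarrow> x \<in> V" "(u, ket u) \<in> G"
    "(x, f) \<in> G \<Longrightarrow> (y, g) \<in> G \<Longrightarrow> (x + y, f + g) \<in> G"
    "(x, f) \<in> G \<Longrightarrow> (c *\<^sub>C x, c *\<^sub>C f) \<in> G"
    "(x, f) \<in> G \<Longrightarrow> (norm f)\<^sup>2 = Re (B x x)"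
    "(x, f) \<in> G \<Longrightarrow> Rep_ell2 f i \<noteq> 0 \<Longrightarrow> i \<in> Domain G"
    "(x, f) \<in> G \<Longrightarrow> Rep_ell2 f i \<noteq> 0 \<Longrightarrow> ket i \<in> closure (Range G)"
proof -
  from assms [unfolded good_def] have *: "Domain G \<subseteq> V" "(u, ket u) \<in> G"
     "\<forall>x f y g. (x, f) \<in> G \<and> (y, g) \<in> G \<longrightarrow> (x + y, f + g) \<in> G"
     "\<forall>x f c. (x, f) \<in> G \<longrightarrow> (c *\<^sub>C x, c *\<^sub>C f) \<in> G"
     "\<forall>x f. (x, f) \<in> G \<longrightarrow> (norm f)\<^sup>2 = Re (B x x)"
     "\<forall>x f i. (x, f) \<in> G \<and> Rep_ell2 f i \<noteq> 0 \<longrightarrow> i \<in> Domain G \<and> ket i \<in> closure (Range G)"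
    by - (elim conjE, assumption)+
  show "(x, f) \<in> G \<Longrightarrow> x \<in> V" using *(1) by blast
  show "(u, ket u) \<in> G" by (rule *(2))
  show "(x, f) \<in> G \<Longrightarrow> (y, g) \<in> G \<Longrightarrow> (x + y, f + g) \<in> G" using *(3) by simp
  show "(x, f) \<in> G \<Longrightarrow> (c *\<^sub>C x, c *\<^sub>C f) \<in> G" using *(4) by simp
  show "(x, f) \<in> G \<Longrightarrow> (norm f)\<^sup>2 = Re (B x x)" using *(5) by simp
  show "(x, f) \<in> G \<Longrightarrow> Rep_ell2 f i \<noteq> 0 \<Longrightarrow> i \<in> Domain G"
    "(x, f) \<in> G \<Longrightarrow> Rep_ell2 f i \<noteq> 0 \<Longrightarrow> ket i \<in> closure (Range G)"
    using *(6) by simp_all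
qed

lemma good_diff:
  assumes "good G" "(x, f) \<in> G" "(y, g) \<in> G"
  shows "(x - y, f - g) \<in> G"
  using goodD(3) [OF assms(1,2) goodD(4) [OF assms(1,3), of "-1"]]
  by (simp add: scaleC_minus_left scaleC_one)

lemma good_zero:
  assumes "good G" shows "(0, 0) \<in> G"
  using goodD(4) [OF assms goodD(2) [OF assms], of 0] by (simp add: scaleC_zero_left)

lemma good_unique:
  assumes "good G" "(x, f) \<in> G" "(x, g) \<in> G"
  shows "f = g"
proof -
  have "(norm (f - g))\<^sup>2 = Re (B (x - x) (x - x))"
    by (rule goodD(5) [OF assms(1) good_diff [OF assms]])
  also have "\<dots> = (norm (0 :: 'v ell2))\<^sup>2"
    using goodD(5) [OF assms(1) good_zero [OF assms(1)]] by simp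
  finally show ?thesis by simp
qed

lemma good_initial: "good (range (\<lambda>c. (c *\<^sub>C u, c *\<^sub>C ket u)))" (is "good ?G")
proof -
  have "(u, ket u) \<in> ?G"
    by (rule range_eqI [of _ _ 1]) (simp add: scaleC_one)
  moreover have "ket i \<in> closure (Range ?G)" "i \<in> Domain ?G" if "Rep_ell2 (c *\<^sub>C ket u) i \<noteq> 0" for c i
  proof -
    have "i = u" using that by (auto simp: ket.rep_eq split: if_splits)
    then show "ket i \<in> closure (Range ?G)" "i \<in> Domain ?G"
      using \<open>(u, ket u) \<in> ?G\<close> closure_subset [of "Range ?G"] by blast+
  qed
  ultimately show ?thesis
    unfolding good_def
    by (auto simp: u V_scale scaleC_scaleC norm_scaleC power_mult_distrib Q_scale
        scaleC_add_left [symmetric])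
qed

lemma good_chain:
  assumes "\<C> \<noteq> {}" "subset.chain (Collect good) \<C>"
  shows "good (\<Union>\<C>)"
proof -
  have g: "good G" if "G \<in> \<C>" for G
    using assms(2) that by (auto simp: subset.chain_def)
  have common: "\<exists>G\<in>\<C>. p \<in> G \<and> q \<in> G" if "p \<in> \<Union>\<C>" "q \<in> \<Union>\<C>" for p q
  proof -
    obtain G H where GH: "G \<in> \<C>" "H \<in> \<C>" "p \<in> G" "q \<in> H" using \<open>p \<in> \<Union>\<C>\<close> \<open>q \<in> \<Union>\<C>\<close> by blast
    then have "G \<subseteq> H \<or> H \<subseteq> G"
      using assms(2) by (auto simp: subset_chain_def)
    then show ?thesis using GH by blast
  qed
  have sup: "i \<in> Domain (\<Union>\<C>) \<and> ket i \<in> closure (Range (\<Union>\<C>))"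
    if xf: "(x, f) \<in> \<Union>\<C>" "Rep_ell2 f i \<noteq> 0" for x f i
  proof -
    obtain G where G: "G \<in> \<C>" "(x, f) \<in> G" using xf by blast
    have "Range G \<subseteq> Range (\<Union>\<C>)" using G by blast
    then show ?thesis
      using goodD(6,7) [OF g [OF G(1)] G(2) xf(2)] G(1) closure_mono by blast
  qed
  show ?thesis
    unfolding good_def
  proof (intro conjI allI impI)
    show "(x + y, f + k) \<in> \<Union>\<C>" if "(x, f) \<in> \<Union>\<C> \<and> (y, k) \<in> \<Union>\<C>" for x f y k
      using common [of "(x, f)" "(y, k)"] that goodD(3) [OF g] by blast
    show "(u, ket u) \<in> \<Union>\<C>" using assms(1) goodD(2) [OF g] by blast
  qed (use goodD(1,4,5) [OF g] sup in blast)+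
qed

text \<open>\<open>x\<close> is sent to \<open>w\<close> plus \<open>d\<close> times
  \<open>ket x\<close>: \<open>w\<close> is the limit of the images of ever better approximations of
  \<open>x\<close> from the domain, and \<open>d\<close> is the distance of \<open>x\<close> from
  the domain. The domain need not be complete, so a best approximation may not exist and
  orthogonality is available only in the limit.\<close>

lemma good_extend:
  assumes G: "good G" and x: "x \<in> V" "x \<notin> Domain G"
  shows "\<exists>G'. good G' \<and> G \<subseteq> G' \<and> G' \<noteq> G"
proof -
  define q where "q p = Re (B (x - p) (x - p))" for p
  define D where "D = Inf (q ` Domain G)"
  have inV: "p \<in> V" if "p \<in> Domain G" for p using that goodD(1) [OF G] by blast
  have q_pos: "0 \<le> q p" if "p \<in> Domain G" for p
    unfolding q_def by (intro B_pos V_diff x inV that)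
  have bdd: "bdd_below (q ` Domain G)"
    by (rule bdd_belowI [of _ 0]) (use q_pos in auto)
  have D_le: "D \<le> q p" if "p \<in> Domain G" for p
    unfolding D_def by (rule cInf_lower [OF _ bdd]) (use that in simp)
  have "0 \<le> D"
    unfolding D_def by (rule cInf_greatest) (use good_zero [OF G] q_pos in auto)
  have "\<exists>p f. (p, f) \<in> G \<and> q p < D + 1 / real (Suc n)" for n
  proof -
    have "\<exists>y\<in>q ` Domain G. y < D + 1 / real (Suc n)"
      unfolding D_def
      by (rule cInf_lessD) (use good_zero [OF G] in auto)
    then show ?thesis by blast
  qed
  then obtain p T where pT: "\<And>n. (p n, T n) \<in> G" and qp: "\<And>n. q (p n) < D + 1 / real (Suc n)"
    by metis
  have pD: "p n \<in> Domain G" and pV: "p n \<in> V" for n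
    using pT [of n] goodD(1) [OF G] by blast+
  have qlim: "(\<lambda>n. q (p n)) \<longlonglongrightarrow> D"
  proof (rule real_tendsto_sandwich [where f = "\<lambda>n. D" and h = "\<lambda>n. D + 1 / real (Suc n)"])
    show "(\<lambda>n. D + 1 / real (Suc n)) \<longlonglongrightarrow> D"
      using tendsto_add [OF tendsto_const LIMSEQ_inverse_real_of_nat, of D]
      by (simp add: inverse_eq_divide)
    show "\<forall>\<^sub>F n in sequentially. q (p n) \<le> D + 1 / real (Suc n)"
      using qp by (auto intro!: always_eventually less_imp_le)
    show "(\<lambda>n. D) \<longlonglongrightarrow> D" by simp
  qed (use D_le pD in auto)
  \<comment> \<open>Moving \<open>p n\<close> by a multiple of \<open>z\<close> cannot bring
    \<open>q\<close> below its infimum \<open>D\<close>. The optimal multiple gives a Cauchy-Schwarz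
    inequality whose defect \<open>q (p n) - D\<close> tends to 0.\<close>
  have ort: "(Re (B z (x - p n)))\<^sup>2 \<le> Re (B z z) * (q (p n) - D)" if z: "z \<in> Domain G" for z n
  proof -
    define r b where "r = Re (B z (x - p n))" and "b = Re (B z z)"
    have zV: "z \<in> V" by (rule inV [OF z])
    have ge: "2 * t * r \<le> q (p n) - D + t\<^sup>2 * b" for t :: real
    proof -
      have tz: "complex_of_real (-t) *\<^sub>C z \<in> V" by (intro V_scale zV)
      obtain f where "(z, f) \<in> G" using z by blast
      then have "p n + complex_of_real t *\<^sub>C z \<in> Domain G"
        using goodD(3) [OF G pT goodD(4) [OF G]] by blast
      from D_le [OF this] have "D \<le> q (p n + complex_of_real t *\<^sub>C z)" .
      also have "x - (p n + complex_of_real t *\<^sub>C z) = complex_of_real (-t) *\<^sub>C z + (x - p n)"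
        by (simp add: scaleC_minus_left)
      then have "q (p n + complex_of_real t *\<^sub>C z) = t\<^sup>2 * b + q (p n) - 2 * t * r"
        unfolding q_def
        by (simp only: Q_add [OF tz V_diff [OF x(1) pV]] Q_scale [OF zV]
            B_scale_left [OF zV V_diff [OF x(1) pV]])
          (simp add: r_def b_def)
      finally show ?thesis by linarith
    qed
    have "0 \<le> b" unfolding b_def by (rule B_pos [OF zV])
    have "r\<^sup>2 \<le> b * (q (p n) - D)"
    proof (cases "b = 0")
      case True
      have "r = 0"
      proof (rule ccontr)
        assume "r \<noteq> 0"
        then show False using ge [of "(q (p n) - D + 1) / (2 * r)"] True by simp
      qed
      then show ?thesis by (simp add: True)
    next
      case False
      then have "0 < b" using \<open>0 \<le> b\<close> by simp
      then show ?thesis using ge [of "r / b"] by (simp add: field_simps power2_eq_square)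
    qed
    then show ?thesis by (simp add: r_def b_def)
  qed
  \<comment> \<open>Parallelogram law; the midpoint of \<open>p n\<close> and \<open>p m\<close>
    lies in the domain, so \<open>q\<close> is at least \<open>D\<close> there.\<close>
  have par: "(norm (T n - T m))\<^sup>2 \<le> 2 * (q (p n) - D) + 2 * (q (p m) - D)" for n m
  proof -
    let ?a = "x - p n" and ?b = "p m - x"
    have V: "?a \<in> V" "?b \<in> V" "(-1) *\<^sub>C ?b \<in> V" by (intro V_diff V_scale x pV)+
    have "(norm (T n - T m))\<^sup>2 = Re (B (p n - p m) (p n - p m))"
      by (rule goodD(5) [OF G good_diff [OF G pT pT]])
    also have "\<dots> = Re (B (?a + ?b) (?a + ?b))"
    proof -
      have "?a + ?b = (-1) *\<^sub>C (p n - p m)" by (simp add: scaleC_minus_left scaleC_one)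
      then show ?thesis by (simp only: Q_scale [OF V_diff [OF pV pV]]) simp
    qed
    also have "\<dots> = 2 * Re (B ?a ?a) + 2 * Re (B ?b ?b) - Re (B (?a + (-1) *\<^sub>C ?b) (?a + (-1) *\<^sub>C ?b))"
      by (simp only: Q_add [OF V(1,2)] Q_add [OF V(1,3)] Q_scale [OF V(2)] B_scale [OF V(1,2)]) simp
    also have "?a + (-1) *\<^sub>C ?b = 2 *\<^sub>C (x - (1/2) *\<^sub>C (p n + p m))"
      using scaleC_of_real [of 2 x]
      by (simp add: scaleC_minus_left scaleC_one scaleC_diff_right scaleC_scaleC scaleR_2)
    also have "Re (B (2 *\<^sub>C (x - (1/2) *\<^sub>C (p n + p m))) (2 *\<^sub>C (x - (1/2) *\<^sub>C (p n + p m))))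
        = 4 * q ((1/2) *\<^sub>C (p n + p m))"
      by (subst Q_scale) (auto simp: q_def intro!: V_diff V_scale V_add x pV)
    also have "Re (B ?b ?b) = q (p m)"
    proof -
      have "?b = (-1) *\<^sub>C (x - p m)" by (simp add: scaleC_minus_left scaleC_one)
      then show ?thesis by (simp only: q_def Q_scale [OF V_diff [OF x(1) pV]]) simp
    qed
    finally have "(norm (T n - T m))\<^sup>2 = 2 * q (p n) + 2 * q (p m) - 4 * q ((1/2) *\<^sub>C (p n + p m))"
      by (simp add: q_def)
    moreover have "D \<le> q ((1/2) *\<^sub>C (p n + p m))"
      by (rule D_le) (use goodD(4) [OF G goodD(3) [OF G pT pT]] in blast)
    ultimately show ?thesis by (simp add: algebra_simps)
  qed
  have "Cauchy T"
  proof (rule metric_CauchyI)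
    fix e :: real assume "0 < e"
    then have "\<forall>\<^sub>F n in sequentially. q (p n) < D + e\<^sup>2 / 4"
      by (intro order_tendstoD(2) [OF qlim]) simp
    then obtain M where M: "\<And>n. n \<ge> M \<Longrightarrow> q (p n) < D + e\<^sup>2 / 4"
      unfolding eventually_sequentially by blast
    have "dist (T n) (T m) < e" if "n \<ge> M" "m \<ge> M" for n m
    proof -
      have "2 * (q (p n) - D) + 2 * (q (p m) - D) < e\<^sup>2"
        using M [OF that(1)] M [OF that(2)] by (simp add: field_simps)
      with par [of n m] have "(norm (T n - T m))\<^sup>2 < e\<^sup>2"
        by (rule le_less_trans)
      then show ?thesis using \<open>0 < e\<close> by (simp add: dist_norm power2_less_imp_less)
    qed
    then show "\<exists>M. \<forall>n\<ge>M. \<forall>m\<ge>M. dist (T n) (T m) < e" by blast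
  qed
  then obtain w where w: "T \<longlonglongrightarrow> w"
    using Cauchy_convergent_iff convergent_def by blast
  define d where "d = sqrt D"
  have dD: "d\<^sup>2 = D" using \<open>0 \<le> D\<close> by (simp add: d_def)
  define y where "y = w + complex_of_real d *\<^sub>C ket x"
  have coord: "Rep_ell2 w i = 0" if "\<And>n. Rep_ell2 (T n) i = 0" for i
  proof -
    have "(\<lambda>n. Rep_ell2 (T n) i) \<longlonglongrightarrow> Rep_ell2 w i"
      using tendsto_cinner_right [OF w, of "ket i"] by (simp add: cinner_ket_left)
    then show ?thesis using that by (simp add: LIMSEQ_const_iff)
  qed
  have fx: "Rep_ell2 f x = 0" if "(z, f) \<in> G" for z f
    using goodD(6) [OF G that] x(2) by blast
  have wx: "Rep_ell2 w x = 0" by (rule coord) (use fx pT in blast)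
  have iso: "(norm (f + c *\<^sub>C y))\<^sup>2 = Re (B (z + c *\<^sub>C x) (z + c *\<^sub>C x))" if zf: "(z, f) \<in> G" for z f c
  proof -
    define Z where "Z n = z + c *\<^sub>C p n" for n
    define F where "F n = f + c *\<^sub>C T n" for n
    have ZF: "(Z n, F n) \<in> G" for n
      unfolding Z_def F_def by (rule goodD(3) [OF G zf goodD(4) [OF G pT]])
    have ZV: "Z n \<in> V" for n by (rule goodD(1) [OF G ZF])
    have F: "F \<longlonglongrightarrow> f + c *\<^sub>C w"
      unfolding F_def by (intro tendsto_intros bounded_linear.tendsto [OF bounded_linear_scaleC] w)
    define r where "r n = Re (B (cnj c *\<^sub>C Z n) (x - p n))" for n
    \<comment> \<open>Replacing \<open>x\<close> by its approximation \<open>p n\<close> leaves the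
      cross term \<open>r n\<close>, which vanishes in the limit by \<open>ort\<close>.\<close>
    have split: "Re (B (z + c *\<^sub>C x) (z + c *\<^sub>C x)) = (norm (F n))\<^sup>2 + (cmod c)\<^sup>2 * q (p n) + 2 * r n" for n
    proof -
      have e: "z + c *\<^sub>C x = Z n + c *\<^sub>C (x - p n)"
        by (simp add: Z_def scaleC_diff_right)
      have V: "x - p n \<in> V" by (intro V_diff x pV)
      show ?thesis
        unfolding e goodD(5) [OF G ZF]
        by (simp add: Q_add [OF ZV V_scale [OF V]] Q_scale [OF V] r_def q_def B_scale [OF ZV V]
            B_scale_left [OF ZV V])
    qed
    have "(r n)\<^sup>2 \<le> (cmod c)\<^sup>2 * (norm (F n))\<^sup>2 * (q (p n) - D)" for n
    proof -
      have "cnj c *\<^sub>C Z n \<in> Domain G" using goodD(4) [OF G ZF] by blast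
      from ort [OF this] show ?thesis
        by (simp add: r_def Q_scale [OF ZV] goodD(5) [OF G ZF])
    qed
    moreover have "(\<lambda>n. (cmod c)\<^sup>2 * (norm (F n))\<^sup>2 * (q (p n) - D)) \<longlonglongrightarrow> (cmod c)\<^sup>2 * (norm (f + c *\<^sub>C w))\<^sup>2 * (D - D)"
      by (rule tendsto_mult [OF tendsto_mult [OF tendsto_const tendsto_power [OF tendsto_norm [OF F]]]
          tendsto_diff [OF qlim tendsto_const]])
    ultimately have "(\<lambda>n. (r n)\<^sup>2) \<longlonglongrightarrow> 0"
      by - (rule Lim_null_comparison [where g = "\<lambda>n. (cmod c)\<^sup>2 * (norm (F n))\<^sup>2 * (q (p n) - D)"], auto)
    then have "(\<lambda>n. \<bar>r n\<bar>) \<longlonglongrightarrow> 0"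
      using tendsto_real_sqrt [of "\<lambda>n. (r n)\<^sup>2" 0] by simp
    then have r0: "r \<longlonglongrightarrow> 0"
      by (rule tendsto_rabs_zero_cancel)
    have "(\<lambda>n. (norm (F n))\<^sup>2 + (cmod c)\<^sup>2 * q (p n) + 2 * r n)
        \<longlonglongrightarrow> (norm (f + c *\<^sub>C w))\<^sup>2 + (cmod c)\<^sup>2 * D + 2 * 0"
      by (rule tendsto_add [OF tendsto_add [OF tendsto_power [OF tendsto_norm [OF F]]
          tendsto_mult [OF tendsto_const qlim]] tendsto_mult [OF tendsto_const r0]])
    then have "(\<lambda>n. Re (B (z + c *\<^sub>C x) (z + c *\<^sub>C x)))
        \<longlonglongrightarrow> (norm (f + c *\<^sub>C w))\<^sup>2 + (cmod c)\<^sup>2 * D + 2 * 0"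
      by (simp only: split [symmetric])
    then have Q: "Re (B (z + c *\<^sub>C x) (z + c *\<^sub>C x)) = (norm (f + c *\<^sub>C w))\<^sup>2 + (cmod c)\<^sup>2 * D"
      using LIMSEQ_unique [OF tendsto_const] by fastforce
    have "cinner (f + c *\<^sub>C w) (ket x) = 0"
      using fx [OF zf] wx by (simp add: cinner_ket_right)
    then have "inner (f + c *\<^sub>C w) (ket x) = 0" and "inner (f + c *\<^sub>C w) (\<i> *\<^sub>C ket x) = 0"
      using inner_scaleC_i_left [of "f + c *\<^sub>C w" "ket x"] by (simp_all add: cinner_def complex_eq_iff)
    then have "inner (f + c *\<^sub>C w) ((c * complex_of_real d) *\<^sub>C ket x) = 0"
      by (simp add: scaleC_decompose [of "c * _"] inner_add_right)
    then have "(norm (f + c *\<^sub>C w + (c * complex_of_real d) *\<^sub>C ket x))\<^sup>2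
        = (norm (f + c *\<^sub>C w))\<^sup>2 + (norm ((c * complex_of_real d) *\<^sub>C ket x))\<^sup>2"
      by (simp add: power2_norm_eq_inner inner_add_left inner_add_right inner_commute)
    then show ?thesis
      unfolding Q by (simp add: y_def scaleC_add_right scaleC_scaleC add.assoc norm_scaleC norm_mult
          power_mult_distrib dD)
  qed
  define G' where "G' = {(z + c *\<^sub>C x, f + c *\<^sub>C y) | z f c. (z, f) \<in> G}"
  have G'I: "(z + c *\<^sub>C x, f + c *\<^sub>C y) \<in> G'" if "(z, f) \<in> G" for z f c
    using that unfolding G'_def by blast
  have sub: "G \<subseteq> G'"
  proof (clarify)
    fix z f assume "(z, f) \<in> G"
    from G'I [OF this, of 0] show "(z, f) \<in> G'" by (simp add: scaleC_zero_left)
  qed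
  have xy: "(x, y) \<in> G'"
    using G'I [OF good_zero [OF G], of 1] by (simp add: scaleC_one)
  have sup: "i \<in> Domain G' \<and> ket i \<in> closure (Range G')"
    if zf: "(z, f) \<in> G" and ne: "Rep_ell2 (f + c *\<^sub>C y) i \<noteq> 0" for z f c i
  proof (cases "i = x")
    case True
    then have "c * complex_of_real d \<noteq> 0"
      using ne fx [OF zf] wx by (auto simp: y_def ket.rep_eq)
    then have "d \<noteq> 0" by simp
    \<comment> \<open>Here \<open>d\<close> is nonzero, and \<open>ket x\<close> equals (y - w) / d,
      a limit of the elements (y - T n) / d of the range of \<open>G'\<close>.\<close>
    let ?k = "complex_of_real (1 / d)"
    have "?k *\<^sub>C (y - T n) \<in> Range G'" for n
      using G'I [OF goodD(4) [OF G pT, of "- ?k" n], of ?k]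
      by (auto simp: scaleC_diff_right scaleC_minus_left intro!: RangeI)
    moreover have "(\<lambda>n. ?k *\<^sub>C (y - T n)) \<longlonglongrightarrow> ?k *\<^sub>C (y - w)"
      by (intro tendsto_intros bounded_linear.tendsto [OF bounded_linear_scaleC] w)
    moreover have "?k *\<^sub>C (y - w) = ket x"
      using \<open>d \<noteq> 0\<close> by (simp add: y_def scaleC_scaleC scaleC_one flip: of_real_mult)
    ultimately have "ket x \<in> closure (Range G')"
      unfolding closure_sequential by (metis (no_types, lifting))
    then show ?thesis using True xy by blast
  next
    case False
    have "Rep_ell2 f i \<noteq> 0 \<or> Rep_ell2 w i \<noteq> 0"
      using ne False by (auto simp: y_def ket.rep_eq)
    then obtain z' f' where "(z', f') \<in> G" "Rep_ell2 f' i \<noteq> 0"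
      using zf coord [of i] pT by blast
    from goodD(6,7) [OF G this] have "i \<in> Domain G" "ket i \<in> closure (Range G)" .
    moreover have "Range G \<subseteq> Range G'" using sub by blast
    ultimately show ?thesis using sub closure_mono by blast
  qed
  have "good G'"
    unfolding good_def
  proof (intro conjI allI impI)
    show "Domain G' \<subseteq> V"
      unfolding G'_def using goodD(1) [OF G] by (auto intro!: V_add V_scale x)
    show "(u, ket u) \<in> G'" using sub goodD(2) [OF G] by blast
    show "(a + b, f + g) \<in> G'" if ab: "(a, f) \<in> G' \<and> (b, g) \<in> G'" for a f b g
    proof -
      obtain z1 f1 c1 z2 f2 c2 where *: "(z1, f1) \<in> G" "(z2, f2) \<in> G"
        "a = z1 + c1 *\<^sub>C x" "f = f1 + c1 *\<^sub>C y" "b = z2 + c2 *\<^sub>C x" "g = f2 + c2 *\<^sub>C y"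
        using ab unfolding G'_def by blast
      from G'I [OF goodD(3) [OF G *(1,2)], of "c1 + c2"] show ?thesis
        by (simp add: * scaleC_add_left add_ac)
    qed
    show "(c *\<^sub>C a, c *\<^sub>C f) \<in> G'" if af: "(a, f) \<in> G'" for a f c
    proof -
      obtain z1 f1 c1 where *: "(z1, f1) \<in> G" "a = z1 + c1 *\<^sub>C x" "f = f1 + c1 *\<^sub>C y"
        using af unfolding G'_def by blast
      from G'I [OF goodD(4) [OF G *(1), of c], of "c * c1"] show ?thesis
        by (simp add: * scaleC_add_right scaleC_scaleC)
    qed
    show "(norm f)\<^sup>2 = Re (B a a)" if "(a, f) \<in> G'" for a f
      using that iso unfolding G'_def by blast
    show "i \<in> Domain G'" if "(a, f) \<in> G' \<and> Rep_ell2 f i \<noteq> 0" for a f i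
      using that sup unfolding G'_def by blast
    show "ket i \<in> closure (Range G')" if "(a, f) \<in> G' \<and> Rep_ell2 f i \<noteq> 0" for a f i
      using that sup unfolding G'_def by blast
  qed
  then show ?thesis using sub xy x(2) by blast
qed

text \<open>This is the Hilbert space completion of \<open>V\<close> modulo the null vectors of
  \<open>B\<close>, realised inside \<open>ell2\<close> over the type of \<open>V\<close> itself, so
  that neither a quotient nor a completion type is formed.\<close>

theorem ell2_embedding:
  "\<exists>v E. (\<forall>x\<in>V. \<forall>y\<in>V. v (x + y) = v x + v y) \<and> (\<forall>x\<in>V. \<forall>c. v (c *\<^sub>C x) = c *\<^sub>C v x) \<and>
     (\<forall>x\<in>V. \<forall>y\<in>V. cinner (v x) (v y) = B x y) \<and> v ` V \<subseteq> ell2_on E \<and>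
     ell2_on E \<subseteq> closure (v ` V) \<and> v u = ket u \<and> u \<in> E"
proof -
  obtain G where G: "good G" and max: "\<And>G'. good G' \<Longrightarrow> G \<subseteq> G' \<Longrightarrow> G' = G"
    using subset_Zorn_nonempty [of "Collect good"] good_initial good_chain by blast
  have dom: "Domain G = V"
    using good_extend [OF G] max goodD(1) [OF G] by blast
  define v where "v x = (THE f. (x, f) \<in> G)" for x
  have v: "(x, v x) \<in> G" if "x \<in> V" for x
    unfolding v_def using that dom good_unique [OF G] by (metis Domain.cases theI')
  have v_eq: "v x = f" if "(x, f) \<in> G" for x f
    using good_unique [OF G v that] goodD(1) [OF G that] by blast
  have add: "v (x + y) = v x + v y" if "x \<in> V" "y \<in> V" for x y
    by (intro v_eq goodD(3) [OF G] v that)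
  have scale: "v (c *\<^sub>C x) = c *\<^sub>C v x" if "x \<in> V" for x c
    by (intro v_eq goodD(4) [OF G] v that)
  have re: "Re (cinner (v x) (v y)) = Re (B x y)" if xy: "x \<in> V" "y \<in> V" for x y
  proof -
    have n: "(norm (v z))\<^sup>2 = Re (B z z)" if "z \<in> V" for z
      by (rule goodD(5) [OF G v [OF that]])
    have "(norm (v x + v y))\<^sup>2 = Re (B (x + y) (x + y))"
      unfolding add [OF xy, symmetric] by (rule n [OF V_add [OF xy]])
    then show ?thesis
      unfolding Q_add [OF xy] n [OF xy(1), symmetric] n [OF xy(2), symmetric]
      by (simp add: power2_norm_eq_inner inner_add_left inner_add_right inner_commute cinner_def)
  qed
  have iso: "cinner (v x) (v y) = B x y" if xy: "x \<in> V" "y \<in> V" for x y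
  proof -
    have "Im z = - Re (\<i> * z)" for z by simp
    moreover have "Re (\<i> * cinner (v x) (v y)) = Re (\<i> * B x y)"
      using re [OF xy(1) V_scale [OF xy(2), of \<i>]]
      unfolding scale [OF xy(2)] cinner_scaleC_right B_scale [OF xy] .
    ultimately show ?thesis using re [OF xy] by (simp add: complex_eq_iff)
  qed
  have range: "v ` V = Range G"
    using v v_eq dom by (force simp: image_iff)
  define E where "E = {i. \<exists>x f. (x, f) \<in> G \<and> Rep_ell2 f i \<noteq> 0}"
  have "v ` V \<subseteq> ell2_on E"
    using v by (auto simp: ell2_on_def E_def)
  moreover have "ell2_on E \<subseteq> closure (v ` V)"
  proof
    fix f assume "f \<in> ell2_on E"
    have lin: "a + b \<in> Range G" "c *\<^sub>C a \<in> Range G" if "a \<in> Range G" "b \<in> Range G" for a b c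
      using that goodD(3,4) [OF G] by blast+
    show "f \<in> closure (v ` V)"
      unfolding range
      by (rule closed_subspace_ell2_on [OF closed_closure _ _ _ _ \<open>f \<in> ell2_on E\<close>])
        (use goodD(7) [OF G] good_zero [OF G] closure_subset [of "Range G"]
          closure_csubspace [of "Range G"] lin in \<open>auto simp: E_def\<close>)
  qed
  moreover have "v u = ket u" by (rule v_eq [OF goodD(2) [OF G]])
  moreover have "u \<in> E"
    using goodD(2) [OF G] by (auto simp: E_def ket.rep_eq intro!: exI [of _ u] exI [of _ "ket u"])
  ultimately show ?thesis using add scale iso by blast
qed

end

section \<open>Operator norm and extension of operators from a dense image\<close>

lemma continuous_on_bop_apply [continuous_intros]: "continuous_on X (bop_apply T)"
  by (intro linear_continuous_on bounded_linear_bop_apply)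

lemma continuous_on_cinner_right [continuous_intros]:
  "continuous_on X f \<Longrightarrow> continuous_on X (\<lambda>t. cinner x (f t))"
  using bounded_linear.continuous_on [OF bounded_linear_cinner_right] .

lemma continuous_on_cinner_left [continuous_intros]:
  assumes "continuous_on X f"
  shows "continuous_on X (\<lambda>t. cinner (f t) x)"
proof -
  have "continuous_on X (\<lambda>t. cnj (cinner x (f t)))"
    by (intro continuous_on_cnj continuous_on_cinner_right assms)
  then show ?thesis by (simp add: cinner_commute [symmetric])
qed

lemma opnorm_leI:
  assumes "\<And>x. norm (bop_apply T x) \<le> K * norm x" "0 \<le> K"
  shows "opnorm T \<le> K"
  unfolding opnorm_def by (rule norm_blinfun_bound [OF assms(2)]) (use assms(1) in \<open>simp add: bop_apply_def\<close>)

lemma opnorm_mult: "opnorm (S * T) \<le> opnorm S * opnorm T"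
proof (rule opnorm_leI)
  fix x
  have "norm (bop_apply (S * T) x) \<le> opnorm S * norm (bop_apply T x)"
    by (simp add: norm_bop_apply_le)
  also have "\<dots> \<le> opnorm S * (opnorm T * norm x)"
    by (intro mult_left_mono norm_bop_apply_le) simp
  finally show "norm (bop_apply (S * T) x) \<le> opnorm S * opnorm T * norm x"
    by (simp add: mult.assoc)
qed simp

lemma opnorm_one: "opnorm 1 \<le> 1"
  by (rule opnorm_leI) simp_all

lemma opnorm_power: "opnorm (T ^ n) \<le> opnorm T ^ n"
proof (induction n)
  case (Suc n)
  have "opnorm (T ^ Suc n) \<le> opnorm T * opnorm (T ^ n)"
    by (simp add: opnorm_mult)
  also have "\<dots> \<le> opnorm T * opnorm T ^ n"
    by (intro mult_left_mono Suc) simp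
  finally show ?case by simp
qed (simp add: opnorm_one)

lemma opnorm_adj_le: "opnorm (adj T) \<le> opnorm T"
proof (rule opnorm_leI)
  fix x
  let ?y = "bop_apply (adj T) x"
  have "norm ?y * norm ?y = cmod (cinner ?y ?y)"
    by (simp add: cinner_self power2_eq_square norm_mult)
  also have "\<dots> = cmod (cinner x (bop_apply T ?y))"
    by (simp add: cinner_adj_left)
  also have "\<dots> \<le> norm x * (opnorm T * norm ?y)"
    by (rule order_trans [OF cinner_Cauchy_Schwarz]) (intro mult_left_mono norm_bop_apply_le norm_ge_zero)
  finally have "norm ?y * norm ?y \<le> (opnorm T * norm x) * norm ?y"
    by (simp add: mult_ac)
  then show "norm ?y \<le> opnorm T * norm x"
    by (cases "norm ?y = 0") (use mult_nonneg_nonneg [OF opnorm_nonneg norm_ge_zero] in auto)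
qed simp

lemma closed_ell2_on: "closed (ell2_on E)"
proof -
  have "ell2_on E = (\<Inter>i\<in>-E. {x. cinner (ket i) x = 0})"
    by (auto simp: ell2_on_def cinner_ket_left)
  also have "closed \<dots>"
    by (intro closed_INT ballI closed_Collect_eq continuous_intros)
  finally show ?thesis .
qed

lemma ell2_on_add: "x \<in> ell2_on E \<Longrightarrow> y \<in> ell2_on E \<Longrightarrow> x + y \<in> ell2_on E"
  and ell2_on_scaleC: "x \<in> ell2_on E \<Longrightarrow> c *\<^sub>C x \<in> ell2_on E"
  by (auto simp: ell2_on_def)

definition coproj :: "'i set \<Rightarrow> 'i ell2 bop" where
  "coproj E = reidx E id"

lemma rep_coproj: "Rep_ell2 (bop_apply (coproj E) x) i = (if i \<in> E then Rep_ell2 x i else 0)"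
  by (simp add: coproj_def rep_reidx)

lemma coproj_on: "bop_apply (coproj E) x \<in> ell2_on E"
  by (simp add: ell2_on_def rep_coproj)

lemma coproj_fix: "x \<in> ell2_on E \<Longrightarrow> bop_apply (coproj E) x = x"
  by (rule ell2_eqI) (auto simp: rep_coproj ell2_on_def)

lemma norm_coproj_le: "norm (bop_apply (coproj E) x) \<le> norm x"
  by (rule ell2_norm_mono) (simp add: rep_coproj)

lemma adj_coproj: "adj (coproj E) = coproj E"
  unfolding coproj_def by (rule adj_reidx) auto

locale embedded = semi_inner +
  fixes v :: "'a \<Rightarrow> 'a ell2" and E :: "'a set"
  assumes v_add: "x \<in> V \<Longrightarrow> y \<in> V \<Longrightarrow> v (x + y) = v x + v y"
    and v_scale: "x \<in> V \<Longrightarrow> v (c *\<^sub>C x) = c *\<^sub>C v x"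
    and v_cinner: "x \<in> V \<Longrightarrow> y \<in> V \<Longrightarrow> cinner (v x) (v y) = B x y"
    and v_on: "x \<in> V \<Longrightarrow> v x \<in> ell2_on E"
    and v_dense: "ell2_on E \<subseteq> closure (v ` V)"
    and v_u: "v u = ket u" and u_E: "u \<in> E"
begin

lemma v_diff: "x \<in> V \<Longrightarrow> y \<in> V \<Longrightarrow> v (x - y) = v x - v y"
  using v_add [of x "(-1) *\<^sub>C y"] v_scale [of y "-1"] V_scale [of y "-1"]
  by (simp add: scaleC_minus_left scaleC_one)

lemma v_norm: "x \<in> V \<Longrightarrow> (norm (v x))\<^sup>2 = Re (B x x)"
  using v_cinner [of x x] by (simp add: cinner_self complex_eq_iff)

text \<open>The factor \<open>coproj E\<close> makes \<open>T\<close> vanish on the coordinates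
  outside \<open>E\<close>; together with density of the image of \<open>v\<close> this lets
  \<open>m\<close> determine \<open>T\<close>.\<close>

definition extends :: "'a ell2 bop \<Rightarrow> ('a \<Rightarrow> 'a) \<Rightarrow> bool" where
  "extends T m \<longleftrightarrow> (\<forall>x\<in>V. m x \<in> V \<and> bop_apply T (v x) = v (m x)) \<and> T * coproj E = T \<and>
     range (bop_apply T) \<subseteq> ell2_on E"

lemma eq_on_closure:
  fixes f g :: "'a ell2 \<Rightarrow> 'b::t2_space"
  assumes "continuous_on UNIV f" "continuous_on UNIV g" "\<And>y. y \<in> V \<Longrightarrow> f (v y) = g (v y)"
    and "x \<in> ell2_on E"
  shows "f x = g x"
proof -
  have "closure (v ` V) \<subseteq> {x. f x = g x}"
    by (rule closure_minimal) (use assms(3) in \<open>auto intro!: closed_Collect_eq assms(1,2)\<close>)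
  then show ?thesis using assms(4) v_dense by blast
qed

text \<open>Extension by continuity. The relation \<open>R\<close> collects all possible limits, and
  \<open>R_bd\<close> applied to differences shows that the limit depends neither on the
  approximating sequence nor on the preimages chosen under \<open>v\<close>, which may have a
  kernel.\<close>

lemma extends_exists:
  assumes m: "\<And>x. x \<in> V \<Longrightarrow> m x \<in> V" "\<And>x y. x \<in> V \<Longrightarrow> y \<in> V \<Longrightarrow> m (x + y) = m x + m y"
    "\<And>x c. x \<in> V \<Longrightarrow> m (c *\<^sub>C x) = c *\<^sub>C m x"
    and bd: "\<And>x. x \<in> V \<Longrightarrow> Re (B (m x) (m x)) \<le> K\<^sup>2 * Re (B x x)" and K: "0 \<le> K"
  shows "\<exists>T. extends T m"
proof -
  have m_diff: "m (x - y) = m x - m y" if "x \<in> V" "y \<in> V" for x y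
    using m(2) [of x "(-1) *\<^sub>C y"] m(3) [of y "-1"] V_scale [of y "-1"] that
    by (simp add: scaleC_minus_left scaleC_one)
  have le: "norm (v (m x)) \<le> K * norm (v x)" if "x \<in> V" for x
  proof (rule power2_le_imp_le)
    show "(norm (v (m x)))\<^sup>2 \<le> (K * norm (v x))\<^sup>2"
      using bd [OF that] that m(1) [OF that] by (simp add: v_norm power_mult_distrib)
  qed (use K in simp)
  define R where "R f l \<longleftrightarrow> (\<exists>y. (\<forall>n::nat. y n \<in> V) \<and> (\<lambda>n. v (y n)) \<longlonglongrightarrow> bop_apply (coproj E) f \<and>
      (\<lambda>n. v (m (y n))) \<longlonglongrightarrow> l)" for f l
  have R_add: "R (f + g) (l + k)" if fl: "R f l" and gk: "R g k" for f g l k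
  proof -
    obtain y where y: "\<And>n. y n \<in> V" "(\<lambda>n. v (y n)) \<longlonglongrightarrow> bop_apply (coproj E) f" "(\<lambda>n. v (m (y n))) \<longlonglongrightarrow> l"
      using fl unfolding R_def by blast
    obtain z where z: "\<And>n. z n \<in> V" "(\<lambda>n. v (z n)) \<longlonglongrightarrow> bop_apply (coproj E) g" "(\<lambda>n. v (m (z n))) \<longlonglongrightarrow> k"
      using gk unfolding R_def by blast
    show ?thesis
      unfolding R_def
      using tendsto_add [OF y(2) z(2)] tendsto_add [OF y(3) z(3)]
      by (intro exI [of _ "\<lambda>n. y n + z n"]) (simp add: y(1) z(1) V_add v_add m bop_apply_add)
  qed
  have R_scale: "R (c *\<^sub>C f) (c *\<^sub>C l)" if fl: "R f l" for c f l
  proof -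
    obtain y where y: "\<And>n. y n \<in> V" "(\<lambda>n. v (y n)) \<longlonglongrightarrow> bop_apply (coproj E) f" "(\<lambda>n. v (m (y n))) \<longlonglongrightarrow> l"
      using fl unfolding R_def by blast
    show ?thesis
      unfolding R_def
      using bounded_linear.tendsto [OF bounded_linear_scaleC y(2), of c]
        bounded_linear.tendsto [OF bounded_linear_scaleC y(3), of c]
      by (intro exI [of _ "\<lambda>n. c *\<^sub>C y n"]) (simp add: y(1) V_scale v_scale m bop_apply_scaleC)
  qed
  have R_bd: "norm l \<le> norm f * K" if fl: "R f l" for f l
  proof -
    obtain y where y: "\<And>n. y n \<in> V" "(\<lambda>n. v (y n)) \<longlonglongrightarrow> bop_apply (coproj E) f" "(\<lambda>n. v (m (y n))) \<longlonglongrightarrow> l"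
      using fl unfolding R_def by blast
    have "norm l \<le> K * norm (bop_apply (coproj E) f)"
      by (rule LIMSEQ_le [OF tendsto_norm [OF y(3)] tendsto_mult [OF tendsto_const tendsto_norm [OF y(2)]]])
        (use le y(1) in auto)
    also have "\<dots> \<le> K * norm f" by (intro mult_left_mono norm_coproj_le K)
    finally show ?thesis by (simp add: mult.commute)
  qed
  have R_unique: "l = k" if "R f l" "R f k" for f l k
    using R_bd [OF R_add [OF that(1) R_scale [OF that(2), of "-1"]]]
    by (simp add: scaleC_minus_left scaleC_one)
  have R_total: "\<exists>l. R f l" for f
  proof -
    have "bop_apply (coproj E) f \<in> closure (v ` V)"
      using coproj_on v_dense by blast
    then obtain z where z: "\<And>n. z n \<in> v ` V" "z \<longlonglongrightarrow> bop_apply (coproj E) f"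
      unfolding closure_sequential by blast
    then have "\<forall>n. \<exists>y. y \<in> V \<and> z n = v y" by blast
    then obtain y where y: "\<And>n. y n \<in> V" "\<And>n. z n = v (y n)" by metis
    have "Cauchy z" using z(2) by (rule LIMSEQ_imp_Cauchy)
    have "Cauchy (\<lambda>n. v (m (y n)))"
    proof (rule metric_CauchyI)
      fix e :: real assume "0 < e"
      then have "0 < e / (K + 1)" using K by simp
      then obtain M where M: "\<And>p q. p \<ge> M \<Longrightarrow> q \<ge> M \<Longrightarrow> dist (z p) (z q) < e / (K + 1)"
        using \<open>Cauchy z\<close> unfolding Cauchy_def by blast
      have "dist (v (m (y p))) (v (m (y q))) < e" if "p \<ge> M" "q \<ge> M" for p q
      proof -
        have "dist (v (m (y p))) (v (m (y q))) = norm (v (m (y p - y q)))"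
          using y(1) by (simp add: dist_norm m_diff v_diff m)
        also have "\<dots> \<le> K * dist (z p) (z q)"
          using le [OF V_diff [OF y(1) y(1)]] by (simp add: dist_norm y v_diff)
        also have "\<dots> \<le> (K + 1) * dist (z p) (z q)"
          by (intro mult_right_mono) auto
        also have "\<dots> < (K + 1) * (e / (K + 1))"
          using M [OF that] K by (intro mult_strict_left_mono) auto
        also have "\<dots> = e" using K by simp
        finally show ?thesis .
      qed
      then show "\<exists>M. \<forall>p\<ge>M. \<forall>q\<ge>M. dist (v (m (y p))) (v (m (y q))) < e" by blast
    qed
    then obtain l where "(\<lambda>n. v (m (y n))) \<longlonglongrightarrow> l"
      using Cauchy_convergent_iff convergent_def by blast
    moreover have "z = (\<lambda>n. v (y n))" using y(2) by blast
    ultimately show ?thesis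
      unfolding R_def using y(1) z(2) by blast
  qed
  define t where "t f = (THE l. R f l)" for f
  have t: "R f (t f)" for f
    unfolding t_def by (rule theI') (use R_total R_unique in blast)
  have t_eq: "t f = l" if "R f l" for f l
    using R_unique [OF t that] .
  have ap: "bop_apply (make_bop t) = t"
    by (rule bop_apply_make_bop [where K = K])
      (auto intro!: t_eq R_add R_scale R_bd t)
  have "bop_apply (make_bop t) (v x) = v (m x)" if "x \<in> V" for x
    unfolding ap
    by (rule t_eq) (auto simp: R_def coproj_fix v_on that intro!: exI [of _ "\<lambda>_. x"])
  moreover have "make_bop t * coproj E = make_bop t"
  proof (rule bop_eqI)
    fix f
    have "t (bop_apply (coproj E) f) = t f"
      by (rule t_eq) (use t [of f] in \<open>simp add: R_def coproj_fix coproj_on\<close>)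
    then show "bop_apply (make_bop t * coproj E) f = bop_apply (make_bop t) f"
      by (simp add: ap)
  qed
  moreover have "t f \<in> ell2_on E" for f
  proof -
    obtain y where y: "\<And>n. y n \<in> V" "(\<lambda>n. v (m (y n))) \<longlonglongrightarrow> t f"
      using t [of f] unfolding R_def by blast
    show ?thesis
      by (rule closed_sequentially [OF closed_ell2_on _ y(2)]) (intro v_on m y(1))
  qed
  ultimately show ?thesis
    unfolding extends_def using m(1) by (intro exI [of _ "make_bop t"]) (auto simp: ap)
qed

lemma extendsD:
  assumes "extends T m"
  shows "x \<in> V \<Longrightarrow> bop_apply T (v x) = v (m x)" "x \<in> V \<Longrightarrow> m x \<in> V"
    "bop_apply T (bop_apply (coproj E) f) = bop_apply T f" "bop_apply T f \<in> ell2_on E"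
    "range (bop_apply T) \<subseteq> ell2_on E"
proof -
  show "bop_apply T (bop_apply (coproj E) f) = bop_apply T f"
    using assms unfolding extends_def by (metis bop_apply_simps(4))
qed (use assms in \<open>auto simp: extends_def\<close>)

lemma extends_unique:
  assumes "extends S m" "extends T m"
  shows "S = T"
proof (rule bop_eqI)
  fix f
  have "bop_apply S (bop_apply (coproj E) f) = bop_apply T (bop_apply (coproj E) f)"
    by (rule eq_on_closure [OF _ _ _ coproj_on])
      (use extendsD(1) [OF assms(1)] extendsD(1) [OF assms(2)] in \<open>auto intro!: continuous_intros\<close>)
  then show "bop_apply S f = bop_apply T f"
    using extendsD(3) [OF assms(1)] extendsD(3) [OF assms(2)] by simp
qed

lemma extends_mult:
  assumes "extends S m" "extends T k"
  shows "extends (S * T) (\<lambda>x. m (k x))"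
  using assms unfolding extends_def by (auto simp: mult.assoc)

lemma extends_add:
  assumes "extends S m" "extends T k"
  shows "extends (S + T) (\<lambda>x. m x + k x)"
  using assms unfolding extends_def
  by (auto simp: distrib_right V_add v_add intro!: ell2_on_add)

lemma extends_scaleC:
  assumes "extends S m"
  shows "extends (c *\<^sub>C S) (\<lambda>x. c *\<^sub>C m x)"
  using assms unfolding extends_def
  by (auto simp: bop_algebra_simps V_scale v_scale intro!: ell2_on_scaleC)

lemma extends_adj:
  assumes S: "extends S m" and T: "extends T k"
    and mk: "\<And>x y. x \<in> V \<Longrightarrow> y \<in> V \<Longrightarrow> B (m x) y = B x (k y)"
  shows "adj S = T"
proof (rule adj_eqI)
  fix f g
  let ?P = "bop_apply (coproj E)"
  have PP: "cinner (?P a) b = cinner a b" if "b \<in> ell2_on E" for a b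
    by (metis adj_coproj cinner_adj_left coproj_fix that)
  have PP': "cinner b (?P a) = cinner b a" if "b \<in> ell2_on E" for a b
    by (metis PP cinner_commute that)
  have 1: "cinner (v x) (bop_apply S (v y)) = cinner (bop_apply T (v x)) (v y)" if "x \<in> V" "y \<in> V" for x y
    using that mk [of y x] by (simp add: extendsD(1,2) [OF S] extendsD(1,2) [OF T] v_cinner)
      (metis B_sym S T extendsD(2))
  have 2: "cinner (v x) (bop_apply S (?P g)) = cinner (bop_apply T (v x)) (?P g)" if "x \<in> V" for x
    by (rule eq_on_closure [OF _ _ _ coproj_on]) (use 1 that in \<open>auto intro!: continuous_intros\<close>)
  have "cinner (?P f) (bop_apply S (?P g)) = cinner (bop_apply T (?P f)) (?P g)"
    by (rule eq_on_closure [OF _ _ _ coproj_on]) (use 2 in \<open>auto intro!: continuous_intros\<close>)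
  then show "cinner (bop_apply T f) g = cinner f (bop_apply S g)"
    by (simp add: extendsD(3) [OF S] extendsD(3) [OF T] PP [OF extendsD(4) [OF S]] PP' [OF extendsD(4) [OF T]])
qed

end

context amplify
begin

text \<open>The elementary tensor of \<open>f\<close>, restricted to \<open>E\<close>, with the
  basis vector at \<open>y\<close>.\<close>

definition inc :: "'y \<Rightarrow> 'x ell2 \<Rightarrow> 'z ell2" where
  "inc y f = Abs_ell2 (\<lambda>z. if t z = y then Rep_ell2 f (h z) else 0)"

lemma rep_inc_norm:
  "Rep_ell2 (inc y f) = (\<lambda>z. if t z = y then Rep_ell2 f (h z) else 0) \<and> norm (inc y f) \<le> norm f"
  unfolding inc_def
proof (rule ell2_Abs)
  fix F :: "'z set" assume F: "finite F"
  have "(\<Sum>z\<in>F. (cmod (if t z = y then Rep_ell2 f (h z) else 0))\<^sup>2)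
      = (\<Sum>z\<in>{z\<in>F. t z = y}. (cmod (Rep_ell2 f (h z)))\<^sup>2)"
    using F by (intro sum.mono_neutral_cong_right) auto
  also have "\<dots> = (\<Sum>x\<in>h ` {z\<in>F. t z = y}. (cmod (Rep_ell2 f x))\<^sup>2)"
    by (rule sum.reindex_cong [symmetric, of h]) (auto intro!: inj_on_inverseI [of _ "\<lambda>x. e x y"])
  also have "\<dots> \<le> (norm f)\<^sup>2"
    using F by (intro ell2_finite_sum_le) auto
  finally show "(\<Sum>z\<in>F. (cmod (if t z = y then Rep_ell2 f (h z) else 0))\<^sup>2) \<le> (norm f)\<^sup>2" .
qed simp

lemma rep_inc: "Rep_ell2 (inc y f) z = (if t z = y then Rep_ell2 f (h z) else 0)"
  using rep_inc_norm by simp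

lemma inc_add: "inc y (f + g) = inc y f + inc y g"
  and inc_scaleC: "inc y (c *\<^sub>C f) = c *\<^sub>C inc y f"
  by (rule ell2_eqI, simp add: rep_inc)+

lemma bounded_linear_inc: "bounded_linear (inc y)"
  by (rule bounded_linear_intro [where K = 1])
    (use rep_inc_norm in \<open>auto simp: inc_add intro!: ell2_eqI simp: rep_inc\<close>)

lemma inc_ket: "x \<in> E \<Longrightarrow> inc y (ket x) = ket (e x y)"
proof (rule ell2_eqI)
  fix z assume "x \<in> E"
  then have "t z = y \<and> h z = x \<longleftrightarrow> z = e x y"
    using e_ht h_e t_e by metis
  then show "Rep_ell2 (inc y (ket x)) z = Rep_ell2 (ket (e x y)) z"
    by (auto simp: rep_inc ket.rep_eq)
qed

lemma amp_inc:
  assumes "f \<in> ell2_on E"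
  shows "bop_apply (amp T) (inc y f) = inc y (bop_apply T f)"
proof (rule ell2_eqI)
  fix z
  have "slice (t z) (inc y f) = (if t z = y then f else 0)"
    by (rule ell2_eqI) (use assms in \<open>auto simp: rep_slice rep_inc ell2_on_def\<close>)
  then show "Rep_ell2 (bop_apply (amp T) (inc y f)) z = Rep_ell2 (inc y (bop_apply T f)) z"
    by (simp add: rep_amp rep_inc)
qed

end

section \<open>Tracial spaces in standard form\<close>

definition commutant :: "'h::complex_hilbert_space bop set \<Rightarrow> 'h bop set" where
  "commutant X = {r. \<forall>x\<in>X. r * x = x * r}"

text \<open>Cyclicity is stated through invariant closed subspaces, so that neither the algebra
  generated by \<open>X\<close> nor a dense orbit has to be described.\<close>

definition cyclic_for :: "'h::complex_hilbert_space bop set \<Rightarrow> 'h \<Rightarrow> bool" where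
  "cyclic_for X w \<longleftrightarrow> (\<forall>N. closed N \<and> (\<forall>x\<in>N. \<forall>y\<in>N. x + y \<in> N) \<and> (\<forall>c. \<forall>x\<in>N. c *\<^sub>C x \<in> N) \<and>
     w \<in> N \<and> (\<forall>r\<in>X. \<forall>x\<in>N. bop_apply r x \<in> N) \<longrightarrow> N = UNIV)"

text \<open>\<open>E\<close> may be a proper subset, but its product with the infinite index type
  has the cardinality of that type. An operator acting as the identity on \<open>ell2_on E\<close>
  is thus amplified to the identity of the whole \<open>ell2\<close>, which makes the standard
  representation unital.\<close>

lemma exists_amplify:
  includes cardinal_syntax
  assumes "infinite (UNIV :: 'a set)" "E \<noteq> ({} :: 'a set)"
  shows "\<exists>(h :: 'a \<Rightarrow> 'a) (t :: 'a \<Rightarrow> 'a) e. amplify h t e E"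
proof -
  have "|E \<times> (UNIV :: 'a set)| =o |UNIV :: 'a set|"
    using card_of_Times_infinite [OF assms card_of_mono1 [OF subset_UNIV]] by blast
  then obtain g :: "'a \<Rightarrow> 'a \<times> 'a" where g: "bij_betw g UNIV (E \<times> UNIV)"
    using card_of_ordIso ordIso_symmetric by blast
  have "amplify (\<lambda>z. fst (g z)) (\<lambda>z. snd (g z)) (\<lambda>x y. inv_into UNIV g (x, y)) E"
  proof
    have gg: "g (inv_into UNIV g (x, y)) = (x, y)" if "x \<in> E" for x y
      using bij_betw_imp_surj_on [OF g] that by (intro f_inv_into_f) auto
    show "fst (g z) \<in> E" for z
      using bij_betwE [OF g] by (metis UNIV_I mem_Times_iff)
    show "inv_into UNIV g (fst (g z), snd (g z)) = z" for z
      using bij_betw_imp_inj_on [OF g] by simp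
    show "fst (g (inv_into UNIV g (x, y))) = x" "snd (g (inv_into UNIV g (x, y))) = y" if "x \<in> E" for x y
      using gg [OF that] by simp_all
  qed
  then show ?thesis by blast
qed

locale tracial_space =
  fixes A :: "'h::complex_hilbert_space bop set" and \<phi> :: "'h bop \<Rightarrow> complex"
  assumes tracial: "tracial_wstar_prob_space A \<phi>"
begin

lemma alg: "1 \<in> A" "a \<in> A \<Longrightarrow> b \<in> A \<Longrightarrow> a + b \<in> A" "a \<in> A \<Longrightarrow> b \<in> A \<Longrightarrow> a * b \<in> A"
    "a \<in> A \<Longrightarrow> c *\<^sub>C a \<in> A" "a \<in> A \<Longrightarrow> adj a \<in> A"
  using tracial by (auto simp: tracial_wstar_prob_space_def von_neumann_algebra_def unital_star_subalgebra_def)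

lemma alg_diff: "a \<in> A \<Longrightarrow> b \<in> A \<Longrightarrow> a - b \<in> A"
  using alg(2) [of a "(-1) *\<^sub>C b"] alg(4) [of b "-1"] by (simp add: scaleC_minus_left scaleC_one)

lemma alg_scaleR: "a \<in> A \<Longrightarrow> r *\<^sub>R a \<in> A"
  using alg(4) [of a "complex_of_real r"] by (simp add: scaleC_of_real)

lemma alg_zero: "0 \<in> A"
  using alg_scaleR [OF alg(1), of 0] by simp

lemma alg_power: "a \<in> A \<Longrightarrow> a ^ n \<in> A"
  by (induction n) (auto intro: alg)

lemma phi_lin: "a \<in> A \<Longrightarrow> b \<in> A \<Longrightarrow> \<phi> (c *\<^sub>C a + d *\<^sub>C b) = c * \<phi> a + d * \<phi> b"
  and phi_one: "\<phi> 1 = 1"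
  and phi_pos: "a \<in> A \<Longrightarrow> \<phi> (adj a * a) \<in> \<real>\<^sub>\<ge>\<^sub>0"
  and phi_faithful: "a \<in> A \<Longrightarrow> \<phi> (adj a * a) = 0 \<Longrightarrow> a = 0"
  and phi_trace: "a \<in> A \<Longrightarrow> b \<in> A \<Longrightarrow> \<phi> (a * b) = \<phi> (b * a)"
proof -
  from tracial [unfolded tracial_wstar_prob_space_def]
  have *: "\<forall>a\<in>A. \<forall>b\<in>A. \<forall>c d. \<phi> (c *\<^sub>C a + d *\<^sub>C b) = c * \<phi> a + d * \<phi> b"
    "\<phi> 1 = 1" "\<forall>a\<in>A. \<phi> (adj a * a) \<in> \<real>\<^sub>\<ge>\<^sub>0" "\<forall>a\<in>A. \<phi> (adj a * a) = 0 \<longrightarrow> a = 0"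
    "\<forall>a\<in>A. \<forall>b\<in>A. \<phi> (a * b) = \<phi> (b * a)"
    by - (elim conjE, assumption)+
  show "a \<in> A \<Longrightarrow> b \<in> A \<Longrightarrow> \<phi> (c *\<^sub>C a + d *\<^sub>C b) = c * \<phi> a + d * \<phi> b"
    by (rule *(1) [rule_format])
  show "\<phi> 1 = 1" by (rule *(2))
  show "a \<in> A \<Longrightarrow> \<phi> (adj a * a) \<in> \<real>\<^sub>\<ge>\<^sub>0" by (rule *(3) [rule_format])
  show "a \<in> A \<Longrightarrow> \<phi> (adj a * a) = 0 \<Longrightarrow> a = 0" by (rule *(4) [rule_format])
  show "a \<in> A \<Longrightarrow> b \<in> A \<Longrightarrow> \<phi> (a * b) = \<phi> (b * a)" by (rule *(5) [rule_format])
qed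

lemma phi_add: "a \<in> A \<Longrightarrow> b \<in> A \<Longrightarrow> \<phi> (a + b) = \<phi> a + \<phi> b"
  using phi_lin [of a b 1 1] by (simp add: scaleC_one)

lemma phi_scaleC: "a \<in> A \<Longrightarrow> \<phi> (c *\<^sub>C a) = c * \<phi> a"
  using phi_lin [of a a c 0] by (simp add: scaleC_zero_left)

lemma phi_bounded: "\<exists>C\<ge>0. \<forall>a\<in>A. cmod (\<phi> a) \<le> C * opnorm a"
proof -
  have "normal_on A \<phi>"
    using tracial unfolding tracial_wstar_prob_space_def by (elim conjE)
  then obtain \<xi> \<eta> :: "nat \<Rightarrow> 'h" where s: "summable (\<lambda>k. (norm (\<xi> k))\<^sup>2)" "summable (\<lambda>k. (norm (\<eta> k))\<^sup>2)"
    and phi: "\<And>a. a \<in> A \<Longrightarrow> (\<lambda>k. cinner (\<xi> k) (bop_apply a (\<eta> k))) sums \<phi> a"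
    unfolding normal_on_def by blast
  let ?s = "\<lambda>k. (norm (\<xi> k))\<^sup>2 + (norm (\<eta> k))\<^sup>2"
  have sum: "summable ?s" by (intro summable_add s)
  have "cmod (\<phi> a) \<le> suminf ?s * opnorm a" if "a \<in> A" for a
  proof -
    have le: "cmod (cinner (\<xi> k) (bop_apply a (\<eta> k))) \<le> ?s k * opnorm a" for k
    proof -
      have "cmod (cinner (\<xi> k) (bop_apply a (\<eta> k))) \<le> norm (\<xi> k) * (opnorm a * norm (\<eta> k))"
        by (rule order_trans [OF cinner_Cauchy_Schwarz]) (intro mult_left_mono norm_bop_apply_le norm_ge_zero)
      also have "\<dots> = (norm (\<xi> k) * norm (\<eta> k)) * opnorm a" by simp
      also have "\<dots> \<le> ?s k * opnorm a"
      proof (rule mult_right_mono)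
        have "2 * (norm (\<xi> k) * norm (\<eta> k)) \<le> ?s k"
          using sum_squares_bound [of "norm (\<xi> k)" "norm (\<eta> k)"] by simp
        moreover have "0 \<le> norm (\<xi> k) * norm (\<eta> k)" by simp
        ultimately show "norm (\<xi> k) * norm (\<eta> k) \<le> ?s k" by linarith
      qed simp
      finally show ?thesis .
    qed
    have "cmod (suminf (\<lambda>k. cinner (\<xi> k) (bop_apply a (\<eta> k)))) \<le> (\<Sum>k. ?s k * opnorm a)"
      by (rule norm_suminf_le [OF le summable_mult2 [OF sum]])
    then show ?thesis
      using sums_unique [OF phi [OF that]] suminf_mult2 [OF sum, of "opnorm a"] by simp
  qed
  moreover have "0 \<le> suminf ?s" by (rule suminf_nonneg [OF sum]) simp
  ultimately show ?thesis by blast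
qed

definition B :: "'h bop \<Rightarrow> 'h bop \<Rightarrow> complex" where
  "B x y = \<phi> (adj x * y)"

lemma B_add': "x \<in> A \<Longrightarrow> y \<in> A \<Longrightarrow> z \<in> A \<Longrightarrow> B x (y + z) = B x y + B x z"
  by (simp add: B_def distrib_left phi_add alg)

lemma B_scale': "x \<in> A \<Longrightarrow> y \<in> A \<Longrightarrow> B x (c *\<^sub>C y) = c * B x y"
  by (simp add: B_def bop_algebra_simps phi_scaleC alg)

lemma B_sym':
  assumes "x \<in> A" "y \<in> A"
  shows "B y x = cnj (B x y)"
proof -
  have real: "Im (B z z) = 0" if "z \<in> A" for z
    using phi_pos [OF that] by (auto simp: B_def nonneg_Reals_def)
  have ex: "B (x + c *\<^sub>C y) (x + c *\<^sub>C y) = B x x + c * B x y + cnj c * B y x + cnj c * c * B y y" for c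
  proof -
    have "adj (x + c *\<^sub>C y) * (x + c *\<^sub>C y)
        = (adj x * x + c *\<^sub>C (adj x * y)) + (cnj c *\<^sub>C (adj y * x) + (cnj c * c) *\<^sub>C (adj y * y))"
      by (simp add: adj_add adj_scaleC bop_algebra_simps distrib_left distrib_right scaleC_scaleC
          scaleC_add_right mult.commute add_ac)
    then show ?thesis
      using assms by (simp add: B_def phi_add phi_scaleC alg)
  qed
  have "Im (B x x + c * B x y + cnj c * B y x + cnj c * c * B y y) = 0" for c
    using real [of "x + c *\<^sub>C y"] assms by (simp add: ex [symmetric] alg)
  from this [of 1] this [of \<i>] show ?thesis
    using real [OF assms(1)] real [OF assms(2)] by (simp add: complex_eq_iff)
qed

lemma semi_inner: "semi_inner A B 1"
proof
  show "0 \<le> Re (B x x)" if "x \<in> A" for x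
    using phi_pos [OF that] by (auto simp: B_def nonneg_Reals_def)
  show "B 1 1 = 1" by (simp add: B_def phi_one)
  show "x + y \<in> A" if "x \<in> A" "y \<in> A" for x y by (rule alg(2) [OF that])
  show "c *\<^sub>C x \<in> A" if "x \<in> A" for x c by (rule alg(4) [OF that])
  show "B x (y + z) = B x y + B x z" if "x \<in> A" "y \<in> A" "z \<in> A" for x y z by (rule B_add' [OF that])
  show "B x (c *\<^sub>C y) = c * B x y" if "x \<in> A" "y \<in> A" for x y c by (rule B_scale' [OF that])
  show "B y x = cnj (B x y)" if "x \<in> A" "y \<in> A" for x y by (rule B_sym' [OF that])
  show "1 \<in> A" by (rule alg(1))
qed

lemma embedding_exists: "\<exists>v E. embedded A B 1 v E"
proof -
  obtain v :: "'h bop \<Rightarrow> 'h bop ell2" and E where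
    "(\<forall>x\<in>A. \<forall>y\<in>A. v (x + y) = v x + v y) \<and> (\<forall>x\<in>A. \<forall>c. v (c *\<^sub>C x) = c *\<^sub>C v x) \<and>
     (\<forall>x\<in>A. \<forall>y\<in>A. cinner (v x) (v y) = B x y) \<and> v ` A \<subseteq> ell2_on E \<and>
     ell2_on E \<subseteq> closure (v ` A) \<and> v 1 = ket 1 \<and> 1 \<in> E"
    using semi_inner.ell2_embedding [OF semi_inner] by (elim exE)
  then have *: "\<forall>x\<in>A. \<forall>y\<in>A. v (x + y) = v x + v y"
      "\<forall>x\<in>A. \<forall>c. v (c *\<^sub>C x) = c *\<^sub>C v x" "\<forall>x\<in>A. \<forall>y\<in>A. cinner (v x) (v y) = B x y"
      "v ` A \<subseteq> ell2_on E" "ell2_on E \<subseteq> closure (v ` A)" "v 1 = ket 1" "1 \<in> E"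
    by - (elim conjE, assumption)+
  have "embedded A B 1 v E"
  proof (intro embedded.intro semi_inner embedded_axioms.intro)
    show "v (x + y) = v x + v y" if "x \<in> A" "y \<in> A" for x y using *(1) that by simp
    show "v (c *\<^sub>C x) = c *\<^sub>C v x" if "x \<in> A" for x c using *(2) that by simp
    show "cinner (v x) (v y) = B x y" if "x \<in> A" "y \<in> A" for x y using *(3) that by simp
    show "v x \<in> ell2_on E" if "x \<in> A" for x using *(4) that by blast
  qed (rule *)+
  then show ?thesis by blast
qed

text \<open>Writing ' for adjoints, let s n be the real part of \<phi>(y' (x' x)^n y). Iterated
  Cauchy-Schwarz gives (s 1 / s 0)^(2^k) \<le> s (2^k) / s 0, and boundedness of \<phi> makes the
  right side at most a constant times r^(2^k) with r the square of \<open>opnorm x\<close>. Letting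
  k grow removes the constant. This avoids a square root of r - x' x inside
  \<open>A\<close>.\<close>

lemma left_bounded:
  assumes x: "x \<in> A" and y: "y \<in> A"
  shows "Re (B (x * y) (x * y)) \<le> (opnorm x)\<^sup>2 * Re (B y y)"
proof -
  obtain v E where "embedded A B 1 v E" using embedding_exists by blast
  then interpret embedded A B 1 v E .
  define s where "s n = Re (B y ((adj x * x) ^ n * y))" for n
  have hA: "(adj x * x) ^ n * y \<in> A" for n
    by (intro alg alg_power x y)
  have adj_h: "adj ((adj x * x) ^ n) = (adj x * x) ^ n" for n
    by (induction n) (simp_all add: adj_mult power_commutes)
  have sq: "(s n)\<^sup>2 \<le> s 0 * s (2 * n)" for n
  proof -
    let ?z = "(adj x * x) ^ n * y"
    have "\<bar>s n\<bar> \<le> cmod (cinner (v y) (v ?z))"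
      unfolding s_def v_cinner [OF y hA] by (rule abs_Re_le_cmod)
    also have "\<dots> \<le> norm (v y) * norm (v ?z)" by (rule cinner_Cauchy_Schwarz)
    finally have "(s n)\<^sup>2 \<le> (norm (v y) * norm (v ?z))\<^sup>2"
      by (metis abs_ge_zero power2_abs power_mono)
    also have "\<dots> = Re (B y y) * Re (B ?z ?z)"
      by (simp add: power_mult_distrib v_norm [OF y] v_norm [OF hA])
    also have "B ?z ?z = B y ((adj x * x) ^ (2 * n) * y)"
      by (simp add: B_def adj_mult adj_h mult.assoc mult_2 power_add)
    finally show ?thesis by (simp add: s_def)
  qed
  obtain C where C: "0 \<le> C" "\<And>a. a \<in> A \<Longrightarrow> cmod (\<phi> a) \<le> C * opnorm a"
    using phi_bounded by blast
  define r where "r = (opnorm x)\<^sup>2"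
  define K where "K = C * (opnorm (adj y) * opnorm y)"
  have K0: "0 \<le> K" by (simp add: K_def C)
  have "0 \<le> r" by (simp add: r_def)
  have h_le: "opnorm (adj x * x) \<le> r"
    using opnorm_mult [of "adj x" x] mult_right_mono [OF opnorm_adj_le [of x] opnorm_nonneg [of x]]
    by (simp add: r_def power2_eq_square)
  have s_le: "s n \<le> K * r ^ n" for n
  proof -
    have "s n \<le> cmod (\<phi> (adj y * ((adj x * x) ^ n * y)))"
      unfolding s_def B_def by (rule complex_Re_le_cmod)
    also have "\<dots> \<le> C * opnorm (adj y * ((adj x * x) ^ n * y))"
      by (rule C(2)) (intro alg hA y)
    also have "\<dots> \<le> C * (opnorm (adj y) * (r ^ n * opnorm y))"
    proof (rule mult_left_mono [OF _ C(1)])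
      have "opnorm ((adj x * x) ^ n * y) \<le> r ^ n * opnorm y"
        by (rule order_trans [OF opnorm_mult], rule mult_right_mono, rule order_trans [OF opnorm_power],
          rule power_mono [OF h_le]) simp_all
      then show "opnorm (adj y * ((adj x * x) ^ n * y)) \<le> opnorm (adj y) * (r ^ n * opnorm y)"
        by - (rule order_trans [OF opnorm_mult], rule mult_left_mono, simp_all)
    qed
    finally show ?thesis by (simp add: K_def mult_ac)
  qed
  have s0: "0 \<le> s 0" using B_pos [OF y] by (simp add: s_def)
  have "s 1 \<le> r * s 0"
  proof (rule ccontr)
    assume "\<not> s 1 \<le> r * s 0"
    then have gt: "r * s 0 < s 1" by simp
    have "s 0 \<noteq> 0" using sq [of 1] gt by auto
    then have s0': "0 < s 0" using s0 by simp
    have s1: "0 \<le> s 1" using gt mult_nonneg_nonneg [OF \<open>0 \<le> r\<close> s0] by linarith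
    have pw: "(s 1 / s 0) ^ (2 ^ k) \<le> s (2 ^ k) / s 0 \<and> 0 \<le> s 1" for k
    proof (induction k)
      case 0
      show ?case using s1 by simp
    next
      case (Suc k)
      have "(s 1 / s 0) ^ (2 ^ Suc k) = ((s 1 / s 0) ^ (2 ^ k))\<^sup>2"
        by (simp add: power_mult [symmetric] mult.commute)
      also have "\<dots> \<le> (s (2 ^ k) / s 0)\<^sup>2"
        using Suc s0' by (intro power_mono) auto
      also have "\<dots> = (s (2 ^ k))\<^sup>2 / (s 0)\<^sup>2"
        by (simp add: power_divide)
      also have "\<dots> \<le> (s 0 * s (2 * 2 ^ k)) / (s 0)\<^sup>2"
        by (intro divide_right_mono sq) simp
      also have "\<dots> = s (2 ^ Suc k) / s 0"
        using s0' by (simp add: power2_eq_square)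
      finally show ?case using Suc by simp
    qed
    define q where "q = s 1 / s 0"
    have qr: "r < q" using gt s0' by (simp add: q_def field_simps)
    have "0 < q" using qr \<open>0 \<le> r\<close> by simp
    have q_le: "q ^ (2 ^ k) \<le> K / s 0 * r ^ (2 ^ k)" for k
      using pw [of k] divide_right_mono [OF s_le [of "2 ^ k"], of "s 0"] s0'
      by (simp add: q_def)
    show False
    proof (cases "r = 0")
      case True
      then show False using q_le [of 0] \<open>0 < q\<close> by simp
    next
      case False
      then have "0 < r" using \<open>0 \<le> r\<close> by simp
      then have qr1: "1 < q / r" using qr by simp
      obtain n where n: "K / s 0 < (q / r) ^ n"
        using real_arch_pow [OF qr1] by blast
      have "(q / r) ^ n \<le> (q / r) ^ (2 ^ n)"
        using qr1 by (intro power_increasing) (auto simp: less_exp less_imp_le)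
      also have "\<dots> \<le> K / s 0"
        using q_le [of n] \<open>0 < r\<close> by (simp add: power_divide divide_le_eq)
      finally show False using n by simp
    qed
  qed
  moreover have "s 1 = Re (B (x * y) (x * y))"
    by (simp add: s_def B_def adj_mult mult.assoc)
  ultimately show ?thesis by (simp add: r_def s_def)
qed

text \<open>Traciality makes the adjoint isometric for \<open>B\<close>, which turns right
  multiplication into left multiplication.\<close>

lemma right_bounded:
  assumes x: "x \<in> A" and y: "y \<in> A"
  shows "Re (B (y * x) (y * x)) \<le> (opnorm x)\<^sup>2 * Re (B y y)"
proof -
  have tr: "B z z = B (adj z) (adj z)" if "z \<in> A" for z
    using phi_trace [OF alg(5) [OF that] that] by (simp add: B_def)
  have "Re (B (y * x) (y * x)) = Re (B (adj x * adj y) (adj x * adj y))"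
    by (subst tr) (simp_all add: adj_mult alg x y)
  also have "\<dots> \<le> (opnorm (adj x))\<^sup>2 * Re (B (adj y) (adj y))"
    by (intro left_bounded alg x y)
  also have "\<dots> \<le> (opnorm x)\<^sup>2 * Re (B (adj y) (adj y))"
    by (intro mult_right_mono power_mono opnorm_adj_le semi_inner.B_pos [OF semi_inner] alg y opnorm_nonneg)
  finally show ?thesis by (simp add: tr [OF y, symmetric])
qed

lemma infinite_bop: "infinite (UNIV :: 'h bop set)"
proof
  assume fin: "finite (UNIV :: 'h bop set)"
  have "(1 :: 'h bop) \<noteq> 0"
    using phi_one phi_scaleC [OF alg(1), of 0] by (auto simp: scaleC_zero_left)
  then have "inj (\<lambda>n::nat. real n *\<^sub>R (1 :: 'h bop))"
    unfolding inj_def by (simp only: scaleR_cancel_right of_nat_eq_iff) blast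
  from range_inj_infinite [OF this] show False
    using finite_subset [OF subset_UNIV fin] by blast
qed

text \<open>\<pi> is left multiplication on the completion of \<open>A\<close>, amplified to the
  whole index type. Right multiplications commute with it, and traciality identifies their adjoints
  with right multiplication by adjoints; hence left and right multiplication by \<open>x\<close>,
  and their adjoints, agree on the vacuum.\<close>

theorem standard_form:
  "\<exists>(\<pi> :: 'h bop \<Rightarrow> 'h bop ell2 bop) w. unital_star_hom_on A \<pi> \<and>
     (\<forall>x\<in>A. cinner (ket w) (bop_apply (\<pi> x) (ket w)) = \<phi> x) \<and>
     cyclic_for (commutant (\<pi> ` A)) (ket w) \<and>
     (\<forall>x\<in>A. \<exists>r\<in>commutant (\<pi> ` A). bop_apply r (ket w) = bop_apply (\<pi> x) (ket w) \<and>
        bop_apply (adj r) (ket w) = bop_apply (adj (\<pi> x)) (ket w))"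
proof -
  obtain v E where "embedded A B 1 v E" using embedding_exists by blast
  then interpret embedded A B 1 v E .
  have "\<exists>T. extends T (\<lambda>y. x * y)" if x: "x \<in> A" for x
    by (rule extends_exists [where K = "opnorm x"])
      (auto simp: distrib_left bop_algebra_simps intro!: alg x left_bounded)
  then obtain L where L: "\<And>x. x \<in> A \<Longrightarrow> extends (L x) (\<lambda>y. x * y)" by metis
  have "\<exists>T. extends T (\<lambda>y. y * x)" if x: "x \<in> A" for x
    by (rule extends_exists [where K = "opnorm x"])
      (auto simp: distrib_right bop_algebra_simps intro!: alg x right_bounded)
  then obtain R where R: "\<And>x. x \<in> A \<Longrightarrow> extends (R x) (\<lambda>y. y * x)" by metis
  have L_lin: "L (c *\<^sub>C a + d *\<^sub>C b) = c *\<^sub>C L a + d *\<^sub>C L b" if "a \<in> A" "b \<in> A" for a b c d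
  proof (rule extends_unique)
    show "extends (L (c *\<^sub>C a + d *\<^sub>C b)) (\<lambda>y. (c *\<^sub>C a + d *\<^sub>C b) * y)"
      by (intro L alg that)
    show "extends (c *\<^sub>C L a + d *\<^sub>C L b) (\<lambda>y. (c *\<^sub>C a + d *\<^sub>C b) * y)"
      using extends_add [OF extends_scaleC [OF L [OF that(1)]] extends_scaleC [OF L [OF that(2)]], of c d]
      by (simp add: distrib_right bop_algebra_simps)
  qed
  have L_mult: "L (a * b) = L a * L b" if "a \<in> A" "b \<in> A" for a b
    using extends_unique [OF L [OF alg(3) [OF that]]] extends_mult [OF L [OF that(1)] L [OF that(2)]]
    by (simp add: mult.assoc)
  have L_adj: "L (adj a) = adj (L a)" if "a \<in> A" for a
    by (rule extends_adj [OF L [OF that] L [OF alg(5) [OF that]], symmetric])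
      (simp add: B_def adj_mult mult.assoc)
  have R_adj: "R (adj a) = adj (R a)" if a: "a \<in> A" for a
  proof (rule extends_adj [OF R [OF a] R [OF alg(5) [OF a]], symmetric])
    fix x y assume "x \<in> A" "y \<in> A"
    then show "B (x * a) y = B x (y * adj a)"
      using phi_trace [of "adj a" "adj x * y"] a by (simp add: B_def adj_mult mult.assoc alg)
  qed
  have LR: "L a * R b = R b * L a" if "a \<in> A" "b \<in> A" for a b
    using extends_unique [OF extends_mult [OF L [OF that(1)] R [OF that(2)]]]
      extends_mult [OF R [OF that(2)] L [OF that(1)]]
    by (simp add: mult.assoc)
  have L_one: "L 1 = coproj E"
    by (rule extends_unique [OF L [OF alg(1)]])
      (auto simp: extends_def coproj_fix v_on coproj_on intro!: bop_eqI)
  obtain h t :: "'h bop \<Rightarrow> 'h bop" and e where amplify: "amplify h t e E"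
    using exists_amplify [OF infinite_bop, of E] u_E by blast
  interpret amplify h t e E by (rule amplify)
  define w where "w = e 1 1"
  have w: "inc 1 (ket 1) = ket w"
    unfolding w_def by (rule inc_ket [OF u_E])
  have ket1: "ket 1 \<in> ell2_on E"
    using u_E by (auto simp: ell2_on_def ket.rep_eq)
  define \<pi> where "\<pi> x = amp (L x)" for x
  define \<rho> where "\<rho> x = amp (R x)" for x
  have Lr: "range (bop_apply (L x)) \<subseteq> ell2_on E" and Rr: "range (bop_apply (R x)) \<subseteq> ell2_on E"
    if "x \<in> A" for x
    using extendsD(5) [OF L [OF that]] extendsD(5) [OF R [OF that]] .
  have pi_w: "bop_apply (\<pi> x) (ket w) = inc 1 (v x)" and rho_w: "bop_apply (\<rho> x) (ket w) = inc 1 (v x)"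
    if "x \<in> A" for x
    unfolding \<pi>_def \<rho>_def w [symmetric] v_u [symmetric] amp_inc [OF v_on [OF alg(1)]]
    by (simp_all add: extendsD(1) [OF L [OF that] alg(1)] extendsD(1) [OF R [OF that] alg(1)])
  have hom: "unital_star_hom_on A \<pi>"
    unfolding unital_star_hom_on_def \<pi>_def
    using amp_one [of "L 1"]
    by (auto simp: L_one L_lin L_mult L_adj amp_add amp_scaleC amp_mult Lr adj_amp coproj_fix)
  have state: "cinner (ket w) (bop_apply (\<pi> x) (ket w)) = \<phi> x" if x: "x \<in> A" for x
  proof -
    have "cinner (ket w) (bop_apply (\<pi> x) (ket w)) = Rep_ell2 (v x) 1"
      using t_e [OF u_E, of 1] h_e [OF u_E, of 1]
      unfolding pi_w [OF x] cinner_ket_left rep_inc by (simp add: w_def)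
    also have "\<dots> = B 1 x"
      using v_cinner [OF alg(1) x] by (simp add: v_u cinner_ket_left)
    finally show ?thesis by (simp add: B_def)
  qed
  have rho_comm: "\<rho> x \<in> commutant (\<pi> ` A)" if x: "x \<in> A" for x
  proof -
    have "\<rho> x * \<pi> a = \<pi> a * \<rho> x" if a: "a \<in> A" for a
      unfolding \<pi>_def \<rho>_def amp_mult [OF Lr [OF a], symmetric] amp_mult [OF Rr [OF x], symmetric]
        LR [OF a x] ..
    then show ?thesis by (simp add: commutant_def)
  qed
  \<comment> \<open>\<open>S k\<close> moves the copy of the completion with second index 1 to the
    copy with second index \<open>k\<close>. It commutes with every amplified operator, which lets
    the commutant reach all copies from the single vector \<open>ket w\<close>.\<close>
  define S where "S k = reidx {z. t z = k} (\<lambda>z. e (h z) 1)" for k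
  have S_inj: "inj_on (\<lambda>z. e (h z) 1) {z. t z = k}" for k
  proof (rule inj_onI)
    fix x y assume xy: "x \<in> {z. t z = k}" "y \<in> {z. t z = k}" "e (h x) 1 = e (h y) 1"
    have "h x = h y"
      using h_e [OF h_mem] xy(3) by metis
    moreover have "t x = t y" using xy(1,2) by simp
    ultimately show "x = y" using e_ht by metis
  qed
  have S_comm: "S k \<in> commutant (\<pi> ` A)" for k
  proof -
    have "S k * amp T = amp T * S k" for T
    proof (intro bop_eqI ell2_eqI)
      fix f z
      have "slice y (bop_apply (S k) f) = (if y = k then slice 1 f else 0)" for y
        by (rule ell2_eqI) (simp add: rep_slice S_def rep_reidx [OF S_inj])
      then show "Rep_ell2 (bop_apply (S k * amp T) f) z = Rep_ell2 (bop_apply (amp T * S k) f) z"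
        using h_e [OF h_mem] t_e [OF h_mem] by (simp add: S_def rep_reidx [OF S_inj] rep_amp)
    qed
    then show ?thesis by (auto simp: commutant_def \<pi>_def)
  qed
  have cyc: "cyclic_for (commutant (\<pi> ` A)) (ket w)"
    unfolding cyclic_for_def
  proof (intro allI impI, elim conjE)
    fix N :: "'h bop ell2 set"
    assume N: "closed N" "\<forall>x\<in>N. \<forall>y\<in>N. x + y \<in> N" "\<forall>c. \<forall>x\<in>N. c *\<^sub>C x \<in> N" "ket w \<in> N"
      and inv: "\<forall>r\<in>commutant (\<pi> ` A). \<forall>x\<in>N. bop_apply r x \<in> N"
    have "inc 1 (v x) \<in> N" if "x \<in> A" for x
      using inv rho_comm [OF that] N(4) rho_w [OF that] by metis
    then have "v ` A \<subseteq> inc 1 -` N" by auto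
    moreover have "closed (inc 1 -` N)"
      by (rule closed_vimage [OF N(1)]) (rule linear_continuous_on [OF bounded_linear_inc])
    ultimately have on: "ell2_on E \<subseteq> inc 1 -` N"
      using v_dense closure_minimal by blast
    have "ket z \<in> N" for z
    proof -
      have "ket (h z) \<in> ell2_on E"
        using h_mem [of z] by (auto simp: ell2_on_def ket.rep_eq)
      then have "ket (e (h z) 1) \<in> N"
        using on inc_ket [OF h_mem] by fastforce
      moreover have "bop_apply (S (t z)) (ket (e (h z) 1)) = ket z"
        unfolding S_def by (rule reidx_ket [OF S_inj]) auto
      ultimately show ?thesis
        using inv S_comm by metis
    qed
    moreover have "0 \<in> N"
      using N(3,4) by (metis scaleC_zero_left)
    ultimately have "x \<in> N" for x
      using closed_subspace_ell2_on [of N UNIV x] N by (simp add: ell2_on_def)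
    then show "N = UNIV" by blast
  qed
  have lift: "\<exists>r\<in>commutant (\<pi> ` A). bop_apply r (ket w) = bop_apply (\<pi> x) (ket w) \<and>
        bop_apply (adj r) (ket w) = bop_apply (adj (\<pi> x)) (ket w)" if x: "x \<in> A" for x
  proof (intro bexI conjI)
    have "adj (\<rho> x) = \<rho> (adj x)" "adj (\<pi> x) = \<pi> (adj x)"
      by (simp_all add: \<rho>_def \<pi>_def adj_amp R_adj L_adj x)
    then show "bop_apply (adj (\<rho> x)) (ket w) = bop_apply (adj (\<pi> x)) (ket w)"
      by (simp add: pi_w rho_w x alg)
  qed (simp_all add: pi_w rho_w rho_comm x)
  show ?thesis
    by (rule exI [of _ \<pi>], rule exI [of _ w]) (use hom state cyc lift in simp)
qed

end

section \<open>Weak operator topology and commutants\<close>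

lemma continuous_map_wot:
  "continuous_map weak_operator_topology euclidean (\<lambda>T. cinner x (bop_apply T y))"
proof -
  have "continuous_map euclidean euclidean (\<lambda>F :: 'a \<times> 'a \<Rightarrow> complex. F (x, y))"
    by (simp add: continuous_on_product_coordinates)
  from continuous_map_pullback [OF this, of UNIV "\<lambda>T (x, y). cinner x (bop_apply T y)"]
  show ?thesis
    unfolding weak_operator_topology_def by (simp add: o_def)
qed

lemma topspace_wot: "topspace weak_operator_topology = UNIV"
  by (simp add: weak_operator_topology_def topspace_pullback_topology)

lemma closedin_wot_eq:
  "closedin weak_operator_topology
     {T. cinner x (bop_apply T y) = cinner x' (bop_apply T y')}"
proof -
  have "continuous_map weak_operator_topology euclidean
      (\<lambda>T. cinner x (bop_apply T y) - cinner x' (bop_apply T y'))"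
    by (intro continuous_map_diff continuous_map_wot)
  from closedin_continuous_map_preimage [OF this, of "{0}"] show ?thesis
    by (simp add: topspace_wot)
qed

lemma commutantI: "(\<And>r. r \<in> X \<Longrightarrow> x * r = r * x) \<Longrightarrow> x \<in> commutant X"
  by (simp add: commutant_def)

lemma commutantD: "x \<in> commutant X \<Longrightarrow> r \<in> X \<Longrightarrow> x * r = r * x"
  by (simp add: commutant_def)

lemma commutantD_apply:
  "x \<in> commutant X \<Longrightarrow> r \<in> X \<Longrightarrow> bop_apply x (bop_apply r f) = bop_apply r (bop_apply x f)"
  unfolding bop_apply_simps(4) [symmetric] by (simp add: commutantD)

lemma adj_commutant:
  assumes "\<And>r. r \<in> X \<Longrightarrow> adj r \<in> X" "x \<in> commutant X"
  shows "adj x \<in> commutant X"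
proof (rule commutantI)
  fix r assume "r \<in> X"
  then have "adj (x * adj r) = adj (adj r * x)"
    using commutantD [OF assms(2) assms(1)] by simp
  then show "adj x * r = r * adj x" by (simp add: adj_mult)
qed

section \<open>The free product with a semicircular element\<close>

text \<open>
  The elements of a commutant that are central for a vector state form a von Neumann algebra
  on which this state is a trace, whether or not it is a trace on the whole commutant.
\<close>

locale vector_trace =
  fixes R :: "'h::complex_hilbert_space bop set" and \<Omega> :: 'h
  assumes R_adj: "r \<in> R \<Longrightarrow> adj r \<in> R" and cyclic: "cyclic_for R \<Omega>" and norm_vac: "norm \<Omega> = 1"
begin

definition \<psi> :: "'h bop \<Rightarrow> complex" where
  "\<psi> x = cinner \<Omega> (bop_apply x \<Omega>)"

definition M :: "'h bop set" where
  "M = {x \<in> commutant R. \<forall>y\<in>commutant R. \<psi> (x * y) = \<psi> (y * x)}"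

lemma psi_simps: "\<psi> (x + y) = \<psi> x + \<psi> y" "\<psi> (c *\<^sub>C x) = c * \<psi> x" "\<psi> 1 = 1" "\<psi> (adj x) = cnj (\<psi> x)"
  by (simp_all add: \<psi>_def cinner_add_right cinner_scaleC_right cinner_self norm_vac
      cinner_adj_right cinner_commute [symmetric])

lemma comm_alg: "1 \<in> commutant R" "x \<in> commutant R \<Longrightarrow> y \<in> commutant R \<Longrightarrow> x + y \<in> commutant R"
  "x \<in> commutant R \<Longrightarrow> y \<in> commutant R \<Longrightarrow> x * y \<in> commutant R"
  "x \<in> commutant R \<Longrightarrow> c *\<^sub>C x \<in> commutant R"
proof -
  show "x * y \<in> commutant R" if "x \<in> commutant R" "y \<in> commutant R"
  proof (rule commutantI)
    fix r assume "r \<in> R"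
    then show "x * y * r = r * (x * y)"
      using commutantD [OF that(1)] commutantD [OF that(2)] by (metis mult.assoc)
  qed
qed (auto simp: commutant_def distrib_left distrib_right bop_algebra_simps)

lemma comm_adj: "x \<in> commutant R \<Longrightarrow> adj x \<in> commutant R"
  by (rule adj_commutant [OF R_adj])

text \<open>The kernel of \<open>x\<close> is a closed subspace invariant under \<open>R\<close>; by
  cyclicity it is everything as soon as it contains \<Omega>.\<close>

lemma separating:
  assumes "x \<in> commutant R" "bop_apply x \<Omega> = 0"
  shows "x = 0"
proof (rule bop_eqI)
  fix f
  have "closed {f. bop_apply x f = 0}"
    by (intro closed_Collect_eq continuous_intros)
  moreover have "bop_apply x (bop_apply r f) = 0" if "r \<in> R" "bop_apply x f = 0" for r f
    using commutantD_apply [OF assms(1) that(1)] that(2) by simp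
  ultimately have "{f. bop_apply x f = 0} = UNIV"
    using cyclic assms(2) unfolding cyclic_for_def
    by (elim allE [of _ "{f. bop_apply x f = 0}"])
      (auto simp: bop_apply_add bop_apply_scaleC scaleC_zero_right)
  then show "bop_apply x f = bop_apply 0 f" by auto
qed

text \<open>With ' for adjoints, \<psi>(x y) is the product of x' \<Omega> = r' \<Omega> with y
  \<Omega>. Moving \<open>r\<close> to the other side and past \<open>y\<close> leaves y r \<Omega>
  = y x \<Omega>. A partner \<open>r\<close> in \<open>R\<close> thus replaces any direct check of
  the trace property.\<close>

lemma M_I:
  assumes x: "x \<in> commutant R" and r: "r \<in> R"
    and eq: "bop_apply r \<Omega> = bop_apply x \<Omega>" "bop_apply (adj r) \<Omega> = bop_apply (adj x) \<Omega>"
  shows "x \<in> M"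
proof -
  have "\<psi> (x * y) = \<psi> (y * x)" if y: "y \<in> commutant R" for y
  proof -
    have "\<psi> (x * y) = cinner (bop_apply (adj x) \<Omega>) (bop_apply y \<Omega>)"
      by (simp add: \<psi>_def cinner_adj_left)
    also have "\<dots> = cinner \<Omega> (bop_apply (r * y) \<Omega>)"
      by (simp add: eq(2) [symmetric] cinner_adj_left)
    also have "r * y = y * r"
      using y r by (simp add: commutant_def)
    finally show ?thesis by (simp add: \<psi>_def eq)
  qed
  then show ?thesis using x by (simp add: M_def)
qed

lemma M_star: "unital_star_subalgebra M"
  unfolding unital_star_subalgebra_def
proof (intro conjI ballI allI)
  show "1 \<in> M" by (simp add: M_def comm_alg)
  fix a assume a: "a \<in> M"
  then have aR: "a \<in> commutant R" and at: "\<And>y. y \<in> commutant R \<Longrightarrow> \<psi> (a * y) = \<psi> (y * a)"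
    by (auto simp: M_def)
  show "c *\<^sub>C a \<in> M" for c
    using aR at by (simp add: M_def comm_alg bop_algebra_simps psi_simps)
  have "\<psi> (adj a * y) = \<psi> (y * adj a)" if y: "y \<in> commutant R" for y
  proof -
    have "\<psi> (adj a * y) = cnj (\<psi> (adj y * a))"
      by (simp add: psi_simps(4) [symmetric] adj_mult)
    also have "\<dots> = cnj (\<psi> (a * adj y))"
      using at [OF comm_adj [OF y]] by simp
    also have "\<dots> = \<psi> (y * adj a)"
      by (simp add: psi_simps(4) [symmetric] adj_mult)
    finally show ?thesis .
  qed
  then show "adj a \<in> M"
    using comm_adj [OF aR] by (simp add: M_def)
  fix b assume b: "b \<in> M"
  then have bR: "b \<in> commutant R" and bt: "\<And>y. y \<in> commutant R \<Longrightarrow> \<psi> (b * y) = \<psi> (y * b)"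
    by (auto simp: M_def)
  show "a + b \<in> M"
    using aR bR at bt by (simp add: M_def comm_alg distrib_left distrib_right psi_simps)
  have "\<psi> ((a * b) * y) = \<psi> (y * (a * b))" if y: "y \<in> commutant R" for y
    using at [OF comm_alg(3) [OF bR y]] bt [OF comm_alg(3) [OF y aR]] by (simp add: mult.assoc)
  then show "a * b \<in> M"
    using comm_alg(3) [OF aR bR] by (simp add: M_def)
qed

lemma M_closed: "closedin weak_operator_topology M"
proof -
  \<comment> \<open>Commuting with \<open>r\<close>, and the trace condition against a fixed
    \<open>y\<close>, are equalities of matrix coefficients and hence closed conditions. Inserting
    \<open>UNIV\<close> keeps the intersected family nonempty.\<close>
  define \<F> where "\<F> = (\<lambda>(r, x, y). {T. cinner (bop_apply (adj r) x) (bop_apply T y)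
        = cinner x (bop_apply T (bop_apply r y))}) ` (R \<times> UNIV \<times> UNIV)
    \<union> (\<lambda>y. {T. cinner \<Omega> (bop_apply T (bop_apply y \<Omega>))
        = cinner (bop_apply (adj y) \<Omega>) (bop_apply T \<Omega>)}) ` commutant R"
  have "closedin weak_operator_topology (\<Inter>(insert UNIV \<F>))"
  proof (rule closedin_Inter)
    fix S assume "S \<in> insert UNIV \<F>"
    moreover have "closedin weak_operator_topology (UNIV :: 'h bop set)"
      by (metis closedin_topspace topspace_wot)
    ultimately show "closedin weak_operator_topology S"
      using closedin_wot_eq unfolding \<F>_def by auto
  qed simp
  moreover have "M = \<Inter>(insert UNIV \<F>)"
  proof -
    have 1: "T \<in> commutant R \<longleftrightarrow> (\<forall>r\<in>R. \<forall>x y. cinner (bop_apply (adj r) x) (bop_apply T y)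
        = cinner x (bop_apply T (bop_apply r y)))" for T
    proof
      assume "T \<in> commutant R"
      then have "bop_apply T (bop_apply r y) = bop_apply r (bop_apply T y)" if "r \<in> R" for r y
        using commutantD_apply that by blast
      then show "\<forall>r\<in>R. \<forall>x y. cinner (bop_apply (adj r) x) (bop_apply T y) = cinner x (bop_apply T (bop_apply r y))"
        by (simp add: cinner_adj_left)
    next
      assume *: "\<forall>r\<in>R. \<forall>x y. cinner (bop_apply (adj r) x) (bop_apply T y) = cinner x (bop_apply T (bop_apply r y))"
      have "T * r = r * T" if "r \<in> R" for r
        by (rule bop_eqI, rule cinner_eqI) (use * that in \<open>simp add: cinner_adj_left\<close>)
      then show "T \<in> commutant R" by (simp add: commutant_def)
    qed
    have 2: "\<psi> (T * y) = \<psi> (y * T) \<longleftrightarrow>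
       cinner \<Omega> (bop_apply T (bop_apply y \<Omega>)) = cinner (bop_apply (adj y) \<Omega>) (bop_apply T \<Omega>)" for T y
      by (simp add: \<psi>_def cinner_adj_left)
    show ?thesis
    proof (rule Set.set_eqI)
      fix T
      have "T \<in> M \<longleftrightarrow> T \<in> commutant R \<and> (\<forall>y\<in>commutant R. \<psi> (T * y) = \<psi> (y * T))"
        by (simp add: M_def)
      also have "\<dots> \<longleftrightarrow> T \<in> \<Inter>(insert UNIV \<F>)"
        unfolding 1 [of T] 2 \<F>_def by (simp add: ball_Un)
      finally show "T \<in> M \<longleftrightarrow> T \<in> \<Inter>(insert UNIV \<F>)" .
    qed
  qed
  ultimately show ?thesis by simp
qed

theorem tracial_M: "tracial_wstar_prob_space M \<psi>"
  unfolding tracial_wstar_prob_space_def von_neumann_algebra_def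
proof (intro conjI ballI allI impI)
  show "unital_star_subalgebra M" by (rule M_star)
  show "closedin weak_operator_topology M" by (rule M_closed)
  show "\<psi> 1 = 1" by (rule psi_simps)
  show "\<psi> (c *\<^sub>C a + d *\<^sub>C b) = c * \<psi> a + d * \<psi> b" for c d a b
    by (simp add: psi_simps)
  have sq: "\<psi> (adj a * a) = complex_of_real ((norm (bop_apply a \<Omega>))\<^sup>2)" for a
    by (simp add: \<psi>_def cinner_adj_right cinner_self)
  show "\<psi> (adj a * a) \<in> \<real>\<^sub>\<ge>\<^sub>0" for a
    by (simp add: sq)
  show "a = 0" if "a \<in> M" "\<psi> (adj a * a) = 0" for a
    by (rule separating) (use that in \<open>simp_all add: sq M_def\<close>)
  show "\<psi> (a * b) = \<psi> (b * a)" if "a \<in> M" "b \<in> M" for a b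
    using that unfolding M_def by blast
  show "normal_on M \<psi>"
    unfolding normal_on_def
  proof (intro exI conjI ballI)
    let ?v = "\<lambda>k::nat. if k = 0 then \<Omega> else 0"
    show "summable (\<lambda>k. (norm (?v k))\<^sup>2)" "summable (\<lambda>k. (norm (?v k))\<^sup>2)"
      by (rule summable_finite [of "{0}"]; simp)+
    show "(\<lambda>k. cinner (?v k) (bop_apply a (?v k))) sums \<psi> a" for a
      using sums_single [of 0 "\<lambda>_. \<psi> a"] by (simp add: \<psi>_def if_distrib cong: if_cong)
  qed
qed

end

text \<open>
  Basis vectors are words in the basis indices, coded by \<open>d\<close> as nonempty words; the letter \<open>w\<close>
  is the vacuum of each factor. \<open>X\<close> acts on the first letter, its commutant on the last one, and
  \<open>L\<close>, \<open>R\<close> insert a letter at either end. The operators acting on the right provide the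
  commutant that makes the vacuum a trace.
\<close>

locale fock =
  fixes X :: "'x ell2 bop set" and w :: 'x and d :: "'x list \<Rightarrow> 'x list"
  assumes d: "bij_betw d UNIV {u. u \<noteq> []}"
    and X_adj: "x \<in> X \<Longrightarrow> adj x \<in> X"
    and X_cyclic: "cyclic_for (commutant X) (ket w)"
begin

definition en :: "'x list \<Rightarrow> 'x list" where "en = inv_into UNIV d"

lemma en_d [simp]: "en (d z) = z"
  using d by (simp add: en_def bij_betw_def)

lemma d_en [simp]: "u \<noteq> [] \<Longrightarrow> d (en u) = u"
  using d unfolding en_def bij_betw_def by (intro f_inv_into_f) auto

lemma d_Nil [simp]: "d z \<noteq> []"
  using bij_betwE [OF d] by auto

sublocale left: amplify "\<lambda>z. hd (d z)" "\<lambda>z. tl (d z)" "\<lambda>x y. en (x # y)" UNIV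
  by unfold_locales simp_all

sublocale right: amplify "\<lambda>z. last (d z)" "\<lambda>z. butlast (d z)" "\<lambda>x y. en (y @ [x])" UNIV
  by unfold_locales simp_all

lemma on_UNIV [simp]: "f \<in> ell2_on UNIV"
  by (simp add: ell2_on_def)

text \<open>Words of length k span the k-th tensor power of the space on which \<open>X\<close>
  acts, for k \<ge> 1. \<open>L\<close> creates a letter \<open>w\<close> in front; its adjoint
  removes a leading \<open>w\<close> and kills all one-letter words. Hence
  \<open>adj L * left.amp x * L\<close> is the vacuum expectation of \<open>x\<close>, the relation
  behind semicircularity and freeness.\<close>

definition L :: "'x list ell2 bop" where
  "L = reidx {z. hd (d z) = w \<and> tl (d z) \<noteq> []} (\<lambda>z. en (tl (d z)))"

definition Ls :: "'x list ell2 bop" where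
  "Ls = reidx UNIV (\<lambda>z. en (w # d z))"

definition R :: "'x list ell2 bop" where
  "R = reidx {z. last (d z) = w \<and> butlast (d z) \<noteq> []} (\<lambda>z. en (butlast (d z)))"

definition Rs :: "'x list ell2 bop" where
  "Rs = reidx UNIV (\<lambda>z. en (d z @ [w]))"

lemma d_inj: "d z = d z' \<Longrightarrow> z = z'"
  by (metis en_d)

lemma inj_L: "inj_on (\<lambda>z. en (tl (d z))) {z. hd (d z) = w \<and> tl (d z) \<noteq> []}"
proof (rule inj_onI, clarify)
  fix z z' assume "en (tl (d z)) = en (tl (d z'))" "hd (d z') = hd (d z)" "tl (d z) \<noteq> []" "tl (d z') \<noteq> []"
  then show "z = z'" by (metis d_Nil d_en d_inj list.expand)
qed

lemma inj_Ls: "inj (\<lambda>z. en (w # d z))"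
  by (rule injI) (metis d_en d_inj list.distinct(1) list.inject)

lemma inj_R: "inj_on (\<lambda>z. en (butlast (d z))) {z. last (d z) = w \<and> butlast (d z) \<noteq> []}"
proof (rule inj_onI, clarify)
  fix z z' assume "en (butlast (d z)) = en (butlast (d z'))" "last (d z') = last (d z)"
    "butlast (d z) \<noteq> []" "butlast (d z') \<noteq> []"
  then show "z = z'" by (metis append_butlast_last_id d_Nil d_en d_inj)
qed

lemma inj_Rs: "inj (\<lambda>z. en (d z @ [w]))"
  by (rule injI) (metis append_is_Nil_conv append_same_eq d_Nil d_en d_inj)

lemma rep_L: "Rep_ell2 (bop_apply L f) z = (if hd (d z) = w \<and> tl (d z) \<noteq> [] then Rep_ell2 f (en (tl (d z))) else 0)"
  and rep_Ls: "Rep_ell2 (bop_apply Ls f) z = Rep_ell2 f (en (w # d z))"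
  and rep_R: "Rep_ell2 (bop_apply R f) z = (if last (d z) = w \<and> butlast (d z) \<noteq> [] then Rep_ell2 f (en (butlast (d z))) else 0)"
  and rep_Rs: "Rep_ell2 (bop_apply Rs f) z = Rep_ell2 f (en (d z @ [w]))"
  by (simp_all add: L_def Ls_def R_def Rs_def rep_reidx inj_L inj_Ls inj_R inj_Rs)

lemma adj_L: "adj L = Ls"
  unfolding L_def Ls_def
  by (rule adj_reidx [OF inj_L inj_Ls]) (simp_all, metis d_Nil d_inj en_d list.collapse d_en list.distinct(1))

lemma adj_R: "adj R = Rs"
  unfolding R_def Rs_def
  by (rule adj_reidx [OF inj_R inj_Rs]) (simp_all, metis append_butlast_last_id d_Nil en_d)

definition a :: "'x list ell2 bop" where "a = L + adj L"

definition ar :: "'x list ell2 bop" where "ar = R + adj R"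

lemma adj_a: "adj a = a" and adj_ar: "adj ar = ar"
  by (simp_all add: a_def ar_def adj_add add.commute)

lemma rep_a: "Rep_ell2 (bop_apply a f) z = Rep_ell2 f (en (w # d z)) +
     (if hd (d z) = w \<and> tl (d z) \<noteq> [] then Rep_ell2 f (en (tl (d z))) else 0)"
  and rep_ar: "Rep_ell2 (bop_apply ar f) z = Rep_ell2 f (en (d z @ [w])) +
     (if last (d z) = w \<and> butlast (d z) \<noteq> [] then Rep_ell2 f (en (butlast (d z))) else 0)"
  by (simp_all add: a_def ar_def adj_L adj_R rep_L rep_Ls rep_R rep_Rs)

lemma comm_left_ar: "left.amp x * ar = ar * left.amp x"
proof (intro bop_eqI ell2_eqI)
  fix f z
  obtain c v where z: "d z = c # v" by (metis d_Nil list.exhaust)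
  have s: "left.slice v (bop_apply ar f) = left.slice (v @ [w]) f
      + (if v \<noteq> [] \<and> last v = w then left.slice (butlast v) f else 0)"
    by (rule ell2_eqI) (auto simp: left.rep_slice rep_ar)
  show "Rep_ell2 (bop_apply (left.amp x * ar) f) z = Rep_ell2 (bop_apply (ar * left.amp x) f) z"
    by (simp add: left.rep_amp rep_ar z s bop_apply_add)
qed

lemma comm_right_a: "right.amp x * a = a * right.amp x"
proof (intro bop_eqI ell2_eqI)
  fix f z
  obtain c v where z: "d z = v @ [c]" by (metis d_Nil rev_exhaust)
  have ht: "hd (v @ [c]) = (if v = [] then c else hd v)" "tl (v @ [c]) = (if v = [] then [] else tl v @ [c])"
    by (cases v; simp)+
  have s: "right.slice v (bop_apply a f) = right.slice (w # v) f
      + (if v \<noteq> [] \<and> hd v = w then right.slice (tl v) f else 0)"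
    by (rule ell2_eqI, cases v) (auto simp: right.rep_slice rep_a)
  show "Rep_ell2 (bop_apply (right.amp x * a) f) z = Rep_ell2 (bop_apply (a * right.amp x) f) z"
    using ht by (simp add: right.rep_amp rep_a z s bop_apply_add)
qed

text \<open>\<open>adj L\<close> and \<open>R\<close> do not commute on one-letter words:
  \<open>adj L * R\<close> fixes the vacuum, while \<open>R * adj L\<close> is zero there. This
  defect is cancelled by the opposite one of \<open>adj R\<close> and \<open>L\<close>, as both ends
  use the same letter \<open>w\<close>.\<close>

lemma comm_a_ar: "a * ar = ar * a"
proof (intro bop_eqI ell2_eqI)
  fix f z
  obtain c v where z: "d z = c # v" by (metis d_Nil list.exhaust)
  show "Rep_ell2 (bop_apply (a * ar) f) z = Rep_ell2 (bop_apply (ar * a) f) z"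
    by (cases v rule: rev_cases) (auto simp: rep_a rep_ar z butlast_append)
qed

text \<open>On words of at least two letters the operators touch different letters. On a one-letter
  word both act on the same letter, and this is where \<open>xr\<close> enters. \<open>p\<close> is
  the common matrix coefficient.\<close>

lemma comm_left_right:
  assumes xr: "x * r = r * x"
  shows "left.amp x * right.amp r = right.amp r * left.amp x"
proof (intro bop_eq_ket ell2_eqI)
  fix i z
  define H where "H = bop_apply x (ket (hd (d i)))"
  define K where "K = bop_apply r (ket (last (d i)))"
  define p where "p = (if tl (d z) = [] then if tl (d i) = [] then Rep_ell2 (bop_apply (x * r) (ket (hd (d i)))) (hd (d z)) else 0
     else if tl (d i) \<noteq> [] \<and> tl (butlast (d i)) = tl (butlast (d z)) then Rep_ell2 H (hd (d z)) * Rep_ell2 K (last (d z)) else 0)"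
  obtain c v where z: "d z = c # v" by (metis d_Nil list.exhaust)
  obtain c' v' where i: "d i = c' # v'" by (metis d_Nil list.exhaust)
  have l: "left.slice v (bop_apply (right.amp r) (ket i)) =
      (if v = [] then if v' = [] then K else 0
       else if v' \<noteq> [] \<and> butlast v' = butlast v then Rep_ell2 K (last v) *\<^sub>C ket c' else 0)"
    by (rule ell2_eqI) (auto simp: left.rep_slice right.rep_amp_ket i K_def ket.rep_eq)
  have "Rep_ell2 (bop_apply (left.amp x * right.amp r) (ket i)) z = p"
    by (auto simp: left.rep_amp z l p_def i H_def K_def bop_apply_scaleC butlast_tl [symmetric])
  moreover have "Rep_ell2 (bop_apply (right.amp r * left.amp x) (ket i)) z = p"
  proof (cases "v = []")
    case True
    have "right.slice [] (bop_apply (left.amp x) (ket i)) = (if v' = [] then H else 0)"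
      by (rule ell2_eqI) (auto simp: right.rep_slice left.rep_amp_ket i H_def)
    then show ?thesis
      using True by (auto simp: right.rep_amp z p_def i H_def xr)
  next
    case False
    then obtain u b where v: "v = u @ [b]" by (metis rev_exhaust)
    have "right.slice (c # u) (bop_apply (left.amp x) (ket i)) =
       (if v' \<noteq> [] \<and> butlast v' = u then Rep_ell2 H c *\<^sub>C ket (last v') else 0)"
      by (rule ell2_eqI, cases v' rule: rev_cases)
        (auto simp: right.rep_slice left.rep_amp_ket i H_def ket.rep_eq)
    then show ?thesis
      by (auto simp: right.rep_amp z v p_def i K_def bop_apply_scaleC butlast_append)
  qed
  ultimately show "Rep_ell2 (bop_apply (left.amp x * right.amp r) (ket i)) z
      = Rep_ell2 (bop_apply (right.amp r * left.amp x) (ket i)) z" by simp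
qed

definition RR :: "'x list ell2 bop set" where
  "RR = insert ar (right.amp ` commutant X)"

definition vac :: "'x list ell2" where
  "vac = ket (en [w])"

text \<open>Induction on the length of a word. On a basis vector \<open>Rs\<close> gives a shorter
  word or zero, so \<open>ar\<close> minus \<open>Rs\<close> appends a letter \<open>w\<close>
  inside the invariant subspace. Cyclicity of the commutant of \<open>X\<close> then turns this last
  letter into any other.\<close>

lemma cyclic_RR: "cyclic_for RR vac"
  unfolding cyclic_for_def
proof (intro allI impI, elim conjE)
  fix N :: "'x list ell2 set"
  assume N: "closed N" "\<forall>x\<in>N. \<forall>y\<in>N. x + y \<in> N" "\<forall>c. \<forall>x\<in>N. c *\<^sub>C x \<in> N" "vac \<in> N"
    and inv: "\<forall>r\<in>RR. \<forall>x\<in>N. bop_apply r x \<in> N"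
  have "0 \<in> N" using N(3,4) by (metis scaleC_zero_left)
  have step: "right.inc u f \<in> N" if u: "right.inc u (ket w) \<in> N" for u f
  proof -
    have "closed (right.inc u -` N)"
      by (rule closed_vimage [OF N(1)]) (rule linear_continuous_on [OF right.bounded_linear_inc])
    moreover have "bop_apply r g \<in> right.inc u -` N" if "r \<in> commutant X" "g \<in> right.inc u -` N" for r g
    proof -
      have "bop_apply (right.amp r) (right.inc u g) \<in> N"
        using inv that by (simp add: RR_def)
      then show ?thesis by (simp add: right.amp_inc)
    qed
    ultimately have "right.inc u -` N = UNIV"
      using X_cyclic [unfolded cyclic_for_def, rule_format, of "right.inc u -` N"] N(2,3) u
      by (simp add: right.inc_add right.inc_scaleC)
    then show ?thesis by blast
  qed
  have ket_N: "ket (en u) \<in> N" if "u \<noteq> []" for u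
    using that
  proof (induction u rule: length_induct)
    case (1 u)
    then obtain u' x where u: "u = u' @ [x]" by (metis rev_exhaust)
    have "right.inc u' (ket w) \<in> N"
    proof (cases "u' = []")
      case True
      then show ?thesis using N(4) by (simp add: right.inc_ket vac_def)
    next
      case False
      have k: "ket (en u') \<in> N" using 1 False u by simp
      have R1: "bop_apply R (ket (en u')) = ket (en (u' @ [w]))"
        unfolding R_def by (rule reidx_ket [OF inj_R]) (use False in auto)
      have kk: "bop_apply Rs (ket (en u')) \<in> N"
      proof (cases "last u' = w \<and> butlast u' \<noteq> []")
        case True
        have "bop_apply Rs (ket (en u')) = ket (en (butlast u'))"
          unfolding Rs_def by (rule reidx_ket [OF inj_Rs]) (use True False in auto)
        moreover have "length (butlast u') < length u" using u by simp
        ultimately show ?thesis using 1 True by simp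
      next
        case no: False
        have "Rep_ell2 (bop_apply Rs (ket (en u'))) z = 0" for z
        proof -
          have "en (d z @ [w]) \<noteq> en u'"
          proof
            assume "en (d z @ [w]) = en u'"
            then have "d z @ [w] = u'" using False by (metis append_is_Nil_conv d_en not_Cons_self2)
            then show False using no by auto
          qed
          then show ?thesis by (simp add: rep_Rs ket.rep_eq)
        qed
        then have "bop_apply Rs (ket (en u')) = 0"
          by (intro ell2_eqI) simp
        then show ?thesis using \<open>0 \<in> N\<close> by simp
      qed
      have "bop_apply ar (ket (en u')) \<in> N"
        using inv k by (simp add: RR_def)
      then have "bop_apply ar (ket (en u')) + (-1) *\<^sub>C bop_apply Rs (ket (en u')) \<in> N"
        using N(2,3) kk by blast
      then have "ket (en (u' @ [w])) \<in> N"
        by (simp add: ar_def adj_R R1 scaleC_minus_left scaleC_one)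
      then show ?thesis by (simp add: right.inc_ket)
    qed
    from step [OF this, of "ket x"] show ?case
      by (simp add: right.inc_ket u)
  qed
  have "ket z \<in> N" for z
    using ket_N [of "d z"] by simp
  then have "x \<in> N" for x
    using closed_subspace_ell2_on [of N UNIV x] N \<open>0 \<in> N\<close> by simp
  then show "N = UNIV" by blast
qed

sublocale trace: vector_trace RR vac
proof
  show "adj r \<in> RR" if "r \<in> RR" for r
  proof -
    show ?thesis
      using that adj_commutant [OF X_adj] by (auto simp: RR_def adj_ar right.adj_amp)
  qed
  show "cyclic_for RR vac" by (rule cyclic_RR)
  show "norm vac = 1" by (simp add: vac_def)
qed

lemma left_vac: "bop_apply (left.amp x) vac = left.inc [] (bop_apply x (ket w))"
  and right_vac: "bop_apply (right.amp x) vac = right.inc [] (bop_apply x (ket w))"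
proof -
  have "vac = left.inc [] (ket w)" "vac = right.inc [] (ket w)"
    by (simp_all add: left.inc_ket right.inc_ket vac_def)
  then show "bop_apply (left.amp x) vac = left.inc [] (bop_apply x (ket w))"
     "bop_apply (right.amp x) vac = right.inc [] (bop_apply x (ket w))"
    by (metis left.amp_inc right.amp_inc on_UNIV)+
qed

lemma inc_Nil: "left.inc [] f = right.inc [] f"
proof (rule ell2_eqI)
  fix z
  obtain c v where z: "d z = c # v" by (metis d_Nil list.exhaust)
  then show "Rep_ell2 (left.inc [] f) z = Rep_ell2 (right.inc [] f) z"
    by (simp add: left.rep_inc right.rep_inc)
qed

lemma left_in_M:
  assumes x: "x \<in> X" and r: "r \<in> commutant X"
    and eq: "bop_apply r (ket w) = bop_apply x (ket w)" "bop_apply (adj r) (ket w) = bop_apply (adj x) (ket w)"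
  shows "left.amp x \<in> trace.M"
proof (rule trace.M_I)
  show "left.amp x \<in> commutant RR"
    using x by (auto simp: commutant_def RR_def comm_left_ar intro!: comm_left_right)
  show "right.amp r \<in> RR" using r by (simp add: RR_def)
  show "bop_apply (right.amp r) vac = bop_apply (left.amp x) vac"
    "bop_apply (adj (right.amp r)) vac = bop_apply (adj (left.amp x)) vac"
    by (simp_all add: left.adj_amp right.adj_amp left_vac right_vac inc_Nil eq)
qed

lemma a_in_M: "a \<in> trace.M"
proof (rule trace.M_I)
  show "a \<in> commutant RR"
    by (auto simp: commutant_def RR_def comm_a_ar comm_right_a)
  show "ar \<in> RR" by (simp add: RR_def)
  show "bop_apply ar vac = bop_apply a vac"
  proof (rule ell2_eqI)
    fix z
    obtain c v where z: "d z = c # v" by (metis d_Nil list.exhaust)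
    have k: "en u = en u' \<longleftrightarrow> u = u'" if "u \<noteq> []" "u' \<noteq> []" for u u'
      using that by (metis d_en)
    show "Rep_ell2 (bop_apply ar vac) z = Rep_ell2 (bop_apply a vac) z"
      by (cases v rule: rev_cases) (auto simp: rep_a rep_ar vac_def ket.rep_eq z k)
  qed
  then show "bop_apply (adj ar) vac = bop_apply (adj a) vac"
    by (simp add: adj_a adj_ar)
qed

lemma Ls_L: "adj L * L = 1"
  by (intro bop_eqI ell2_eqI) (simp add: adj_L rep_Ls rep_L)

lemma Ls_left_L: "adj L * left.amp x * L = cinner (ket w) (bop_apply x (ket w)) *\<^sub>C 1"
proof (intro bop_eqI ell2_eqI)
  fix f z
  have "left.slice (d z) (bop_apply L f) = Rep_ell2 f z *\<^sub>C ket w"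
    by (rule ell2_eqI) (auto simp: left.rep_slice rep_L ket.rep_eq)
  then show "Rep_ell2 (bop_apply (adj L * left.amp x * L) f) z
      = Rep_ell2 (bop_apply (cinner (ket w) (bop_apply x (ket w)) *\<^sub>C 1) f) z"
    by (simp add: adj_L rep_Ls left.rep_amp bop_apply_scaleC cinner_ket_left mult.commute)
qed

lemma Ls_left_vac: "bop_apply (adj L) (bop_apply (left.amp x) vac) = 0"
  by (rule ell2_eqI) (simp add: adj_L rep_Ls left_vac left.rep_inc)

end

text \<open>The relations for \<open>L\<close> and \<Omega> are recorded because freeness and
  moments are later derived from them alone, without the model on words.\<close>

theorem semicircular_enlargement:
  fixes A :: "'h::complex_hilbert_space bop set"
  assumes "tracial_wstar_prob_space A \<phi>"
  shows "\<exists>(M :: 'h enlarged bop set) \<psi> \<iota> L \<Omega>. enlargement A \<phi> M \<psi> \<iota> \<and>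
    L + adj L \<in> M \<and> adj L * L = 1 \<and> (\<forall>x\<in>A. adj L * \<iota> x * L = \<phi> x *\<^sub>C 1) \<and>
    (\<forall>x\<in>A. bop_apply (adj L) (bop_apply (\<iota> x) \<Omega>) = 0) \<and>
    norm \<Omega> = 1 \<and> \<psi> = (\<lambda>x. cinner \<Omega> (bop_apply x \<Omega>))"
proof -
  interpret tracial_space A \<phi> by unfold_locales (rule assms)
  obtain \<pi> :: "'h bop \<Rightarrow> 'h bop ell2 bop" and w where hom: "unital_star_hom_on A \<pi>"
    and state: "\<And>x. x \<in> A \<Longrightarrow> cinner (ket w) (bop_apply (\<pi> x) (ket w)) = \<phi> x"
    and cyc: "cyclic_for (commutant (\<pi> ` A)) (ket w)"
    and lift: "\<And>x. x \<in> A \<Longrightarrow> \<exists>r\<in>commutant (\<pi> ` A). bop_apply r (ket w) = bop_apply (\<pi> x) (ket w) \<and>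
        bop_apply (adj r) (ket w) = bop_apply (adj (\<pi> x)) (ket w)"
    using standard_form by blast
  have "infinite (UNIV :: 'h bop list set)" by (rule infinite_UNIV_listI)
  then obtain d :: "'h bop list \<Rightarrow> 'h bop list" where d: "bij_betw d UNIV (UNIV - {[]})"
    using infinite_imp_bij_betw [of "UNIV :: 'h bop list set" "[]"] by blast
  have pi_adj: "adj (\<pi> x) = \<pi> (adj x)" if "x \<in> A" for x
    using hom that by (simp add: unital_star_hom_on_def)
  interpret fock "\<pi> ` A" w d
  proof
    show "bij_betw d UNIV {u. u \<noteq> []}" using d by (simp add: set_diff_eq)
    show "adj x \<in> \<pi> ` A" if "x \<in> \<pi> ` A" for x
      using that alg(5) by (auto simp: pi_adj)
  qed (rule cyc)
  define \<iota> where "\<iota> x = left.amp (\<pi> x)" for x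
  have "unital_star_hom_on A \<iota>"
    using hom unfolding unital_star_hom_on_def \<iota>_def
    by (auto simp: left.amp_one left.amp_add left.amp_scaleC left.adj_amp intro!: left.amp_mult)
  moreover have "\<iota> x \<in> trace.M" if "x \<in> A" for x
    unfolding \<iota>_def using lift [OF that] left_in_M [of "\<pi> x"] that by blast
  moreover have "trace.\<psi> (\<iota> x) = \<phi> x" if "x \<in> A" for x
    using state [OF that]
    by (simp add: \<iota>_def trace.\<psi>_def left_vac, simp add: vac_def cinner_ket_left left.rep_inc)
  ultimately have "enlargement A \<phi> trace.M trace.\<psi> \<iota>"
    unfolding enlargement_def using trace.tracial_M by blast
  moreover have "L + adj L \<in> trace.M"
    using a_in_M by (simp add: a_def)
  moreover have "adj L * \<iota> x * L = \<phi> x *\<^sub>C 1" if "x \<in> A" for x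
    unfolding \<iota>_def Ls_left_L state [OF that] ..
  moreover have "bop_apply (adj L) (bop_apply (\<iota> x) vac) = 0" for x
    unfolding \<iota>_def by (rule Ls_left_vac)
  moreover have "norm vac = 1" by (simp add: vac_def)
  moreover have "trace.\<psi> = (\<lambda>x. cinner vac (bop_apply x vac))"
    by (simp add: trace.\<psi>_def fun_eq_iff)
  ultimately show ?thesis using Ls_L by blast
qed

section \<open>Wick words and freeness\<close>

text \<open>Wick words: noncommutative analogues of the Chebyshev polynomials, in which only equal
  neighbours contract. For free semicircular elements of variance 1 the state vanishes on all
  nonempty Wick words, and this determines their joint moments.\<close>

fun wick :: "('i \<Rightarrow> 'a::{ring, monoid_mult}) \<Rightarrow> 'i list \<Rightarrow> 'a" where
  "wick s [] = 1"
| "wick s [i] = s i"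
| "wick s (i # j # w) = s i * wick s (j # w) - (if i = j then wick s w else 0)"

lemma mult_wick: "s i * wick s w = wick s (i # w) + (if w \<noteq> [] \<and> hd w = i then wick s (tl w) else 0)"
  by (cases w) auto

lemma wick_append:
  assumes "u \<noteq> []" "w \<noteq> []" "last u \<noteq> hd w"
  shows "wick s (u @ w) = wick s u * wick s w"
  using assms
proof (induction s u rule: wick.induct)
  case (2 s i)
  then show ?case by (cases w) auto
next
  case (3 s i j u)
  show ?case
  proof (cases "u = []")
    case True
    then show ?thesis
      using 3 by (cases w) (auto simp: algebra_simps)
  next
    case False
    then show ?thesis
      using 3 by (auto simp: algebra_simps)
  qed
qed simp

inductive_set polys :: "'h::complex_hilbert_space bop \<Rightarrow> 'h bop set" for a where
  polys_one: "1 \<in> polys a"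
| polys_add: "x \<in> polys a \<Longrightarrow> y \<in> polys a \<Longrightarrow> x + y \<in> polys a"
| polys_scale: "x \<in> polys a \<Longrightarrow> c *\<^sub>C x \<in> polys a"
| polys_mult: "x \<in> polys a \<Longrightarrow> a * x \<in> polys a"

lemma polys_times: "x \<in> polys a \<Longrightarrow> y \<in> polys a \<Longrightarrow> x * y \<in> polys a"
  by (induction rule: polys.induct)
    (auto simp: distrib_right bop_algebra_simps mult.assoc intro: polys.intros)

lemma polys_self: "a \<in> polys a"
  using polys_mult [OF polys_one, of a] by simp

lemma polys_adj:
  assumes "adj a = a"
  shows "x \<in> polys a \<Longrightarrow> adj x \<in> polys a"
  by (induction rule: polys.induct)
    (auto simp: adj_add adj_scaleC adj_mult assms intro: polys.intros polys_times polys_self)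

lemma star_algebra_polys:
  assumes "adj a = a"
  shows "star_algebra_generated {r *\<^sub>R a} \<subseteq> polys a"
proof -
  have "unital_star_subalgebra (polys a)"
    unfolding unital_star_subalgebra_def
    by (auto intro: polys.intros polys_times polys_adj [OF assms])
  moreover have "r *\<^sub>R a \<in> polys a"
    using polys_scale [OF polys_self, of "complex_of_real r" a] by (simp add: scaleC_of_real)
  ultimately show ?thesis
    unfolding star_algebra_generated_def by blast
qed

lemma polys_decompose:
  "q \<in> polys a \<Longrightarrow> \<exists>c. \<exists>q'\<in>polys a. q = c *\<^sub>C 1 + a * q'"
proof (induction rule: polys.induct)
  case polys_one
  have "0 \<in> polys a"
    using polys_scale [OF polys.polys_one, of 0 a] by (simp add: scaleC_zero_left)
  then show ?case by (intro exI [of _ 1] bexI [of _ 0]) (simp_all add: scaleC_one)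
next
  case (polys_add x y)
  then obtain c x' d y' where "x' \<in> polys a" "x = c *\<^sub>C 1 + a * x'" "y' \<in> polys a" "y = d *\<^sub>C 1 + a * y'"
    by blast
  then show ?case
    by (intro exI [of _ "c + d"] bexI [of _ "x' + y'"])
      (simp_all add: scaleC_add_left distrib_left polys.polys_add)
next
  case (polys_scale x k)
  then obtain c x' where "x' \<in> polys a" "x = c *\<^sub>C 1 + a * x'"
    by blast
  then show ?case
    by (intro exI [of _ "k * c"] bexI [of _ "k *\<^sub>C x'"])
      (simp_all add: scaleC_add_right scaleC_scaleC bop_algebra_simps polys.polys_scale)
next
  case (polys_mult x)
  then show ?case
    by (intro exI [of _ 0] bexI [of _ x]) (simp_all add: scaleC_zero_left)
qed

locale semicircular_extension = base: tracial_space A \<phi>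
  for A :: "'h::complex_hilbert_space bop set" and \<phi> +
  fixes M :: "'k::complex_hilbert_space bop set" and \<psi> \<iota> L \<Omega>
  assumes enl: "enlargement A \<phi> M \<psi> \<iota>" and a_M: "L + adj L \<in> M" and LL: "adj L * L = 1"
    and LxL: "x \<in> A \<Longrightarrow> adj L * \<iota> x * L = \<phi> x *\<^sub>C 1"
    and Lx_vac: "x \<in> A \<Longrightarrow> bop_apply (adj L) (bop_apply (\<iota> x) \<Omega>) = 0"
    and norm_vac: "norm \<Omega> = 1" and psi: "\<psi> = (\<lambda>x. cinner \<Omega> (bop_apply x \<Omega>))"
begin

sublocale tracial_space M \<psi>
  using enl by unfold_locales (simp add: enlargement_def)

lemma iota_hom: "\<iota> 1 = 1" "x \<in> A \<Longrightarrow> y \<in> A \<Longrightarrow> \<iota> (c *\<^sub>C x + d *\<^sub>C y) = c *\<^sub>C \<iota> x + d *\<^sub>C \<iota> y"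
  "x \<in> A \<Longrightarrow> y \<in> A \<Longrightarrow> \<iota> (x * y) = \<iota> x * \<iota> y" "x \<in> A \<Longrightarrow> \<iota> (adj x) = adj (\<iota> x)"
  "x \<in> A \<Longrightarrow> \<iota> x \<in> M" "x \<in> A \<Longrightarrow> \<psi> (\<iota> x) = \<phi> x"
  using enl unfolding enlargement_def unital_star_hom_on_def by auto

lemma iota_add: "x \<in> A \<Longrightarrow> y \<in> A \<Longrightarrow> \<iota> (x + y) = \<iota> x + \<iota> y"
  using iota_hom(2) [of x y 1 1] by (simp add: scaleC_one)

lemma iota_scaleC: "x \<in> A \<Longrightarrow> \<iota> (c *\<^sub>C x) = c *\<^sub>C \<iota> x"
  using iota_hom(2) [of x x c 0] by (simp add: scaleC_zero_left)

lemma iota_scaleR: "x \<in> A \<Longrightarrow> \<iota> (r *\<^sub>R x) = r *\<^sub>R \<iota> x"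
  using iota_scaleC [of x "complex_of_real r"] by (simp add: scaleC_of_real)

lemma iota_diff: "x \<in> A \<Longrightarrow> y \<in> A \<Longrightarrow> \<iota> (x - y) = \<iota> x - \<iota> y"
  using iota_hom(2) [of x y 1 "-1"] by (simp add: scaleC_one scaleC_minus_left)

lemma iota_power: "x \<in> A \<Longrightarrow> \<iota> (x ^ n) = \<iota> x ^ n"
  by (induction n) (simp_all add: iota_hom base.alg_power)

definition a :: "'k bop" where "a = L + adj L"

lemma a_apply: "bop_apply a f = bop_apply L f + bop_apply (adj L) f"
  by (simp add: a_def)

lemma adj_a: "adj a = a"
  by (simp add: a_def adj_add add.commute)

lemma adjL_L: "bop_apply (adj L) (bop_apply L f) = f"
  using LL by (metis bop_apply_simps(4,6))

lemma adjL_x_L: "x \<in> A \<Longrightarrow> bop_apply (adj L) (bop_apply (\<iota> x) (bop_apply L f)) = \<phi> x *\<^sub>C f"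
  using LxL [of x] by (metis bop_apply_simps(4,6,8))

lemma adjL_vac: "bop_apply (adj L) \<Omega> = 0"
  using Lx_vac [OF base.alg(1)] by (simp add: iota_hom)

lemma vac_L: "cinner \<Omega> (bop_apply L f) = 0"
  by (metis adjL_vac cinner_adj_left cinner_zero(1))

lemma vac_x_L: "x \<in> A \<Longrightarrow> cinner \<Omega> (bop_apply (\<iota> x) (bop_apply L f)) = 0"
  using Lx_vac [OF base.alg(5), of x]
  by (metis base.alg(5) cinner_adj_left cinner_adj_right cinner_zero(1) iota_hom(4))

lemma vac_x_vac: "x \<in> A \<Longrightarrow> cinner \<Omega> (bop_apply (\<iota> x) \<Omega>) = \<phi> x"
  using iota_hom(6) [of x] by (simp add: psi)

lemma centered_left:
  assumes x: "x \<in> A" "\<phi> x = 0" and f: "f = \<Omega> \<or> f \<in> range (bop_apply L)"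
  shows "bop_apply (adj L) (bop_apply (\<iota> x) f) = 0" "cinner \<Omega> (bop_apply (\<iota> x) f) = 0"
  using x f by (auto simp: Lx_vac adjL_x_L vac_x_vac vac_x_L scaleC_zero_left)

text \<open>Since \<open>adj L * L = 1\<close>, applying \<open>adj L\<close> to a polynomial in
  \<open>L\<close> removes one factor and, on vectors killed by \<open>adj L\<close>, drops the
  constant term. Annihilation therefore never leaves the polynomials in \<open>L\<close>.\<close>

lemma polys_on_kernel:
  "x \<in> polys a \<Longrightarrow> \<exists>q\<in>polys L. \<forall>f. bop_apply (adj L) f = 0 \<longrightarrow> bop_apply x f = bop_apply q f"
proof (induction rule: polys.induct)
  case polys_one
  show ?case by (rule bexI [OF _ polys.polys_one]) simp
next
  case (polys_add x y)
  then obtain q r where "q \<in> polys L" "r \<in> polys L"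
    "\<forall>f. bop_apply (adj L) f = 0 \<longrightarrow> bop_apply x f = bop_apply q f"
    "\<forall>f. bop_apply (adj L) f = 0 \<longrightarrow> bop_apply y f = bop_apply r f" by blast
  then show ?case by (intro bexI [of _ "q + r"]) (auto intro: polys.polys_add)
next
  case (polys_scale x c)
  then obtain q where "q \<in> polys L" "\<forall>f. bop_apply (adj L) f = 0 \<longrightarrow> bop_apply x f = bop_apply q f" by blast
  then show ?case by (intro bexI [of _ "c *\<^sub>C q"]) (auto intro: polys.polys_scale)
next
  case (polys_mult x)
  then obtain q where q: "q \<in> polys L" "\<forall>f. bop_apply (adj L) f = 0 \<longrightarrow> bop_apply x f = bop_apply q f" by blast
  obtain c q' where q': "q' \<in> polys L" "q = c *\<^sub>C 1 + L * q'"
    using polys_decompose [OF q(1)] by blast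
  have "bop_apply (a * x) f = bop_apply (L * q + q') f" if f: "bop_apply (adj L) f = 0" for f
  proof -
    have "bop_apply (adj L) (bop_apply q f) = bop_apply q' f"
      by (simp add: q'(2) bop_apply_add bop_apply_scaleC f scaleC_zero_right adjL_L)
    then show ?thesis using q(2) f by (simp add: a_apply)
  qed
  then show ?case
    using q(1) q'(1) by (intro bexI [of _ "L * q + q'"]) (auto intro: polys.intros)
qed

text \<open>The range of \<open>L\<close> is orthogonal to \<Omega>, so the state reads off the
  constant term of the polynomial in \<open>L\<close>.\<close>

lemma centered_polys:
  assumes "x \<in> polys a" "\<psi> x = 0" "bop_apply (adj L) f = 0"
  shows "bop_apply x f \<in> range (bop_apply L)"
proof -
  obtain q where q: "q \<in> polys L" "\<forall>f. bop_apply (adj L) f = 0 \<longrightarrow> bop_apply x f = bop_apply q f"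
    using polys_on_kernel [OF assms(1)] by blast
  obtain c q' where q': "q = c *\<^sub>C 1 + L * q'"
    using polys_decompose [OF q(1)] by blast
  have "\<psi> x = cinner \<Omega> (bop_apply q \<Omega>)"
    using q(2) adjL_vac by (simp add: psi)
  also have "\<dots> = c"
    by (simp add: q' cinner_add_right cinner_scaleC_right vac_L cinner_self norm_vac)
  finally have "c = 0" using assms(2) by simp
  then have "bop_apply x f = bop_apply L (bop_apply q' f)"
    using q(2) assms(3) by (simp add: q' scaleC_zero_left)
  then show ?thesis by blast
qed

lemma star_algebra_iota:
  assumes "Y \<subseteq> A"
  shows "star_algebra_generated (\<iota> ` Y) \<subseteq> \<iota> ` A"
proof -
  have "1 \<in> \<iota> ` A" using iota_hom(1) base.alg(1) by (metis imageI)
  then have "unital_star_subalgebra (\<iota> ` A)"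
    unfolding unital_star_subalgebra_def
    using base.alg
    by (auto simp: iota_hom(3,4) [symmetric] iota_add [symmetric] iota_scaleC [symmetric])
  then show ?thesis
    using assms unfolding star_algebra_generated_def by blast
qed

text \<open>The factors are applied to \<Omega> one after the other. A centred polynomial in
  \<open>a\<close> maps the kernel of \<open>adj L\<close> into the range of \<open>L\<close>; a
  centred element of \<open>A\<close> maps \<Omega> and the range of \<open>L\<close> back into that
  kernel. The vectors reached are orthogonal to \<Omega> at every stage.\<close>

lemma free:
  assumes Y: "Y \<subseteq> A"
  shows "free_independent \<psi> (UNIV :: bool set) (\<lambda>b. if b then {r *\<^sub>R a} else \<iota> ` Y)"
  unfolding free_independent_def
proof (intro allI impI, elim conjE)
  fix ws :: "(bool \<times> 'k bop) list"
  assume "ws \<noteq> []" "successively (\<noteq>) (map fst ws)"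
    "\<forall>(i, x)\<in>set ws. i \<in> UNIV \<and> x \<in> star_algebra_generated (if i then {r *\<^sub>R a} else \<iota> ` Y) \<and> \<psi> x = 0"
  then have "(let v = bop_apply (prod_list (map snd ws)) \<Omega> in cinner \<Omega> v = 0 \<and>
      (if fst (hd ws) then v \<in> range (bop_apply L) else bop_apply (adj L) v = 0))"
  proof (induction ws)
    case (Cons p ws)
    obtain b x where p: "p = (b, x)" by (cases p)
    let ?v = "bop_apply (prod_list (map snd ws)) \<Omega>"
    have x: "x \<in> star_algebra_generated (if b then {r *\<^sub>R a} else \<iota> ` Y)" "\<psi> x = 0"
      using Cons.prems(3) by (auto simp: p)
    have IH: "ws = [] \<or> (fst (hd ws) \<noteq> b \<and>
      (if fst (hd ws) then ?v \<in> range (bop_apply L) else bop_apply (adj L) ?v = 0))"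
    proof (cases ws)
      case (Cons p' ws')
      have "successively (\<noteq>) (map fst ws)" "fst (hd ws) \<noteq> b"
        using Cons.prems(2) by (auto simp: p Cons)
      then show ?thesis
        using Cons.IH Cons.prems(3) by (auto simp: Cons Let_def)
    qed simp
    show ?case
    proof (cases b)
      case True
      have "bop_apply (adj L) ?v = 0"
        using IH True adjL_vac by (auto simp: Let_def)
      then have "bop_apply x ?v \<in> range (bop_apply L)"
        using centered_polys x star_algebra_polys [OF adj_a, of r] True by auto
      then show ?thesis
        using True vac_L by (auto simp: p Let_def)
    next
      case False
      obtain y where y: "y \<in> A" "x = \<iota> y"
        using x(1) star_algebra_iota [OF Y] False by auto
      have "\<phi> y = 0" using x(2) y iota_hom(6) by simp
      moreover have "?v = \<Omega> \<or> ?v \<in> range (bop_apply L)"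
        using IH False by auto
      ultimately show ?thesis
        using centered_left [OF y(1)] False by (auto simp: p y(2) Let_def)
    qed
  qed simp
  then show "\<psi> (prod_list (map snd ws)) = 0"
    by (simp add: psi Let_def)
qed

definition extend :: "(nat \<Rightarrow> 'h bop) \<Rightarrow> nat \<Rightarrow> 'k bop" where
  "extend t i = (case i of 0 \<Rightarrow> a | Suc j \<Rightarrow> \<iota> (t j))"

lemma wick_A: "(\<And>i. t i \<in> A) \<Longrightarrow> wick t u \<in> A"
  by (induction t u rule: wick.induct) (auto intro: base.alg base.alg_diff base.alg_zero)

lemma wick_map_Suc:
  assumes "\<And>i. t i \<in> A"
  shows "wick (extend t) (map Suc u) = \<iota> (wick t u)"
  using assms
proof (induction t u rule: wick.induct)
  case (3 t i j w)
  then show ?case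
    using wick_A [of t] by (auto simp: iota_diff iota_hom base.alg extend_def)
qed (auto simp: iota_hom extend_def)

text \<open>The alternation used for freeness, now on words: a leading letter 0 acts as
  \<open>L\<close>, and a leading block of other letters as a centred element of \<open>A\<close>.
  Every nonempty word therefore yields a vector orthogonal to \<Omega>.\<close>

lemma wick_extend:
  assumes t: "\<And>i. t i \<in> A" and wick: "\<And>u. u \<noteq> [] \<Longrightarrow> \<phi> (wick t u) = 0" and "w \<noteq> []"
  shows "\<psi> (wick (extend t) w) = 0"
proof -
  let ?v = "\<lambda>w. bop_apply (wick (extend t) w) \<Omega>"
  have split: "\<exists>u w'. w = map Suc u @ w' \<and> (w' = [] \<or> hd w' = 0)" for w :: "nat list"
  proof (intro exI conjI)
    show "w = map Suc (map (\<lambda>i. i - 1) (takeWhile (\<lambda>i. i \<noteq> 0) w)) @ dropWhile (\<lambda>i. i \<noteq> 0) w"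
    proof -
      have "map Suc (map (\<lambda>i. i - 1) (takeWhile (\<lambda>i. i \<noteq> 0) w)) = takeWhile (\<lambda>i. i \<noteq> 0) w"
        by (auto simp: o_def intro!: map_idI dest: set_takeWhileD)
      then show ?thesis by simp
    qed
    show "dropWhile (\<lambda>i. i \<noteq> 0) w = [] \<or> hd (dropWhile (\<lambda>i. i \<noteq> 0) w) = 0"
      using hd_dropWhile by blast
  qed
  have main: "(w = [] \<or> hd w \<noteq> 0 \<longrightarrow> bop_apply (adj L) (?v w) = 0) \<and> (w \<noteq> [] \<longrightarrow> cinner \<Omega> (?v w) = 0) \<and>
    (\<forall>w'. w = 0 # w' \<longrightarrow> ?v w = bop_apply L (?v w'))" for w
  proof (induction w rule: length_induct)
    case (1 w)
    consider "w = []" | w' where "w = 0 # w'" | "w \<noteq> []" "hd w \<noteq> 0"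
      by (cases w) auto
    then show ?case
    proof cases
      case 1
      then show ?thesis by (simp add: adjL_vac)
    next
      case w: (2 w')
      have IH: "(w' = [] \<or> hd w' \<noteq> 0 \<longrightarrow> bop_apply (adj L) (?v w') = 0) \<and>
          (\<forall>w''. w' = 0 # w'' \<longrightarrow> ?v w' = bop_apply L (?v w''))"
      proof -
        have "length w' < length w" by (simp add: w)
        from 1 [rule_format, OF this] show ?thesis by - (intro conjI; elim conjE; assumption)
      qed
      have e: "extend t 0 = a" by (simp add: extend_def)
      have "wick (extend t) w = a * wick (extend t) w' - (if w' \<noteq> [] \<and> hd w' = 0 then wick (extend t) (tl w') else 0)"
        using mult_wick [of "extend t" 0 w'] by (simp add: w e)
      \<comment> \<open>The annihilating half of \<open>a\<close> gives a nonzero contribution only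
        when \<open>w'\<close> begins with 0 again, and this is the contraction that
        \<open>wick\<close> subtracts.\<close>
      moreover have "bop_apply (adj L) (?v w') = (if w' \<noteq> [] \<and> hd w' = 0 then ?v (tl w') else 0)"
      proof (cases "w' \<noteq> [] \<and> hd w' = 0")
        case True
        then have "w' = 0 # tl w'" by (metis list.collapse)
        then show ?thesis using IH True by (metis adjL_L)
      qed (use IH in auto)
      ultimately have "?v w = bop_apply L (?v w')"
        by (simp add: a_apply)
      then show ?thesis by (simp add: w vac_L)
    next
      case 3
      obtain u w' where uw: "w = map Suc u @ w'" "w' = [] \<or> hd w' = 0" using split by blast
      have u: "u \<noteq> []" using 3 uw by auto
      have "wick (extend t) w = \<iota> (wick t u) * wick (extend t) w'"
      proof (cases "w' = []")
        case False
        have "last (map Suc u) \<noteq> hd w'" using uw(2) False u by (simp add: last_map)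
        then show ?thesis
          using wick_append [of "map Suc u" w' "extend t"] False u by (simp add: uw(1) wick_map_Suc t)
      qed (simp add: uw(1) wick_map_Suc t)
      then have v: "?v w = bop_apply (\<iota> (wick t u)) (?v w')" by simp
      have "?v w' = \<Omega> \<or> ?v w' \<in> range (bop_apply L)"
      proof (cases w')
        case (Cons i w'')
        have "length w' < length w" using uw(1) u by simp
        from 1 [rule_format, OF this] have "\<forall>w''. w' = 0 # w'' \<longrightarrow> ?v w' = bop_apply L (?v w'')"
          by - (elim conjE)
        then have "?v w' = bop_apply L (?v w'')" using Cons uw(2) by simp
        then show ?thesis by blast
      qed simp
      from centered_left [OF wick_A [OF t] wick [OF u] this] show ?thesis
        using 3 by (auto simp: v)
    qed
  qed
  then show ?thesis using \<open>w \<noteq> []\<close> by (simp add: psi)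
qed

end

section \<open>Moments of quadratic expressions\<close>

unbundle no vec_syntax
no_notation vec_index (infixl \<open>$\<close> 100)
unbundle fps_syntax

text \<open>
  The moment series of the law with free cumulants \<open>\<kappa>\<close> is the solution of
  \<open>M = 1 + K(z M)\<close>, where \<open>K\<close> is the power series of the cumulants.
\<close>

definition moment_series :: "(nat \<Rightarrow> real) \<Rightarrow> real fps" where
  "moment_series \<kappa> = 1 + (Abs_fps \<kappa> oo fps_inv (fps_X * inverse (1 + Abs_fps \<kappa>)))"

text \<open>With y = z M the equation reads y / (1 + K(y)) = z, which exhibits y as the
  compositional inverse of z / (1 + K).\<close>

lemma moment_series_eq:
  assumes "\<kappa> 0 = 0"
  shows "moment_series \<kappa> = 1 + (Abs_fps \<kappa> oo (fps_X * moment_series \<kappa>))"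
proof -
  define K where "K = Abs_fps \<kappa>"
  define g where "g = fps_X * inverse (1 + K)"
  define y where "y = fps_inv g"
  have K0: "(1 + K) $ 0 = 1" using assms by (simp add: K_def)
  have g: "g $ 0 = 0" "g $ 1 \<noteq> 0" using K0 by (simp_all add: g_def)
  have y0: "y $ 0 = 0" by (simp add: y_def fps_inv_def)
  have "g oo y = fps_X" unfolding y_def by (rule fps_inv_right [OF g])
  moreover have "g oo y = y * inverse (1 + (K oo y))"
    using y0 K0 by (simp add: g_def fps_compose_mult_distrib fps_inverse_compose fps_compose_add_distrib)
  moreover have "inverse (1 + (K oo y)) * (1 + (K oo y)) = 1"
    by (rule inverse_mult_eq_1) (use assms in \<open>simp add: K_def\<close>)
  ultimately have "y = fps_X * (1 + (K oo y))"
    by (metis mult.assoc mult.right_neutral)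
  moreover have "moment_series \<kappa> = 1 + (K oo y)"
    by (simp add: moment_series_def K_def g_def y_def)
  ultimately show ?thesis by (simp add: K_def)
qed

lemma moment_series_nth_0: "\<kappa> 0 = 0 \<Longrightarrow> moment_series \<kappa> $ 0 = 1"
  by (subst moment_series_eq) simp_all

lemma moment_series_power_0: "\<kappa> 0 = 0 \<Longrightarrow> (moment_series \<kappa> ^ r) $ 0 = 1"
  by (simp add: moment_series_nth_0 fps_power_zeroth)

text \<open>The relation is triangular: moment \<open>n\<close> is cumulant \<open>n\<close> plus a
  polynomial in cumulants and moments of lower order. Convergence and boundedness can therefore be
  passed between the two sequences by strong induction.\<close>

lemma moment_series_nth:
  assumes "\<kappa> 0 = 0" "n > 0"
  shows "moment_series \<kappa> $ n = \<kappa> n + (\<Sum>r\<in>{1..<n}. \<kappa> r * (moment_series \<kappa> ^ r) $ (n - r))"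
proof -
  let ?M = "moment_series \<kappa>"
  have "?M $ n = (1 + (Abs_fps \<kappa> oo (fps_X * ?M))) $ n"
    using moment_series_eq [of \<kappa>] assms by simp
  also have "\<dots> = (\<Sum>i=0..n. \<kappa> i * ((fps_X * ?M) ^ i) $ n)"
    using assms by (simp add: fps_compose_nth)
  also have "\<dots> = (\<Sum>i=0..n. \<kappa> i * (?M ^ i) $ (n - i))"
    by (intro sum.cong) (auto simp: power_mult_distrib fps_X_power_mult_nth)
  also have "{0..n} = insert 0 (insert n {1..<n})"
    using assms by auto
  finally show ?thesis
    using assms by (simp add: moment_series_power_0)
qed

lemma tendsto_fps_power_nth:
  assumes "\<And>j. j \<le> k \<Longrightarrow> (\<lambda>n. (A n :: real fps) $ j) \<longlonglongrightarrow> a $ j"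
  shows "(\<lambda>n. (A n ^ r) $ k) \<longlonglongrightarrow> (a ^ r) $ k"
  using assms
proof (induction r arbitrary: k)
  case (Suc r)
  show ?case
    unfolding power_Suc fps_mult_nth
    by (intro tendsto_sum tendsto_mult Suc) auto
qed simp

lemma Bseq_plus:
  fixes f g :: "nat \<Rightarrow> 'a::real_normed_vector"
  assumes "Bseq f" "Bseq g"
  shows "Bseq (\<lambda>n. f n + g n)"
proof -
  obtain K L where "\<And>n. norm (f n) \<le> K" "\<And>n. norm (g n) \<le> L"
    using assms by (meson BseqE)
  then have "norm (f n + g n) \<le> K + L" for n
    by (meson add_mono norm_triangle_ineq order_trans)
  then show ?thesis by (rule BseqI')
qed

lemma bounded_fps_power_nth:
  assumes "\<And>j. j \<le> k \<Longrightarrow> Bseq (\<lambda>n. (A n :: real fps) $ j)"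
  shows "Bseq (\<lambda>n. (A n ^ r) $ k)"
  using assms
proof (induction r arbitrary: k)
  case (Suc r)
  have "Bseq (\<lambda>n. \<Sum>i\<in>I. A n $ i * (A n ^ r) $ (k - i))" if "finite I" "I \<subseteq> {0..k}" for I
    using that
    by induction (auto intro!: Bseq_plus Bseq_mult Suc)
  then show ?case
    unfolding power_Suc fps_mult_nth by blast
qed simp

lemma moment_series_tendsto:
  assumes "\<And>n. \<kappa> n 0 = 0" "\<And>r. (\<lambda>n. \<kappa> n r) \<longlonglongrightarrow> k r"
  shows "(\<lambda>n. moment_series (\<kappa> n) $ m) \<longlonglongrightarrow> moment_series k $ m"
proof (induction m rule: less_induct)
  case (less m)
  have k0: "k 0 = 0"
    using assms(2) [of 0] by (simp add: assms(1) LIMSEQ_const_iff)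
  show ?case
  proof (cases "m = 0")
    case False
    then have m: "0 < m" by simp
    have "(\<lambda>n. \<kappa> n m + (\<Sum>r\<in>{1..<m}. \<kappa> n r * (moment_series (\<kappa> n) ^ r) $ (m - r)))
        \<longlonglongrightarrow> k m + (\<Sum>r\<in>{1..<m}. k r * (moment_series k ^ r) $ (m - r))"
      by (intro tendsto_add tendsto_sum tendsto_mult assms tendsto_fps_power_nth less) auto
    then show ?thesis
      using m by (simp add: moment_series_nth k0 assms(1))
  qed (simp add: moment_series_nth_0 assms(1) k0)
qed

lemma moment_series_bounded:
  assumes "\<And>n. \<kappa> n 0 = 0" "\<And>r. Bseq (\<lambda>n. \<kappa> n r)"
  shows "Bseq (\<lambda>n. moment_series (\<kappa> n) $ m)"
proof (induction m rule: less_induct)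
  case (less m)
  show ?case
  proof (cases "m = 0")
    case False
    have "Bseq (\<lambda>n. \<Sum>r\<in>I. \<kappa> n r * (moment_series (\<kappa> n) ^ r) $ (m - r))" if "finite I" "I \<subseteq> {1..<m}" for I
      using that
      by induction (auto intro!: Bseq_plus Bseq_mult assms bounded_fps_power_nth less)
    then have "Bseq (\<lambda>n. \<kappa> n m + (\<Sum>r\<in>{1..<m}. \<kappa> n r * (moment_series (\<kappa> n) ^ r) $ (m - r)))"
      by (intro Bseq_plus assms) auto
    then show ?thesis
      using False by (simp add: moment_series_nth assms(1))
  qed (simp add: moment_series_nth_0 assms(1))
qed

lemma cumulants_convergent:
  assumes "\<And>n. \<kappa> n 0 = 0" "\<And>m. convergent (\<lambda>n. moment_series (\<kappa> n) $ m)"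
  shows "convergent (\<lambda>n. \<kappa> n r)"
proof (induction r rule: less_induct)
  case (less r)
  define A where "A = Abs_fps (\<lambda>m. lim (\<lambda>n. moment_series (\<kappa> n) $ m))"
  have A: "(\<lambda>n. moment_series (\<kappa> n) $ m) \<longlonglongrightarrow> A $ m" for m
    using assms(2) [of m] by (simp add: A_def convergent_LIMSEQ_iff)
  show ?case
  proof (cases "r = 0")
    case False
    have "convergent (\<lambda>n. moment_series (\<kappa> n) $ r
        - (\<Sum>q\<in>{1..<r}. \<kappa> n q * (moment_series (\<kappa> n) ^ q) $ (r - q)))"
      by (intro convergent_diff assms convergent_sum convergent_mult less)
        (auto intro: convergentI tendsto_fps_power_nth [OF A])
    then show ?thesis
      using False by (simp add: moment_series_nth assms(1))
  qed (simp add: assms(1) convergent_const)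
qed

section \<open>Generating series for the moments of a quadratic expression\<close>

fun matpow :: "nat \<Rightarrow> (nat \<Rightarrow> nat \<Rightarrow> real) \<Rightarrow> nat \<Rightarrow> nat \<Rightarrow> nat \<Rightarrow> real" where
  "matpow n A 0 i j = (if i = j then 1 else 0)"
| "matpow n A (Suc k) i j = (\<Sum>l<n. A i l * matpow n A k l j)"

definition cumulant :: "nat \<Rightarrow> (nat \<Rightarrow> nat \<Rightarrow> real) \<Rightarrow> real \<Rightarrow> nat \<Rightarrow> real" where
  "cumulant n A b r = (if r < 2 then 0 else (\<Sum>i<n. matpow n A r i i) + (if r = 2 then b\<^sup>2 else 0))"

definition quadratic :: "(nat \<Rightarrow> 'h::complex_hilbert_space bop) \<Rightarrow> nat \<Rightarrow> (nat \<Rightarrow> nat \<Rightarrow> real) \<Rightarrow> real \<Rightarrow> 'h bop" where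
  "quadratic s n A b = b *\<^sub>R s 0 +
     (\<Sum>i<n. \<Sum>j<n. A i j *\<^sub>R (s (Suc i) * s (Suc j) - (if i = j then 1 else 0)))"

text \<open>
  Expanding \<open>T\<^sup>k\<close> applied to a Wick word, each letter \<open>0\<close> and each pair of letters
  \<open>Suc i, Suc j\<close> has to be annihilated again, and the intermediate powers of \<open>T\<close> contribute
  one factor \<open>M\<close> each; this leads to the following generating series.
\<close>

fun word_series :: "(nat \<Rightarrow> nat \<Rightarrow> real fps) \<Rightarrow> real fps \<Rightarrow> real fps \<Rightarrow> nat list \<Rightarrow> real fps" where
  "word_series N c M [] = M"
| "word_series N c M (0 # w) = c * word_series N c M w"
| "word_series N c M (Suc i # Suc j # w) = N i j * word_series N c M w"
| "word_series N c M [Suc i] = 0"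
| "word_series N c M (Suc i # 0 # w) = 0"

lemma word_series_nth_0:
  assumes "M $ 0 = 1" "c $ 0 = 0" "\<And>i j. N i j $ 0 = 0"
  shows "word_series N c M w $ 0 = (if w = [] then 1 else 0)"
  using assms by (induction N c M w rule: word_series.induct) auto

locale wick_quadratic =
  fixes s :: "nat \<Rightarrow> 'h::complex_hilbert_space bop" and n :: nat and A :: "nat \<Rightarrow> nat \<Rightarrow> real" and b :: real
  assumes sym: "i < n \<Longrightarrow> j < n \<Longrightarrow> A i j = A j i"
begin

definition "M = moment_series (cumulant n A b)"
definition "y = fps_X * M"
text \<open>The entries of the matrix series A z / (1 - A z); \<open>N\<close> substitutes z M for
  z.\<close>

definition "G i j = Abs_fps (\<lambda>k. if k = 0 then 0 else matpow n A k i j)"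
definition "N i j = G i j oo y"
text \<open>Coefficient \<open>k\<close> of \<open>F w\<close> is meant to be the state on the k-th
  power of the quadratic expression times \<open>wick s w\<close>.\<close>

definition "F = word_series N (fps_const b * y) M"

lemma y0: "y $ 0 = 0" by (simp add: y_def)

text \<open>The resolvent identity G = A z (1 + G), composed with \<open>y\<close>.\<close>

lemma N_eq: "i < n \<Longrightarrow> N i j = y * (\<Sum>l<n. fps_const (A i l) * ((if l = j then 1 else 0) + N l j))"
proof -
  have "G i j = fps_X * (\<Sum>l<n. fps_const (A i l) * ((if l = j then 1 else 0) + G l j))"
  proof (rule fps_ext)
    fix k
    show "G i j $ k = (fps_X * (\<Sum>l<n. fps_const (A i l) * ((if l = j then 1 else 0) + G l j))) $ k"
      by (cases k; cases "k - 1") (auto simp: G_def fps_sum_nth if_distrib intro!: sum.cong)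
  qed
  then have "N i j = (fps_X * (\<Sum>l<n. fps_const (A i l) * ((if l = j then 1 else 0) + G l j))) oo y"
    by (simp add: N_def)
  also have "\<dots> = y * (\<Sum>l<n. fps_const (A i l) * ((if l = j then 1 else 0) + N l j))"
    using y0 by (auto simp: fps_compose_mult_distrib fps_compose_sum_distrib fps_compose_add_distrib N_def
        fps_X_fps_compose_startby0 intro!: arg_cong2 [where f = "(*)"] sum.cong)
  finally show ?thesis .
qed

text \<open>The trace of a power of \<open>A\<close> is rewritten, by symmetry of \<open>A\<close>,
  as a sum of \<open>A i j\<close> times entries with the same indices i, j. In this form it matches
  the uncontracted terms in \<open>F_step\<close>.\<close>

lemma M_eq: "M = 1 + y * (fps_const (b\<^sup>2) * y + (\<Sum>i<n. \<Sum>j<n. fps_const (A i j) * N i j))"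
proof -
  have "Abs_fps (cumulant n A b) = fps_X * (fps_const (b\<^sup>2) * fps_X + (\<Sum>i<n. \<Sum>j<n. fps_const (A i j) * G i j))"
  proof (rule fps_ext)
    fix k
    show "Abs_fps (cumulant n A b) $ k = (fps_X * (fps_const (b\<^sup>2) * fps_X + (\<Sum>i<n. \<Sum>j<n. fps_const (A i j) * G i j))) $ k"
    proof (cases "k < 2")
      case True
      then have "k = 0 \<or> k = 1" by auto
      then show ?thesis by (auto simp: cumulant_def G_def fps_sum_nth)
    next
      case False
      then obtain r where k: "k = Suc (Suc r)" by (metis One_nat_def Suc_1 add_2_eq_Suc le_Suc_ex not_less)
      have "(\<Sum>i<n. matpow n A k i i) = (\<Sum>i<n. \<Sum>j<n. A i j * matpow n A (Suc r) j i)"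
        by (simp add: k)
      also have "\<dots> = (\<Sum>j<n. \<Sum>i<n. A i j * matpow n A (Suc r) j i)"
        by (rule sum.swap)
      also have "\<dots> = (\<Sum>j<n. \<Sum>i<n. A j i * matpow n A (Suc r) j i)"
        by (intro sum.cong) (auto simp: sym simp del: matpow.simps)
      finally show ?thesis
        by (simp add: cumulant_def k G_def fps_sum_nth del: matpow.simps)
    qed
  qed
  then have "Abs_fps (cumulant n A b) oo y = y * (fps_const (b\<^sup>2) * y + (\<Sum>i<n. \<Sum>j<n. fps_const (A i j) * N i j))"
    using y0 by (simp add: fps_compose_mult_distrib fps_compose_sum_distrib fps_compose_add_distrib N_def
        fps_X_fps_compose_startby0)
  then show ?thesis
    using moment_series_eq [of "cumulant n A b"] by (simp add: M_def y_def cumulant_def)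
qed

lemma F_nth_0: "F w $ 0 = (if w = [] then 1 else 0)"
  unfolding F_def
  by (rule word_series_nth_0) (simp_all add: M_def moment_series_nth_0 cumulant_def y0 N_def G_def)

text \<open>The expansion of the quadratic expression times a Wick word, with no, one or two
  contractions for each pair of letters. Scaling and values are parameters, so that one recursion
  serves operators, numbers and power series.\<close>

definition step :: "(real \<Rightarrow> 'v::ab_group_add \<Rightarrow> 'v) \<Rightarrow> (nat list \<Rightarrow> 'v) \<Rightarrow> nat list \<Rightarrow> 'v" where
  "step sm g w = sm b (g (0 # w) + (if w \<noteq> [] \<and> hd w = 0 then g (tl w) else 0)) +
     (\<Sum>i<n. \<Sum>j<n. sm (A i j) (g (Suc i # Suc j # w) +
       (if w \<noteq> [] \<and> hd w = Suc j then
          g (Suc i # tl w) + (if tl w \<noteq> [] \<and> hd (tl w) = Suc i then g (tl (tl w)) else 0) else 0)))"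

lemma quadratic_wick: "quadratic s n A b * wick s w = step scaleR (wick s) w"
proof -
  have "s (Suc i) * s (Suc j) * wick s w - (if i = j then 1 else 0) * wick s w =
      wick s (Suc i # Suc j # w) + (if w \<noteq> [] \<and> hd w = Suc j then
        wick s (Suc i # tl w) + (if tl w \<noteq> [] \<and> hd (tl w) = Suc i then wick s (tl (tl w)) else 0) else 0)" for i j
    by (simp add: mult.assoc distrib_left mult_wick del: wick.simps)
  then show ?thesis
    unfolding quadratic_def step_def
    by (simp add: distrib_right sum_distrib_right bop_algebra_simps left_diff_distrib mult_wick del: wick.simps)
qed

lemma step_cong:
  assumes "\<And>v. set v \<subseteq> {..n} \<Longrightarrow> g v = h v" "set w \<subseteq> {..n}"
  shows "step sm g w = step sm h w"
proof -
  have "set (tl v) \<subseteq> {..n}" if "set v \<subseteq> {..n}" for v :: "nat list"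
    using that by (cases v) auto
  then show ?thesis
    using assms(2) unfolding step_def by (auto simp: assms(1) intro!: arg_cong2 [where f = "(+)"] sum.cong)
qed

text \<open>\<open>F\<close> obeys the same recursion as the moments. After the uncontracted terms
  are summed by \<open>base\<close>, each shape of the word reduces to \<open>yQ\<close>, a
  rewriting of y = z M, and to the resolvent identity for \<open>N\<close>.\<close>

lemma F_step:
  assumes "set w \<subseteq> {..n}"
  shows "F w = (if w = [] then 1 else 0) + fps_X * step (\<lambda>r x. fps_const r * x) F w"
proof -
  define Q where "Q = fps_const (b\<^sup>2) * y + (\<Sum>i<n. \<Sum>j<n. fps_const (A i j) * N i j)"
  have M: "M = 1 + y * Q" unfolding Q_def by (rule M_eq)
  have F: "F [] = M" "F (0 # v) = fps_const b * y * F v" "F (Suc i # Suc j # v) = N i j * F v"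
    "F [Suc i] = 0" "F (Suc i # 0 # v) = 0" for i j v
    by (simp_all add: F_def)
  have bb: "fps_const b * fps_const b = fps_const (b\<^sup>2)"
    by (simp add: power2_eq_square fps_const_mult)
  \<comment> \<open>The uncontracted terms always add up to \<open>Q * F v\<close>; the shape of the
    word matters only for the contracted ones.\<close>
  have base: "fps_const b * F (0 # v) + (\<Sum>i<n. \<Sum>j<n. fps_const (A i j) * F (Suc i # Suc j # v)) = Q * F v" for v
  proof -
    have "fps_const b * F (0 # v) = fps_const (b\<^sup>2) * y * F v"
      unfolding F bb [symmetric] by (simp add: mult.assoc)
    then show ?thesis
      by (simp add: Q_def F distrib_right sum_distrib_right mult.assoc)
  qed
  have yX: "y = fps_X * M" by (simp add: y_def)
  have yQ: "y = fps_X * (1 + y * Q)" unfolding M [symmetric] by (rule yX)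
  consider "w = []" | v where "w = 0 # v" | i where "w = [Suc i]" | i v where "w = Suc i # 0 # v"
    | i j v where "w = Suc i # Suc j # v"
    by (cases "(N, y, M, w)" rule: word_series.cases) auto
  then show ?thesis
  proof cases
    case 1
    then have "step (\<lambda>r x. fps_const r * x) F w = Q * M"
      using base [of "[]"] by (simp add: step_def F(1))
    moreover have "y * Q = fps_X * (Q * M)"
      by (simp add: yX mult_ac)
    ultimately have "F w = 1 + fps_X * step (\<lambda>r x. fps_const r * x) F w"
      by (metis M 1 F(1))
    then show ?thesis by (simp only: 1 simp_thms if_True)
  next
    case (2 v)
    have "step (\<lambda>r x. fps_const r * x) F w = (fps_const b * F (0 # w)
        + (\<Sum>i<n. \<Sum>j<n. fps_const (A i j) * F (Suc i # Suc j # w))) + fps_const b * F v"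
      by (simp add: step_def 2 distrib_left)
    then have "step (\<lambda>r x. fps_const r * x) F w = Q * F w + fps_const b * F v"
      by (simp only: base)
    moreover have "F w = fps_const b * (fps_X * (1 + y * Q)) * F v"
      by (simp only: 2 F(2) yQ [symmetric])
    moreover have "\<dots> = fps_X * (Q * (fps_const b * y * F v) + fps_const b * F v)"
      by (simp add: algebra_simps)
    ultimately show ?thesis
      by (simp add: 2 F(2))
  next
    case (3 i)
    have "step (\<lambda>r x. fps_const r * x) F w = (fps_const b * F (0 # w)
        + (\<Sum>k<n. \<Sum>l<n. fps_const (A k l) * F (Suc k # Suc l # w)))"
      by (simp add: step_def 3 F(4) cong: if_cong)
    then show ?thesis
      unfolding base by (simp add: 3 F(4))
  next
    case (4 i v)
    have "step (\<lambda>r x. fps_const r * x) F w = (fps_const b * F (0 # w)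
        + (\<Sum>k<n. \<Sum>l<n. fps_const (A k l) * F (Suc k # Suc l # w)))"
      by (simp add: step_def 4 F(5) cong: if_cong)
    then show ?thesis
      unfolding base by (simp add: 4 F(5))
  next
    case (5 i j v)
    then have ij: "i < n" "j < n" using assms by auto
    define P where "P = (\<Sum>l<n. fps_const (A i l) * ((if l = j then 1 else 0) + N l j))"
    have NP: "N i j = y * P" unfolding P_def by (rule N_eq [OF ij(1)])
    have delta: "(\<Sum>l<n. f l * (if i = l then x else 0)) = f i * x" for f and x :: "real fps"
    proof -
      have "(\<Sum>l<n. f l * (if i = l then x else 0)) = (\<Sum>l<n. if l = i then f l * x else 0)"
        by (rule sum.cong) auto
      then show ?thesis using ij by simp
    qed
    have "(\<Sum>k<n. \<Sum>l<n. fps_const (A k l) * (if i = l then F (Suc k # Suc j # v) + (if j = k then F v else 0) else 0))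
        = (\<Sum>k<n. fps_const (A k i) * (F (Suc k # Suc j # v) + (if j = k then F v else 0)))"
      by (simp only: delta)
    also have "\<dots> = P * F v"
      unfolding P_def sum_distrib_right
      by (rule sum.cong) (auto simp: F sym ij distrib_left distrib_right mult.assoc)
    finally have *: "(\<Sum>k<n. \<Sum>l<n. fps_const (A k l) * (if i = l then F (Suc k # Suc j # v) + (if j = k then F v else 0) else 0))
        = P * F v" .
    have "step (\<lambda>r x. fps_const r * x) F w = (fps_const b * F (0 # w)
        + (\<Sum>k<n. \<Sum>l<n. fps_const (A k l) * F (Suc k # Suc l # w)))
        + (\<Sum>k<n. \<Sum>l<n. fps_const (A k l) * (if i = l then F (Suc k # Suc j # v) + (if j = k then F v else 0) else 0))"
      by (simp add: step_def 5 distrib_left sum.distrib cong: if_cong)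
    then have "step (\<lambda>r x. fps_const r * x) F w = Q * F w + P * F v"
      by (simp only: base *)
    moreover have "F w = fps_X * (1 + y * Q) * P * F v"
      by (simp only: 5 F(3) NP yQ [symmetric])
    moreover have "\<dots> = fps_X * (Q * (y * P * F v) + P * F v)"
      by (simp add: algebra_simps)
    ultimately show ?thesis
      by (simp add: 5 F(3) NP)
  qed
qed

text \<open>Absorbing one factor into the Wick word replaces it by \<open>step\<close>, which is
  also the recursion of \<open>F\<close>; both sides have the same values for exponent 0.\<close>

theorem moments_quadratic:
  assumes add: "\<And>x y. \<psi> (x + y) = \<psi> x + (\<psi> y :: complex)"
    and scale: "\<And>r x. \<psi> (r *\<^sub>R x) = complex_of_real r * \<psi> x"
    and wick: "\<And>w. \<psi> (wick s w) = (if w = [] then 1 else 0)"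
  shows "\<psi> (quadratic s n A b ^ k) = complex_of_real (moment_series (cumulant n A b) $ k)"
proof -
  have zero: "\<psi> 0 = 0" using scale [of 0 0] by simp
  have sum: "\<psi> (sum f I) = (\<Sum>i\<in>I. \<psi> (f i))" for f and I :: "nat set"
    using zero by (induction I rule: infinite_finite_induct) (simp_all add: add)
  have psi_if: "\<psi> (if P then x else 0) = (if P then \<psi> x else 0)" for P x
    using zero by simp
  have "\<psi> (quadratic s n A b ^ k * wick s w) = complex_of_real (F w $ k)" if "set w \<subseteq> {..n}" for w
    using that
  proof (induction k arbitrary: w)
    case 0
    then show ?case by (simp add: wick F_nth_0)
  next
    case (Suc k)
    let ?p = "quadratic s n A b ^ k"
    let ?g = "\<lambda>w. \<psi> (?p * wick s w)"
    have p_if: "?p * (if P then x else 0) = (if P then ?p * x else 0)" for P x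
      by simp
    have "\<psi> (quadratic s n A b ^ Suc k * wick s w) = \<psi> (?p * step scaleR (wick s) w)"
      by (simp only: power_Suc2 mult.assoc quadratic_wick)
    also have "\<dots> = step (\<lambda>r x. complex_of_real r * x) ?g w"
      by (simp add: step_def add sum scale psi_if p_if bop_algebra_simps distrib_left sum_distrib_left
          del: wick.simps cong: if_cong)
    also have "\<dots> = step (\<lambda>r x. complex_of_real r * x) (\<lambda>w. complex_of_real (F w $ k)) w"
      by (rule step_cong [OF _ Suc.prems]) (rule Suc.IH)
    also have "\<dots> = complex_of_real (step (*) (\<lambda>w. F w $ k) w)"
      by (simp add: step_def if_distrib [where f = complex_of_real] cong: if_cong)
    also have "step (*) (\<lambda>w. F w $ k) w = step (\<lambda>r x. fps_const r * x) F w $ k"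
      by (simp add: step_def fps_sum_nth if_distrib [where f = "\<lambda>x. x $ k"] cong: if_cong)
    also have "\<dots> = F w $ Suc k"
      using arg_cong [OF F_step [OF Suc.prems], of "\<lambda>x. x $ Suc k"] by simp
    finally show ?case .
  qed
  from this [of "[]"] show ?thesis
    by (simp add: F_def M_def)
qed

end

section \<open>Chebyshev polynomials and the semicircle law\<close>

text \<open>\<open>cheb x n\<close> is \<open>U\<^sub>n(x/2)\<close>; these polynomials are orthogonal for the semicircle law of variance 1.\<close>

fun cheb :: "'a::{ring, monoid_mult} \<Rightarrow> nat \<Rightarrow> 'a" where
  "cheb x 0 = 1"
| "cheb x (Suc 0) = x"
| "cheb x (Suc (Suc n)) = x * cheb x (Suc n) - cheb x n"

lemma wick_replicate: "wick s (replicate n i) = cheb (s i) n"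
  by (induction "s i" n rule: cheb.induct) simp_all

text \<open>The value on the \<open>n\<close>-th Chebyshev polynomial of a functional with moments \<open>m\<close>.\<close>

fun cheb_moment :: "nat \<Rightarrow> (nat \<Rightarrow> 'a::ab_group_add) \<Rightarrow> 'a" where
  "cheb_moment 0 m = m 0"
| "cheb_moment (Suc 0) m = m 1"
| "cheb_moment (Suc (Suc n)) m = cheb_moment (Suc n) (\<lambda>k. m (Suc k)) - cheb_moment n m"

lemma cheb_moment_cong: "(\<And>k. k \<le> n \<Longrightarrow> m k = m' k) \<Longrightarrow> cheb_moment n m = cheb_moment n m'"
proof (induction n m arbitrary: m' rule: cheb_moment.induct)
  case (3 n m)
  have "cheb_moment (Suc n) (\<lambda>k. m (Suc k)) = cheb_moment (Suc n) (\<lambda>k. m' (Suc k))"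
    by (rule 3(1)) (simp add: 3(3))
  moreover have "cheb_moment n m = cheb_moment n m'"
    by (rule 3(2)) (simp add: 3(3))
  ultimately show ?case by simp
qed simp_all

text \<open>The Chebyshev polynomials are monic, so once the lower moments agree only the leading
  one is seen.\<close>

lemma cheb_moment_diff:
  "(\<And>k. k < n \<Longrightarrow> m k = m' k) \<Longrightarrow> cheb_moment n m - cheb_moment n m' = m n - m' n"
proof (induction n m arbitrary: m' rule: cheb_moment.induct)
  case (3 n m)
  have "cheb_moment (Suc n) (\<lambda>k. m (Suc k)) - cheb_moment (Suc n) (\<lambda>k. m' (Suc k)) = m (Suc (Suc n)) - m' (Suc (Suc n))"
    by (rule 3(1)) (simp add: 3(3))
  moreover have "cheb_moment n m = cheb_moment n m'"
    by (rule cheb_moment_cong) (simp add: 3(3))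
  ultimately show ?case by simp
qed simp_all

lemma cheb_moment_unique:
  assumes "\<And>n. cheb_moment n m = cheb_moment n m'"
  shows "m n = m' n"
proof (induction n rule: less_induct)
  case (less n)
  have "cheb_moment n m - cheb_moment n m' = m n - m' n"
    by (rule cheb_moment_diff) (rule less)
  then show ?case using assms by simp
qed

lemma cheb_moment_of_real:
  "cheb_moment n (\<lambda>k. complex_of_real (m k)) = complex_of_real (cheb_moment n m)"
  by (induction n m rule: cheb_moment.induct) simp_all

text \<open>The extra factor \<open>x ^ j\<close> strengthens the induction, in which one occurrence
  of \<open>x\<close> is moved out of the polynomial and shifts the moments.\<close>

lemma cheb_moment_functional:
  fixes x :: "'a::{ring, monoid_mult}" and \<phi> :: "'a \<Rightarrow> 'b::ab_group_add"
  assumes diff: "\<And>u v. u \<in> X \<Longrightarrow> v \<in> X \<Longrightarrow> \<phi> (u - v) = \<phi> u - \<phi> v"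
    and X: "\<And>u v. u \<in> X \<Longrightarrow> v \<in> X \<Longrightarrow> u - v \<in> X" "\<And>u. u \<in> X \<Longrightarrow> x * u \<in> X" "1 \<in> X"
  shows "\<phi> (x ^ j * cheb x n) = cheb_moment n (\<lambda>k. \<phi> (x ^ (j + k)))"
proof (induction n arbitrary: j rule: induct_nat_012)
  case (ge2 n)
  have XX: "x ^ j * u \<in> X" if "u \<in> X" for j u
    using that by (induction j) (simp_all add: X mult.assoc)
  have "cheb x n \<in> X \<and> cheb x (Suc n) \<in> X" for n
  proof (induction n)
    case 0
    then show ?case using X(2) [OF X(3)] X(3) by simp
  next
    case (Suc n)
    then show ?case by (simp add: X)
  qed
  then have c: "cheb x n \<in> X" for n by blast
  have "\<phi> (x ^ j * cheb x (Suc (Suc n))) = \<phi> (x ^ Suc j * cheb x (Suc n) - x ^ j * cheb x n)"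
    by (simp add: right_diff_distrib mult.assoc power_Suc2 del: power_Suc)
  also have "\<dots> = \<phi> (x ^ Suc j * cheb x (Suc n)) - \<phi> (x ^ j * cheb x n)"
    by (intro diff XX c)
  finally show ?case
    using ge2(1) [of j] ge2(2) [of "Suc j"] by simp
qed (simp_all add: power_Suc2 del: power_Suc)

text \<open>The minus sign in -2 cos \<theta> makes the substitution increasing on [0, \<pi>], as is
  wanted when integrating; it costs the factor (-1)^n.\<close>

lemma cheb_cos: "cheb (- 2 * cos \<theta>) n * sin \<theta> = (- 1) ^ n * sin (real (Suc n) * \<theta>)"
proof (induction n rule: induct_nat_012)
  case 1
  show ?case using sin_double [of \<theta>] by (simp add: mult.commute)
next
  case (ge2 n)
  have "sin (real (Suc n) * \<theta>) + sin (real (Suc (Suc (Suc n))) * \<theta>) = 2 * sin (real (Suc (Suc n)) * \<theta>) * cos \<theta>"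
  proof -
    have "real (Suc n) * \<theta> = real (Suc (Suc n)) * \<theta> - \<theta>"
      "real (Suc (Suc (Suc n))) * \<theta> = real (Suc (Suc n)) * \<theta> + \<theta>"
      by (simp_all add: algebra_simps)
    then show ?thesis by (simp only: sin_add sin_diff)
  qed
  then have *: "sin (real (Suc (Suc (Suc n))) * \<theta>)
      = 2 * sin (real (Suc (Suc n)) * \<theta>) * cos \<theta> - sin (real (Suc n) * \<theta>)" by linarith
  have "cheb (- 2 * cos \<theta>) (Suc (Suc n)) * sin \<theta>
      = - 2 * cos \<theta> * (cheb (- 2 * cos \<theta>) (Suc n) * sin \<theta>) - cheb (- 2 * cos \<theta>) n * sin \<theta>"
    by (simp add: algebra_simps)
  also have "\<dots> = (- 1) ^ Suc (Suc n) * sin (real (Suc (Suc (Suc n))) * \<theta>)"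
    unfolding ge2 * by (simp add: algebra_simps)
  finally show ?case .
qed simp

lemma continuous_cheb: "continuous_on X (\<lambda>x. cheb (f x :: real) n)" if "continuous_on X f"
  by (induction n rule: induct_nat_012) (auto intro!: continuous_intros that)

definition semicircle_density :: "real \<Rightarrow> real \<Rightarrow> real" where
  "semicircle_density v x = sqrt (4 * v - x\<^sup>2) / (2 * pi * v)"

lemma
  assumes v: "0 < v" and f: "continuous_on UNIV (f :: real \<Rightarrow> real)"
  shows integrable_semicircle: "integrable (semicircle_law v) f"
    and integral_semicircle: "integral\<^sup>L (semicircle_law v) f =
      (LBINT x. (semicircle_density v x * f x) * indicator {- 2 * sqrt v .. 2 * sqrt v} x)"
proof -
  let ?I = "{- 2 * sqrt v .. 2 * sqrt v}"
  define g where "g x = indicator ?I x * semicircle_density v x" for x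
  have nn: "0 \<le> g x" for x
  proof (cases "x \<in> ?I")
    case True
    then have "\<bar>x\<bar> \<le> 2 * sqrt v" by auto
    then have "x\<^sup>2 \<le> (2 * sqrt v)\<^sup>2" by (metis abs_le_square_iff abs_of_nonneg abs_ge_zero order_trans)
    then have "x\<^sup>2 \<le> 4 * v" using v by (simp add: power_mult_distrib)
    then show ?thesis using v by (simp add: g_def semicircle_density_def)
  qed (simp add: g_def)
  have dens: "semicircle_law v = density lborel g"
    using v by (simp add: semicircle_law_def g_def semicircle_density_def)
  have [measurable]: "f \<in> borel_measurable borel"
    by (rule borel_measurable_continuous_onI [OF f])
  have [measurable]: "g \<in> borel_measurable borel"
    unfolding g_def semicircle_density_def by measurable
  have c: "continuous_on ?I (\<lambda>x. semicircle_density v x * f x)"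
    unfolding semicircle_density_def using v
    by (intro continuous_intros continuous_on_subset [OF f]) auto
  have "integrable lborel (\<lambda>x. g x *\<^sub>R f x)"
    using borel_integrable_atLeastAtMost' [OF c] by (simp add: set_integrable_def g_def mult_ac)
  then show "integrable (semicircle_law v) f"
    unfolding dens by (subst integrable_density) (auto simp: nn)
  have "integral\<^sup>L (semicircle_law v) f = (LBINT x. g x *\<^sub>R f x)"
    unfolding dens by (rule integral_density) (auto simp: nn)
  then show "integral\<^sup>L (semicircle_law v) f = (LBINT x. (semicircle_density v x * f x) * indicator ?I x)"
    by (simp add: g_def mult_ac)
qed

lemma integral_sin_sin:
  "(LBINT t. (sin (real (Suc n) * t) * sin t) * indicator {0..pi} t) = (if n = 0 then pi / 2 else 0)"
proof -
  define F where "F t = (if n = 0 then t / 2 - sin (2 * t) / 4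
      else sin (real n * t) / (2 * real n) - sin (real (n + 2) * t) / (2 * real (n + 2)))" for t
  have "(F has_vector_derivative sin (real (Suc n) * t) * sin t) (at t within {0..pi})" for t
  proof (cases "n = 0")
    case True
    have "((\<lambda>t. t / 2 - sin (2 * t) / 4) has_real_derivative (1 / 2 - cos (2 * t) * 2 / 4)) (at t)"
      by (auto intro!: derivative_eq_intros)
    moreover have "1 / 2 - cos (2 * t) * 2 / 4 = sin t * sin t"
      using cos_double_sin [of t] by (simp add: power2_eq_square field_simps)
    ultimately show ?thesis
      using True by (simp add: F_def [abs_def] has_real_derivative_iff_has_vector_derivative
        has_vector_derivative_at_within)
  next
    case False
    have "((\<lambda>t. sin (real n * t) / (2 * real n) - sin (real (n + 2) * t) / (2 * real (n + 2)))
        has_real_derivative (cos (real n * t) / 2 - cos (real (n + 2) * t) / 2)) (at t)"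
    proof -
      have "((\<lambda>t. sin (k * t) / (2 * k)) has_real_derivative cos (k * t) / 2) (at t)" if "k \<noteq> 0" for k
        using that by (auto intro!: derivative_eq_intros)
      from DERIV_diff [OF this [of "real n"] this [of "real (n + 2)"]] show ?thesis
        using False by simp
    qed
    moreover have "cos (real n * t) / 2 - cos (real (n + 2) * t) / 2 = sin (real (Suc n) * t) * sin t"
    proof -
      have "real n * t = real (Suc n) * t - t" "real (n + 2) * t = real (Suc n) * t + t"
        by (simp_all add: algebra_simps)
      then show ?thesis
        by (simp only: cos_add cos_diff diff_divide_distrib add_divide_distrib)
    qed
    ultimately show ?thesis
      using False by (simp add: F_def [abs_def] has_real_derivative_iff_has_vector_derivative
        has_vector_derivative_at_within)
  qed
  then have "(LBINT t. indicator {0..pi} t *\<^sub>R (sin (real (Suc n) * t) * sin t)) = F pi - F 0"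
    by (intro integral_FTC_atLeastAtMost) (auto intro!: continuous_intros)
  also have "F pi - F 0 = (if n = 0 then pi / 2 else 0)"
    using sin_npi [of n] sin_npi [of "n + 2"] by (simp add: F_def)
  finally show ?thesis by (simp add: mult.commute)
qed

text \<open>Under x = -2 sqrt v cos t the density contributes one factor sin t and the differential
  another. One of them turns the Chebyshev polynomial into a sine, and orthogonality of sines
  finishes.\<close>

theorem integral_cheb_semicircle:
  assumes v: "0 < v"
  shows "(\<integral>x. cheb (x / sqrt v) n \<partial>semicircle_law v) = (if n = 0 then 1 else 0)"
proof -
  define g where "g t = - 2 * sqrt v * cos t" for t
  define f where "f x = semicircle_density v x * cheb (x / sqrt v) n" for x
  have cont: "continuous_on X f" for X
    unfolding f_def semicircle_density_def using v by (intro continuous_intros continuous_cheb) auto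
  have "(\<integral>x. cheb (x / sqrt v) n \<partial>semicircle_law v) = (LBINT x. f x * indicator {- 2 * sqrt v .. 2 * sqrt v} x)"
    unfolding f_def by (rule integral_semicircle [OF v]) (use v in \<open>intro continuous_cheb continuous_intros; simp\<close>)
  also have "\<dots> = (LBINT x. f x * indicator {g 0..g pi} x)"
    by (simp add: g_def)
  also have "\<dots> = (LBINT t. f (g t) * (2 * sqrt v * sin t) * indicator {0..pi} t)"
  proof (rule integral_substitution(2))
    show "set_integrable lborel {g 0..g pi} f"
      by (rule borel_integrable_atLeastAtMost' [OF cont])
    show "(g has_real_derivative 2 * sqrt v * sin t) (at t)" for t
      unfolding g_def by (auto intro!: derivative_eq_intros)
  qed (use v in \<open>auto intro!: continuous_intros mult_nonneg_nonneg sin_ge_zero\<close>)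
  also have "\<dots> = (LBINT t. (2 / pi * (- 1) ^ n) * ((sin (real (Suc n) * t) * sin t) * indicator {0..pi} t))"
  proof (rule Bochner_Integration.integral_cong)
    fix t :: real
    show "f (g t) * (2 * sqrt v * sin t) * indicator {0..pi} t
        = (2 / pi * (- 1) ^ n) * ((sin (real (Suc n) * t) * sin t) * indicator {0..pi} t)"
    proof (cases "t \<in> {0..pi}")
      case True
      then have s: "0 \<le> sin t" by (auto intro: sin_ge_zero)
      have "4 * v - (g t)\<^sup>2 = 4 * v * (sin t)\<^sup>2"
        using v by (simp add: g_def power_mult_distrib sin_squared_eq algebra_simps)
      then have "sqrt (4 * v - (g t)\<^sup>2) = 2 * sqrt v * sin t"
        using v s by (simp add: real_sqrt_mult)
      moreover have "g t / sqrt v = - 2 * cos t" using v by (simp add: g_def)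
      ultimately have "f (g t) * (2 * sqrt v * sin t)
          = (2 * sqrt v * sin t) / (2 * pi * v) * (2 * sqrt v) * (cheb (- 2 * cos t) n * sin t)"
        by (simp add: f_def semicircle_density_def)
      also have "\<dots> = 2 / pi * sin t * ((- 1) ^ n * sin (real (Suc n) * t))"
        unfolding cheb_cos using v by (simp add: field_simps flip: power2_eq_square)
      finally show ?thesis using True by (simp add: mult_ac)
    qed simp
  qed simp
  also have "\<dots> = (2 / pi * (- 1) ^ n) * (if n = 0 then pi / 2 else 0)"
    by (simp only: Bochner_Integration.integral_mult_right_zero integral_sin_sin)
  finally show ?thesis by simp
qed

lemma cheb_moment_semicircle:
  assumes v: "0 < v"
  shows "cheb_moment n (\<lambda>k. \<integral>x. (x / sqrt v) ^ k \<partial>semicircle_law v) = (if n = 0 then 1 else 0)"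
proof -
  define X where "X = {f :: real \<Rightarrow> real. continuous_on UNIV f}"
  have "(\<integral>x. (x / sqrt v) ^ j * cheb (x / sqrt v) n \<partial>semicircle_law v)
      = cheb_moment n (\<lambda>k. \<integral>x. (x / sqrt v) ^ (j + k) \<partial>semicircle_law v)" for j
  proof (induction n arbitrary: j rule: induct_nat_012)
    case (ge2 n)
    have i: "integrable (semicircle_law v) (\<lambda>x. (x / sqrt v) ^ j * cheb (x / sqrt v) n)" for j n
      by (rule integrable_semicircle [OF v]) (use v in \<open>intro continuous_intros continuous_cheb; simp\<close>)
    have "(\<integral>x. (x / sqrt v) ^ j * cheb (x / sqrt v) (Suc (Suc n)) \<partial>semicircle_law v)
        = (\<integral>x. (x / sqrt v) ^ Suc j * cheb (x / sqrt v) (Suc n) - (x / sqrt v) ^ j * cheb (x / sqrt v) n \<partial>semicircle_law v)"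
      by (simp add: algebra_simps)
    also have "\<dots> = (\<integral>x. (x / sqrt v) ^ Suc j * cheb (x / sqrt v) (Suc n) \<partial>semicircle_law v)
        - (\<integral>x. (x / sqrt v) ^ j * cheb (x / sqrt v) n \<partial>semicircle_law v)"
      by (rule Bochner_Integration.integral_diff [OF i i])
    finally show ?case using ge2(1) [of j] ge2(2) [of "Suc j"] by simp
  qed (simp_all add: power_Suc2 del: power_Suc)
  from this [of 0] show ?thesis
    using integral_cheb_semicircle [OF v, of n] by simp
qed

context tracial_space
begin

lemma phi_diff: "a \<in> A \<Longrightarrow> b \<in> A \<Longrightarrow> \<phi> (a - b) = \<phi> a - \<phi> b"
  using phi_lin [of a b 1 "-1"] by (simp add: scaleC_one scaleC_minus_left)

lemma phi_scaleR: "a \<in> A \<Longrightarrow> \<phi> (r *\<^sub>R a) = complex_of_real r * \<phi> a"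
  using phi_scaleC [of a "complex_of_real r"] by (simp add: scaleC_of_real)

lemma phi_cheb: "s \<in> A \<Longrightarrow> \<phi> (cheb s n) = cheb_moment n (\<lambda>k. \<phi> (s ^ k))"
  using cheb_moment_functional [of A \<phi> s 0 n] by (simp add: phi_diff alg alg_diff)

lemma bop_power_scaleR: "(r *\<^sub>R (s :: 'h bop)) ^ k = r ^ k *\<^sub>R s ^ k"
  by (induction k) (simp_all add: bop_algebra_simps mult.commute)

lemma semicircle_moment_scale:
  assumes "0 < v"
  shows "(\<integral>x. (x / sqrt v) ^ k \<partial>semicircle_law v) = (\<integral>x. x ^ k \<partial>semicircle_law v) / sqrt v ^ k"
  by (simp add: power_divide)

lemma cheb_semicircular:
  assumes s: "s \<in> A" "has_semicircle_law \<phi> s v" and v: "0 < v"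
  shows "\<phi> (cheb ((1 / sqrt v) *\<^sub>R s) n) = (if n = 0 then 1 else 0)"
proof -
  have "\<phi> (((1 / sqrt v) *\<^sub>R s) ^ k) = complex_of_real (\<integral>x. (x / sqrt v) ^ k \<partial>semicircle_law v)" for k
  proof (cases "k = 0")
    case True
    then show ?thesis
      using integral_cheb_semicircle [OF v, of 0] by (simp add: phi_one)
  next
    case False
    then have "\<phi> (s ^ k) = complex_of_real (\<integral>x. x ^ k \<partial>semicircle_law v)"
      using s(2) by (simp add: has_semicircle_law_def)
    then show ?thesis
      unfolding semicircle_moment_scale [OF v]
      by (simp add: bop_power_scaleR phi_scaleR alg_power s power_one_over field_simps)
  qed
  then have "\<phi> (cheb ((1 / sqrt v) *\<^sub>R s) n)
      = cheb_moment n (\<lambda>k. complex_of_real (\<integral>x. (x / sqrt v) ^ k \<partial>semicircle_law v))"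
    by (simp add: phi_cheb alg_scaleR s)
  then show ?thesis
    unfolding cheb_moment_of_real cheb_moment_semicircle [OF v] by simp
qed

text \<open>Vanishing on all nonconstant Chebyshev polynomials fixes every moment, by
  \<open>cheb_moment_unique\<close>. The scale 0 is separate because it yields a Dirac mass.\<close>

lemma has_semicircle_law_cheb:
  assumes s: "s \<in> A" and cheb: "\<And>n. n \<ge> 1 \<Longrightarrow> \<phi> (cheb s n) = 0" and r: "0 \<le> r"
  shows "has_semicircle_law \<phi> (r *\<^sub>R s) (r\<^sup>2)"
proof (cases "r = 0")
  case True
  have "\<phi> 0 = 0" using phi_scaleC [OF alg(1), of 0] by (simp add: scaleC_zero_left)
  moreover have "(0 :: 'h bop) ^ m = 0" if "m \<ge> 1" for m using that by (cases m) simp_all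
  ultimately show ?thesis
    using True by (simp add: has_semicircle_law_def semicircle_law_def integral_return power_0_left)
next
  case False
  then have r2: "0 < r\<^sup>2" and sq: "sqrt (r\<^sup>2) = r" using r by simp_all
  have "cheb_moment n (\<lambda>k. \<phi> (s ^ k))
      = cheb_moment n (\<lambda>k. complex_of_real (\<integral>x. (x / r) ^ k \<partial>semicircle_law (r\<^sup>2)))" for n
    using cheb_moment_semicircle [OF r2, of n] cheb [of n]
    unfolding cheb_moment_of_real phi_cheb [OF s, symmetric] by (cases n) (auto simp: abs_of_nonneg [OF r] phi_one)
  then have "\<phi> (s ^ m) = complex_of_real (\<integral>x. (x / r) ^ m \<partial>semicircle_law (r\<^sup>2))" for m
    by (rule cheb_moment_unique)
  then show ?thesis
    using False semicircle_moment_scale [OF r2]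
    by (simp add: has_semicircle_law_def bop_power_scaleR phi_scaleR alg_power s abs_of_nonneg [OF r])
qed

end

section \<open>Limits of power sums of eigenvalues\<close>

lemma trace_mult_commute:
  fixes X Y :: "complex mat"
  assumes "X \<in> carrier_mat n n" "Y \<in> carrier_mat n n"
  shows "(\<Sum>i<n. (X * Y) $$ (i, i)) = (\<Sum>i<n. (Y * X) $$ (i, i))"
proof -
  have "(\<Sum>i<n. (X * Y) $$ (i, i)) = (\<Sum>i<n. \<Sum>k<n. X $$ (i, k) * Y $$ (k, i))"
    using assms by (auto simp: scalar_prod_def lessThan_atLeast0 intro!: sum.cong)
  also have "\<dots> = (\<Sum>k<n. \<Sum>i<n. Y $$ (k, i) * X $$ (i, k))"
    by (subst sum.swap) (simp add: mult.commute)
  also have "\<dots> = (\<Sum>i<n. (Y * X) $$ (i, i))"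
    using assms by (auto simp: scalar_prod_def lessThan_atLeast0 intro!: sum.cong)
  finally show ?thesis .
qed

lemma upper_triangular_pow:
  fixes B :: "complex mat"
  assumes B: "B \<in> carrier_mat n n" "upper_triangular B" and i: "i < n"
  shows "j < n \<Longrightarrow> j < i \<Longrightarrow> (B ^\<^sub>m k) $$ (i, j) = 0" "(B ^\<^sub>m k) $$ (i, i) = (B $$ (i, i)) ^ k"
proof -
  have ut: "B $$ (l, j) = 0" if "j < l" "l < n" for l j
    using B that by auto
  have e: "(B ^\<^sub>m Suc k) $$ (i, j) = (\<Sum>l<n. (B ^\<^sub>m k) $$ (i, l) * B $$ (l, j))" if "i < n" "j < n" for i j k
    using B that by (auto simp: scalar_prod_def lessThan_atLeast0 pow_carrier_mat [OF B(1)] intro!: sum.cong)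
  have z: "\<forall>i j. i < n \<and> j < i \<longrightarrow> (B ^\<^sub>m k) $$ (i, j) = 0" for k
  proof (induction k)
    case 0
    then show ?case using B by auto
  next
    case (Suc k)
    have "(B ^\<^sub>m k) $$ (i, l) * B $$ (l, j) = 0" if "i < n" "j < i" "l < n" for i j l
      using Suc ut [of j l] that by (cases "l < i") auto
    then show ?case by (auto simp: e simp del: pow_mat.simps intro!: sum.neutral)
  qed
  then show "j < n \<Longrightarrow> j < i \<Longrightarrow> (B ^\<^sub>m k) $$ (i, j) = 0" using i by blast
  show "(B ^\<^sub>m k) $$ (i, i) = (B $$ (i, i)) ^ k"
  proof (induction k)
    case 0
    then show ?case using B i by simp
  next
    case (Suc k)
    have "(B ^\<^sub>m k) $$ (i, l) * B $$ (l, i) = 0" if "l < n" "l \<noteq> i" for l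
      using z [of k] ut [of i l] that i by (cases "l < i") auto
    then have "(B ^\<^sub>m Suc k) $$ (i, i) = (\<Sum>l<n. if l = i then (B ^\<^sub>m k) $$ (i, i) * B $$ (i, i) else 0)"
      unfolding e [OF i i] by (intro sum.cong) auto
    also have "\<dots> = (B ^\<^sub>m k) $$ (i, i) * B $$ (i, i)" using i by simp
    finally show ?case by (simp add: Suc mult.commute)
  qed
qed

lemma eigenvalue_symmetric_real:
  fixes A :: "nat \<Rightarrow> nat \<Rightarrow> real"
  assumes sym: "\<And>i j. i < n \<Longrightarrow> j < n \<Longrightarrow> A i j = A j i"
    and ev: "eigenvalue (Matrix.mat n n (\<lambda>(i, j). complex_of_real (A i j))) c"
  shows "c \<in> \<real>"
proof -
  let ?C = "Matrix.mat n n (\<lambda>(i, j). complex_of_real (A i j))"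
  obtain v where v: "v \<in> carrier_vec n" "v \<noteq> 0\<^sub>v n" "?C *\<^sub>v v = c \<cdot>\<^sub>v v"
    using ev by (auto simp: eigenvalue_def eigenvector_def)
  have row: "(\<Sum>j<n. complex_of_real (A i j) * vec_index v j) = c * vec_index v i" if "i < n" for i
  proof -
    have "vec_index (?C *\<^sub>v v) i = (\<Sum>j<n. complex_of_real (A i j) * vec_index v j)"
      using that v(1) by (auto simp: scalar_prod_def lessThan_atLeast0 intro!: sum.cong)
    then show ?thesis using v that by simp
  qed
  define q where "q = (\<Sum>i<n. \<Sum>j<n. cnj (vec_index v i) * complex_of_real (A i j) * vec_index v j)"
  define r where "r = (\<Sum>i<n. (cmod (vec_index v i))\<^sup>2)"
  have "cnj q = (\<Sum>i<n. \<Sum>j<n. cnj (vec_index v j) * complex_of_real (A i j) * vec_index v i)"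
    by (simp add: q_def mult_ac)
  also have "\<dots> = (\<Sum>j<n. \<Sum>i<n. cnj (vec_index v j) * complex_of_real (A i j) * vec_index v i)"
    by (rule sum.swap)
  also have "\<dots> = q"
    unfolding q_def by (intro sum.cong) (auto simp: sym)
  finally have "cnj q = q" .
  moreover have "q = c * complex_of_real r"
  proof -
    have "q = (\<Sum>i<n. cnj (vec_index v i) * (\<Sum>j<n. complex_of_real (A i j) * vec_index v j))"
      by (simp add: q_def sum_distrib_left mult.assoc)
    also have "\<dots> = (\<Sum>i<n. c * complex_of_real ((cmod (vec_index v i))\<^sup>2))"
      unfolding complex_norm_square
      by (intro sum.cong refl) (simp only: row lessThan_iff, simp only: mult_ac)
    finally show ?thesis by (simp add: r_def sum_distrib_left)
  qed
  moreover have "r \<noteq> 0"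
  proof
    assume "r = 0"
    then have "vec_index v i = 0" if "i < n" for i
      using that by (simp add: r_def sum_nonneg_eq_0_iff)
    then have "v = 0\<^sub>v n" using v(1) by (intro eq_vecI) auto
    then show False using v(2) by simp
  qed
  ultimately have "cnj c = c" by simp
  then show ?thesis by (simp add: Reals_cnj_iff)
qed

lemma matpow_eq_pow_mat:
  fixes A :: "nat \<Rightarrow> nat \<Rightarrow> real" and n :: nat
  defines "C \<equiv> Matrix.mat n n (\<lambda>(i, j). complex_of_real (A i j))"
  shows "i < n \<Longrightarrow> j < n \<Longrightarrow> (C ^\<^sub>m k) $$ (i, j) = complex_of_real (matpow n A k i j)"
proof (induction k arbitrary: i j)
  case 0
  then show ?case by (simp add: C_def)
next
  case (Suc k)
  have C: "C \<in> carrier_mat n n" by (simp add: C_def)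
  have "C ^\<^sub>m Suc k = C * C ^\<^sub>m k"
  proof (induction k)
    case (Suc k)
    then show ?case
      using assoc_mult_mat [OF C pow_carrier_mat [OF C] C, of k] by simp
  qed (use C in simp)
  then have "(C ^\<^sub>m Suc k) $$ (i, j) = (\<Sum>l<n. C $$ (i, l) * (C ^\<^sub>m k) $$ (l, j))"
    using C Suc.prems pow_carrier_mat [OF C, of k]
    by (auto simp: scalar_prod_def lessThan_atLeast0 simp del: pow_mat.simps intro!: sum.cong)
  also have "\<dots> = complex_of_real (matpow n A (Suc k) i j)"
    using Suc by (simp add: C_def)
  finally show ?case .
qed

text \<open>A complex Schur form suffices: powers of a triangular matrix have the powers of its
  diagonal on the diagonal, and these diagonal entries are eigenvalues of the real symmetric matrix,
  hence real. Diagonalisation is avoided.\<close>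

theorem symmetric_eigenvalues:
  fixes A :: "nat \<Rightarrow> nat \<Rightarrow> real"
  assumes sym: "\<And>i j. i < n \<Longrightarrow> j < n \<Longrightarrow> A i j = A j i"
  shows "\<exists>l :: nat \<Rightarrow> real. \<forall>r. (\<Sum>i<n. matpow n A r i i) = (\<Sum>i<n. l i ^ r)"
proof -
  define C where "C = Matrix.mat n n (\<lambda>(i, j). complex_of_real (A i j))"
  have C: "C \<in> carrier_mat n n" by (simp add: C_def)
  obtain es where es: "char_poly C = (\<Prod>a\<leftarrow>es. [:- a, 1:])"
    using char_poly_factorized [OF C] by blast
  obtain B where B: "B \<in> carrier_mat n n" "upper_triangular B" "similar_mat C B"
    using schur_decomposition_exists [OF C es] by blast
  obtain P Q where PQ: "similar_mat_wit C B P Q"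
    using B(3) by (auto simp: similar_mat_def)
  define l where "l i = Re (B $$ (i, i))" for i
  have l: "B $$ (i, i) = complex_of_real (l i)" if "i < n" for i
  proof -
    have "poly (char_poly B) (B $$ (i, i)) = 0"
    proof -
      have "B $$ (i, i) \<in> set (diag_mat B)"
        using that B(1) by (auto simp: diag_mat_def)
      then show ?thesis
        unfolding char_poly_upper_triangular [OF B(1,2)]
        by (auto simp: poly_prod_list prod_list_zero_iff o_def intro!: image_eqI [where x = "B $$ (i, i)"])
    qed
    then have ev: "eigenvalue C (B $$ (i, i))"
      using eigenvalue_root_char_poly [OF C] char_poly_similar [OF B(3)] by simp
    have "B $$ (i, i) \<in> \<real>"
      by (rule eigenvalue_symmetric_real [OF sym ev [unfolded C_def]])
    then show ?thesis by (simp add: l_def)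
  qed
  have "(\<Sum>i<n. matpow n A r i i) = (\<Sum>i<n. l i ^ r)" for r
  proof -
    have wit: "similar_mat_wit (C ^\<^sub>m r) (B ^\<^sub>m r) P Q"
      by (rule similar_mat_wit_pow [OF PQ])
    note D = similar_mat_witD2 [OF pow_carrier_mat [OF C] wit]
    have "complex_of_real (\<Sum>i<n. matpow n A r i i) = (\<Sum>i<n. (C ^\<^sub>m r) $$ (i, i))"
      using matpow_eq_pow_mat [of _ n _ A r] by (simp add: C_def)
    also have "\<dots> = (\<Sum>i<n. (P * (B ^\<^sub>m r * Q)) $$ (i, i))"
      using D by (simp add: assoc_mult_mat [OF D(6) D(5) D(7)])
    also have "\<dots> = (\<Sum>i<n. (B ^\<^sub>m r * Q * P) $$ (i, i))"
      by (rule trace_mult_commute) (use D in auto)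
    also have "B ^\<^sub>m r * Q * P = B ^\<^sub>m r"
      using D(2) right_mult_one_mat [OF D(5)] by (simp add: assoc_mult_mat [OF D(5) D(7) D(6)])
    also have "(\<Sum>i<n. (B ^\<^sub>m r) $$ (i, i)) = (\<Sum>i<n. complex_of_real (l i ^ r))"
      by (intro sum.cong) (auto simp: upper_triangular_pow(2) [OF B(1,2)] l)
    finally show ?thesis by (metis of_real_eq_iff of_real_sum)
  qed
  then show ?thesis by blast
qed

text \<open>Decreasing modulus turns a bound on the sum of squares into a decay rate for each entry;
  padding with zeros gives all matrices, whatever their size, sequences over the same index
  set.\<close>

lemma sort_by_modulus:
  fixes l :: "nat \<Rightarrow> real"
  shows "\<exists>v :: nat \<Rightarrow> real. (\<forall>i j. i \<le> j \<longrightarrow> \<bar>v j\<bar> \<le> \<bar>v i\<bar>) \<and> (\<forall>j\<ge>N. v j = 0) \<and>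
    (\<forall>r. (\<Sum>i<N. v i ^ r) = (\<Sum>i<N. l i ^ r))"
proof -
  define ys where "ys = sort_key (\<lambda>x. - \<bar>x\<bar>) (map l [0..<N])"
  define v where "v j = (if j < N then ys ! j else 0)" for j
  have len: "length ys = N" by (simp add: ys_def)
  have srt: "sorted (map (\<lambda>x. - \<bar>x\<bar>) ys)" by (simp add: ys_def)
  have "\<bar>v j\<bar> \<le> \<bar>v i\<bar>" if "i \<le> j" for i j
  proof (cases "j < N")
    case True
    then show ?thesis
      using sorted_nth_mono [OF srt that] that len by (simp add: v_def)
  qed (simp add: v_def)
  moreover have "(\<Sum>i<N. v i ^ r) = (\<Sum>i<N. l i ^ r)" for r
  proof -
    have "(\<Sum>i<N. v i ^ r) = sum_list (map (\<lambda>x. x ^ r) ys)"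
      by (simp add: v_def sum_list_sum_nth len lessThan_atLeast0)
    also have "\<dots> = sum_mset (image_mset (\<lambda>x. x ^ r) (mset ys))"
      by (simp flip: sum_mset_sum_list)
    also have "mset ys = mset (map l [0..<N])" by (simp add: ys_def)
    also have "sum_mset (image_mset (\<lambda>x. x ^ r) (mset (map l [0..<N]))) = sum_list (map (\<lambda>x. x ^ r) (map l [0..<N]))"
      by (metis mset_map sum_mset_sum_list)
    also have "\<dots> = (\<Sum>i<N. l i ^ r)"
      by (simp add: sum_list_sum_nth lessThan_atLeast0)
    finally show ?thesis .
  qed
  ultimately show ?thesis by (intro exI [of _ v]) (auto simp: v_def)
qed

text \<open>
  In the limit of the power sums, the mass of many small eigenvalues can only survive in the
  second power; it becomes the semicircular part.
\<close>

theorem power_sums_limit: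
  fixes l :: "nat \<Rightarrow> nat \<Rightarrow> real"
  assumes lim: "\<And>r. r \<ge> 2 \<Longrightarrow> (\<lambda>n. \<Sum>i<N n. l n i ^ r) \<longlonglongrightarrow> \<kappa> r"
  shows "\<exists>c (\<mu> :: nat \<Rightarrow> real). (\<lambda>i. (\<mu> i)\<^sup>2) sums (\<kappa> 2 - c\<^sup>2) \<and> (\<forall>r\<ge>3. (\<lambda>i. \<mu> i ^ r) sums \<kappa> r)"
proof -
  have "\<exists>v. \<forall>n. (\<forall>i j. i \<le> j \<longrightarrow> \<bar>v n j\<bar> \<le> \<bar>v n i\<bar>) \<and> (\<forall>j\<ge>N n. v n j = 0) \<and>
      (\<forall>r. (\<Sum>i<N n. v n i ^ r) = (\<Sum>i<N n. l n i ^ r))"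
    by (rule choice) (use sort_by_modulus in blast)
  then obtain v :: "nat \<Rightarrow> nat \<Rightarrow> real" where mono: "\<And>n i j. i \<le> j \<Longrightarrow> \<bar>v n j\<bar> \<le> \<bar>v n i\<bar>"
    and zero: "\<And>n j. j \<ge> N n \<Longrightarrow> v n j = 0"
    and pow: "\<And>n r. (\<Sum>i<N n. v n i ^ r) = (\<Sum>i<N n. l n i ^ r)" by blast
  have sums: "(\<lambda>i. v n i ^ r) sums (\<Sum>i<N n. l n i ^ r)" if "r \<ge> 2" for n r
    unfolding pow [symmetric] by (rule sums_finite) (use zero that in auto)
  obtain C where C: "\<And>n. (\<Sum>i<N n. (l n i)\<^sup>2) \<le> C"
    using convergent_imp_Bseq [OF convergentI [OF lim [of 2]]] unfolding Bseq_def by (auto simp: abs_le_iff)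
  have part: "(\<Sum>i<J. (v n i)\<^sup>2) \<le> C" for n J
  proof -
    have "(\<Sum>i<J. (v n i)\<^sup>2) \<le> suminf (\<lambda>i. (v n i)\<^sup>2)"
      using sums [of 2 n] by (intro sum_le_suminf) (auto dest: sums_summable)
    also have "\<dots> = (\<Sum>i<N n. (l n i)\<^sup>2)"
      using sums [of 2 n] by (simp add: sums_iff)
    finally show ?thesis using C [of n] by simp
  qed
  have C0: "0 \<le> C" using part [of 0 0] by simp
  \<comment> \<open>The first j + 1 squares are all at least that of entry j and add up to at most
    \<open>C\<close>.\<close>
  have bd: "\<bar>v n j\<bar> \<le> sqrt (C / real (Suc j))" for n j
  proof -
    have "real (Suc j) * (v n j)\<^sup>2 = (\<Sum>i<Suc j. (v n j)\<^sup>2)" by simp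
    also have "\<dots> \<le> (\<Sum>i<Suc j. (v n i)\<^sup>2)"
    proof (rule sum_mono)
      fix i assume "i \<in> {..<Suc j}"
      then have "\<bar>v n j\<bar> \<le> \<bar>v n i\<bar>" by (intro mono) simp
      then show "(v n j)\<^sup>2 \<le> (v n i)\<^sup>2" by (simp add: abs_le_square_iff)
    qed
    also have "\<dots> \<le> C" by (rule part)
    finally have "(v n j)\<^sup>2 \<le> C / real (Suc j)" by (simp add: field_simps)
    then show ?thesis by (metis real_sqrt_abs real_sqrt_le_mono)
  qed
  \<comment> \<open>Diagonal argument: every coordinate is bounded in \<open>n\<close>, so one
    subsequence makes all of them converge.\<close>
  interpret subseqs "\<lambda>j s. convergent (\<lambda>n. v (s n) j)"
  proof
    fix j and s :: "nat \<Rightarrow> nat"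
    have "\<forall>n. v (s n) j \<in> {- sqrt (C / real (Suc j))..sqrt (C / real (Suc j))}"
      using bd by (auto simp: abs_le_iff minus_le_iff)
    then obtain x and r :: "nat \<Rightarrow> nat" where "strict_mono r" "((\<lambda>n. v (s n) j) \<circ> r) \<longlonglongrightarrow> x"
      using compact_Icc [unfolded compact_def, rule_format, of "\<lambda>n. v (s n) j"] by blast
    then show "\<exists>r'. strict_mono r' \<and> convergent (\<lambda>n. v ((s \<circ> r') n) j)"
      by (auto simp: o_def intro: convergentI)
  qed
  define s where "s = diagseq"
  have s: "strict_mono s" unfolding s_def by (rule subseq_diagseq)
  have "convergent (\<lambda>n. v (s n) j)" for j
  proof -
    have "convergent (\<lambda>n. v ((diagseq \<circ> ((+) (Suc j))) n) j)"
    proof (rule diagseq_holds)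
      fix r t :: "nat \<Rightarrow> nat" and n assume "strict_mono r" "convergent (\<lambda>k. v (t k) n)"
      then show "convergent (\<lambda>k. v ((t \<circ> r) k) n)"
        using convergent_subseq_convergent [of "\<lambda>k. v (t k) n" r] by (simp add: o_def)
    qed
    then have "convergent (\<lambda>n. v (s (n + Suc j)) j)"
      by (simp add: s_def o_def add.commute)
    then show ?thesis
      by (rule convergent_ignore_initial_segment [THEN iffD1])
  qed
  then obtain \<mu> where \<mu>: "\<And>j. (\<lambda>n. v (s n) j) \<longlonglongrightarrow> \<mu> j"
    unfolding convergent_def by metis
  have lims: "(\<lambda>n. \<Sum>i<N (s n). l (s n) i ^ r) \<longlonglongrightarrow> \<kappa> r" if "r \<ge> 2" for r
    using LIMSEQ_subseq_LIMSEQ [OF lim [OF that] s] by (simp add: o_def)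
  have part2: "(\<Sum>i<J. (\<mu> i)\<^sup>2) \<le> \<kappa> 2" for J
  proof (rule LIMSEQ_le)
    show "(\<lambda>n. \<Sum>i<J. (v (s n) i)\<^sup>2) \<longlonglongrightarrow> (\<Sum>i<J. (\<mu> i)\<^sup>2)"
      by (intro tendsto_sum tendsto_power \<mu>)
    show "(\<lambda>n. \<Sum>i<N (s n). (l (s n) i)\<^sup>2) \<longlonglongrightarrow> \<kappa> 2" by (rule lims) simp
    have "(\<Sum>i<J. (v (s n) i)\<^sup>2) \<le> (\<Sum>i<N (s n). (l (s n) i)\<^sup>2)" for n
      using sums [of 2 "s n"] sum_le_suminf [of "\<lambda>i. (v (s n) i)\<^sup>2" "{..<J}"] by (simp add: sums_iff)
    then show "\<exists>M. \<forall>n\<ge>M. (\<Sum>i<J. (v (s n) i)\<^sup>2) \<le> (\<Sum>i<N (s n). (l (s n) i)\<^sup>2)" by blast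
  qed
  have summ2: "summable (\<lambda>i. (\<mu> i)\<^sup>2)"
    by (rule summableI_nonneg_bounded [OF _ part2]) simp
  have le2: "suminf (\<lambda>i. (\<mu> i)\<^sup>2) \<le> \<kappa> 2"
    by (rule suminf_le_const [OF summ2 part2])
  \<comment> \<open>For squares only the inequality \<open>part2\<close> survives the limit; the gap
    is the variance of the semicircular part.\<close>
  define c where "c = sqrt (\<kappa> 2 - suminf (\<lambda>i. (\<mu> i)\<^sup>2))"
  have c: "c\<^sup>2 = \<kappa> 2 - suminf (\<lambda>i. (\<mu> i)\<^sup>2)"
    using le2 by (simp add: c_def)
  have two: "(\<lambda>i. (\<mu> i)\<^sup>2) sums (\<kappa> 2 - c\<^sup>2)"
    using summ2 by (simp add: c sums_iff)
  have three: "(\<lambda>i. \<mu> i ^ r) sums \<kappa> r" if r: "r \<ge> 3" for r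
  proof -
    \<comment> \<open>Three of the \<open>r\<close> factors are bounded by \<open>bd\<close> and
      decay like (i + 1)^(-3/2), which is summable; the other r - 3 are at most
      \<open>sqrt C\<close>. With two factors the majorant would be the harmonic series, which is
      why the second power sum may lose mass.\<close>
    define h where "h i = sqrt C ^ (r - 3) * (sqrt (C / real (Suc i))) ^ 3" for i
    have hb: "norm (v n i ^ r) \<le> h i" for n i
    proof -
      have "\<bar>v n i\<bar> \<le> sqrt C"
        by (rule order_trans [OF bd]) (use C0 in \<open>simp add: divide_le_eq mult_le_cancel_left1\<close>)
      then have "\<bar>v n i\<bar> ^ (r - 3) * \<bar>v n i\<bar> ^ 3 \<le> h i"
        unfolding h_def using C0 by (intro mult_mono power_mono bd) auto
      moreover have "\<bar>v n i\<bar> ^ (r - 3) * \<bar>v n i\<bar> ^ 3 = \<bar>v n i\<bar> ^ r"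
        using r by (simp flip: power_add)
      ultimately show ?thesis by (simp add: power_abs)
    qed
    have "summable h"
    proof -
      have "sqrt (C / real (Suc i)) ^ 3 = sqrt C ^ 3 * real (Suc i) powr (- 3 / 2)" for i
      proof -
        have "sqrt (real (Suc i)) ^ 3 = real (Suc i) powr (3 / 2)"
          by (simp add: powr_half_sqrt [symmetric] powr_power)
        then show ?thesis
          by (simp add: real_sqrt_divide power_divide powr_minus_divide)
      qed
      moreover have "summable (\<lambda>i. real (Suc i) powr (- 3 / 2))"
        using summable_real_powr_iff [of "- 3 / 2"] summable_Suc_iff [of "\<lambda>i. real i powr (- 3 / 2)"] by simp
      ultimately show ?thesis
        unfolding h_def by (intro summable_mult) simp
    qed
    have tan: "(\<lambda>n. suminf (\<lambda>i. v (s n) i ^ r)) \<longlonglongrightarrow> suminf (\<lambda>i. \<mu> i ^ r)" "summable (\<lambda>i. \<mu> i ^ r)"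
    proof -
      have ev: "\<forall>\<^sub>F (k, n) in sequentially \<times>\<^sub>F sequentially. norm (v (s n) k ^ r) \<le> h k"
        by (rule always_eventually) (use hb in auto)
      have "(\<lambda>n. v (s n) k ^ r) \<longlonglongrightarrow> \<mu> k ^ r" for k
        by (intro tendsto_power \<mu>)
      from tannerys_theorem [OF this ev \<open>summable h\<close>]
      show "(\<lambda>n. suminf (\<lambda>i. v (s n) i ^ r)) \<longlonglongrightarrow> suminf (\<lambda>i. \<mu> i ^ r)" "summable (\<lambda>i. \<mu> i ^ r)"
        using summable_norm_cancel [of "\<lambda>i. \<mu> i ^ r"] by simp_all
    qed
    have "suminf (\<lambda>i. v n i ^ r) = (\<Sum>i<N n. l n i ^ r)" for n
      using sums [of r n] r by (simp add: sums_iff)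
    then have "(\<lambda>n. \<Sum>i<N (s n). l (s n) i ^ r) \<longlonglongrightarrow> suminf (\<lambda>i. \<mu> i ^ r)"
      using tan by simp
    then have "suminf (\<lambda>i. \<mu> i ^ r) = \<kappa> r"
      using LIMSEQ_unique [OF lims [of r]] r by simp
    then show ?thesis using tan by (simp add: sums_iff)
  qed
  show ?thesis using two three by blast
qed

section \<open>Density of step functions\<close>

lemma L2_measurable: "f \<in> L2 M \<Longrightarrow> f \<in> borel_measurable M"
  and L2_integrable: "f \<in> L2 M \<Longrightarrow> integrable M (\<lambda>x. (f x)\<^sup>2)"
  by (simp_all add: L2_def)

lemma L2_bounded:
  assumes "f \<in> borel_measurable M" "w \<in> L2 M" "\<And>x. x \<in> space M \<Longrightarrow> \<bar>f x\<bar> \<le> \<bar>w x\<bar>"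
  shows "f \<in> L2 M"
proof -
  have "integrable M (\<lambda>x. (f x)\<^sup>2)"
    by (rule Bochner_Integration.integrable_bound [OF L2_integrable [OF assms(2)]])
      (use assms in \<open>auto intro!: AE_I2 simp: abs_le_square_iff\<close>)
  then show ?thesis using assms(1) by (simp add: L2_def)
qed

lemma square_add_le: "(a + b)\<^sup>2 \<le> 2 * a\<^sup>2 + 2 * (b :: real)\<^sup>2"
  using sum_squares_bound [of a b] by (simp add: power2_sum)

lemma L2_scale: "f \<in> L2 M \<Longrightarrow> (\<lambda>x. c * f x) \<in> L2 M"
  by (auto simp: L2_def power_mult_distrib)

lemma L2_add:
  assumes "f \<in> L2 M" "g \<in> L2 M"
  shows "(\<lambda>x. f x + g x) \<in> L2 M"
proof -
  have "integrable M (\<lambda>x. (f x + g x)\<^sup>2)"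
  proof (rule Bochner_Integration.integrable_bound)
    show "integrable M (\<lambda>x. 2 * (f x)\<^sup>2 + 2 * (g x)\<^sup>2)"
      using assms by (auto simp: L2_def)
    show "AE x in M. norm ((f x + g x)\<^sup>2) \<le> norm (2 * (f x)\<^sup>2 + 2 * (g x)\<^sup>2)"
      using square_add_le by (intro AE_I2) simp
  qed (use assms in \<open>auto simp: L2_def\<close>)
  then show ?thesis using assms by (auto simp: L2_def)
qed

lemma L2_lincomb: "f \<in> L2 M \<Longrightarrow> g \<in> L2 M \<Longrightarrow> (\<lambda>x. c * f x + d * g x) \<in> L2 M"
  by (intro L2_add L2_scale)

lemma L2_diff: "f \<in> L2 M \<Longrightarrow> g \<in> L2 M \<Longrightarrow> (\<lambda>x. f x - g x) \<in> L2 M"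
  using L2_lincomb [of f M g 1 "-1"] by simp

lemma L2_integral_add_le:
  assumes "f \<in> L2 M" "g \<in> L2 M"
  shows "(\<integral>x. (f x + g x)\<^sup>2 \<partial>M) \<le> 2 * (\<integral>x. (f x)\<^sup>2 \<partial>M) + 2 * (\<integral>x. (g x)\<^sup>2 \<partial>M)"
proof -
  have "(\<integral>x. (f x + g x)\<^sup>2 \<partial>M) \<le> (\<integral>x. 2 * (f x)\<^sup>2 + 2 * (g x)\<^sup>2 \<partial>M)"
    by (rule integral_mono) (use L2_add [OF assms] assms square_add_le in \<open>auto simp: L2_def\<close>)
  then show ?thesis using assms by (simp add: L2_def)
qed

lemma L2_dominated_convergence:
  assumes F: "\<And>n. F n \<in> borel_measurable M" and f: "f \<in> borel_measurable M" and w: "w \<in> L2 M"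
    and le: "\<And>n x. x \<in> space M \<Longrightarrow> \<bar>F n x\<bar> \<le> \<bar>w x\<bar>"
    and lim: "\<And>x. x \<in> space M \<Longrightarrow> (\<lambda>n. F n x) \<longlonglongrightarrow> f x"
  shows "f \<in> L2 M" "(\<lambda>n. \<integral>x. (f x - F n x)\<^sup>2 \<partial>M) \<longlonglongrightarrow> 0"
proof -
  have f_le: "\<bar>f x\<bar> \<le> \<bar>w x\<bar>" if "x \<in> space M" for x
    by (rule LIMSEQ_le_const2 [OF tendsto_rabs [OF lim [OF that]]]) (use le that in auto)
  show "f \<in> L2 M" by (rule L2_bounded [OF f w f_le])
  have "(\<lambda>n. \<integral>x. (f x - F n x)\<^sup>2 \<partial>M) \<longlonglongrightarrow> (\<integral>x. 0 \<partial>M)"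
  proof (rule integral_dominated_convergence)
    show "integrable M (\<lambda>x. 4 * (w x)\<^sup>2)" using w by (simp add: L2_def)
    show "AE x in M. (\<lambda>n. (f x - F n x)\<^sup>2) \<longlonglongrightarrow> 0"
    proof (rule AE_I2)
      fix x assume "x \<in> space M"
      from tendsto_power [OF tendsto_diff [OF tendsto_const lim [OF this]], of "f x" 2]
      show "(\<lambda>n. (f x - F n x)\<^sup>2) \<longlonglongrightarrow> 0" by simp
    qed
    show "AE x in M. norm ((f x - F n x)\<^sup>2) \<le> 4 * (w x)\<^sup>2" for n
    proof (rule AE_I2)
      fix x assume x: "x \<in> space M"
      have "\<bar>f x - F n x\<bar> \<le> \<bar>2 * w x\<bar>" using f_le [OF x] le [OF x, of n] by linarith
      then have "(f x - F n x)\<^sup>2 \<le> (2 * w x)\<^sup>2" by (simp add: abs_le_square_iff)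
      then show "norm ((f x - F n x)\<^sup>2) \<le> 4 * (w x)\<^sup>2" by (simp add: power_mult_distrib)
    qed
  qed (use F f in auto)
  then show "(\<lambda>n. \<integral>x. (f x - F n x)\<^sup>2 \<partial>M) \<longlonglongrightarrow> 0" by simp
qed

lemma indicator_square: "(indicat_real A x)\<^sup>2 = indicat_real A x"
  by (simp add: indicator_def)

lemma L2_indicator: "A \<in> sets M \<Longrightarrow> emeasure M A < \<infinity> \<Longrightarrow> indicat_real A \<in> L2 M"
  by (simp add: L2_def indicator_square integrable_indicator_iff sets.Int_space_eq2)

section \<open>Approximation in L2 by a linear class of functions\<close>

locale L2_approximation =
  fixes M :: "'x measure" and D :: "('x \<Rightarrow> real) set"
  assumes D_L2: "g \<in> D \<Longrightarrow> g \<in> L2 M"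
    and D_lincomb: "g \<in> D \<Longrightarrow> k \<in> D \<Longrightarrow> (\<lambda>x. c * g x + d * k x) \<in> D"
    and D_zero: "(\<lambda>x. 0) \<in> D"
begin

definition approx :: "('x \<Rightarrow> real) \<Rightarrow> bool" where
  "approx f \<longleftrightarrow> f \<in> L2 M \<and> (\<forall>e>0. \<exists>g\<in>D. (\<integral>x. (f x - g x)\<^sup>2 \<partial>M) < e)"

lemma approx_D: "g \<in> D \<Longrightarrow> approx g"
  unfolding approx_def using D_L2 by (auto intro!: bexI [of _ g])

lemma approx_limit:
  assumes "f \<in> L2 M" "\<And>e. e > 0 \<Longrightarrow> \<exists>g. approx g \<and> (\<integral>x. (f x - g x)\<^sup>2 \<partial>M) < e"
  shows "approx f"
  unfolding approx_def
proof (intro conjI allI impI)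
  fix e :: real assume "0 < e"
  then have e4: "0 < e / 4" by simp
  obtain g where g: "approx g" "(\<integral>x. (f x - g x)\<^sup>2 \<partial>M) < e / 4"
    using assms(2) [OF e4] by blast
  obtain k where k: "k \<in> D" "(\<integral>x. (g x - k x)\<^sup>2 \<partial>M) < e / 4"
    using g(1) e4 unfolding approx_def by blast
  have "(\<integral>x. (f x - k x)\<^sup>2 \<partial>M) = (\<integral>x. ((f x - g x) + (g x - k x))\<^sup>2 \<partial>M)" by simp
  also have "\<dots> \<le> 2 * (\<integral>x. (f x - g x)\<^sup>2 \<partial>M) + 2 * (\<integral>x. (g x - k x)\<^sup>2 \<partial>M)"
    by (rule L2_integral_add_le; rule L2_diff) (use g(1) D_L2 [OF k(1)] assms(1) in \<open>auto simp: approx_def\<close>)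
  also have "\<dots> < e" using g(2) k(2) by simp
  finally show "\<exists>g\<in>D. (\<integral>x. (f x - g x)\<^sup>2 \<partial>M) < e" using k(1) by blast
qed (rule assms)

lemma approx_scale:
  assumes "approx f"
  shows "approx (\<lambda>x. c * f x)"
  unfolding approx_def
proof (intro conjI allI impI)
  show "(\<lambda>x. c * f x) \<in> L2 M" using assms by (simp add: approx_def L2_scale)
  fix e :: real assume "0 < e"
  then have "0 < e / (c\<^sup>2 + 1)" by (simp add: add_nonneg_pos)
  then obtain g where g: "g \<in> D" "(\<integral>x. (f x - g x)\<^sup>2 \<partial>M) < e / (c\<^sup>2 + 1)"
    using assms unfolding approx_def by blast
  have "(\<integral>x. (c * f x - c * g x)\<^sup>2 \<partial>M) = c\<^sup>2 * (\<integral>x. (f x - g x)\<^sup>2 \<partial>M)"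
    by (simp add: power_mult_distrib flip: right_diff_distrib)
  also have "\<dots> \<le> (c\<^sup>2 + 1) * (\<integral>x. (f x - g x)\<^sup>2 \<partial>M)"
    by (intro mult_right_mono) auto
  also have "\<dots> < (c\<^sup>2 + 1) * (e / (c\<^sup>2 + 1))"
    using g(2) by (intro mult_strict_left_mono) (auto simp: add_nonneg_pos)
  also have "\<dots> = e"
  proof -
    have "0 < c\<^sup>2 + 1" by (rule add_nonneg_pos) simp_all
    then show ?thesis by simp
  qed
  finally have "(\<integral>x. (c * f x - c * g x)\<^sup>2 \<partial>M) < e" .
  moreover have "(\<lambda>x. c * g x) \<in> D"
    using D_lincomb [OF g(1) D_zero, of c 0] by simp
  ultimately show "\<exists>g\<in>D. (\<integral>x. (c * f x - g x)\<^sup>2 \<partial>M) < e"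
    by (intro bexI [of _ "\<lambda>x. c * g x"])
qed

lemma approx_add:
  assumes f: "approx f" and g: "approx g"
  shows "approx (\<lambda>x. f x + g x)"
  unfolding approx_def
proof (intro conjI allI impI)
  show "(\<lambda>x. f x + g x) \<in> L2 M" using assms by (simp add: approx_def L2_add)
  fix e :: real assume "0 < e"
  then have "0 < e / 4" by simp
  then obtain h k where h: "h \<in> D" "(\<integral>x. (f x - h x)\<^sup>2 \<partial>M) < e / 4"
    and k: "k \<in> D" "(\<integral>x. (g x - k x)\<^sup>2 \<partial>M) < e / 4"
    using f g unfolding approx_def by blast
  have "(\<integral>x. (f x + g x - (h x + k x))\<^sup>2 \<partial>M) = (\<integral>x. ((f x - h x) + (g x - k x))\<^sup>2 \<partial>M)"
    by (simp add: algebra_simps)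
  also have "\<dots> \<le> 2 * (\<integral>x. (f x - h x)\<^sup>2 \<partial>M) + 2 * (\<integral>x. (g x - k x)\<^sup>2 \<partial>M)"
    by (rule L2_integral_add_le; rule L2_diff)
      (use f g D_L2 [OF h(1)] D_L2 [OF k(1)] in \<open>auto simp: approx_def\<close>)
  also have "\<dots> < e" using h(2) k(2) by simp
  finally have "(\<integral>x. (f x + g x - (h x + k x))\<^sup>2 \<partial>M) < e" .
  moreover have "(\<lambda>x. h x + k x) \<in> D"
    using D_lincomb [OF h(1) k(1), of 1 1] by simp
  ultimately show "\<exists>g'\<in>D. (\<integral>x. (f x + g x - g' x)\<^sup>2 \<partial>M) < e"
    by (intro bexI [of _ "\<lambda>x. h x + k x"])
qed

lemma approx_sum: "finite I \<Longrightarrow> (\<And>i. i \<in> I \<Longrightarrow> approx (f i)) \<Longrightarrow> approx (\<lambda>x. \<Sum>i\<in>I. f i x)"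
  by (induction I rule: finite_induct) (auto intro: approx_add approx_D D_zero)

lemma approx_diff: "approx f \<Longrightarrow> approx g \<Longrightarrow> approx (\<lambda>x. f x - g x)"
  using approx_add [of f "\<lambda>x. - 1 * g x"] approx_scale [of g "-1"] by simp

lemma approx_cong:
  assumes "approx f" "g \<in> borel_measurable M" "\<And>x. x \<in> space M \<Longrightarrow> f x = g x"
  shows "approx g"
proof (rule approx_limit)
  show "g \<in> L2 M"
    by (rule L2_bounded [OF assms(2), of f]) (use assms in \<open>auto simp: approx_def\<close>)
  fix e :: real assume "0 < e"
  moreover have "(\<integral>x. (g x - f x)\<^sup>2 \<partial>M) = (\<integral>x. 0 \<partial>M)"
    by (rule Bochner_Integration.integral_cong) (use assms(3) in auto)
  ultimately show "\<exists>f. approx f \<and> (\<integral>x. (g x - f x)\<^sup>2 \<partial>M) < e"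
    using assms(1) by (intro exI [of _ f]) simp
qed

lemma approx_dominated:
  assumes "\<And>n. approx (F n)" "f \<in> borel_measurable M" "w \<in> L2 M"
    and "\<And>n x. x \<in> space M \<Longrightarrow> \<bar>F n x\<bar> \<le> \<bar>w x\<bar>"
    and "\<And>x. x \<in> space M \<Longrightarrow> (\<lambda>n. F n x) \<longlonglongrightarrow> f x"
  shows "approx f"
proof (rule approx_limit)
  have m: "F n \<in> borel_measurable M" for n
    using assms(1) by (simp add: approx_def L2_measurable)
  note conv = L2_dominated_convergence [OF m assms(2-5)]
  show "f \<in> L2 M" by (rule conv)
  fix e :: real assume "0 < e"
  with order_tendstoD(2) [OF conv(2)] have "\<forall>\<^sub>F n in sequentially. (\<integral>x. (f x - F n x)\<^sup>2 \<partial>M) < e" by blast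
  then obtain n where "(\<integral>x. (f x - F n x)\<^sup>2 \<partial>M) < e"
    using eventually_happens' [OF sequentially_bot] by blast
  then show "\<exists>g. approx g \<and> (\<integral>x. (f x - g x)\<^sup>2 \<partial>M) < e" using assms(1) by blast
qed

text \<open>Dynkin's argument for sets cut down by \<open>K\<close>: its finite measure keeps
  complements and countable unions square integrable.\<close>

lemma approx_generator:
  assumes G: "Int_stable G" "G \<subseteq> Pow (space M)" "sets M = sigma_sets (space M) G"
    and K: "K \<in> sets M" "emeasure M K < \<infinity>" "approx (indicat_real K)"
    and GK: "\<And>A. A \<in> G \<Longrightarrow> approx (indicat_real (A \<inter> K))"
    and A: "A \<in> sets M"
  shows "approx (indicat_real (A \<inter> K))"
proof -
  have wK: "indicat_real K \<in> L2 M" by (rule L2_indicator [OF K(1,2)])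
  show ?thesis
    using G(1,2) A [unfolded G(3)]
  proof (induction rule: sigma_sets_induct_disjoint)
    case (basic A)
    then show ?case by (rule GK)
  next
    case empty
    then show ?case using approx_D [OF D_zero] by simp
  next
    case (compl A)
    have "approx (\<lambda>x. indicat_real K x - indicat_real (A \<inter> K) x)"
      by (rule approx_diff [OF K(3) compl(2)])
    moreover have "indicat_real K x - indicat_real (A \<inter> K) x = indicat_real ((space M - A) \<inter> K) x"
      if "x \<in> space M" for x
      using that by (auto simp: indicator_def)
    moreover have "(space M - A) \<inter> K \<in> sets M"
      using compl(1) K(1) by (simp add: G(3) [symmetric])
    ultimately show ?case
      by (metis (mono_tags, lifting) approx_cong borel_measurable_indicator)
  next
    case (union A)
    have sets: "A i \<in> sets M" for i using union(2) G(3) by (metis range_subsetD)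
    have "(\<Sum>i<n. indicat_real (A i \<inter> K) x) = indicat_real ((\<Union>i<n. A i) \<inter> K) x" for n x
    proof -
      have "disjoint_family (\<lambda>i. A i \<inter> K)"
        using union(1) by (auto simp: disjoint_family_on_def)
      then have "indicat_real (\<Union>i<n. A i \<inter> K) x = (\<Sum>i<n. indicat_real (A i \<inter> K) x)"
        by (intro indicator_UN_disjoint) (auto simp: disjoint_family_on_def)
      then show ?thesis by simp
    qed
    then have part: "approx (indicat_real ((\<Union>i<n. A i) \<inter> K))" for n
      using approx_sum [of "{..<n}" "\<lambda>i. indicat_real (A i \<inter> K)"] union(3) by simp
    show ?case
    proof (rule approx_dominated [OF part])
      show "indicat_real ((\<Union>i. A i) \<inter> K) \<in> borel_measurable M"
        using sets K(1) by (intro borel_measurable_indicator) auto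
      show "indicat_real K \<in> L2 M" by (rule wK)
      show "\<bar>indicat_real ((\<Union>i<n. A i) \<inter> K) x\<bar> \<le> \<bar>indicat_real K x\<bar>" for n x
        by (auto simp: indicator_def)
      fix x
      show "(\<lambda>n. indicat_real ((\<Union>i<n. A i) \<inter> K) x) \<longlonglongrightarrow> indicat_real ((\<Union>i. A i) \<inter> K) x"
      proof (cases "x \<in> (\<Union>i. A i) \<inter> K")
        case True
        then obtain i where "x \<in> A i" "x \<in> K" by blast
        then have "\<forall>\<^sub>F n in sequentially. indicat_real ((\<Union>i<n. A i) \<inter> K) x = 1"
          by (intro eventually_sequentiallyI [of "Suc i"]) (auto simp: indicator_def)
        then show ?thesis using True by (simp add: tendsto_eventually)
      next
        case False
        then have "indicat_real ((\<Union>i<n. A i) \<inter> K) x = 0" for n by (auto simp: indicator_def)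
        then show ?thesis using False by simp
      qed
    qed
  qed
qed

lemma approx_all:
  assumes ind: "\<And>A. A \<in> sets M \<Longrightarrow> emeasure M A < \<infinity> \<Longrightarrow> approx (indicat_real A)"
    and f: "f \<in> L2 M"
  shows "approx f"
proof -
  have [measurable]: "f \<in> borel_measurable M" by (rule L2_measurable [OF f])
  have "f \<in> borel_measurable M" by (rule L2_measurable [OF f])
  from borel_measurable_implies_sequence_metric [OF this, of 0]
  obtain F where F1: "\<forall>i. simple_function M (F i)" and F2: "\<forall>x\<in>space M. (\<lambda>i. F i x) \<longlonglongrightarrow> f x"
    and F3: "\<forall>i. \<forall>x\<in>space M. dist (F i x) 0 \<le> 2 * dist (f x) 0"
    by (elim exE conjE)
  have F: "\<And>i. simple_function M (F i)" "\<And>x. x \<in> space M \<Longrightarrow> (\<lambda>i. F i x) \<longlonglongrightarrow> f x"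
    using F1 F2 by blast+
  have F_le: "\<And>i x. x \<in> space M \<Longrightarrow> \<bar>F i x\<bar> \<le> \<bar>2 * f x\<bar>"
    using F3 by (simp add: abs_mult)
  have w: "(\<lambda>x. 2 * f x) \<in> L2 M" by (rule L2_scale [OF f])
  have "approx (F i)" for i
  proof -
    have meas [measurable]: "F i \<in> borel_measurable M"
      by (rule borel_measurable_simple_function [OF F(1)])
    have FL: "F i \<in> L2 M" by (rule L2_bounded [OF meas w F_le])
    have level: "approx (indicat_real (F i -` {y} \<inter> space M))" if "y \<noteq> 0" for y
    proof (rule ind)
      show S: "F i -` {y} \<inter> space M \<in> sets M" by measurable
      have "(indicat_real (F i -` {y} \<inter> space M)) \<in> L2 M"
      proof (rule L2_bounded)
        show "(\<lambda>x. (1 / y) * F i x) \<in> L2 M" by (rule L2_scale [OF FL])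
        show "\<bar>indicat_real (F i -` {y} \<inter> space M) x\<bar> \<le> \<bar>1 / y * F i x\<bar>" for x
          using that by (auto simp: indicator_def)
      qed (use S in simp)
      then have "integrable M (indicat_real (F i -` {y} \<inter> space M))"
        by (simp add: L2_def indicator_square)
      then show "emeasure M (F i -` {y} \<inter> space M) < \<infinity>"
        using S by (simp add: integrable_indicator_iff)
    qed
    \<comment> \<open>The value 0 is left out, since its level set may have infinite
      measure.\<close>
    have "approx (\<lambda>x. \<Sum>y\<in>F i ` space M - {0}. y * indicat_real (F i -` {y} \<inter> space M) x)"
      using F(1) [of i] by (intro approx_sum approx_scale level) (auto simp: simple_function_def)
    then show ?thesis
    proof (rule approx_cong [OF _ meas])
      fix x assume x: "x \<in> space M"
      have fin: "finite (F i ` space M)" using F(1) by (simp add: simple_function_def)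
      have "(\<Sum>y\<in>F i ` space M - {0}. y * indicat_real (F i -` {y} \<inter> space M) x)
          = (\<Sum>y\<in>F i ` space M - {0}. if y = F i x then y else 0)"
        using x by (intro sum.cong) (auto simp: indicator_def)
      also have "\<dots> = F i x"
        using x fin by simp
      finally show "(\<Sum>y\<in>F i ` space M - {0}. y * indicat_real (F i -` {y} \<inter> space M) x) = F i x" .
    qed
  qed
  then show ?thesis
    using approx_dominated [of F f "\<lambda>x. 2 * f x"] F(2) F_le w by simp
qed

end

section \<open>Dyadic grids on the quarter plane\<close>

definition cell :: "nat \<Rightarrow> real \<Rightarrow> nat" where
  "cell N x = nat \<lfloor>2 ^ N * x\<rfloor>"

definition grid_function :: "nat \<Rightarrow> (nat \<Rightarrow> nat \<Rightarrow> real) \<Rightarrow> real \<times> real \<Rightarrow> real" where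
  "grid_function N A = (\<lambda>(x, y). A (cell N x) (cell N y))"

definition supported :: "nat \<Rightarrow> (nat \<Rightarrow> nat \<Rightarrow> real) \<Rightarrow> bool" where
  "supported n A \<longleftrightarrow> (\<forall>i j. n \<le> i \<or> n \<le> j \<longrightarrow> A i j = 0)"

definition cell_indicator :: "nat \<Rightarrow> nat \<Rightarrow> real \<Rightarrow> real" where
  "cell_indicator N i x = (if cell N x = i then 1 else 0)"

lemma cell_Suc: "cell N x = cell (Suc N) x div 2"
proof -
  have "\<lfloor>2 ^ N * x\<rfloor> = \<lfloor>(2 ^ Suc N * x) / real_of_int 2\<rfloor>" by simp
  also have "\<dots> = \<lfloor>2 ^ Suc N * x\<rfloor> div 2" by (rule floor_divide_real_eq_div) simp
  finally show ?thesis by (simp add: cell_def nat_div_distrib')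
qed

lemma cell_less_iff: "0 \<le> x \<Longrightarrow> cell N x < nat \<lfloor>2 ^ N * (q::real)\<rfloor> \<longleftrightarrow> \<lfloor>2 ^ N * x\<rfloor> < \<lfloor>2 ^ N * q\<rfloor>"
  unfolding cell_def by (rule nat_less_eq_zless) simp

lemma measurable_cell [measurable]: "cell N \<in> borel \<rightarrow>\<^sub>M count_space UNIV"
  unfolding cell_def by measurable

lemma space_Rplus: "space Rplus = {0..}"
  by (simp add: space_restrict_space)

lemma measurable_Rplus: "f \<in> borel \<rightarrow>\<^sub>M N \<Longrightarrow> f \<in> Rplus \<rightarrow>\<^sub>M N"
  by (rule measurable_restrict_space1) simp

lemma measurable_cell_Rplus [measurable]: "cell N \<in> Rplus \<rightarrow>\<^sub>M count_space UNIV"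
  by (rule measurable_Rplus [OF measurable_cell])

lemma cell_indicator_eq:
  assumes "0 \<le> x"
  shows "cell_indicator N i x = indicat_real {real i / 2 ^ N ..< real (Suc i) / 2 ^ N} x"
proof -
  have "cell N x = i \<longleftrightarrow> \<lfloor>2 ^ N * x\<rfloor> = int i"
    using assms by (auto simp: cell_def)
  also have "\<dots> \<longleftrightarrow> real i \<le> 2 ^ N * x \<and> 2 ^ N * x < real (Suc i)"
    by (auto simp: floor_eq_iff)
  also have "\<dots> \<longleftrightarrow> x \<in> {real i / 2 ^ N ..< real (Suc i) / 2 ^ N}"
    by (auto simp: field_simps)
  finally show ?thesis by (simp add: cell_indicator_def indicator_def)
qed

lemma Ico_Rplus:
  assumes "0 \<le> (p::real)"
  shows "{p..<q} \<in> sets Rplus" "emeasure Rplus {p..<q} = emeasure lborel {p..<q}"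
proof -
  have "{p..<q} \<subseteq> {0..}" using assms by auto
  then show "{p..<q} \<in> sets Rplus" "emeasure Rplus {p..<q} = emeasure lborel {p..<q}"
    by (simp_all add: sets_restrict_space_iff emeasure_restrict_space)
qed

lemma emeasure_cell: "emeasure Rplus {real i / 2 ^ N ..< real (Suc i) / 2 ^ N} = ennreal (1 / 2 ^ N)"
proof -
  have "real i / 2 ^ N \<le> real (Suc i) / 2 ^ N" by (intro divide_right_mono) auto
  moreover have "real (Suc i) / 2 ^ N - real i / 2 ^ N = 1 / 2 ^ N"
    by (simp flip: diff_divide_distrib)
  ultimately have "emeasure lborel {real i / 2 ^ N ..< real (Suc i) / 2 ^ N} = ennreal (1 / 2 ^ N)"
    using emeasure_lborel_Ico by metis
  then show ?thesis by (subst Ico_Rplus(2)) simp_all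
qed

lemma integral_cell_indicator:
  "integrable Rplus (cell_indicator N i)" "(\<integral>x. cell_indicator N i x \<partial>Rplus) = 1 / 2 ^ N"
proof -
  let ?S = "{real i / 2 ^ N ..< real (Suc i) / 2 ^ N}"
  have S: "?S \<in> sets Rplus"
    by (rule Ico_Rplus) simp
  have eq: "\<And>x. x \<in> space Rplus \<Longrightarrow> cell_indicator N i x = indicat_real ?S x"
    by (rule cell_indicator_eq) (simp add: space_Rplus)
  have int: "integrable Rplus (indicat_real ?S)"
    unfolding integrable_indicator_iff sets.Int_space_eq2 [OF S] using S by (simp add: emeasure_cell del: of_nat_Suc)
  show "integrable Rplus (cell_indicator N i)"
    using int by (subst Bochner_Integration.integrable_cong [OF refl eq])
  have "(\<integral>x. cell_indicator N i x \<partial>Rplus) = (\<integral>x. indicat_real ?S x \<partial>Rplus)"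
    by (rule Bochner_Integration.integral_cong [OF refl eq])
  also have "\<dots> = measure Rplus ?S"
    by (simp only: Bochner_Integration.integral_indicator sets.Int_space_eq2 [OF S])
  finally show "(\<integral>x. cell_indicator N i x \<partial>Rplus) = 1 / 2 ^ N"
    by (simp add: measure_def emeasure_cell del: of_nat_Suc)
qed

lemma cell_indicator_mult: "cell_indicator N i x * cell_indicator N j x = (if i = j then cell_indicator N i x else 0)"
  by (simp add: cell_indicator_def)

lemma cell_indicator_L2: "cell_indicator N i \<in> L2 Rplus"
  using integral_cell_indicator(1) by (simp add: L2_def power2_eq_square cell_indicator_mult)

lemma grid_function_sum:
  assumes "supported n A"
  shows "grid_function N A (x, y) = (\<Sum>i<n. \<Sum>j<n. A i j * (cell_indicator N i x * cell_indicator N j y))"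
proof -
  have "(\<Sum>i<n. \<Sum>j<n. A i j * (cell_indicator N i x * cell_indicator N j y))
      = (\<Sum>i<n. if cell N x = i then \<Sum>j<n. if cell N y = j then A i j else 0 else 0)"
    by (intro sum.cong refl) (simp add: cell_indicator_def if_distrib [of "times _"] cong: if_cong)
  also have "\<dots> = (if cell N x < n then if cell N y < n then A (cell N x) (cell N y) else 0 else 0)"
    by simp
  finally show ?thesis
    using assms by (auto simp: grid_function_def supported_def)
qed

interpretation Rplus: sigma_finite_measure Rplus
  by (rule sigma_finite_measure_restrict_space) (auto intro: lborel.sigma_finite_measure_axioms)

interpretation Rplus2: pair_sigma_finite Rplus Rplus ..

lemma grid_function_measurable [measurable]: "grid_function N A \<in> borel_measurable (Rplus \<Otimes>\<^sub>M Rplus)"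
proof -
  have "(\<lambda>p. A (cell N (fst p)) (cell N (snd p))) \<in> borel_measurable (Rplus \<Otimes>\<^sub>M Rplus)"
    by measurable
  then show ?thesis by (simp add: grid_function_def case_prod_beta')
qed

lemma cell_square_finite:
  "emeasure (Rplus \<Otimes>\<^sub>M Rplus) ({0..<q} \<times> {0..<r}) < \<infinity>" "{0..<q} \<times> {0..<r} \<in> sets (Rplus \<Otimes>\<^sub>M Rplus)"
proof -
  have S: "{0..<q} \<in> sets Rplus" for q :: real
    by (rule Ico_Rplus) simp
  have fin: "emeasure Rplus {0..<q} < \<infinity>" for q :: real
    by (cases "0 \<le> q") (simp_all add: Ico_Rplus)
  show "emeasure (Rplus \<Otimes>\<^sub>M Rplus) ({0..<q} \<times> {0..<r}) < \<infinity>"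
    using fin [of q] fin [of r] by (simp add: Rplus.emeasure_pair_measure_Times S ennreal_mult_less_top)
  show "{0..<q} \<times> {0..<r} \<in> sets (Rplus \<Otimes>\<^sub>M Rplus)" using S by blast
qed

lemma grid_function_L2:
  assumes "supported n A"
  shows "grid_function N A \<in> L2 (Rplus \<Otimes>\<^sub>M Rplus)"
proof -
  let ?q = "real n / 2 ^ N"
  define C where "C = (\<Sum>i<n. \<Sum>j<n. \<bar>A i j\<bar>)"
  have w: "(\<lambda>p. C * indicat_real ({0..<?q} \<times> {0..<?q}) p) \<in> L2 (Rplus \<Otimes>\<^sub>M Rplus)"
    by (intro L2_scale L2_indicator cell_square_finite)
  show ?thesis
  proof (rule L2_bounded [OF _ w])
    fix p assume "p \<in> space (Rplus \<Otimes>\<^sub>M Rplus)"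
    then obtain x y where p: "p = (x, y)" "0 \<le> x" "0 \<le> y"
      by (auto simp: space_pair_measure space_Rplus)
    show "\<bar>grid_function N A p\<bar> \<le> \<bar>C * indicat_real ({0..<?q} \<times> {0..<?q}) p\<bar>"
    proof (cases "cell N x < n \<and> cell N y < n")
      case True
      have "x < ?q" if "cell N x < n" "0 \<le> x" for x
      proof -
        have "2 ^ N * x < real n"
          using that by (simp add: cell_def nat_less_iff floor_less_iff)
        then show ?thesis by (simp add: field_simps)
      qed
      then have in_sq: "p \<in> {0..<?q} \<times> {0..<?q}" using p True by auto
      have "\<bar>A (cell N x) (cell N y)\<bar> \<le> (\<Sum>j<n. \<bar>A (cell N x) j\<bar>)"
        using True by (intro member_le_sum) auto
      also have "\<dots> \<le> C"
        unfolding C_def using True by (intro member_le_sum [of _ _ "\<lambda>i. \<Sum>j<n. \<bar>A i j\<bar>"]) (auto intro: sum_nonneg)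
      finally show ?thesis using in_sq by (simp add: p(1) grid_function_def)
    next
      case False
      then have "grid_function N A p = 0"
        using assms by (auto simp: p(1) grid_function_def supported_def)
      then show ?thesis by simp
    qed
  qed simp
qed

definition grid_functions :: "(real \<times> real \<Rightarrow> real) set" where
  "grid_functions = {grid_function N A | N A. \<exists>n. supported n A}"

text \<open>Each cell splits into two of half the length. Combining functions given on different
  grids needs a common refinement.\<close>

lemma grid_function_refine: "supported n A \<Longrightarrow>
  \<exists>A' n'. grid_function N A = grid_function (N + k) A' \<and> supported n' A'"
proof (induction k)
  case (Suc k)
  then obtain A' n' where A': "grid_function N A = grid_function (N + k) A'" "supported n' A'" by blast
  have "grid_function (N + k) A' = grid_function (N + Suc k) (\<lambda>i j. A' (i div 2) (j div 2))"
    by (simp add: grid_function_def fun_eq_iff cell_Suc [of "N + k"])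
  moreover have "supported (2 * n') (\<lambda>i j. A' (i div 2) (j div 2))"
    using A'(2) unfolding supported_def by (metis div_le_mono mult.commute nonzero_mult_div_cancel_left zero_neq_numeral)
  ultimately show ?case using A'(1) by metis
qed auto

interpretation grid: L2_approximation "Rplus \<Otimes>\<^sub>M Rplus" grid_functions
proof
  show "g \<in> L2 (Rplus \<Otimes>\<^sub>M Rplus)" if "g \<in> grid_functions" for g
    using that grid_function_L2 by (auto simp: grid_functions_def)
  show "(\<lambda>x. 0) \<in> grid_functions"
    unfolding grid_functions_def
    by (intro CollectI exI [of _ 0] exI [of _ "\<lambda>_ _. 0"]) (auto simp: grid_function_def supported_def)
  fix g k c d assume "g \<in> grid_functions" "k \<in> grid_functions"
  then obtain N A n N' A' n' where g: "g = grid_function N A" "supported n A" and k: "k = grid_function N' A'" "supported n' A'"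
    unfolding grid_functions_def by blast
  obtain A1 n1 where 1: "g = grid_function (N + N') A1" "supported n1 A1"
    using grid_function_refine [OF g(2), of N N'] g(1) by metis
  obtain A2 n2 where 2: "k = grid_function (N + N') A2" "supported n2 A2"
    using grid_function_refine [OF k(2), of N' N] k(1) by (metis add.commute)
  have "(\<lambda>x. c * g x + d * k x) = grid_function (N + N') (\<lambda>i j. c * A1 i j + d * A2 i j)"
    by (simp add: 1(1) 2(1) grid_function_def fun_eq_iff)
  moreover have "supported (max n1 n2) (\<lambda>i j. c * A1 i j + d * A2 i j)"
    using 1(2) 2(2) by (auto simp: supported_def)
  ultimately show "(\<lambda>x. c * g x + d * k x) \<in> grid_functions"
    unfolding grid_functions_def by blast
qed

lemma sets_Rplus: "sets Rplus = sigma_sets {0..} (range (\<lambda>q. {0..<q}))"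
proof -
  have "sets Rplus = (\<inter>) {0..} ` sigma_sets UNIV (range lessThan)"
    by (simp add: sets_restrict_space borel_Iio)
  also have "\<dots> = sigma_sets {0..} ((\<inter>) {0..} ` range lessThan)"
  proof (rule sigma_sets_Int)
    have "{0..} \<in> sets (borel :: real measure)" by simp
    then show "{0::real..} \<in> sigma_sets UNIV (range lessThan)"
      unfolding borel_Iio by simp
  qed simp
  also have "(\<inter>) {0..} ` range lessThan = range (\<lambda>q::real. {0..<q})"
    by (auto simp: image_image atLeastLessThan_def)
  finally show ?thesis .
qed

text \<open>The approximants use only cells strictly before those containing the endpoints. They
  thus lie below the indicator of the rectangle, which also serves as the dominating function, and
  each interior point is eventually covered.\<close>

lemma approx_rectangle: "grid.approx (indicat_real ({0..<q} \<times> {0..<r}))"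
proof (rule grid.approx_dominated)
  define A where "A N i j = (if i < nat \<lfloor>2 ^ N * q\<rfloor> \<and> j < nat \<lfloor>2 ^ N * r\<rfloor> then 1 else 0 :: real)" for N i j
  show "grid.approx (grid_function N (A N))" for N
  proof (rule grid.approx_D)
    have "supported (max (nat \<lfloor>2 ^ N * q\<rfloor>) (nat \<lfloor>2 ^ N * r\<rfloor>)) (A N)"
      by (auto simp: supported_def A_def)
    then show "grid_function N (A N) \<in> grid_functions"
      unfolding grid_functions_def by blast
  qed
  show "indicat_real ({0..<q} \<times> {0..<r}) \<in> borel_measurable (Rplus \<Otimes>\<^sub>M Rplus)"
    by (intro borel_measurable_indicator cell_square_finite)
  show "indicat_real ({0..<q} \<times> {0..<r}) \<in> L2 (Rplus \<Otimes>\<^sub>M Rplus)"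
    by (intro L2_indicator cell_square_finite)
  have imp: "x < q" if "\<lfloor>2 ^ N * x\<rfloor> < \<lfloor>2 ^ N * q\<rfloor>" for x q :: real and N
    using that by (metis floor_mono mult_left_mono not_le zero_le_numeral zero_le_power)
  fix p assume "p \<in> space (Rplus \<Otimes>\<^sub>M Rplus)"
  then obtain x y where p: "p = (x, y)" "0 \<le> x" "0 \<le> y"
    by (auto simp: space_pair_measure space_Rplus)
  have val: "grid_function N (A N) p = (if \<lfloor>2 ^ N * x\<rfloor> < \<lfloor>2 ^ N * q\<rfloor> \<and> \<lfloor>2 ^ N * y\<rfloor> < \<lfloor>2 ^ N * r\<rfloor> then 1 else 0)" for N
    using p(2,3) by (simp add: p(1) grid_function_def A_def cell_less_iff)
  show "\<bar>grid_function N (A N) p\<bar> \<le> \<bar>indicat_real ({0..<q} \<times> {0..<r}) p\<bar>" for N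
    using imp [of N x q] imp [of N y r] p(2,3) unfolding val by (auto simp: p(1) indicator_def)
  show "(\<lambda>N. grid_function N (A N) p) \<longlonglongrightarrow> indicat_real ({0..<q} \<times> {0..<r}) p"
  proof (cases "x < q \<and> y < r")
    case True
    have ev: "\<forall>\<^sub>F N in sequentially. \<lfloor>2 ^ N * x\<rfloor> < \<lfloor>2 ^ N * q\<rfloor>" if "x < q" for x q :: real
    proof -
      have "filterlim (\<lambda>N. 2 ^ N * (q - x)) at_top sequentially"
        using that by real_asymp
      then have "\<forall>\<^sub>F N in sequentially. 1 < 2 ^ N * (q - x)"
        by (simp add: filterlim_at_top_dense)
      then show ?thesis
      proof eventually_elim
        case (elim N)
        then have "2 ^ N * x + 1 < 2 ^ N * q" by (simp add: algebra_simps)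
        then show ?case by linarith
      qed
    qed
    have "\<forall>\<^sub>F N in sequentially. grid_function N (A N) p = 1"
      using eventually_conj [OF ev [of x q] ev [of y r]] True by (simp add: val)
    then show ?thesis using True p by (simp add: tendsto_eventually indicator_def)
  next
    case False
    then have "grid_function N (A N) p = 0" for N
      using imp [of N x q] imp [of N y r] unfolding val by auto
    then show ?thesis using False p by (auto simp: indicator_def)
  qed
qed

theorem grid_functions_dense:
  assumes "f \<in> L2 (Rplus \<Otimes>\<^sub>M Rplus)"
  shows "grid.approx f"
proof (rule grid.approx_all [OF _ assms])
  let ?R = "Rplus \<Otimes>\<^sub>M Rplus"
  let ?E = "range (\<lambda>q::real. {0..<q})"
  define G where "G = {a \<times> b | a b. a \<in> ?E \<and> b \<in> ?E}"
  define K where "K n = {0..<real n} \<times> {0..<real n}" for n :: nat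
  have space: "space ?R = {0..} \<times> {0..}"
    by (simp add: space_pair_measure space_Rplus)
  have G_sub: "G \<subseteq> Pow (space ?R)" by (auto simp: G_def space)
  have cover: "\<Union> (range (\<lambda>n::nat. {0..<real n})) = {0..}"
  proof
    show "{0..} \<subseteq> \<Union> (range (\<lambda>n::nat. {0..<real n}))"
    proof
      fix x :: real assume "x \<in> {0..}"
      moreover obtain n :: nat where "x < real n" using reals_Archimedean2 by blast
      ultimately show "x \<in> \<Union> (range (\<lambda>n::nat. {0..<real n}))" by auto
    qed
  qed auto
  have "sets ?R = sets (sigma (space Rplus \<times> space Rplus) G)"
    unfolding G_def
  proof (rule sets_pair_eq)
    show "?E \<subseteq> Pow (space Rplus)" "?E \<subseteq> Pow (space Rplus)" by (auto simp: space_Rplus)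
    show "sets Rplus = sigma_sets (space Rplus) ?E" "sets Rplus = sigma_sets (space Rplus) ?E"
      unfolding space_Rplus by (rule sets_Rplus)+
    show "countable (range (\<lambda>n::nat. {0..<real n}))" "countable (range (\<lambda>n::nat. {0..<real n}))"
      by simp_all
    show "range (\<lambda>n::nat. {0..<real n}) \<subseteq> ?E" "range (\<lambda>n::nat. {0..<real n}) \<subseteq> ?E" by blast+
    show "\<Union> (range (\<lambda>n::nat. {0..<real n})) = space Rplus" "\<Union> (range (\<lambda>n::nat. {0..<real n})) = space Rplus"
      unfolding space_Rplus by (rule cover)+
  qed
  then have G_sets: "sets ?R = sigma_sets (space ?R) G"
    using G_sub by (simp add: space_pair_measure)
  have G_Int: "Int_stable G"
  proof (rule Int_stableI)
    fix a b assume "a \<in> G" "b \<in> G"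
    then obtain q r q' r' :: real where ab: "a = {0..<q} \<times> {0..<r}" "b = {0..<q'} \<times> {0..<r'}"
      unfolding G_def by auto
    have "a \<inter> b = {0..<min q q'} \<times> {0..<min r r'}" by (auto simp: ab)
    then show "a \<inter> b \<in> G" unfolding G_def by blast
  qed
  have AK: "grid.approx (indicat_real (A \<inter> K n))" if "A \<in> sets ?R" for A n
  proof (rule grid.approx_generator [OF G_Int G_sub G_sets _ _ _ _ that])
    show "K n \<in> sets ?R" "emeasure ?R (K n) < \<infinity>" "grid.approx (indicat_real (K n))"
      unfolding K_def by (rule cell_square_finite approx_rectangle)+
    fix B assume "B \<in> G"
    then obtain q r :: real where B: "B = {0..<q} \<times> {0..<r}" unfolding G_def by auto
    have "B \<inter> K n = {0..<min q (real n)} \<times> {0..<min r (real n)}" by (auto simp: B K_def)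
    then show "grid.approx (indicat_real (B \<inter> K n))" by (simp add: approx_rectangle)
  qed
  fix A assume A: "A \<in> sets ?R" "emeasure ?R A < \<infinity>"
  show "grid.approx (indicat_real A)"
  proof (rule grid.approx_dominated [OF AK [OF A(1)]])
    show "indicat_real A \<in> L2 ?R" by (rule L2_indicator [OF A])
    show "\<bar>indicat_real (A \<inter> K n) x\<bar> \<le> \<bar>indicat_real A x\<bar>" for n x
      by (auto simp: indicator_def)
    fix p assume "p \<in> space ?R"
    then obtain x y where p: "p = (x, y)" "0 \<le> x" "0 \<le> y" by (auto simp: space)
    obtain n :: nat where n: "max x y < real n" using reals_Archimedean2 by blast
    have "\<forall>\<^sub>F n in sequentially. indicat_real (A \<inter> K n) p = indicat_real A p"
      by (rule eventually_sequentiallyI [of n]) (use p n in \<open>auto simp: K_def indicator_def\<close>)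
    then show "(\<lambda>n. indicat_real (A \<inter> K n) p) \<longlonglongrightarrow> indicat_real A p"
      by (rule tendsto_eventually)
  qed (use A in auto)
qed

text \<open>By symmetry of \<open>f\<close> the transposed approximation is equally good, and so is
  the mean of the two, by convexity.\<close>

theorem symmetric_grid_functions_dense:
  assumes f: "f \<in> L2_sym" and e: "e > 0"
  shows "\<exists>N n A. supported n A \<and> (\<forall>i j. A i j = A j i) \<and>
    (\<integral>p. (f p - grid_function N A p)\<^sup>2 \<partial>(Rplus \<Otimes>\<^sub>M Rplus)) < e"
proof -
  let ?R = "Rplus \<Otimes>\<^sub>M Rplus"
  have fL: "f \<in> L2 ?R" and fsym: "AE (x, y) in ?R. f (x, y) = f (y, x)"
    using f by (auto simp: L2_sym_def)
  obtain N n A where A: "supported n A" and less: "(\<integral>p. (f p - grid_function N A p)\<^sup>2 \<partial>?R) < e"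
    using grid_functions_dense [OF fL] e unfolding grid.approx_def by (force simp: grid_functions_def)
  let ?g = "grid_function N A"
  let ?h = "grid_function N (\<lambda>i j. A j i)"
  have At: "supported n (\<lambda>i j. A j i)" using A by (auto simp: supported_def)
  note gL = grid_function_L2 [OF A, of N] and hL = grid_function_L2 [OF At, of N]
  have [measurable]: "f \<in> borel_measurable ?R" by (rule L2_measurable [OF fL])
  have "(\<integral>p. (f p - ?h p)\<^sup>2 \<partial>?R) = (\<integral>(x, y). (f (y, x) - ?g (y, x))\<^sup>2 \<partial>?R)"
  proof (rule integral_cong_AE)
    show "(\<lambda>(x, y). (f (y, x) - ?g (y, x))\<^sup>2) \<in> borel_measurable ?R"
      by measurable
    show "AE p in ?R. (f p - ?h p)\<^sup>2 = (case p of (x, y) \<Rightarrow> (f (y, x) - ?g (y, x))\<^sup>2)"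
      using fsym by eventually_elim (auto simp: grid_function_def)
  qed measurable
  also have "\<dots> = (\<integral>p. (f p - ?g p)\<^sup>2 \<partial>?R)"
    using Rplus2.integral_product_swap [of "\<lambda>p. (f p - ?g p)\<^sup>2"] by simp
  finally have h: "(\<integral>p. (f p - ?h p)\<^sup>2 \<partial>?R) < e" using less by simp
  define A' where "A' i j = (A i j + A j i) / 2" for i j
  have "(\<integral>p. (f p - grid_function N A' p)\<^sup>2 \<partial>?R) = (\<integral>p. ((1/2) * (f p - ?g p) + (1/2) * (f p - ?h p))\<^sup>2 \<partial>?R)"
  proof -
    have "f p - grid_function N A' p = (1/2) * (f p - ?g p) + (1/2) * (f p - ?h p)" for p
      by (cases p) (simp add: grid_function_def A'_def field_simps)
    then show ?thesis by simp
  qed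
  also have "\<dots> \<le> 2 * (\<integral>p. ((1/2) * (f p - ?g p))\<^sup>2 \<partial>?R) + 2 * (\<integral>p. ((1/2) * (f p - ?h p))\<^sup>2 \<partial>?R)"
    by (intro L2_integral_add_le L2_scale L2_diff fL gL hL)
  also have "\<dots> = ((\<integral>p. (f p - ?g p)\<^sup>2 \<partial>?R) + (\<integral>p. (f p - ?h p)\<^sup>2 \<partial>?R)) / 2"
    by (simp add: power_divide field_simps)
  also have "\<dots> < e" using less h by simp
  finally have "(\<integral>p. (f p - grid_function N A' p)\<^sup>2 \<partial>?R) < e" .
  moreover have "supported n A'" using A by (auto simp: supported_def A'_def)
  moreover have "\<forall>i j. A' i j = A' j i" by (simp add: A'_def)
  ultimately show ?thesis by blast
qed

section \<open>Wigner integrals of step functions\<close>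

lemma L2_sym_lincomb:
  assumes "f \<in> L2_sym" "g \<in> L2_sym"
  shows "(\<lambda>x. c * f x + d * g x) \<in> L2_sym"
proof -
  have "AE (x, y) in Rplus \<Otimes>\<^sub>M Rplus. f (x, y) = f (y, x)" "AE (x, y) in Rplus \<Otimes>\<^sub>M Rplus. g (x, y) = g (y, x)"
    using assms by (simp_all add: L2_sym_def)
  then have "AE (x, y) in Rplus \<Otimes>\<^sub>M Rplus. c * f (x, y) + d * g (x, y) = c * f (y, x) + d * g (y, x)"
    by eventually_elim auto
  then show ?thesis
    using L2_lincomb [of f _ g c d] assms by (simp add: L2_sym_def)
qed

lemma L2_sym_diff: "f \<in> L2_sym \<Longrightarrow> g \<in> L2_sym \<Longrightarrow> (\<lambda>x. f x - g x) \<in> L2_sym"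
  using L2_sym_lincomb [of f g 1 "-1"] by simp

lemma grid_function_L2_sym:
  assumes "supported n A" "\<And>i j. A i j = A j i"
  shows "grid_function N A \<in> L2_sym"
  using grid_function_L2 [OF assms(1)] assms(2)
  by (simp add: L2_sym_def grid_function_def)

lemma L2_sym_zero: "(\<lambda>x. 0) \<in> L2_sym"
  using grid_function_L2_sym [of 0 "\<lambda>_ _. 0" 0] by (simp add: supported_def grid_function_def case_prod_beta')

lemma integral_grid_function:
  assumes A: "supported n A"
  shows "(\<integral>p. grid_function N A p \<partial>(Rplus \<Otimes>\<^sub>M Rplus)) = (\<Sum>i<n. \<Sum>j<n. A i j) / 4 ^ N"
proof -
  let ?R = "Rplus \<Otimes>\<^sub>M Rplus"
  let ?C = "\<lambda>i. {real i / 2 ^ N ..< real (Suc i) / 2 ^ N}"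
  have C: "?C i \<in> sets Rplus" for i by (rule Ico_Rplus) simp
  have rect: "?C i \<times> ?C j \<in> sets ?R" for i j using C by blast
  have em: "emeasure ?R (?C i \<times> ?C j) = ennreal (1 / 4 ^ N)" for i j
  proof -
    have "emeasure ?R (?C i \<times> ?C j) = ennreal (1 / 2 ^ N) * ennreal (1 / 2 ^ N)"
      using Rplus.emeasure_pair_measure_Times [OF C C, of i j] by (simp only: emeasure_cell)
    also have "\<dots> = ennreal (1 / 2 ^ N * (1 / 2 ^ N))" by (rule ennreal_mult [symmetric]) simp_all
    also have "1 / 2 ^ N * (1 / 2 ^ N) = 1 / (4 ^ N :: real)"
      by (simp flip: power_mult_distrib)
    finally show ?thesis .
  qed
  have int: "integrable ?R (indicat_real (?C i \<times> ?C j))" for i j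
    unfolding integrable_indicator_iff sets.Int_space_eq2 [OF rect] using rect by (simp only: em) simp
  have val: "(\<integral>p. indicat_real (?C i \<times> ?C j) p \<partial>?R) = 1 / 4 ^ N" for i j
    unfolding Bochner_Integration.integral_indicator sets.Int_space_eq2 [OF rect] measure_def em by simp
  have "(\<integral>p. grid_function N A p \<partial>?R)
      = (\<integral>p. (\<Sum>i<n. \<Sum>j<n. A i j * indicat_real (?C i \<times> ?C j) p) \<partial>?R)"
  proof (rule Bochner_Integration.integral_cong [OF refl])
    fix p assume "p \<in> space ?R"
    then obtain x y where p: "p = (x, y)" "0 \<le> x" "0 \<le> y"
      by (auto simp: space_pair_measure space_Rplus)
    have "cell_indicator N i x * cell_indicator N j y = indicat_real (?C i \<times> ?C j) p" for i j
      using p(2,3) by (simp add: p(1) cell_indicator_eq indicator_times)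
    then show "grid_function N A p = (\<Sum>i<n. \<Sum>j<n. A i j * indicat_real (?C i \<times> ?C j) p)"
      using grid_function_sum [OF A, of N x y] by (simp add: p(1))
  qed
  also have "\<dots> = (\<Sum>i<n. \<Sum>j<n. A i j * (1 / 4 ^ N))"
  proof -
    have "integrable ?R (\<lambda>p. A i j * indicat_real (?C i \<times> ?C j) p)" for i j
      by (rule integrable_mult_right [OF int])
    then show ?thesis
      by (simp only: Bochner_Integration.integral_sum Bochner_Integration.integrable_sum
          integral_mult_right_zero val)
  qed
  finally show ?thesis by (simp add: sum_divide_distrib)
qed

lemma grid_function_square: "(grid_function N A p)\<^sup>2 = grid_function N (\<lambda>i j. (A i j)\<^sup>2) p"
  by (simp add: grid_function_def case_prod_beta')

lemma supported_square: "supported n A \<Longrightarrow> supported n (\<lambda>i j. (A i j)\<^sup>2)"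
  by (simp add: supported_def)

lemma step_function:
  assumes "\<And>i. n \<le> i \<Longrightarrow> u i = 0"
  shows "(\<lambda>x. \<Sum>i<n. u i * cell_indicator N i x) = (\<lambda>x. u (cell N x))"
    and "(\<lambda>x. u (cell N x)) \<in> L2 Rplus"
    and "(\<integral>x. (u (cell N x))\<^sup>2 \<partial>Rplus) = (\<Sum>i<n. (u i)\<^sup>2) / 2 ^ N"
proof -
  have eq: "(\<Sum>i<n. v i * cell_indicator N i x) = v (cell N x)" if "\<And>i. n \<le> i \<Longrightarrow> v i = 0" for v x
    using that [of "cell N x"] by (cases "cell N x < n") (simp_all add: cell_indicator_def if_distrib [of "times _"] cong: if_cong)
  show 1: "(\<lambda>x. \<Sum>i<n. u i * cell_indicator N i x) = (\<lambda>x. u (cell N x))"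
    by (rule ext) (rule eq [OF assms])
  have sq: "(\<lambda>x. (u (cell N x))\<^sup>2) = (\<lambda>x. \<Sum>i<n. (u i)\<^sup>2 * cell_indicator N i x)"
    using eq [of "\<lambda>i. (u i)\<^sup>2"] assms by auto
  have int: "integrable Rplus (\<lambda>x. (u i)\<^sup>2 * cell_indicator N i x)" for i
    by (intro integrable_mult_right integral_cell_indicator)
  have i2: "integrable Rplus (\<lambda>x. (u (cell N x))\<^sup>2)"
    unfolding sq by (intro Bochner_Integration.integrable_sum int)
  have meas: "(\<lambda>x. u (cell N x)) \<in> borel_measurable Rplus" by measurable
  show "(\<lambda>x. u (cell N x)) \<in> L2 Rplus"
    using meas i2 by (simp add: L2_def)
  show "(\<integral>x. (u (cell N x))\<^sup>2 \<partial>Rplus) = (\<Sum>i<n. (u i)\<^sup>2) / 2 ^ N"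
    unfolding sq using int
    by (simp add: Bochner_Integration.integral_sum integral_cell_indicator sum_divide_distrib)
qed

text \<open>Cells are half open so that they partition the half-line, while the single integral is
  prescribed on closed intervals. The right endpoint is a null set.\<close>

lemma cell_indicator_AE:
  "(\<integral>x. (cell_indicator N i x - indicat_real {real i / 2 ^ N .. real (Suc i) / 2 ^ N} x)\<^sup>2 \<partial>Rplus) = 0"
proof -
  have "AE x in lborel. x \<noteq> real (Suc i) / 2 ^ N" by (rule AE_lborel_singleton)
  then have "AE x in Rplus. x \<noteq> real (Suc i) / 2 ^ N"
    by (subst AE_restrict_space_iff) auto
  moreover have "AE x in Rplus. x \<in> {0..}"
    using AE_space [of Rplus] by (simp add: space_Rplus)
  ultimately have "AE x in Rplus. (cell_indicator N i x - indicat_real {real i / 2 ^ N .. real (Suc i) / 2 ^ N} x)\<^sup>2 = 0"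
    by eventually_elim (auto simp: cell_indicator_eq indicator_def simp del: of_nat_Suc)
  then show ?thesis by (rule integral_eq_zero_AE)
qed

lemma indicator_Icc_L2: "0 \<le> s \<Longrightarrow> indicat_real {s..t} \<in> L2 Rplus"
proof (rule L2_indicator)
  assume "0 \<le> s"
  then have "{s..t} \<subseteq> {0..}" by auto
  then show "{s..t} \<in> sets Rplus" "emeasure Rplus {s..t} < \<infinity>"
    by (simp_all add: sets_restrict_space_iff emeasure_restrict_space emeasure_lborel_Icc_eq)
qed

section \<open>Elements of A as vectors of L2\<close>

context semicircular_extension
begin

text \<open>The image of \<open>x\<close> in L2(\<phi>): since \<iota> preserves the state, the
  trace norm becomes the norm of a vector, and convergence in it is convergence in a Hilbert
  space.\<close>

definition vec :: "'h bop \<Rightarrow> 'k" where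
  "vec x = bop_apply (\<iota> x) \<Omega>"

lemma vec_diff: "x \<in> A \<Longrightarrow> y \<in> A \<Longrightarrow> vec (x - y) = vec x - vec y"
  and vec_scaleR: "x \<in> A \<Longrightarrow> vec (r *\<^sub>R x) = r *\<^sub>R vec x"
  by (simp_all add: vec_def iota_diff iota_scaleR)

lemma trace_norm2_eq: "x \<in> A \<Longrightarrow> trace_norm2 \<phi> x = norm (vec x)"
proof -
  assume x: "x \<in> A"
  have "\<phi> (adj x * x) = \<psi> (\<iota> (adj x * x))" using x by (intro iota_hom(6) [symmetric] base.alg)
  also have "\<iota> (adj x * x) = adj (\<iota> x) * \<iota> x" using x by (simp add: iota_hom base.alg)
  also have "\<psi> \<dots> = cinner (vec x) (vec x)" by (simp add: psi vec_def cinner_adj_right)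
  finally show ?thesis by (simp add: trace_norm2_def cinner_self)
qed

lemma vec_eqI:
  assumes x: "x \<in> A" "y \<in> A" "vec x = vec y"
  shows "x = y"
proof -
  have d: "x - y \<in> A" using x(1,2) by (rule base.alg_diff)
  have "\<phi> (adj (x - y) * (x - y)) = \<psi> (\<iota> (adj (x - y) * (x - y)))" using d by (intro iota_hom(6) [symmetric] base.alg)
  also have "\<iota> (adj (x - y) * (x - y)) = adj (\<iota> (x - y)) * \<iota> (x - y)" using d by (simp add: iota_hom base.alg)
  also have "\<psi> \<dots> = cinner (vec (x - y)) (vec (x - y))" by (simp add: psi vec_def cinner_adj_right)
  also have "\<dots> = 0" using x by (simp add: vec_diff)
  finally show ?thesis using base.phi_faithful [OF d] by simp
qed

lemma continuous_linear_L2D: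
  assumes "continuous_linear_L2 R V A \<phi> J"
  shows "f \<in> V \<Longrightarrow> J f \<in> A"
    and "f \<in> V \<Longrightarrow> g \<in> V \<Longrightarrow> J (\<lambda>x. c * f x + d * g x) = c *\<^sub>R J f + d *\<^sub>R J g"
    and "\<exists>C\<ge>0. \<forall>f\<in>V. norm (vec (J f)) \<le> C * L2_norm R f"
proof -
  note * = assms [unfolded continuous_linear_L2_def]
  show A: "J f \<in> A" if "f \<in> V" for f using * that by (elim conjE) blast
  show "f \<in> V \<Longrightarrow> g \<in> V \<Longrightarrow> J (\<lambda>x. c * f x + d * g x) = c *\<^sub>R J f + d *\<^sub>R J g"
    using * by (elim conjE) blast
  obtain C where C: "\<forall>f\<in>V. trace_norm2 \<phi> (J f) \<le> C * L2_norm R f" using * by (elim conjE exE)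
  have "norm (vec (J f)) \<le> \<bar>C\<bar> * L2_norm R f" if "f \<in> V" for f
  proof -
    have "norm (vec (J f)) \<le> C * L2_norm R f" using C that A by (simp add: trace_norm2_eq [symmetric])
    also have "\<dots> \<le> \<bar>C\<bar> * L2_norm R f"
      by (intro mult_right_mono) (simp_all add: L2_norm_def)
    finally show ?thesis .
  qed
  then show "\<exists>C\<ge>0. \<forall>f\<in>V. norm (vec (J f)) \<le> C * L2_norm R f" by (intro exI [of _ "\<bar>C\<bar>"]) simp
qed

lemma continuous_linear_diff:
  assumes J: "continuous_linear_L2 R V A \<phi> J" and "f \<in> V" "g \<in> V"
  shows "J (\<lambda>x. f x - g x) = J f - J g"
  using continuous_linear_L2D(2) [OF assms, of 1 "-1"] by simp

lemma continuous_linear_tendsto: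
  assumes J: "continuous_linear_L2 R V A \<phi> J" and V: "\<And>f g. f \<in> V \<Longrightarrow> g \<in> V \<Longrightarrow> (\<lambda>x. f x - g x) \<in> V"
    and f: "f \<in> V" and g: "\<And>k. g k \<in> V" and lim: "(\<lambda>k. \<integral>x. (f x - g k x)\<^sup>2 \<partial>R) \<longlonglongrightarrow> 0"
  shows "(\<lambda>k. vec (J (g k))) \<longlonglongrightarrow> vec (J f)"
proof -
  obtain C where C: "\<And>f. f \<in> V \<Longrightarrow> norm (vec (J f)) \<le> C * L2_norm R f"
    using continuous_linear_L2D(3) [OF J] by blast
  have null: "(\<lambda>k. C * sqrt (\<integral>x. (f x - g k x)\<^sup>2 \<partial>R)) \<longlonglongrightarrow> 0"
    using tendsto_mult [OF tendsto_const [of C] tendsto_real_sqrt [OF lim]] by simp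
  have le: "norm (vec (J f) - vec (J (g k))) \<le> C * sqrt (\<integral>x. (f x - g k x)\<^sup>2 \<partial>R)" for k
    using C [OF V [OF f g [of k]]] continuous_linear_L2D(1) [OF J]
    by (simp add: L2_norm_def continuous_linear_diff [OF J f g] vec_diff f g)
  have "(\<lambda>k. vec (J f) - vec (J (g k))) \<longlonglongrightarrow> 0"
    by (rule Lim_null_comparison [OF always_eventually null]) (simp add: le)
  from tendsto_diff [OF tendsto_const [of "vec (J f)"] this] show ?thesis by simp
qed

lemma continuous_linear_cong:
  assumes J: "continuous_linear_L2 R V A \<phi> J" and V: "\<And>f g. f \<in> V \<Longrightarrow> g \<in> V \<Longrightarrow> (\<lambda>x. f x - g x) \<in> V"
    and f: "f \<in> V" "g \<in> V" and eq: "(\<integral>x. (f x - g x)\<^sup>2 \<partial>R) = 0"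
  shows "J f = J g"
proof -
  have "(\<lambda>k::nat. vec (J g)) \<longlonglongrightarrow> vec (J f)"
    by (rule continuous_linear_tendsto [OF J V f]) (simp_all add: eq)
  then have "vec (J f) = vec (J g)" by (simp add: LIMSEQ_const_iff)
  then show ?thesis
    by (intro vec_eqI continuous_linear_L2D(1) [OF J] f) simp
qed

lemma continuous_linear_zero:
  assumes J: "continuous_linear_L2 R V A \<phi> J" and z: "(\<lambda>x. 0) \<in> V"
  shows "J (\<lambda>x. 0) = 0"
  using continuous_linear_L2D(2) [OF J z z, of 0 0] by simp

lemma continuous_linear_sum:
  assumes J: "continuous_linear_L2 R V A \<phi> J" and z: "(\<lambda>x. 0) \<in> V"
    and V: "\<And>f g c d. f \<in> V \<Longrightarrow> g \<in> V \<Longrightarrow> (\<lambda>x. c * f x + d * g x) \<in> V"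
    and "finite I" "\<And>i. i \<in> I \<Longrightarrow> f i \<in> V"
  shows "(\<lambda>x. \<Sum>i\<in>I. c i * f i x) \<in> V \<and> J (\<lambda>x. \<Sum>i\<in>I. c i * f i x) = (\<Sum>i\<in>I. c i *\<^sub>R J (f i))"
  using assms(4,5)
proof (induction I rule: finite_induct)
  case empty
  then show ?case using z continuous_linear_zero [OF J z] by simp
next
  case (insert j I)
  let ?g = "\<lambda>x. \<Sum>i\<in>I. c i * f i x"
  have IH: "?g \<in> V" "J ?g = (\<Sum>i\<in>I. c i *\<^sub>R J (f i))" using insert by auto
  have fj: "f j \<in> V" using insert by simp
  show ?case
    using V [OF fj IH(1), of "c j" 1] continuous_linear_L2D(2) [OF J fj IH(1), of "c j" 1] insert(1,2)
    by (simp add: IH(2))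
qed

end

section \<open>Free Brownian increments as semicircular letters\<close>

locale brownian_extension = semicircular_extension A \<phi> M \<psi> \<iota> L \<Omega>
  for A :: "'h::complex_hilbert_space bop set" and \<phi> and M :: "'k::complex_hilbert_space bop set"
    and \<psi> \<iota> L \<Omega> +
  fixes S :: "real \<Rightarrow> 'h bop"
  assumes brownian: "free_brownian_motion A \<phi> S"
begin

lemma S_A: "0 \<le> t \<Longrightarrow> S t \<in> A"
  and S_self_adjoint: "0 \<le> t \<Longrightarrow> adj (S t) = S t"
  and S_increment: "0 \<le> s \<Longrightarrow> s \<le> t \<Longrightarrow> has_semicircle_law \<phi> (S t - S s) (t - s)"
  and S_free: "0 \<le> r 0 \<Longrightarrow> (\<And>i. i < n \<Longrightarrow> r i < r (Suc i)) \<Longrightarrow>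
    free_independent \<phi> {..<n} (\<lambda>i. {S (r (Suc i)) - S (r i)})"
proof -
  from brownian [unfolded free_brownian_motion_def]
  have 1: "\<forall>t\<ge>0. S t \<in> A \<and> self_adjoint (S t)"
    and 2: "\<forall>s t. 0 \<le> s \<and> s \<le> t \<longrightarrow> has_semicircle_law \<phi> (S t - S s) (t - s)"
    and 3: "\<forall>(t :: nat \<Rightarrow> real) n. 0 \<le> t 0 \<and> (\<forall>i<n. t i < t (Suc i))
        \<longrightarrow> free_independent \<phi> {..<n} (\<lambda>i. {S (t (Suc i)) - S (t i)})"
    by - (elim conjE, assumption)+
  show "0 \<le> t \<Longrightarrow> S t \<in> A" "0 \<le> t \<Longrightarrow> adj (S t) = S t"
    using 1 by (auto simp: self_adjoint_def)
  show "0 \<le> s \<Longrightarrow> s \<le> t \<Longrightarrow> has_semicircle_law \<phi> (S t - S s) (t - s)"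
    using 2 by blast
  show "0 \<le> r 0 \<Longrightarrow> (\<And>i. i < n \<Longrightarrow> r i < r (Suc i)) \<Longrightarrow>
    free_independent \<phi> {..<n} (\<lambda>i. {S (r (Suc i)) - S (r i)})"
    by (rule 3 [rule_format]) simp
qed

definition increment :: "nat \<Rightarrow> nat \<Rightarrow> 'h bop" where
  "increment N i = S (real (Suc i) / 2 ^ N) - S (real i / 2 ^ N)"

lemma increment_A: "increment N i \<in> A"
  unfolding increment_def by (intro base.alg_diff S_A) simp_all

lemma increment_self_adjoint: "adj (increment N i) = increment N i"
  by (simp add: increment_def adj_diff S_self_adjoint)

definition letter :: "nat \<Rightarrow> nat \<Rightarrow> 'h bop" where
  "letter N i = (1 / sqrt (1 / 2 ^ N)) *\<^sub>R increment N i"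

lemma letter_A: "letter N i \<in> A"
  unfolding letter_def by (intro base.alg_scaleR increment_A)

lemma increment_letter: "increment N i = sqrt (1 / 2 ^ N) *\<^sub>R letter N i"
  by (simp add: letter_def)

lemma phi_cheb_letter: "k \<ge> 1 \<Longrightarrow> \<phi> (cheb (letter N i) k) = 0"
proof -
  assume k: "k \<ge> 1"
  have "real i / 2 ^ N \<le> real (Suc i) / 2 ^ N" by (intro divide_right_mono) auto
  then have "has_semicircle_law \<phi> (increment N i) (real (Suc i) / 2 ^ N - real i / 2 ^ N)"
    unfolding increment_def by (intro S_increment) simp_all
  moreover have "real (Suc i) / 2 ^ N - real i / 2 ^ N = 1 / 2 ^ N"
    by (simp flip: diff_divide_distrib)
  ultimately have "has_semicircle_law \<phi> (increment N i) (1 / 2 ^ N)" by metis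
  from base.cheb_semicircular [OF increment_A this, of k] k show ?thesis
    by (simp add: letter_def)
qed

lemma cheb_letter_generated: "cheb (letter N i) k \<in> star_algebra_generated {increment N i}"
proof -
  have "cheb (letter N i) k \<in> B" if B: "unital_star_subalgebra B" "increment N i \<in> B" for B
  proof -
    have B': "1 \<in> B" "\<And>x y. x \<in> B \<Longrightarrow> y \<in> B \<Longrightarrow> x + y \<in> B" "\<And>x y. x \<in> B \<Longrightarrow> y \<in> B \<Longrightarrow> x * y \<in> B"
      "\<And>x c. x \<in> B \<Longrightarrow> c *\<^sub>C x \<in> B"
      using B(1) by (auto simp: unital_star_subalgebra_def)
    have diff: "x - y \<in> B" if "x \<in> B" "y \<in> B" for x y
      using B'(2) [OF that(1) B'(4) [OF that(2), of "-1"]] by (simp add: scaleC_minus_left scaleC_one)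
    have l: "letter N i \<in> B"
      using B'(4) [OF B(2), of "complex_of_real (1 / sqrt (1 / 2 ^ N))"] by (simp only: letter_def scaleC_of_real)
    show ?thesis
      by (induction k rule: induct_nat_012) (auto intro: B' diff l)
  qed
  then show ?thesis by (auto simp: star_algebra_generated_def)
qed

text \<open>A word is cut into maximal runs of one letter. Nothing contracts across the borders, and
  each run is a Chebyshev polynomial in its letter. For centred runs this is exactly the kind of
  alternating product that freeness speaks about.\<close>

lemma wick_runs:
  assumes "w \<noteq> []"
  shows "\<exists>ws :: (nat \<times> 'h bop) list. ws \<noteq> [] \<and> successively (\<noteq>) (map fst ws) \<and> fst (hd ws) = hd w \<and>
    prod_list (map snd ws) = wick s w \<and> (\<forall>(i, x)\<in>set ws. i \<in> set w \<and> (\<exists>k\<ge>1. x = cheb (s i) k))"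
  using assms
proof (induction w rule: length_induct)
  case (1 w)
  obtain i w' where w: "w = i # w'" using 1(2) by (cases w) auto
  define k where "k = length (takeWhile (\<lambda>j. j = i) w)"
  define v where "v = dropWhile (\<lambda>j. j = i) w"
  have "takeWhile (\<lambda>j. j = i) w = replicate k i"
    unfolding k_def by (rule replicate_eqI) (auto dest: set_takeWhileD)
  then have wv: "w = replicate k i @ v" unfolding v_def using takeWhile_dropWhile_id by metis
  have k: "k \<ge> 1" by (simp add: k_def w)
  have i: "hd w = i" "i \<in> set w" by (simp_all add: w)
  show ?case
  proof (cases "v = []")
    case True
    then have "wick s w = cheb (s i) k" by (simp add: wv wick_replicate)
    then show ?thesis
      using k i by (intro exI [of _ "[(i, cheb (s i) k)]"]) auto
  next
    case False
    have hd: "hd v \<noteq> i" using False hd_dropWhile [of "\<lambda>j. j = i" w] by (simp add: v_def)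
    have "length v < length w" using arg_cong [OF wv, of length] k by simp
    from 1(1) [rule_format, OF this False] obtain ws :: "(nat \<times> 'h bop) list"
      where ws: "ws \<noteq> []" "successively (\<noteq>) (map fst ws)" "fst (hd ws) = hd v"
        "prod_list (map snd ws) = wick s v" "\<forall>(i, x)\<in>set ws. i \<in> set v \<and> (\<exists>k\<ge>1. x = cheb (s i) k)"
      by (elim exE conjE)
    have v_sub: "set v \<subseteq> set w" by (auto simp: v_def dest: set_dropWhileD)
    have last: "last (replicate k i) \<noteq> hd v" using hd k by simp
    have "wick s w = cheb (s i) k * wick s v"
      using wick_append [OF _ False last, of s] k by (simp add: wv wick_replicate)
    moreover have "successively (\<noteq>) (map fst ((i, cheb (s i) k) # ws))"
      using ws(1,2,3) hd by (cases ws) auto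
    ultimately show ?thesis
      using ws(4,5) k i v_sub by (intro exI [of _ "(i, cheb (s i) k) # ws"]) auto
  qed
qed

lemma wick_letter:
  assumes "w \<noteq> []"
  shows "\<phi> (wick (letter N) w) = 0"
proof -
  obtain ws where ws: "ws \<noteq> []" "successively (\<noteq>) (map fst ws)" "prod_list (map snd ws) = wick (letter N) w"
    "\<forall>(i, x)\<in>set ws. i \<in> set w \<and> (\<exists>k\<ge>1. x = cheb (letter N i) k)"
    using wick_runs [OF assms, of "letter N"] by (elim exE conjE)
  define n where "n = Suc (Max (set w))"
  have free: "free_independent \<phi> {..<n} (\<lambda>i. {increment N i})"
    unfolding increment_def by (rule S_free) (simp_all add: divide_strict_right_mono)
  have less: "i < n" if "i \<in> set w" for i
    using that by (simp add: n_def less_Suc_eq_le)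
  have "\<forall>(i, x)\<in>set ws. i \<in> {..<n} \<and> x \<in> star_algebra_generated {increment N i} \<and> \<phi> x = 0"
    using ws(4) less cheb_letter_generated phi_cheb_letter by fastforce
  then have "\<phi> (prod_list (map snd ws)) = 0"
    using free ws(1,2) unfolding free_independent_def by blast
  then show ?thesis by (simp add: ws(3))
qed

lemma psi_wick_letter: "\<psi> (wick (extend (letter N)) w) = (if w = [] then 1 else 0)"
proof (cases "w = []")
  case True
  then show ?thesis by (simp add: phi_one)
next
  case False
  then show ?thesis
    using wick_extend [of "letter N" w, OF letter_A wick_letter] by simp
qed

lemma moments_quadratic_letter:
  assumes "\<And>i j. i < n \<Longrightarrow> j < n \<Longrightarrow> D i j = D j i"
  shows "\<psi> (quadratic (extend (letter N)) n D b ^ k) = complex_of_real (moment_series (cumulant n D b) $ k)"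
proof (rule wick_quadratic.moments_quadratic [OF wick_quadratic.intro [OF assms]])
  show "\<psi> (x + y) = \<psi> x + \<psi> y" for x y by (simp add: psi cinner_add_right)
  show "\<psi> (r *\<^sub>R x) = complex_of_real r * \<psi> x" for r x
    using bop_apply_simps by (simp add: psi cinner_scaleR_right)
qed (simp_all add: psi_wick_letter)

lemma semicircle_a: "0 \<le> r \<Longrightarrow> has_semicircle_law \<psi> (r *\<^sub>R a) (r\<^sup>2)"
proof (rule has_semicircle_law_cheb)
  show "a \<in> M" using a_M by (simp add: a_def)
  fix n :: nat assume n: "n \<ge> 1"
  have "wick (extend (letter 0)) (replicate n 0) = cheb a n"
    by (simp add: wick_replicate extend_def)
  then show "\<psi> (cheb a n) = 0"
    using psi_wick_letter [of 0 "replicate n 0"] n by simp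
qed

lemma iota_sum: "(\<And>i. i \<in> I \<Longrightarrow> f i \<in> A) \<Longrightarrow> \<iota> (sum f I) = (\<Sum>i\<in>I. \<iota> (f i)) \<and> sum f I \<in> A"
proof (induction I rule: infinite_finite_induct)
  case (infinite I)
  then show ?case using iota_scaleC [OF base.alg(1), of 0] by (simp add: scaleC_zero_left base.alg_zero)
next
  case empty
  then show ?case using iota_scaleC [OF base.alg(1), of 0] by (simp add: scaleC_zero_left base.alg_zero)
qed (simp_all add: iota_add base.alg)

text \<open>On step functions all candidates for the integral agree, which resolves the definite
  description there; nothing more is asked of the single integral.\<close>

lemma wigner_integral1_step:
  assumes "\<exists>J. is_wigner_integral1 A \<phi> S J"
  shows "wigner_integral1 A \<phi> S (\<lambda>x. \<Sum>i<n. c i * cell_indicator N i x) = (\<Sum>i<n. c i *\<^sub>R increment N i)"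
proof -
  let ?h = "\<lambda>x. \<Sum>i<n. c i * cell_indicator N i x"
  have "J ?h = (\<Sum>i<n. c i *\<^sub>R increment N i)" if "is_wigner_integral1 A \<phi> S J" for J
  proof -
    have J: "continuous_linear_L2 Rplus (L2 Rplus) A \<phi> J"
      and Ji: "\<And>s t. 0 \<le> s \<Longrightarrow> s \<le> t \<Longrightarrow> J (indicat_real {s..t}) = S t - S s"
      using that unfolding is_wigner_integral1_def by blast+
    have cell: "J (cell_indicator N i) = increment N i" for i
    proof -
      have "J (cell_indicator N i) = J (indicat_real {real i / 2 ^ N .. real (Suc i) / 2 ^ N})"
        by (rule continuous_linear_cong [OF J L2_diff cell_indicator_L2 indicator_Icc_L2 cell_indicator_AE]) simp_all
      also have "\<dots> = increment N i"
        unfolding increment_def by (rule Ji) (simp_all add: divide_right_mono)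
      finally show ?thesis .
    qed
    have z: "(\<lambda>x. 0) \<in> L2 Rplus" by (simp add: L2_def)
    have "?h \<in> L2 Rplus \<and> J ?h = (\<Sum>i<n. c i *\<^sub>R J (cell_indicator N i))"
      by (rule continuous_linear_sum [OF J z L2_lincomb finite_lessThan cell_indicator_L2])
    then show ?thesis by (simp add: cell)
  qed
  then show ?thesis
    unfolding wigner_integral1_def using assms by (intro the_equality) auto
qed

section \<open>Double integrals of grid kernels\<close>

context
  fixes J assumes J: "is_wigner_integral2 A \<phi> S J"
begin

lemma J_linear: "continuous_linear_L2 (Rplus \<Otimes>\<^sub>M Rplus) L2_sym A \<phi> J"
  and J_square: "h \<in> L2 Rplus \<Longrightarrow> J (\<lambda>(x, y). h x * h y) = (wigner_integral1 A \<phi> S h)\<^sup>2 - (\<integral>t. (h t)\<^sup>2 \<partial>Rplus) *\<^sub>R 1"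
  using J unfolding is_wigner_integral2_def by blast+

text \<open>Otherwise \<open>wigner_integral1\<close> is one operator \<open>c\<close> for all h.
  Taking h = 0 gives c^2 = 0, so \<open>J\<close> sends h \<otimes> h to minus the squared norm of
  h, times 1. The sum of h \<otimes> h over n orthonormal unit cells then goes to -n, although its
  norm in L2 is sqrt n; this contradicts the continuity of \<open>J\<close>.\<close>

lemma wigner_integral1_exists: "\<exists>J. is_wigner_integral1 A \<phi> S J"
proof (rule ccontr)
  assume no: "\<nexists>J. is_wigner_integral1 A \<phi> S J"
  define c where "c = wigner_integral1 A \<phi> S (\<lambda>x. 0)"
  have W1: "wigner_integral1 A \<phi> S h = c" for h
    using no by (simp add: c_def wigner_integral1_def)
  have "c\<^sup>2 = 0"
    using J_square [of "\<lambda>x. 0"] continuous_linear_zero [OF J_linear L2_sym_zero]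
    by (simp add: W1 L2_def case_prod_beta')
  then have Jsq: "J (\<lambda>(x, y). h x * h y) = - (\<integral>t. (h t)\<^sup>2 \<partial>Rplus) *\<^sub>R 1" if "h \<in> L2 Rplus" for h
    using J_square [OF that] by (simp add: W1)
  define e where "e i = (\<lambda>k l. (if k = i then 1 else 0) * (if l = i then 1 else 0) :: real)" for i :: nat
  have e: "grid_function 0 (e i) \<in> L2_sym" "J (grid_function 0 (e i)) = - 1" for i
  proof -
    have "supported (Suc i) (e i)" by (auto simp: supported_def e_def)
    then show "grid_function 0 (e i) \<in> L2_sym" by (rule grid_function_L2_sym) (simp add: e_def)
    have "(\<Sum>k<Suc i. (if k = i then 1 else 0 :: real)\<^sup>2) = 1" by simp
    then show "J (grid_function 0 (e i)) = - 1"
      using Jsq [OF step_function(2) [where N = 0 and n = "Suc i" and u = "\<lambda>k. if k = i then 1 else 0"]]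
        step_function(3) [where N = 0 and n = "Suc i" and u = "\<lambda>k. if k = i then 1 else 0"]
      by (simp add: grid_function_def e_def)
  qed
  define D where "D n = (\<lambda>k l. \<Sum>i<n. e i k l)" for n
  have sum: "(\<lambda>x. \<Sum>i<n. 1 * grid_function 0 (e i) x) = grid_function 0 (D n)" for n
    by (auto simp: grid_function_def D_def)
  have D: "D n k l = (if k = l \<and> k < n then 1 else 0)" for n k l
    by (auto simp: D_def e_def if_distrib [of "times _"] cong: if_cong)
  have supp: "supported n (D n)" for n by (auto simp: D supported_def)
  have "(\<lambda>x. \<Sum>i<n. 1 * grid_function 0 (e i) x) \<in> L2_sym \<and>
      J (\<lambda>x. \<Sum>i<n. 1 * grid_function 0 (e i) x) = (\<Sum>i<n. 1 *\<^sub>R J (grid_function 0 (e i)))" for n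
    by (rule continuous_linear_sum [OF J_linear L2_sym_zero L2_sym_lincomb finite_lessThan e(1)])
  moreover have "(\<Sum>i<n. 1 *\<^sub>R J (grid_function 0 (e i))) = - real n *\<^sub>R 1" for n
    by (simp only: e(2) scaleR_one sum_constant_scaleR card_lessThan) simp
  ultimately have JD: "grid_function 0 (D n) \<in> L2_sym" "J (grid_function 0 (D n)) = - real n *\<^sub>R 1" for n
    by (simp_all only: sum)
  obtain C where C: "0 \<le> C" "\<And>f. f \<in> L2_sym \<Longrightarrow> norm (vec (J f)) \<le> C * L2_norm (Rplus \<Otimes>\<^sub>M Rplus) f"
    using continuous_linear_L2D(3) [OF J_linear] by blast
  have "real n \<le> C * sqrt (real n)" for n
  proof -
    have "vec (- real n *\<^sub>R 1) = - real n *\<^sub>R \<Omega>"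
      using vec_scaleR [OF base.alg(1), of "- real n"] by (simp add: vec_def iota_hom)
    then have "norm (vec (J (grid_function 0 (D n)))) = real n"
      by (simp add: JD norm_vac)
    moreover have "L2_norm (Rplus \<Otimes>\<^sub>M Rplus) (grid_function 0 (D n)) = sqrt (real n)"
      unfolding L2_norm_def grid_function_square integral_grid_function [OF supported_square [OF supp]]
      by (simp add: D if_distrib [of "\<lambda>x. x\<^sup>2"] cong: if_cong)
    ultimately show ?thesis using C(2) [OF JD(1), of n] by simp
  qed
  note bound = this
  obtain m :: nat where m: "C < real m" using reals_Archimedean2 by blast
  then have "0 < real m" using C(1) by linarith
  moreover have "real m * real m \<le> C * real m" using bound [of "m * m"] by simp
  ultimately show False using m by simp
qed

lemma J_step:
  assumes u: "\<And>i. n \<le> i \<Longrightarrow> u i = 0"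
  shows "J (grid_function N (\<lambda>i j. u i * u j)) = (\<Sum>i<n. u i *\<^sub>R increment N i)\<^sup>2 - ((\<Sum>i<n. (u i)\<^sup>2) / 2 ^ N) *\<^sub>R 1"
proof -
  have "wigner_integral1 A \<phi> S (\<lambda>x. u (cell N x)) = (\<Sum>i<n. u i *\<^sub>R increment N i)"
    using wigner_integral1_step [OF wigner_integral1_exists, where c = u and n = n and N = N]
    by (simp only: step_function(1) [where u = u and n = n, OF u])
  moreover have "grid_function N (\<lambda>i j. u i * u j) = (\<lambda>(x, y). u (cell N x) * u (cell N y))"
    by (simp add: grid_function_def)
  ultimately show ?thesis
    using J_square [OF step_function(2) [where u = u and n = n and N = N, OF u]]
    by (simp only: step_function(3) [where u = u and n = n and N = N, OF u])
qed

text \<open>\<open>J\<close> is prescribed on squares u \<otimes> u only. Polarisation with the sum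
  of \<open>e i\<close> and \<open>e j\<close> yields the kernels \<open>f (i, j)\<close>, which are
  \<open>e i\<close> \<otimes> \<open>e j\<close> plus its transpose, and half of their combinations
  with coefficients \<open>D i j\<close> is the given kernel.\<close>

lemma J_grid:
  assumes D: "supported n D" "\<And>i j. D i j = D j i"
  shows "J (grid_function N D) = (\<Sum>i<n. \<Sum>j<n. D i j *\<^sub>R (increment N i * increment N j - (if i = j then 1 / 2 ^ N else 0) *\<^sub>R 1))"
proof -
  define e :: "nat \<Rightarrow> nat \<Rightarrow> real" where "e i k = (if k = i then 1 else 0)" for i k
  define G where "G u = grid_function N (\<lambda>k l. u k * u l)" for u :: "nat \<Rightarrow> real"
  let ?d = "increment N"
  have G_sym: "G u \<in> L2_sym" if "\<And>k. n \<le> k \<Longrightarrow> u k = 0" for u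
    unfolding G_def by (rule grid_function_L2_sym [of n]) (use that in \<open>auto simp: supported_def\<close>)
  define f where "f = (\<lambda>(i, j) p. G (\<lambda>k. e i k + e j k) p - G (e i) p - G (e j) p)"
  have f: "f (i, j) \<in> L2_sym" "J (f (i, j)) = ?d i * ?d j + ?d j * ?d i - (if i = j then 2 / 2 ^ N else 0) *\<^sub>R 1"
    if ij: "i < n" "j < n" for i j
  proof -
    have z: "\<And>k. n \<le> k \<Longrightarrow> e i k + e j k = 0" "\<And>k. n \<le> k \<Longrightarrow> e i k = 0" "\<And>k. n \<le> k \<Longrightarrow> e j k = 0"
      using ij by (auto simp: e_def)
    note Gij = G_sym [of "\<lambda>k. e i k + e j k", OF z(1)] and Gi = G_sym [of "e i", OF z(2)] and Gj = G_sym [of "e j", OF z(3)]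
    note G1 = L2_sym_diff [OF Gij Gi]
    show "f (i, j) \<in> L2_sym"
      using L2_sym_diff [OF G1 Gj] by (simp add: f_def)
    have "J (f (i, j)) = J (G (\<lambda>k. e i k + e j k)) - J (G (e i)) - J (G (e j))"
      using continuous_linear_diff [OF J_linear G1 Gj] continuous_linear_diff [OF J_linear Gij Gi]
      by (simp add: f_def)
    moreover have de: "(\<Sum>k<n. e i k *\<^sub>R ?d k) = ?d i" "(\<Sum>k<n. (e i k)\<^sup>2) = 1" if "i < n" for i
      using that by (simp_all add: e_def if_distrib [of "\<lambda>x. x *\<^sub>R _"] if_distrib [of "\<lambda>x. x\<^sup>2"] cong: if_cong)
    moreover have "(\<Sum>k<n. (e i k + e j k) *\<^sub>R ?d k) = ?d i + ?d j"
      using de ij by (simp add: scaleR_add_left sum.distrib)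
    moreover have "(\<Sum>k<n. (e i k + e j k)\<^sup>2) = 2 + (if i = j then 2 else 0)"
    proof -
      have "(\<Sum>k<n. e i k * e j k) = (if i = j then 1 else 0)"
        using ij by (simp add: e_def if_distrib [of "\<lambda>x. x * _"] cong: if_cong)
      then show ?thesis
        using de ij by (simp add: power2_sum sum.distrib mult.assoc flip: sum_distrib_left)
    qed
    ultimately have Jf: "J (f (i, j)) = (?d i + ?d j)\<^sup>2 - ((2 + (if i = j then 2 else 0)) / 2 ^ N) *\<^sub>R 1
        - ((?d i)\<^sup>2 - (1 / 2 ^ N) *\<^sub>R 1) - ((?d j)\<^sup>2 - (1 / 2 ^ N) *\<^sub>R 1)"
      using J_step [where u = "\<lambda>k. e i k + e j k" and n = n and N = N] J_step [where u = "e i" and n = n and N = N]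
        J_step [where u = "e j" and n = n and N = N] ij z
      by (simp add: G_def)
    have two: "(2 / 2 ^ N) *\<^sub>R 1 = (1 / 2 ^ N) *\<^sub>R 1 + (1 / 2 ^ N) *\<^sub>R (1 :: 'h bop)"
      by (simp flip: scaleR_add_left)
    have four: "(4 / 2 ^ N) *\<^sub>R 1 = (1 / 2 ^ N) *\<^sub>R 1 + (1 / 2 ^ N) *\<^sub>R 1 + (1 / 2 ^ N) *\<^sub>R 1 + (1 / 2 ^ N) *\<^sub>R (1 :: 'h bop)"
      by (simp flip: scaleR_add_left)
    show "J (f (i, j)) = ?d i * ?d j + ?d j * ?d i - (if i = j then 2 / 2 ^ N else 0) *\<^sub>R 1"
      unfolding Jf using two four by (cases "i = j") (simp_all add: power2_eq_square distrib_left distrib_right)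
  qed
  let ?I = "{..<n} \<times> {..<n}"
  have "grid_function N D = (\<lambda>p. \<Sum>q\<in>?I. (case q of (i, j) \<Rightarrow> D i j / 2) * f q p)"
  proof (rule ext)
    fix p :: "real \<times> real"
    obtain x y where p: "p = (x, y)" by (cases p)
    let ?c = "cell N x" and ?c' = "cell N y"
    have "(\<Sum>q\<in>?I. (case q of (i, j) \<Rightarrow> D i j / 2) * f q p)
        = (\<Sum>i<n. \<Sum>j<n. D i j / 2 * (e i ?c * e j ?c' + e j ?c * e i ?c'))"
      unfolding sum.cartesian_product by (intro sum.cong) (auto simp: f_def G_def grid_function_def p algebra_simps)
    also have "\<dots> = (\<Sum>i<n. \<Sum>j<n. D i j / 2 * (e i ?c * e j ?c')) + (\<Sum>i<n. \<Sum>j<n. D i j / 2 * (e j ?c * e i ?c'))"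
      by (simp add: distrib_left sum.distrib)
    also have "(\<Sum>i<n. \<Sum>j<n. D i j / 2 * (e j ?c * e i ?c')) = (\<Sum>i<n. \<Sum>j<n. D i j / 2 * (e i ?c * e j ?c'))"
      by (subst sum.swap) (simp add: D(2))
    also have "(\<Sum>i<n. \<Sum>j<n. D i j / 2 * (e i ?c * e j ?c')) = grid_function N D p / 2"
      using grid_function_sum [OF D(1), of N x y] by (simp add: p e_def cell_indicator_def sum_divide_distrib)
    finally show "grid_function N D p = (\<Sum>q\<in>?I. (case q of (i, j) \<Rightarrow> D i j / 2) * f q p)" by simp
  qed
  moreover have "J (\<lambda>p. \<Sum>q\<in>?I. (case q of (i, j) \<Rightarrow> D i j / 2) * f q p) = (\<Sum>q\<in>?I. (case q of (i, j) \<Rightarrow> D i j / 2) *\<^sub>R J (f q))"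
    using f(1) by (intro continuous_linear_sum [OF J_linear L2_sym_zero L2_sym_lincomb, THEN conjunct2]) auto
  ultimately have "J (grid_function N D) = (\<Sum>q\<in>?I. (case q of (i, j) \<Rightarrow> D i j / 2) *\<^sub>R J (f q))" by simp
  also have "\<dots> = (\<Sum>i<n. \<Sum>j<n. (D i j / 2) *\<^sub>R (?d i * ?d j - (if i = j then 1 / 2 ^ N else 0) *\<^sub>R 1) +
      (D i j / 2) *\<^sub>R (?d j * ?d i - (if j = i then 1 / 2 ^ N else 0) *\<^sub>R 1))"
    unfolding sum.cartesian_product by (intro sum.cong) (auto simp: f(2) algebra_simps simp flip: scaleR_add_left)
  also have "\<dots> = (\<Sum>i<n. \<Sum>j<n. (D i j / 2) *\<^sub>R (?d i * ?d j - (if i = j then 1 / 2 ^ N else 0) *\<^sub>R 1)) +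
      (\<Sum>i<n. \<Sum>j<n. (D i j / 2) *\<^sub>R (?d j * ?d i - (if j = i then 1 / 2 ^ N else 0) *\<^sub>R 1))"
    by (simp add: sum.distrib)
  also have "(\<Sum>i<n. \<Sum>j<n. (D i j / 2) *\<^sub>R (?d j * ?d i - (if j = i then 1 / 2 ^ N else 0) *\<^sub>R 1))
      = (\<Sum>i<n. \<Sum>j<n. (D i j / 2) *\<^sub>R (?d i * ?d j - (if i = j then 1 / 2 ^ N else 0) *\<^sub>R 1))"
    by (subst sum.swap) (simp add: D(2))
  finally show ?thesis
    by (simp flip: sum.distrib scaleR_add_left)
qed

text \<open>Each increment is its letter of variance 1 times the square root of 1 / 2^N, and two of
  them occur in every term; this is where the factor on \<open>D\<close> comes from.\<close>

lemma iota_J_grid: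
  assumes D: "supported n D" "\<And>i j. D i j = D j i"
  shows "b *\<^sub>R a + \<iota> (J (grid_function N D)) = quadratic (extend (letter N)) n (\<lambda>i j. D i j / 2 ^ N) b"
proof -
  let ?s = "extend (letter N)"
  define t where "t i j = D i j *\<^sub>R (increment N i * increment N j - (if i = j then 1 / 2 ^ N else 0) *\<^sub>R 1)" for i j
  have tA: "t i j \<in> A" for i j
    unfolding t_def by (intro base.alg_scaleR base.alg_diff base.alg increment_A)
  have "\<iota> (J (grid_function N D)) = (\<Sum>i<n. \<Sum>j<n. \<iota> (t i j))"
  proof -
    have "\<iota> (\<Sum>i<n. \<Sum>j<n. t i j) = (\<Sum>i<n. \<iota> (\<Sum>j<n. t i j))"
      using iota_sum [of "{..<n}" "t _"] tA by (intro iota_sum [THEN conjunct1]) auto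
    also have "\<dots> = (\<Sum>i<n. \<Sum>j<n. \<iota> (t i j))"
      using tA by (intro sum.cong refl iota_sum [THEN conjunct1])
    finally show ?thesis by (simp add: J_grid [OF D] t_def)
  qed
  also have "\<dots> = (\<Sum>i<n. \<Sum>j<n. (D i j / 2 ^ N) *\<^sub>R (?s (Suc i) * ?s (Suc j) - (if i = j then 1 else 0)))"
  proof (intro sum.cong refl)
    fix i j
    have "increment N i * increment N j = (1 / 2 ^ N) *\<^sub>R (letter N i * letter N j)"
    proof -
      have "sqrt (1 / 2 ^ N) * sqrt (1 / 2 ^ N) = 1 / (2 ^ N :: real)" by (rule real_sqrt_mult_self [THEN trans]) simp
      then show ?thesis by (simp only: increment_letter bop_algebra_simps scaleR_scaleR)
    qed
    then have "t i j = (D i j / 2 ^ N) *\<^sub>R (letter N i * letter N j - (if i = j then 1 else 0) *\<^sub>R 1)"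
      by (simp add: t_def scaleR_diff_right)
    then have "\<iota> (t i j) = (D i j / 2 ^ N) *\<^sub>R (\<iota> (letter N i) * \<iota> (letter N j) - (if i = j then 1 else 0) *\<^sub>R 1)"
      by (simp add: iota_scaleR iota_diff iota_hom letter_A base.alg base.alg_diff base.alg_scaleR base.alg_zero)
    then show "\<iota> (t i j) = (D i j / 2 ^ N) *\<^sub>R (?s (Suc i) * ?s (Suc j) - (if i = j then 1 else 0))"
      by (simp add: extend_def)
  qed
  finally show ?thesis by (simp add: quadratic_def extend_def)
qed

lemma moments_J_grid:
  assumes D: "supported n D" "\<And>i j. D i j = D j i"
  shows "\<psi> ((b *\<^sub>R a + \<iota> (J (grid_function N D))) ^ k)
    = complex_of_real (moment_series (cumulant n (\<lambda>i j. D i j / 2 ^ N) b) $ k)"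
  unfolding iota_J_grid [OF D] by (rule moments_quadratic_letter) (simp add: D(2))

end

end

section \<open>Limits in the second chaos\<close>

lemma L2_sym_grid_sequence:
  assumes "f \<in> L2_sym"
  shows "\<exists>N n D. (\<forall>k. supported (n k) (D k)) \<and> (\<forall>k i j. D k i j = D k j i) \<and>
    (\<lambda>k. \<integral>p. (f p - grid_function (N k) (D k) p)\<^sup>2 \<partial>(Rplus \<Otimes>\<^sub>M Rplus)) \<longlonglongrightarrow> 0"
proof -
  define P where "P k N n D \<longleftrightarrow> supported n D \<and> (\<forall>i j. D i j = D j i) \<and>
      (\<integral>p. (f p - grid_function N D p)\<^sup>2 \<partial>(Rplus \<Otimes>\<^sub>M Rplus)) < inverse (real (Suc k))" for k N n D
  have "\<forall>k. \<exists>N n D. P k N n D"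
    using symmetric_grid_functions_dense [OF assms] by (simp add: P_def)
  from choice [OF this] obtain N where "\<forall>k. \<exists>n D. P k (N k) n D" by (elim exE)
  from choice [OF this] obtain n where "\<forall>k. \<exists>D. P k (N k) (n k) D" by (elim exE)
  from choice [OF this] obtain D where P: "\<forall>k. P k (N k) (n k) (D k)" by (elim exE)
  then have D: "\<forall>k. supported (n k) (D k)" "\<forall>k i j. D k i j = D k j i"
    and less: "\<And>k. (\<integral>p. (f p - grid_function (N k) (D k) p)\<^sup>2 \<partial>(Rplus \<Otimes>\<^sub>M Rplus)) < inverse (real (Suc k))"
    by (simp_all add: P_def)
  have "(\<lambda>k. \<integral>p. (f p - grid_function (N k) (D k) p)\<^sup>2 \<partial>(Rplus \<Otimes>\<^sub>M Rplus)) \<longlonglongrightarrow> 0"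
    by (rule Lim_null_comparison [OF always_eventually LIMSEQ_inverse_real_of_nat])
      (use less in \<open>auto intro: less_imp_le\<close>)
  then show ?thesis using D by blast
qed

text \<open>Unit cells have orthonormal indicators, so the diagonal kernel at level 0 has the
  eigenvalues \<mu> i. Truncation to the first \<open>k\<close> cells returns to kernels of finite
  support.\<close>

lemma diagonal_grid_function:
  assumes "summable (\<lambda>i. (\<mu> i)\<^sup>2)"
  shows "grid_function 0 (\<lambda>i j. if i = j then \<mu> i else 0) \<in> L2_sym"
    and "(\<lambda>k. \<integral>p. (grid_function 0 (\<lambda>i j. if i = j then \<mu> i else 0) p -
      grid_function 0 (\<lambda>i j. if i = j then if i < k then \<mu> i else 0 else 0) p)\<^sup>2 \<partial>(Rplus \<Otimes>\<^sub>M Rplus)) \<longlonglongrightarrow> 0"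
proof -
  let ?R = "Rplus \<Otimes>\<^sub>M Rplus"
  define g where "g = grid_function 0 (\<lambda>i j. if i = j then \<mu> i else 0)"
  define E where "E k = (\<lambda>i j. if i = j then if i < k then \<mu> i else 0 else 0)" for k :: nat
  have E: "supported k (E k)" for k by (auto simp: supported_def E_def)
  have trunc: "grid_function 0 (E k) (x, y) = (if cell 0 x < k then g (x, y) else 0)" for k x y
    by (simp add: grid_function_def g_def E_def)
  have lim: "(\<lambda>k. grid_function 0 (E k) p) \<longlonglongrightarrow> g p" for p
  proof -
    obtain x y where p: "p = (x, y)" by (cases p)
    have "\<forall>\<^sub>F k in sequentially. grid_function 0 (E k) p = g p"
      by (rule eventually_sequentiallyI [of "Suc (cell 0 x)"]) (simp add: p trunc)
    then show ?thesis by (rule tendsto_eventually)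
  qed
  have meas: "g \<in> borel_measurable ?R" unfolding g_def by (rule grid_function_measurable)
  have "integrable ?R (\<lambda>p. (g p)\<^sup>2)"
  proof (rule integrable_monotone_convergence)
    show "integrable ?R (\<lambda>p. (grid_function 0 (E k) p)\<^sup>2)" for k
      by (rule L2_integrable [OF grid_function_L2 [OF E]])
    show "AE p in ?R. mono (\<lambda>k. (grid_function 0 (E k) p)\<^sup>2)"
    proof (rule AE_I2, rule monoI)
      fix p :: "real \<times> real" and k l :: nat
      assume "k \<le> l"
      obtain x y where p: "p = (x, y)" by (cases p)
      show "(grid_function 0 (E k) p)\<^sup>2 \<le> (grid_function 0 (E l) p)\<^sup>2"
        using \<open>k \<le> l\<close> by (simp add: p trunc)
    qed
    show "AE p in ?R. (\<lambda>k. (grid_function 0 (E k) p)\<^sup>2) \<longlonglongrightarrow> (g p)\<^sup>2"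
      by (intro AE_I2 tendsto_power lim)
    have "(\<integral>p. (grid_function 0 (E k) p)\<^sup>2 \<partial>?R) = (\<Sum>i<k. (\<mu> i)\<^sup>2)" for k
      unfolding grid_function_square integral_grid_function [OF supported_square [OF E]]
      by (simp add: E_def if_distrib [of "\<lambda>x. x\<^sup>2"] cong: if_cong)
    then show "(\<lambda>k. \<integral>p. (grid_function 0 (E k) p)\<^sup>2 \<partial>?R) \<longlonglongrightarrow> (\<Sum>i. (\<mu> i)\<^sup>2)"
      using summable_LIMSEQ [OF assms] by simp
  qed (use meas in simp)
  then have gL: "g \<in> L2 ?R" using meas by (simp add: L2_def)
  then show "grid_function 0 (\<lambda>i j. if i = j then \<mu> i else 0) \<in> L2_sym"
    by (simp add: L2_sym_def g_def grid_function_def eq_commute)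
  have "(\<lambda>k. \<integral>p. (g p - grid_function 0 (E k) p)\<^sup>2 \<partial>?R) \<longlonglongrightarrow> 0"
  proof (rule L2_dominated_convergence(2) [OF grid_function_measurable meas gL _ lim])
    fix k and p :: "real \<times> real"
    obtain x y where p: "p = (x, y)" by (cases p)
    show "\<bar>grid_function 0 (E k) p\<bar> \<le> \<bar>g p\<bar>" by (simp add: p trunc)
  qed
  then show "(\<lambda>k. \<integral>p. (grid_function 0 (\<lambda>i j. if i = j then \<mu> i else 0) p -
      grid_function 0 (\<lambda>i j. if i = j then if i < k then \<mu> i else 0 else 0) p)\<^sup>2 \<partial>?R) \<longlonglongrightarrow> 0"
    by (simp only: g_def E_def)
qed

text \<open>The sum of the squared eigenvalues is at most \<open>K\<close>, so each eigenvalue is at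
  most \<open>K\<close> in modulus because K \<le> K^2. Hence a bound on the second cumulant
  controls all the others.\<close>

lemma trace_power_bound:
  assumes sym: "\<And>i j. i < n \<Longrightarrow> j < n \<Longrightarrow> D i j = D j i"
    and bound: "cumulant n D b 2 \<le> K" and K: "1 \<le> K"
  shows "\<bar>cumulant n D b r\<bar> \<le> K ^ r"
proof (cases "r < 2")
  case True
  then show ?thesis using K by (simp add: cumulant_def)
next
  case False
  obtain l where l: "\<And>r. (\<Sum>i<n. matpow n D r i i) = (\<Sum>i<n. l i ^ r)"
    using symmetric_eigenvalues [of n D] sym by blast
  have sq: "(\<Sum>i<n. (l i)\<^sup>2) \<le> K"
  proof -
    have "(\<Sum>i<n. (l i)\<^sup>2) + b\<^sup>2 \<le> K" using bound by (simp add: cumulant_def l)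
    then show ?thesis using zero_le_power2 [of b] by linarith
  qed
  show ?thesis
  proof (cases "r = 2")
    case True
    have "0 \<le> (\<Sum>i<n. (l i)\<^sup>2)" by (intro sum_nonneg) simp
    moreover have "K \<le> K\<^sup>2" using K by (simp add: power2_eq_square)
    ultimately show ?thesis using bound True by (simp add: cumulant_def l)
  next
    case r: False
    have li: "\<bar>l i\<bar> \<le> K" if "i < n" for i
    proof -
      have "(l i)\<^sup>2 \<le> (\<Sum>i<n. (l i)\<^sup>2)" using that by (intro member_le_sum) auto
      also note sq
      also have "K \<le> K\<^sup>2" using K by (simp add: power2_eq_square)
      finally show ?thesis using K abs_le_square_iff [of "l i" K] by simp
    qed
    have "\<bar>\<Sum>i<n. l i ^ r\<bar> \<le> (\<Sum>i<n. K ^ (r - 2) * (l i)\<^sup>2)"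
    proof (rule order_trans [OF sum_abs], rule sum_mono)
      fix i assume "i \<in> {..<n}"
      then have "\<bar>l i\<bar> ^ (r - 2) * \<bar>l i\<bar>\<^sup>2 \<le> K ^ (r - 2) * \<bar>l i\<bar>\<^sup>2"
        using li by (intro mult_right_mono power_mono) auto
      moreover have "\<bar>l i ^ r\<bar> = \<bar>l i\<bar> ^ (r - 2) * \<bar>l i\<bar>\<^sup>2"
      proof -
        have "r - 2 + 2 = r" using False by simp
        then show ?thesis by (metis power_abs power_add)
      qed
      ultimately show "\<bar>l i ^ r\<bar> \<le> K ^ (r - 2) * (l i)\<^sup>2" by simp
    qed
    also have "\<dots> = K ^ (r - 2) * (\<Sum>i<n. (l i)\<^sup>2)" by (simp add: sum_distrib_left)
    also have "\<dots> \<le> K ^ (r - 2) * K\<^sup>2"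
    proof (rule mult_left_mono)
      note sq
      also have "K \<le> K\<^sup>2" using K by (simp add: power2_eq_square)
      finally show "(\<Sum>i<n. (l i)\<^sup>2) \<le> K\<^sup>2" .
    qed (use K in simp)
    also have "\<dots> = K ^ r" by (metis False le_add_diff_inverse2 not_less power_add)
    finally show ?thesis using False r by (simp add: cumulant_def l)
  qed
qed

lemma cumulant_diagonal:
  assumes "r \<ge> 2"
  shows "cumulant n (\<lambda>i j. if i = j then \<mu> i else 0) b r = (\<Sum>i<n. \<mu> i ^ r) + (if r = 2 then b\<^sup>2 else 0)"
proof -
  have "matpow n (\<lambda>i j. if i = j then \<mu> i else 0) r i j = (if i = j then \<mu> i ^ r else 0)" if "i < n" for i j
    using that by (induction r) (auto simp: if_distrib [of "\<lambda>x. x * _"] cong: if_cong)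
  then show ?thesis using assms by (simp add: cumulant_def)
qed

lemma moment_series_2: "\<kappa> 0 = 0 \<Longrightarrow> \<kappa> 1 = 0 \<Longrightarrow> moment_series \<kappa> $ 2 = \<kappa> 2"
  by (simp add: moment_series_nth sum.atLeastLessThan_Suc numeral_2_eq_2)

section \<open>Convergence of moments\<close>

context semicircular_extension
begin

text \<open>Factors \<open>X k\<close> are exchanged for \<open>Y\<close> one at a time, which
  avoids operator norms: each exchange costs a product of a vector bounded through the moments and
  the difference of \<open>X k\<close> and \<open>Y\<close> applied to \<Omega>.\<close>

lemma psi_moments_tendsto:
  assumes X: "\<And>k. X k \<in> M" "\<And>k. adj (X k) = X k" and Y: "Y \<in> M" "adj Y = Y"
    and lim: "(\<lambda>k. bop_apply (X k) \<Omega>) \<longlonglongrightarrow> bop_apply Y \<Omega>"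
    and bounded: "\<And>m. Bseq (\<lambda>k. \<psi> (X k ^ m))"
  shows "(\<lambda>k. \<psi> (X k ^ m)) \<longlonglongrightarrow> \<psi> (Y ^ m)"
proof -
  have adj_pow: "adj (Z ^ j) = Z ^ j" if "adj Z = Z" for Z :: "'k bop" and j
    by (induction j) (simp_all add: adj_mult that power_commutes)
  have norm_pow: "(norm (bop_apply (Z ^ j) \<Omega>))\<^sup>2 = cmod (\<psi> (Z ^ (j + j)))" if "adj Z = Z" for Z :: "'k bop" and j
  proof -
    have "\<psi> (Z ^ (j + j)) = cinner (bop_apply (Z ^ j) \<Omega>) (bop_apply (Z ^ j) \<Omega>)"
      using cinner_adj_right [of \<Omega> "Z ^ j" "bop_apply (Z ^ j) \<Omega>"] by (simp add: psi adj_pow [OF that] power_add)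
    then show ?thesis by (simp add: cinner_self norm_power)
  qed
  have main: "(\<lambda>k. \<psi> (X k ^ p * Y ^ q)) \<longlonglongrightarrow> \<psi> (Y ^ (p + q))" for p q
  proof (induction p arbitrary: q)
    case 0
    then show ?case by simp
  next
    case (Suc p)
    obtain K where K: "\<And>k. cmod (\<psi> (X k ^ (p + p + (p + p)))) \<le> K"
      using bounded [of "p + p + (p + p)"] unfolding Bseq_def by blast
    define C where "C = sqrt (norm (bop_apply (Y ^ (q + q)) \<Omega>) * sqrt K)"
    have le: "norm (bop_apply (X k ^ p * Y ^ q) \<Omega>) \<le> C" for k
    proof -
      let ?x = "X k ^ p" and ?y = "Y ^ q"
      have mem: "?x \<in> M" "?y \<in> M" using X Y by (simp_all add: alg_power)
      have "cinner (bop_apply (?x * ?y) \<Omega>) (bop_apply (?x * ?y) \<Omega>) = \<psi> (adj (?x * ?y) * (?x * ?y))"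
        by (simp add: psi cinner_adj_right)
      also have "adj (?x * ?y) * (?x * ?y) = ?y * (X k ^ (p + p) * ?y)"
        by (simp add: adj_mult adj_pow X Y mult.assoc power_add)
      also have "\<psi> \<dots> = \<psi> (X k ^ (p + p) * ?y * ?y)"
        by (rule phi_trace) (auto intro: alg alg_power mem X)
      also have "X k ^ (p + p) * ?y * ?y = X k ^ (p + p) * Y ^ (q + q)" by (simp add: mult.assoc power_add)
      also have "\<psi> \<dots> = cinner (bop_apply (X k ^ (p + p)) \<Omega>) (bop_apply (Y ^ (q + q)) \<Omega>)"
        using cinner_adj_right [of \<Omega> "X k ^ (p + p)" "bop_apply (Y ^ (q + q)) \<Omega>"]
        by (simp add: psi adj_pow X)
      finally have eq: "cinner (bop_apply (?x * ?y) \<Omega>) (bop_apply (?x * ?y) \<Omega>)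
          = cinner (bop_apply (X k ^ (p + p)) \<Omega>) (bop_apply (Y ^ (q + q)) \<Omega>)" .
      have "(norm (bop_apply (?x * ?y) \<Omega>))\<^sup>2 = cmod (cinner (bop_apply (?x * ?y) \<Omega>) (bop_apply (?x * ?y) \<Omega>))"
        by (simp only: cinner_self) (simp add: norm_power)
      also have "\<dots> \<le> norm (bop_apply (X k ^ (p + p)) \<Omega>) * norm (bop_apply (Y ^ (q + q)) \<Omega>)"
        unfolding eq by (rule cinner_Cauchy_Schwarz)
      also have "\<dots> \<le> sqrt K * norm (bop_apply (Y ^ (q + q)) \<Omega>)"
      proof (rule mult_right_mono)
        show "norm (bop_apply (X k ^ (p + p)) \<Omega>) \<le> sqrt K"
          by (rule real_le_rsqrt) (simp only: norm_pow [OF X(2)] K)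
      qed simp
      finally show ?thesis unfolding C_def by (intro real_le_rsqrt) (simp add: mult.commute)
    qed
    \<comment> \<open>Two uses of the trace property bring the difference next to \<Omega>; the
      remaining factors go to the other side of the inner product.\<close>
    have step: "cmod (\<psi> (X k ^ Suc p * Y ^ q) - \<psi> (X k ^ p * Y ^ Suc q)) \<le> C * norm (bop_apply (X k) \<Omega> - bop_apply Y \<Omega>)" for k
    proof -
      have mem: "X k ^ p \<in> M" "Y ^ q \<in> M" "X k - Y \<in> M" using X Y by (simp_all add: alg_power alg_diff)
      have "\<psi> (X k ^ Suc p * Y ^ q) - \<psi> (X k ^ p * Y ^ Suc q) = \<psi> (X k ^ p * ((X k - Y) * Y ^ q))"
        by (simp only: power_Suc2 [of "X k"] power_Suc [of Y] psi left_diff_distrib right_diff_distrib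
            mult.assoc cinner_diff_right bop_apply_simps)
      also have "\<dots> = \<psi> ((X k - Y) * Y ^ q * X k ^ p)"
        by (rule phi_trace) (auto intro: alg mem)
      also have "\<dots> = \<psi> ((X k - Y) * (Y ^ q * X k ^ p))" by (simp add: mult.assoc)
      also have "\<dots> = \<psi> (Y ^ q * X k ^ p * (X k - Y))"
        by (rule phi_trace) (auto intro: alg mem)
      also have "\<dots> = cinner (bop_apply (X k ^ p * Y ^ q) \<Omega>) (bop_apply (X k - Y) \<Omega>)"
        using cinner_adj_right [of \<Omega> "X k ^ p * Y ^ q" "bop_apply (X k - Y) \<Omega>"]
        by (simp add: psi adj_mult adj_pow X Y)
      finally have "cmod (\<psi> (X k ^ Suc p * Y ^ q) - \<psi> (X k ^ p * Y ^ Suc q))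
          \<le> norm (bop_apply (X k ^ p * Y ^ q) \<Omega>) * norm (bop_apply (X k - Y) \<Omega>)"
        using cinner_Cauchy_Schwarz by metis
      also have "\<dots> \<le> C * norm (bop_apply (X k - Y) \<Omega>)"
        by (intro mult_right_mono le) simp
      finally show ?thesis by simp
    qed
    have "(\<lambda>k. C * norm (bop_apply (X k) \<Omega> - bop_apply Y \<Omega>)) \<longlonglongrightarrow> C * norm (bop_apply Y \<Omega> - bop_apply Y \<Omega>)"
      by (intro tendsto_intros lim)
    then have null: "(\<lambda>k. C * norm (bop_apply (X k) \<Omega> - bop_apply Y \<Omega>)) \<longlonglongrightarrow> 0" by simp
    have "(\<lambda>k. \<psi> (X k ^ Suc p * Y ^ q) - \<psi> (X k ^ p * Y ^ Suc q)) \<longlonglongrightarrow> 0"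
      by (rule Lim_null_comparison [OF always_eventually null]) (use step in blast)
    from tendsto_add [OF this Suc [of "Suc q"]] show ?case by simp
  qed
  show ?thesis using main [of m 0] by simp
qed

lemma norm_vec_adj: "x \<in> A \<Longrightarrow> norm (vec (adj x)) = norm (vec x)"
  using base.phi_trace [of x "adj x"]
  by (simp add: trace_norm2_eq [symmetric] base.alg) (simp add: trace_norm2_def)

lemma extension_in_M: "x \<in> A \<Longrightarrow> b *\<^sub>R a + \<iota> x \<in> M"
  using a_M by (intro alg alg_scaleR iota_hom) (simp_all add: a_def)

end

context brownian_extension
begin

context
  fixes J assumes J: "is_wigner_integral2 A \<phi> S J"
begin

lemma J_A: "f \<in> L2_sym \<Longrightarrow> J f \<in> A"
  by (rule continuous_linear_L2D(1) [OF J_linear [OF J]])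

lemma J_tendsto:
  assumes "f \<in> L2_sym" "\<And>k. g k \<in> L2_sym" "(\<lambda>k. \<integral>p. (f p - g k p)\<^sup>2 \<partial>(Rplus \<Otimes>\<^sub>M Rplus)) \<longlonglongrightarrow> 0"
  shows "(\<lambda>k. vec (J (g k))) \<longlonglongrightarrow> vec (J f)"
  by (rule continuous_linear_tendsto [OF J_linear [OF J] L2_sym_diff assms])

lemma J_grid_self_adjoint:
  assumes "supported n D" "\<And>i j. D i j = D j i"
  shows "adj (J (grid_function N D)) = J (grid_function N D)"
proof -
  have adj_sum: "adj (sum f I) = (\<Sum>i\<in>I. adj (f i))" for f :: "nat \<Rightarrow> 'h bop" and I
    by (induction I rule: infinite_finite_induct) (simp_all add: adj_add)
  have adj_scaleR: "adj (r *\<^sub>R x) = r *\<^sub>R adj x" for r and x :: "'h bop"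
    using adj_scaleC [of "complex_of_real r" x] by (simp add: scaleC_of_real)
  have "adj (J (grid_function N D)) = (\<Sum>i<n. \<Sum>j<n. D j i *\<^sub>R (increment N j * increment N i - (if j = i then 1 / 2 ^ N else 0) *\<^sub>R 1))"
    unfolding J_grid [OF J assms]
    by (simp add: adj_sum adj_scaleR adj_diff adj_mult increment_self_adjoint assms(2) [of _ "_ :: nat"] eq_commute cong: if_cong)
  also have "\<dots> = J (grid_function N D)"
    unfolding J_grid [OF J assms] by (rule sum.swap)
  finally show ?thesis .
qed

text \<open>The adjoint is isometric for the trace norm, so self-adjointness passes from grid
  kernels to their limits.\<close>

lemma J_self_adjoint:
  assumes f: "f \<in> L2_sym"
  shows "adj (J f) = J f"
proof -
  obtain N n D where D: "\<And>k. supported (n k) (D k)" "\<And>k i j. D k i j = D k j i"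
    and lim: "(\<lambda>k. \<integral>p. (f p - grid_function (N k) (D k) p)\<^sup>2 \<partial>(Rplus \<Otimes>\<^sub>M Rplus)) \<longlonglongrightarrow> 0"
    using L2_sym_grid_sequence [OF f] by blast
  let ?g = "\<lambda>k. J (grid_function (N k) (D k))"
  have g: "grid_function (N k) (D k) \<in> L2_sym" for k by (rule grid_function_L2_sym [OF D])
  note gA = J_A [OF g] and fA = J_A [OF f]
  have 1: "(\<lambda>k. vec (?g k)) \<longlonglongrightarrow> vec (J f)" by (rule J_tendsto [OF f g lim])
  have "(\<lambda>k. norm (vec (?g k) - vec (J f))) \<longlonglongrightarrow> 0"
    using 1 by (simp add: LIM_zero tendsto_norm_zero)
  moreover have "norm (vec (?g k) - vec (adj (J f))) = norm (vec (?g k) - vec (J f))" for k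
    using norm_vec_adj [of "?g k - J f"] gA [of k] fA
    by (simp add: vec_diff base.alg base.alg_diff adj_diff J_grid_self_adjoint [OF D])
  ultimately have "(\<lambda>k. norm (vec (?g k) - vec (adj (J f)))) \<longlonglongrightarrow> 0" by simp
  then have "(\<lambda>k. vec (?g k)) \<longlonglongrightarrow> vec (adj (J f))"
    by (simp add: LIM_zero_iff tendsto_norm_zero_iff)
  from LIMSEQ_unique [OF this 1] show ?thesis
    using fA by (intro vec_eqI base.alg)
qed

text \<open>Any two candidates agree on grid kernels, by the explicit formula \<open>J_grid\<close>,
  and then everywhere by density and continuity.\<close>

lemma wigner_integral2_eq:
  assumes f: "f \<in> L2_sym"
  shows "wigner_integral2 A \<phi> S f = J f"
proof -
  obtain N n D where D: "\<And>k. supported (n k) (D k)" "\<And>k i j. D k i j = D k j i"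
    and lim: "(\<lambda>k. \<integral>p. (f p - grid_function (N k) (D k) p)\<^sup>2 \<partial>(Rplus \<Otimes>\<^sub>M Rplus)) \<longlonglongrightarrow> 0"
    using L2_sym_grid_sequence [OF f] by blast
  have g: "grid_function (N k) (D k) \<in> L2_sym" for k by (rule grid_function_L2_sym [OF D])
  have unique: "J' f = J f" if J': "is_wigner_integral2 A \<phi> S J'" for J'
  proof -
    have "(\<lambda>k. vec (J' (grid_function (N k) (D k)))) \<longlonglongrightarrow> vec (J' f)"
      by (rule continuous_linear_tendsto [OF J_linear [OF J'] L2_sym_diff f g lim])
    then have "(\<lambda>k. vec (J (grid_function (N k) (D k)))) \<longlonglongrightarrow> vec (J' f)"
      by (simp only: J_grid [OF J' D] J_grid [OF J D])
    from LIMSEQ_unique [OF this J_tendsto [OF f g lim]] show ?thesis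
      by (intro vec_eqI J_A f continuous_linear_L2D(1) [OF J_linear [OF J']])
  qed
  show ?thesis
    unfolding wigner_integral2_def by (rule the_equality) (use J unique in blast)+
qed

text \<open>Convergence of the vectors bounds the second moments, which are the second cumulants;
  \<open>trace_power_bound\<close> extends the bound to all cumulants and hence to all moments, as
  \<open>psi_moments_tendsto\<close> requires.\<close>

lemma moments_grid_tendsto:
  assumes f: "f \<in> L2_sym" and D: "\<And>k. supported (n k) (D k)" "\<And>k i j. D k i j = D k j i"
    and lim: "(\<lambda>k. \<integral>p. (f p - grid_function (N k) (D k) p)\<^sup>2 \<partial>(Rplus \<Otimes>\<^sub>M Rplus)) \<longlonglongrightarrow> 0"
  shows "(\<lambda>k. complex_of_real (moment_series (cumulant (n k) (\<lambda>i j. D k i j / 2 ^ N k) b) $ m))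
    \<longlonglongrightarrow> \<psi> ((b *\<^sub>R a + \<iota> (J f)) ^ m)"
proof -
  define X where "X k = b *\<^sub>R a + \<iota> (J (grid_function (N k) (D k)))" for k
  define \<kappa> where "\<kappa> k = cumulant (n k) (\<lambda>i j. D k i j / 2 ^ N k) b" for k
  have g: "grid_function (N k) (D k) \<in> L2_sym" for k by (rule grid_function_L2_sym [OF D])
  have adj_sum: "adj (b *\<^sub>R a + \<iota> x) = b *\<^sub>R a + \<iota> x" if "x \<in> A" "adj x = x" for x
    using adj_scaleC [of "complex_of_real b" a] that iota_hom(4) [of x]
    by (simp add: adj_add adj_a scaleC_of_real)
  have XM: "X k \<in> M" "adj (X k) = X k" for k
    unfolding X_def by (intro extension_in_M adj_sum J_A g J_grid_self_adjoint [OF D])+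
  have YM: "b *\<^sub>R a + \<iota> (J f) \<in> M" "adj (b *\<^sub>R a + \<iota> (J f)) = b *\<^sub>R a + \<iota> (J f)"
    by (intro extension_in_M adj_sum J_A f J_self_adjoint)+
  have XY: "(\<lambda>k. bop_apply (X k) \<Omega>) \<longlonglongrightarrow> bop_apply (b *\<^sub>R a + \<iota> (J f)) \<Omega>"
    using tendsto_add [OF tendsto_const J_tendsto [OF f g lim], of "bop_apply (b *\<^sub>R a) \<Omega>"]
    by (simp add: X_def vec_def)
  have mom: "\<psi> (X k ^ j) = complex_of_real (moment_series (\<kappa> k) $ j)" for k j
    unfolding X_def \<kappa>_def by (rule moments_J_grid [OF J D])
  have \<kappa>0: "\<kappa> k 0 = 0" "\<kappa> k 1 = 0" for k by (simp_all add: \<kappa>_def cumulant_def)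
  obtain K where K: "\<And>k. norm (bop_apply (X k) \<Omega>) \<le> K"
    using convergent_imp_Bseq [OF convergentI [OF XY]] unfolding Bseq_def by blast
  \<comment> \<open>Adding 1 makes the constant at least 1, as \<open>trace_power_bound\<close>
    asks.\<close>
  have "\<kappa> k 2 \<le> K\<^sup>2 + 1" for k
  proof -
    have "complex_of_real (\<kappa> k 2) = \<psi> (X k ^ 2)"
      using mom [of k 2] moment_series_2 [OF \<kappa>0] by simp
    also have "\<dots> = cinner (bop_apply (X k) \<Omega>) (bop_apply (X k) \<Omega>)"
      using cinner_adj_right [of \<Omega> "X k" "bop_apply (X k) \<Omega>"] by (simp add: psi XM power2_eq_square)
    also have "\<dots> = complex_of_real ((norm (bop_apply (X k) \<Omega>))\<^sup>2)" by (rule cinner_self)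
    finally have "\<kappa> k 2 = (norm (bop_apply (X k) \<Omega>))\<^sup>2" by (simp only: of_real_eq_iff)
    also have "\<dots> \<le> K\<^sup>2" by (intro power_mono K) simp
    finally show ?thesis by simp
  qed
  then have "\<bar>\<kappa> k r\<bar> \<le> (K\<^sup>2 + 1) ^ r" for k r
    unfolding \<kappa>_def by (intro trace_power_bound) (simp_all add: D(2))
  then have "Bseq (\<lambda>k. \<kappa> k r)" for r by (intro BseqI') auto
  then have "Bseq (\<lambda>k. moment_series (\<kappa> k) $ j)" for j
    by (intro moment_series_bounded \<kappa>0)
  then have bounded: "Bseq (\<lambda>k. \<psi> (X k ^ j))" for j
    unfolding mom by (simp add: Bseq_def)
  show ?thesis
    using psi_moments_tendsto [OF XM YM XY bounded, of m] by (simp only: mom \<kappa>_def)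
qed

text \<open>Finitely many moments of an arbitrary double integral are matched by one symmetric
  matrix, which is all that convergence in law requires.\<close>

lemma moments_approximation:
  assumes f: "f \<in> L2_sym" and e: "0 < e"
  shows "\<exists>n D. (\<forall>i j. D i j = D j i) \<and>
    (\<forall>m\<le>p. cmod (complex_of_real (moment_series (cumulant n D 0) $ m) - \<phi> (J f ^ m)) < e)"
proof -
  obtain N n D where D: "\<And>k. supported (n k) (D k)" "\<And>k i j. D k i j = D k j i"
    and lim: "(\<lambda>k. \<integral>p. (f p - grid_function (N k) (D k) p)\<^sup>2 \<partial>(Rplus \<Otimes>\<^sub>M Rplus)) \<longlonglongrightarrow> 0"
    using L2_sym_grid_sequence [OF f] by blast
  define \<kappa> where "\<kappa> k = cumulant (n k) (\<lambda>i j. D k i j / 2 ^ N k) 0" for k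
  have "\<psi> ((0 *\<^sub>R a + \<iota> (J f)) ^ m) = \<phi> (J f ^ m)" for m
    using iota_power [OF J_A [OF f], of m] iota_hom(6) [OF base.alg_power [OF J_A [OF f]], of m] by simp
  then have conv: "(\<lambda>k. complex_of_real (moment_series (\<kappa> k) $ m)) \<longlonglongrightarrow> \<phi> (J f ^ m)" for m
    using moments_grid_tendsto [OF f D lim, of 0 m] by (simp only: \<kappa>_def)
  have "\<forall>\<^sub>F k in sequentially. cmod (complex_of_real (moment_series (\<kappa> k) $ m) - \<phi> (J f ^ m)) < e" for m
    using tendstoD [OF conv e] by (simp only: dist_norm)
  then have "\<forall>\<^sub>F k in sequentially. \<forall>m\<in>{..p}. cmod (complex_of_real (moment_series (\<kappa> k) $ m) - \<phi> (J f ^ m)) < e"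
    by (intro eventually_ball_finite) auto
  then obtain k where k: "\<forall>m\<in>{..p}. cmod (complex_of_real (moment_series (\<kappa> k) $ m) - \<phi> (J f ^ m)) < e"
    using eventually_happens' [OF sequentially_bot] by blast
  then show ?thesis
    by (intro exI [of _ "n k"] exI [of _ "\<lambda>i j. D k i j / 2 ^ N k"]) (simp add: \<kappa>_def D(2))
qed

text \<open>Matrices replace the kernels, convergence of moments becomes convergence of cumulants,
  and \<open>power_sums_limit\<close> supplies the semicircular scale and the eigenvalues. The
  element built from them has the limiting cumulants, hence the limiting moments.\<close>

theorem law_of_limit:
  assumes f: "\<And>n. n \<ge> 1 \<Longrightarrow> f n \<in> L2_sym"
    and lim: "\<And>m. m \<ge> 1 \<Longrightarrow> (\<lambda>n. \<phi> (J (f n) ^ m)) \<longlonglongrightarrow> \<tau> m"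
  shows "\<exists>c\<ge>0. \<exists>g\<in>L2_sym. \<forall>m\<ge>1. \<psi> ((c *\<^sub>R a + \<iota> (J g)) ^ m) = \<tau> m"
proof -
  \<comment> \<open>Matching the moments up to \<open>k\<close> within 1 / (k + 1) is a diagonal
    choice: each fixed moment is matched from some index on. The shift to \<open>Suc k\<close> stays
    where \<open>f\<close> is known to lie in \<open>L2_sym\<close>.\<close>
  define P where "P k n D \<longleftrightarrow> (\<forall>i j. D i j = D j i) \<and>
    (\<forall>m\<le>k. cmod (complex_of_real (moment_series (cumulant n D 0) $ m) - \<phi> (J (f (Suc k)) ^ m)) < inverse (real (Suc k)))"
    for k n D
  have "\<forall>k. \<exists>n D. P k n D"
    unfolding P_def by (intro allI moments_approximation f) simp_all
  from choice [OF this] obtain n where "\<forall>k. \<exists>D. P k (n k) D" by (elim exE)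
  from choice [OF this] obtain D where P: "\<forall>k. P k (n k) (D k)" by (elim exE)
  define \<kappa> where "\<kappa> k = cumulant (n k) (D k) 0" for k
  have D: "D k i j = D k j i" for k i j using P by (auto simp: P_def)
  have close: "cmod (complex_of_real (moment_series (\<kappa> k) $ m) - \<phi> (J (f (Suc k)) ^ m)) \<le> inverse (real (Suc k))"
    if "m \<le> k" for m k
    using P that by (auto simp: P_def \<kappa>_def intro: less_imp_le)
  have \<kappa>0: "\<kappa> k 0 = 0" for k by (simp add: \<kappa>_def cumulant_def)
  have moments: "(\<lambda>k. complex_of_real (moment_series (\<kappa> k) $ m)) \<longlonglongrightarrow> \<tau> m" if "m \<ge> 1" for m
  proof -
    have "\<forall>\<^sub>F k in sequentially. norm (complex_of_real (moment_series (\<kappa> k) $ m) - \<phi> (J (f (Suc k)) ^ m)) \<le> inverse (real (Suc k))"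
      using close by (intro eventually_sequentiallyI [of m])
    then have "(\<lambda>k. complex_of_real (moment_series (\<kappa> k) $ m) - \<phi> (J (f (Suc k)) ^ m)) \<longlonglongrightarrow> 0"
      by (rule Lim_null_comparison [OF _ LIMSEQ_inverse_real_of_nat])
    from tendsto_add [OF this LIMSEQ_Suc [OF lim [OF that]]] show ?thesis by simp
  qed
  have conv: "convergent (\<lambda>k. moment_series (\<kappa> k) $ m)" for m
  proof (cases "m = 0")
    case True
    then show ?thesis by (simp add: moment_series_nth_0 \<kappa>0 convergent_const)
  next
    case False
    from tendsto_Re [OF moments [of m]] False show ?thesis
      by (auto simp: convergent_def)
  qed
  define \<kappa>' where "\<kappa>' r = lim (\<lambda>k. \<kappa> k r)" for r
  have \<kappa>_lim: "(\<lambda>k. \<kappa> k r) \<longlonglongrightarrow> \<kappa>' r" for r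
    using cumulants_convergent [OF \<kappa>0 conv, of r] by (simp add: \<kappa>'_def convergent_LIMSEQ_iff)
  have \<tau>_eq: "\<tau> m = complex_of_real (moment_series \<kappa>' $ m)" if "m \<ge> 1" for m
  proof (rule LIMSEQ_unique [OF moments [OF that]], rule tendsto_of_real)
    show "(\<lambda>k. moment_series (\<kappa> k) $ m) \<longlonglongrightarrow> moment_series \<kappa>' $ m"
      by (rule moment_series_tendsto [where \<kappa> = \<kappa>]) (rule \<kappa>0 \<kappa>_lim)+
  qed
  have "\<forall>k. \<exists>l. \<forall>r. (\<Sum>i<n k. matpow (n k) (D k) r i i) = (\<Sum>i<n k. l i ^ r)"
    by (intro allI symmetric_eigenvalues D)
  from choice [OF this] obtain l where l: "\<And>k r. (\<Sum>i<n k. matpow (n k) (D k) r i i) = (\<Sum>i<n k. l k i ^ r)"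
    by blast
  have "(\<lambda>k. \<Sum>i<n k. l k i ^ r) \<longlonglongrightarrow> \<kappa>' r" if "r \<ge> 2" for r
    using \<kappa>_lim [of r] that by (cases "r = 2") (simp_all add: \<kappa>_def cumulant_def l not_less)
  from power_sums_limit [OF this] obtain c \<mu> where \<mu>: "(\<lambda>i. (\<mu> i)\<^sup>2) sums (\<kappa>' 2 - c\<^sup>2)"
    "\<And>r. r \<ge> 3 \<Longrightarrow> (\<lambda>i. \<mu> i ^ r) sums \<kappa>' r" by blast
  define g where "g = grid_function 0 (\<lambda>i j. if i = j then \<mu> i else 0)"
  define E where "E k = (\<lambda>i j. if i = j then if i < k then \<mu> i else 0 else 0)" for k :: nat
  have g: "g \<in> L2_sym" and g_lim: "(\<lambda>k. \<integral>p. (g p - grid_function 0 (E k) p)\<^sup>2 \<partial>(Rplus \<Otimes>\<^sub>M Rplus)) \<longlonglongrightarrow> 0"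
    unfolding g_def E_def using diagonal_grid_function [OF sums_summable [OF \<mu>(1)]] by blast+
  have E: "supported k (E k)" "E k i j = E k j i" for k i j
    by (auto simp: supported_def E_def)
  \<comment> \<open>The scale is taken nonnegative, as \<open>semicircle_a\<close> wants; the
    cumulants contain only its square.\<close>
  define \<nu> where "\<nu> k = cumulant k (E k) \<bar>c\<bar>" for k
  have \<nu>: "\<nu> k r = (if r < 2 then 0 else (\<Sum>i<k. \<mu> i ^ r) + (if r = 2 then c\<^sup>2 else 0))" for k r
    using cumulant_diagonal [of r k "\<lambda>i. if i < k then \<mu> i else 0" "\<bar>c\<bar>"]
    by (cases "r < 2") (simp_all add: \<nu>_def E_def cumulant_def)
  have \<nu>_lim: "(\<lambda>k. \<nu> k r) \<longlonglongrightarrow> \<kappa>' r" for r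
  proof -
    consider "r < 2" | "r = 2" | "r \<ge> 3" by linarith
    then show ?thesis
    proof cases
      case 1
      then have "\<kappa>' r = 0"
        using \<kappa>_lim [of r] by (simp add: \<kappa>_def cumulant_def LIMSEQ_const_iff)
      then show ?thesis using 1 by (simp add: \<nu>)
    next
      case 2
      then show ?thesis
        using tendsto_add [OF \<mu>(1) [unfolded sums_def] tendsto_const [of "c\<^sup>2"]] by (simp add: \<nu>)
    next
      case 3
      then show ?thesis using \<mu>(2) [OF 3] by (simp add: \<nu> sums_def)
    qed
  qed
  have "\<psi> ((\<bar>c\<bar> *\<^sub>R a + \<iota> (J g)) ^ m) = \<tau> m" if "m \<ge> 1" for m
  proof -
    have "(\<lambda>k. complex_of_real (moment_series (\<nu> k) $ m)) \<longlonglongrightarrow> \<psi> ((\<bar>c\<bar> *\<^sub>R a + \<iota> (J g)) ^ m)"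
      using moments_grid_tendsto [OF g E, where N = "\<lambda>_. 0" and b = "\<bar>c\<bar>" and m = m] g_lim by (simp add: \<nu>_def)
    moreover have "\<nu> k 0 = 0" for k by (simp add: \<nu>)
    then have "(\<lambda>k. complex_of_real (moment_series (\<nu> k) $ m)) \<longlonglongrightarrow> complex_of_real (moment_series \<kappa>' $ m)"
      by (intro tendsto_of_real moment_series_tendsto [where \<kappa> = \<nu>] \<nu>_lim)
    ultimately show ?thesis using \<tau>_eq [OF that] LIMSEQ_unique by metis
  qed
  then show ?thesis using g by (intro exI [of _ "\<bar>c\<bar>"] conjI bexI [of _ g]) auto
qed

end

end

section \<open>The case without a double integral\<close>

lemma tracial_wstar_prob_space_cong:
  assumes "tracial_wstar_prob_space M \<psi>" "\<And>x. x \<in> M \<Longrightarrow> \<psi>' x = \<psi> x"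
  shows "tracial_wstar_prob_space M \<psi>'"
proof -
  interpret tracial_space M \<psi> by unfold_locales (rule assms)
  have "von_neumann_algebra M" "normal_on M \<psi>"
    using assms(1) unfolding tracial_wstar_prob_space_def by - (elim conjE, assumption)+
  moreover have "normal_on M \<psi>'"
    using \<open>normal_on M \<psi>\<close> assms(2) by (simp add: normal_on_def)
  ultimately show ?thesis
    unfolding tracial_wstar_prob_space_def
    by (simp add: assms(2) alg phi_lin phi_one phi_pos) (use phi_trace phi_faithful in blast)
qed

lemma free_independent_cong:
  fixes \<psi> :: "'h::complex_hilbert_space bop \<Rightarrow> complex" and X :: "'i \<Rightarrow> 'h bop set"
  assumes free: "free_independent \<psi> I X" and M: "unital_star_subalgebra M" "\<And>i. i \<in> I \<Longrightarrow> X i \<subseteq> M"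
    and eq: "\<And>x. x \<in> M \<Longrightarrow> \<psi>' x = \<psi> x"
  shows "free_independent \<psi>' I X"
  unfolding free_independent_def
proof (intro allI impI, elim conjE)
  fix w :: "('i \<times> 'h bop) list"
  assume w: "w \<noteq> []" "successively (\<noteq>) (map fst w)"
    "\<forall>(i, a)\<in>set w. i \<in> I \<and> a \<in> star_algebra_generated (X i) \<and> \<psi>' a = 0"
  have sub: "star_algebra_generated (X i) \<subseteq> M" if "i \<in> I" for i
    using M(1) M(2) [OF that] by (auto simp: star_algebra_generated_def)
  have in_M: "snd p \<in> M" if "p \<in> set w" for p
    using w(3) sub that by (cases p) fastforce
  have "prod_list (map snd v) \<in> M" if "set v \<subseteq> set w" for v
    using that by (induction v) (use M(1) in_M in \<open>auto simp: unital_star_subalgebra_def\<close>)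
  then have "\<psi>' (prod_list (map snd w)) = \<psi> (prod_list (map snd w))" by (intro eq) simp
  moreover have "\<forall>(i, a)\<in>set w. i \<in> I \<and> a \<in> star_algebra_generated (X i) \<and> \<psi> a = 0"
    using w(3) eq in_M by fastforce
  ultimately show "\<psi>' (prod_list (map snd w)) = 0"
    using free w(1,2) unfolding free_independent_def by auto
qed

context brownian_extension
begin

lemma free_brownian: "free_independent \<psi> (UNIV :: bool set) (\<lambda>b. if b then {r *\<^sub>R a} else (\<lambda>t. \<iota> (S t)) ` {0..})"
  using free [of "S ` {0..}" r] S_A unfolding image_image by auto

text \<open>
  If there is no double Wigner integral, \<open>wigner_integral2\<close> is the constant \<open>THE a. False\<close>, of which
  it is not even known whether it lies in \<open>A\<close>. If it does not, it may be embedded as an operator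
  all of whose powers lie outside \<open>M\<close>, where the values of the state can be prescribed.
\<close>

lemma exists_outside: "\<exists>T. \<forall>m\<ge>1. T ^ m \<notin> M \<and> (\<forall>m'\<ge>1. T ^ m = T ^ m' \<longrightarrow> m = m')"
proof -
  define P where "P = make_bop (\<lambda>x. cinner \<Omega> x *\<^sub>C \<Omega>)"
  have P: "bop_apply P x = cinner \<Omega> x *\<^sub>C \<Omega>" for x
  proof -
    have "bop_apply P = (\<lambda>x. cinner \<Omega> x *\<^sub>C \<Omega>)"
      unfolding P_def
    proof (rule bop_apply_make_bop)
      show "norm (cinner \<Omega> x *\<^sub>C \<Omega>) \<le> norm x * 1" for x
        using cinner_Cauchy_Schwarz [of \<Omega> x] by (simp add: norm_scaleC norm_vac)
    qed (simp_all add: cinner_add_right cinner_scaleC_right scaleC_add_left scaleC_scaleC)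
    then show ?thesis by simp
  qed
  have vac: "bop_apply P \<Omega> = \<Omega>" by (simp add: P cinner_self norm_vac scaleC_one)
  have PP: "P * P = P"
    by (rule bop_eqI) (simp add: P cinner_scaleC_right cinner_self norm_vac)
  \<comment> \<open>\<open>P\<close> is the projection onto the line of \<Omega>; the factor 2 makes
    the powers distinct.\<close>
  have pow: "(2 *\<^sub>R P) ^ m = 2 ^ m *\<^sub>R P" if "m \<ge> 1" for m
    using that
  proof (induction m rule: nat_induct_at_least)
    case (Suc m)
    then show ?case by (simp add: bop_algebra_simps PP mult.commute)
  qed simp
  \<comment> \<open>The state is faithful on \<open>M\<close>, whereas 1 - P kills \<Omega> without
    being zero, since it fixes the nonzero vector L \<Omega>.\<close>
  have "P \<notin> M"
  proof
    assume "P \<in> M"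
    then have "1 - P \<in> M" by (intro alg_diff alg)
    moreover have "\<psi> (adj (1 - P) * (1 - P)) = 0" by (simp add: psi vac)
    ultimately have "1 - P = 0" by (rule phi_faithful)
    then have "bop_apply 1 (bop_apply L \<Omega>) = bop_apply P (bop_apply L \<Omega>)" by simp
    then have "bop_apply L \<Omega> = 0" by (simp add: P vac_L scaleC_zero_left)
    then have "\<Omega> = 0" using adjL_L [of \<Omega>] by simp
    then show False using norm_vac by simp
  qed
  moreover have "P \<noteq> 0" using vac norm_vac by auto
  ultimately have "2 ^ m *\<^sub>R P \<notin> M" for m :: nat
    using alg_scaleR [of "2 ^ m *\<^sub>R P" "1 / 2 ^ m"] by auto
  moreover have "2 ^ m *\<^sub>R P = 2 ^ m' *\<^sub>R P \<longrightarrow> m = m'" for m m' :: nat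
    using \<open>P \<noteq> 0\<close> by simp
  ultimately show ?thesis by (intro exI [of _ "2 *\<^sub>R P"]) (simp add: pow)
qed

text \<open>For \<open>c\<close> in \<open>A\<close> the embedding preserves its moments, and 0
  serves as the semicircular part of variance 0. For \<open>c\<close> outside \<open>A\<close> only
  the image of \<open>c\<close> and the values of the state off \<open>M\<close> are changed, which
  neither the enlargement nor freeness inside \<open>M\<close> detects.\<close>

lemma constant_wigner_integral:
  fixes \<mu> :: "nat \<Rightarrow> complex"
  assumes "c \<in> A \<Longrightarrow> \<forall>m\<ge>1. \<phi> (c ^ m) = \<mu> m"
  shows "\<exists>\<psi>' \<iota>'. enlargement A \<phi> M \<psi>' \<iota>' \<and> 0 \<in> M \<and> self_adjoint (0 :: 'k bop) \<and> has_semicircle_law \<psi>' 0 (0\<^sup>2) \<and>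
    free_independent \<psi>' (UNIV :: bool set) (\<lambda>b. if b then {0} else (\<lambda>t. \<iota>' (S t)) ` {0..}) \<and>
    (\<forall>m\<ge>1. \<psi>' ((0 + \<iota>' c) ^ m) = \<mu> m)"
proof -
  have law: "has_semicircle_law \<psi> 0 (0\<^sup>2)" using semicircle_a [of 0] by simp
  have freeS: "free_independent \<psi> (UNIV :: bool set) (\<lambda>b. if b then {0} else (\<lambda>t. \<iota> (S t)) ` {0..})"
    using free_brownian [of 0] unfolding scaleR_zero_left .
  have z: "0 \<in> M" "self_adjoint (0 :: 'k bop)" by (simp_all add: alg_zero self_adjoint_def)
  show ?thesis
  proof (cases "c \<in> A")
    case True
    then have "\<psi> ((0 + \<iota> c) ^ m) = \<mu> m" if "m \<ge> 1" for m
      using assms that iota_power [OF True, of m] iota_hom(6) [OF base.alg_power [OF True], of m] by simp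
    then show ?thesis using enl law freeS z by blast
  next
    case False
    obtain T where T: "\<And>m. m \<ge> 1 \<Longrightarrow> T ^ m \<notin> M" "\<And>m m'. m \<ge> 1 \<Longrightarrow> m' \<ge> 1 \<Longrightarrow> T ^ m = T ^ m' \<Longrightarrow> m = m'"
      using exists_outside by blast
    define \<iota>' where "\<iota>' = \<iota>(c := T)"
    \<comment> \<open>The positive powers of \<open>T\<close> are distinct and lie outside
      \<open>M\<close>, so the value \<mu> m can be assigned to the m-th of them without
      conflict.\<close>
    define \<psi>' where "\<psi>' x = (if x \<in> M then \<psi> x else \<mu> (THE m. m \<ge> 1 \<and> x = T ^ m))" for x
    have \<iota>': "\<iota>' x = \<iota> x" if "x \<in> A" for x using that False by (auto simp: \<iota>'_def)
    have \<psi>': "\<psi>' x = \<psi> x" if "x \<in> M" for x using that by (simp add: \<psi>'_def)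
    have "tracial_wstar_prob_space M \<psi>'"
      by (rule tracial_wstar_prob_space_cong [OF tracial \<psi>'])
    moreover have "unital_star_hom_on A \<iota>'"
      using enl unfolding enlargement_def unital_star_hom_on_def by (simp add: \<iota>' base.alg)
    ultimately have "enlargement A \<phi> M \<psi>' \<iota>'"
      by (simp add: enlargement_def \<iota>' \<psi>' iota_hom)
    moreover have "has_semicircle_law \<psi>' 0 (0\<^sup>2)"
      using law alg_power [OF alg_zero] by (simp add: has_semicircle_law_def \<psi>')
    moreover have "free_independent \<psi>' (UNIV :: bool set) (\<lambda>b. if b then {0} else (\<lambda>t. \<iota>' (S t)) ` {0..})"
    proof -
      have "(\<lambda>t. \<iota>' (S t)) ` {0..} = (\<lambda>t. \<iota> (S t)) ` {0..}"
        using S_A by (intro image_cong) (simp_all add: \<iota>')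
      moreover have "unital_star_subalgebra M" using alg by (simp add: unital_star_subalgebra_def)
      ultimately show ?thesis
        using S_A by (simp only:) (rule free_independent_cong [OF freeS _ _ \<psi>'], auto simp: alg_zero iota_hom)
    qed
    moreover have "\<psi>' ((0 + \<iota>' c) ^ m) = \<mu> m" if m: "m \<ge> 1" for m
    proof -
      have "(THE m'. m' \<ge> 1 \<and> T ^ m = T ^ m') = m"
        using m T(2) by (intro the_equality) blast+
      then show ?thesis using T(1) [OF m] by (simp add: \<psi>'_def \<iota>'_def)
    qed
    ultimately show ?thesis using z by blast
  qed
qed

end

theorem theorem4p1:
  fixes A :: "'h::complex_hilbert_space bop set" and \<phi> :: "'h bop \<Rightarrow> complex"
    and S :: "real \<Rightarrow> 'h bop"
    and C :: "'k::complex_hilbert_space bop set" and \<tau> :: "'k bop \<Rightarrow> complex"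
    and F :: "nat \<Rightarrow> 'h bop" and Finf :: "'k bop"
  assumes "tracial_wstar_prob_space A \<phi>"
    and "free_brownian_motion A \<phi> S"
    and "\<forall>n\<ge>1. \<exists>f\<in>L2_sym. F n = wigner_integral2 A \<phi> S f"
    and "tracial_wstar_prob_space C \<tau>"
    and "Finf \<in> C" and "self_adjoint Finf"
    and "converges_in_law \<phi> F \<tau> Finf"
  shows "\<exists>(lambda0 :: real). \<exists>f\<in>L2_sym.
    \<exists>(B :: 'h enlarged bop set) (\<psi> :: 'h enlarged bop \<Rightarrow> complex)
      (\<iota> :: 'h bop \<Rightarrow> 'h enlarged bop) (a :: 'h enlarged bop).
      enlargement A \<phi> B \<psi> \<iota> \<and>
      a \<in> B \<and> self_adjoint a \<and> has_semicircle_law \<psi> a (lambda0\<^sup>2) \<and>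
      free_independent \<psi> (UNIV :: bool set) (\<lambda>b. if b then {a} else (\<lambda>t. \<iota> (S t)) ` {0..}) \<and>
      eq_law \<tau> Finf \<psi> (a + \<iota> (wigner_integral2 A \<phi> S f))"
proof -
  obtain M :: "'h enlarged bop set" and \<psi> \<iota> L \<Omega> where enl: "enlargement A \<phi> M \<psi> \<iota>" "L + adj L \<in> M" "adj L * L = 1"
      "\<forall>x\<in>A. adj L * \<iota> x * L = \<phi> x *\<^sub>C 1" "\<forall>x\<in>A. bop_apply (adj L) (bop_apply (\<iota> x) \<Omega>) = 0"
      "norm \<Omega> = 1" "\<psi> = (\<lambda>x. cinner \<Omega> (bop_apply x \<Omega>))"
    using semicircular_enlargement [OF assms(1)] by (elim exE conjE)
  interpret E: brownian_extension A \<phi> M \<psi> \<iota> L \<Omega> S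
    by unfold_locales (use enl assms(1,2) in blast)+
  have lim: "(\<lambda>n. \<phi> (F n ^ m)) \<longlonglongrightarrow> \<tau> (Finf ^ m)" if "m \<ge> 1" for m
    using assms(7) that by (simp add: converges_in_law_def)
  show ?thesis
  proof (cases "\<exists>J. is_wigner_integral2 A \<phi> S J")
    case True
    then obtain J where J: "is_wigner_integral2 A \<phi> S J" by blast
    have "\<forall>n. \<exists>f. n \<ge> 1 \<longrightarrow> f \<in> L2_sym \<and> F n = wigner_integral2 A \<phi> S f"
      using assms(3) by blast
    from choice [OF this] obtain f where f: "\<And>n. n \<ge> 1 \<Longrightarrow> f n \<in> L2_sym"
      and F: "\<And>n. n \<ge> 1 \<Longrightarrow> F n = wigner_integral2 A \<phi> S (f n)" by blast
    have "(\<lambda>n. \<phi> (J (f n) ^ m)) \<longlonglongrightarrow> \<tau> (Finf ^ m)" if "m \<ge> 1" for m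
    proof (rule Lim_transform_eventually [OF lim [OF that]])
      show "\<forall>\<^sub>F n in sequentially. \<phi> (F n ^ m) = \<phi> (J (f n) ^ m)"
        using f F by (intro eventually_sequentiallyI [of 1]) (simp add: E.wigner_integral2_eq [OF J])
    qed
    from E.law_of_limit [OF J f this] obtain c g where c: "0 \<le> c" and g: "g \<in> L2_sym"
      and law: "\<And>m. m \<ge> 1 \<Longrightarrow> \<psi> ((c *\<^sub>R E.a + \<iota> (J g)) ^ m) = \<tau> (Finf ^ m)" by blast
    have "self_adjoint (c *\<^sub>R E.a)"
      using adj_scaleC [of "complex_of_real c" E.a] by (simp add: self_adjoint_def E.adj_a scaleC_of_real)
    moreover have "c *\<^sub>R E.a \<in> M" using enl(2) by (simp add: E.a_def E.alg_scaleR)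
    moreover have "eq_law \<tau> Finf \<psi> (c *\<^sub>R E.a + \<iota> (wigner_integral2 A \<phi> S g))"
      using law by (simp add: eq_law_def E.wigner_integral2_eq [OF J g])
    ultimately show ?thesis
      using enl(1) g E.semicircle_a [OF c] E.free_brownian [of c]
      by (intro exI [of _ c] bexI [of _ g] exI [of _ M] exI [of _ \<psi>] exI [of _ \<iota>] exI [of _ "c *\<^sub>R E.a"]) simp_all
  next
    case False
    \<comment> \<open>With no double integral the description denotes one and the same operator for
      every kernel. The sequence is constant from index 1 on, and its moments are those of the
      limit.\<close>
    define c where "c = wigner_integral2 A \<phi> S (\<lambda>x. 0)"
    have W: "wigner_integral2 A \<phi> S f = c" for f
      using False by (simp add: c_def wigner_integral2_def)
    have "\<phi> (c ^ m) = \<tau> (Finf ^ m)" if "m \<ge> 1" for m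
    proof -
      have "\<forall>\<^sub>F n in sequentially. \<phi> (F n ^ m) = \<phi> (c ^ m)"
        using assms(3) W by (intro eventually_sequentiallyI [of 1]) metis
      from Lim_transform_eventually [OF lim [OF that] this] show ?thesis
        by (simp add: LIMSEQ_const_iff)
    qed
    then obtain \<psi>' \<iota>' where "enlargement A \<phi> M \<psi>' \<iota>'" "0 \<in> M" "self_adjoint (0 :: 'h enlarged bop)"
      "has_semicircle_law \<psi>' 0 (0\<^sup>2)"
      "free_independent \<psi>' (UNIV :: bool set) (\<lambda>b. if b then {0} else (\<lambda>t. \<iota>' (S t)) ` {0..})"
      "\<forall>m\<ge>1. \<psi>' ((0 + \<iota>' c) ^ m) = \<tau> (Finf ^ m)"
      using E.constant_wigner_integral [of c "\<lambda>m. \<tau> (Finf ^ m)"] by (elim meta_impE exE conjE) blast+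
    then show ?thesis
      using L2_sym_zero W
      by (intro exI [of _ 0] bexI [of _ "\<lambda>x. 0"] exI [of _ M] exI [of _ \<psi>'] exI [of _ \<iota>'] exI [of _ 0])
        (simp_all add: eq_law_def)
  qed
qed

end
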